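(* Let $V$ be the Hilbert form space for the truncated problem on $[0,L]$, for instance $V=H^8(0,L)$, let $(Rf)(a)=\Lambda_a(f)=\sum_{k=0}^8e_k(a)\frac{f^{(k)}(a)}{k!}$ for $0\le a<s_*$, and let $q$ be the Hermitian form of the Volterra moment form $Q_\Psi$ (so $q(f,f)=Q_\Psi(f)$), where $e_k$, $s_*$, $Q_\Psi$ are the specific objects described in the context. Suppose the eigenline $e(a)$ is simple and bounded on the active interval $[0,s_* )$. Then $$\|Rf\|_{L^2(0,s_* )}\le C\sum_{k=0}^8\|f^{(k)}\|_{L^2(0,s_* )}\le C\|f\|_{H^8(0,L)},$$ so $R$ is closed and $N=\ker R$ is closed. Write $V=N\oplus U$, $U=N^\perp$, and give $X_R=R(U)$ the transported norm $\|Ru\|_{X_R}:=\|u\|_V$ ($u\in U$), so that $R|_U:U\to X_R$ is unitary. Block $$q(n+u,m+v)=a(n,m)+b(n,v)+\overline{b(m,u)}+c(u,v),\qquad n,m\in N,\ u,v\in U .$$ Consider the hypotheses (i) $a\ge0$ on $N$; (ii) (Douglas range condition) $b(n,u)=\langle A^{1/2}n,\Gamma u\rangle_{\mathcal H_A}$ for all $n\in N$, $u\in U$, for a bounded operator $\Gamma:U\to\mathcal H_A$. If (i) and (ii) hold, put $T=\Gamma^*\Gamma-C$, $M=T_+$ (positive part), define $S:X_R\to U$ by $S(Ru)=M^{1/2}u$, and put $$p(n+u)=\|A^{1/2}n+\Gamma u\|_{\mathcal H_A}^2+\langle(C+M-\Gamma^*\Gamma)u,u\rangle .$$ Then $S$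 is bounded, $p\ge0$, and, with $G$ the map determined by $\|Gf\|^2:=p(f)$, $$Q_\Psi(f)=\|Gf\|^2-\|SRf\|^2\qquad(f\in V).$$ In particular $Rf=0$ implies $Q_\Psi(f)\ge0$. Conversely, any such quotient factorization (with $S$ bounded on $X_R$) forces (i) and the range condition (ii). Hence the continuum Schur/range problem is exactly the positivity of $Q_\Psi$ on $\ker R$ together with the bounded $A^{1/2}$-factorization (ii) of the cross form.
   Context: Operators: $A$ is the nonnegative operator on $N$ representing $a$, $C$ (in $T$ and $p$) is the operator on $U$ representing $c$, and $\mathcal H_A$ is the completion of $N/\ker A$ in the norm $a(n,n)^{1/2}$, with $A^{1/2}n\in\mathcal H_A$ the class of $n$, so $\|A^{1/2}n\|_{\mathcal H_A}^2=a(n,n)$. The $C$ in the estimate for $R$ is just a constant. The form $Q_\Psi$: for $n\ge1$ and $t\ge0$ let $\phi_n(t)=2(2\pi^2n^4e^{9t/2}-3\pi n^2e^{5t/2})e^{-\pi n^2e^{2t}}$, let $\widetilde\Phi_3=\phi_1+\phi_2+\alpha_3\phi_3$ with $\alpha_3=-(\phi_1'(0+)+\phi_2'(0+))/\phi_3'(0+)$, and $\Psi(v)=\widetilde\Phi_3(v/2)$. Fix real $\omega$ with $|\omega|<1/2$. For $\sigma=\pm1$ put $B_\sigma(s,u)=e^{\sigma\omega(s+u)/2}\,\Psi(s+u)/\Psi(s)$, $m_\sigma(u)=\int_0^Lf(s)B_\sigma(s,u)\,ds$, $n_\sigma(u)=\int_0^L(s+u)f(s)B_\sigma(s,u)\,ds$.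 Then (for real $f$) $Q_\Psi(f)=\frac12\sum_{\sigma=\pm1}\int_0^\infty m_\sigma(u)n_\sigma(u)\,du$. Equivalently, $q(f,g)=\int_0^L\int_0^Lf(s)K_{\rm red}(s,t)\overline{g(t)}\,ds\,dt$ with $$K_{\rm red}(s,t)=\int_0^\infty\Bigl[u+\tfrac{s+t}2\Bigr]\cosh\Bigl(\omega\bigl[u+\tfrac{s+t}2\bigr]\Bigr)\frac{\Psi(s+u)}{\Psi(s)}\frac{\Psi(t+u)}{\Psi(t)}\,du .$$ The trace coefficients: let $c_0=\pi$, $x=1+\tau$, $\lambda=c_0e^s$, $F_s(\tau)=\frac{e^{-\lambda\tau}-e^{-c_0\tau}}{\lambda-c_0}$, $H_s(\tau)=\frac{s\,e^{-\lambda\tau}}{\lambda-c_0}$ (limits taken at $s=0$), $DY=(xY)'$ (derivative in $\tau$), and let the endpoint kernel be $$K_B(s,t)=\int_0^\infty x^{3/2}\Bigl\{\log x\,DF_s\,DF_t+\tfrac12DF_s\,DH_t+\tfrac12DH_s\,DF_t\Bigr\}d\tau .$$ Let $J_9(a)=\Bigl[\frac{\partial_s^i\partial_t^jK_B(a,a)}{i!\,j!}\Bigr]_{i,j=0}^8$. Then $e(a)=(e_0(a),\dots,e_8(a))$ is the unit eigenvector of $J_9(a)$ for its lowest eigenvalue, with sign convention $e_0(a)<0$. The number $s_*<L$ (numerically $s_*\simeq0.5530736$) is the point where this lowest eigenvalue crosses zero, being negative for $a<s_*$. *)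

theory Defs
  imports "HOL-Analysis.Analysis" "Jordan_Normal_Form.Char_Poly"
begin

section \<open>Complex inner product spaces on carrier sets\<close>

text \<open>Inner products are linear in the first and conjugate-linear in the second argument.\<close>

record 'a cspace =
  pts :: "'a set"
  zer :: "'a"
  pls :: "'a \<Rightarrow> 'a \<Rightarrow> 'a"
  scl :: "complex \<Rightarrow> 'a \<Rightarrow> 'a"
  ip  :: "'a \<Rightarrow> 'a \<Rightarrow> complex"

definition dif :: "('a, 'm) cspace_scheme \<Rightarrow> 'a \<Rightarrow> 'a \<Rightarrow> 'a" where
  "dif H x y = pls H x (scl H (-1) y)"

definition nrm :: "('a, 'm) cspace_scheme \<Rightarrow> 'a \<Rightarrow> real" where
  "nrm H x = sqrt (Re (ip H x x))"

definition vector_space_on :: "('a, 'm) cspace_scheme \<Rightarrow> bool" where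
  "vector_space_on H \<longleftrightarrow>
     zer H \<in> pts H \<and>
     (\<forall>x\<in>pts H. \<forall>y\<in>pts H. pls H x y \<in> pts H \<and> pls H x y = pls H y x) \<and>
     (\<forall>x\<in>pts H. \<forall>y\<in>pts H. \<forall>z\<in>pts H. pls H (pls H x y) z = pls H x (pls H y z)) \<and>
     (\<forall>x\<in>pts H. pls H x (zer H) = x \<and> dif H x x = zer H \<and> scl H 1 x = x) \<and>
     (\<forall>c. \<forall>x\<in>pts H. scl H c x \<in> pts H) \<and>
     (\<forall>c d. \<forall>x\<in>pts H. scl H c (scl H d x) = scl H (c * d) x
                      \<and> scl H (c + d) x = pls H (scl H c x) (scl H d x)) \<and>
     (\<forall>c. \<forall>x\<in>pts H. \<forall>y\<in>pts H. scl H c (pls H x y) = pls H (scl H c x) (scl H c y))"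

definition hermitian_form :: "('a, 'm) cspace_scheme \<Rightarrow> ('a \<Rightarrow> 'a \<Rightarrow> complex) \<Rightarrow> bool" where
  "hermitian_form H b \<longleftrightarrow>
     (\<forall>x\<in>pts H. \<forall>y\<in>pts H. \<forall>z\<in>pts H. b (pls H x y) z = b x z + b y z) \<and>
     (\<forall>c. \<forall>x\<in>pts H. \<forall>y\<in>pts H. b (scl H c x) y = c * b x y) \<and>
     (\<forall>x\<in>pts H. \<forall>y\<in>pts H. b y x = cnj (b x y))"

definition nonneg_form :: "('a, 'm) cspace_scheme \<Rightarrow> ('a \<Rightarrow> 'a \<Rightarrow> complex) \<Rightarrow> bool" where
  "nonneg_form H b \<longleftrightarrow> (\<forall>x\<in>pts H. Im (b x x) = 0 \<and> 0 \<le> Re (b x x))"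

definition tends :: "('a, 'm) cspace_scheme \<Rightarrow> (nat \<Rightarrow> 'a) \<Rightarrow> 'a \<Rightarrow> bool" where
  "tends H x l \<longleftrightarrow> (\<lambda>k. nrm H (dif H (x k) l)) \<longlonglongrightarrow> 0"

definition cauchy_seq :: "('a, 'm) cspace_scheme \<Rightarrow> (nat \<Rightarrow> 'a) \<Rightarrow> bool" where
  "cauchy_seq H x \<longleftrightarrow> (\<forall>k. x k \<in> pts H) \<and>
     (\<forall>\<epsilon>>0. \<exists>K. \<forall>i\<ge>K. \<forall>j\<ge>K. nrm H (dif H (x i) (x j)) < \<epsilon>)"

definition hilbert_space :: "('a, 'm) cspace_scheme \<Rightarrow> bool" where
  "hilbert_space H \<longleftrightarrow>
     vector_space_on H \<and> hermitian_form H (ip H) \<and> nonneg_form H (ip H) \<and>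
     (\<forall>x\<in>pts H. ip H x x = 0 \<longrightarrow> x = zer H) \<and>
     (\<forall>x. cauchy_seq H x \<longrightarrow> (\<exists>l\<in>pts H. tends H x l))"

definition closed_subset :: "('a, 'm) cspace_scheme \<Rightarrow> 'a set \<Rightarrow> bool" where
  "closed_subset H W \<longleftrightarrow> W \<subseteq> pts H \<and>
     (\<forall>x f. (\<forall>k. x k \<in> W) \<and> f \<in> pts H \<and> tends H x f \<longrightarrow> f \<in> W)"

definition linear_op ::
  "('a, 'm) cspace_scheme \<Rightarrow> ('b, 'n) cspace_scheme \<Rightarrow> ('a \<Rightarrow> 'b) \<Rightarrow> bool" where
  "linear_op H K T \<longleftrightarrow>
     (\<forall>x\<in>pts H. T x \<in> pts K) \<and>
     (\<forall>x\<in>pts H. \<forall>y\<in>pts H. T (pls H x y) = pls K (T x) (T y)) \<and>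
     (\<forall>c. \<forall>x\<in>pts H. T (scl H c x) = scl K c (T x))"

definition bounded_op ::
  "('a, 'm) cspace_scheme \<Rightarrow> ('b, 'n) cspace_scheme \<Rightarrow> ('a \<Rightarrow> 'b) \<Rightarrow> bool" where
  "bounded_op H K T \<longleftrightarrow> linear_op H K T \<and> (\<exists>B. \<forall>x\<in>pts H. nrm K (T x) \<le> B * nrm H x)"

definition closed_op ::
  "('a, 'm) cspace_scheme \<Rightarrow> ('b, 'n) cspace_scheme \<Rightarrow> ('a \<Rightarrow> 'b) \<Rightarrow> bool" where
  "closed_op H K T \<longleftrightarrow> linear_op H K T \<and>
     (\<forall>x f g. (\<forall>k. x k \<in> pts H) \<and> f \<in> pts H \<and> g \<in> pts K \<and>
        tends H x f \<and> tends K (\<lambda>k. T (x k)) g \<longrightarrow> T f = g)"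

definition unitary_op ::
  "('a, 'm) cspace_scheme \<Rightarrow> ('b, 'n) cspace_scheme \<Rightarrow> ('a \<Rightarrow> 'b) \<Rightarrow> bool" where
  "unitary_op H K T \<longleftrightarrow> linear_op H K T \<and> bij_betw T (pts H) (pts K) \<and>
     (\<forall>x\<in>pts H. \<forall>y\<in>pts H. ip K (T x) (T y) = ip H x y)"

text \<open>The operators below are unique on the carrier whenever they exist, so the choice operator
  only affects values outside it.\<close>

definition adjoint_op ::
  "('a, 'm) cspace_scheme \<Rightarrow> ('b, 'n) cspace_scheme \<Rightarrow> ('a \<Rightarrow> 'b) \<Rightarrow> 'b \<Rightarrow> 'a" where
  "adjoint_op H K T = (SOME T'. bounded_op K H T' \<and>
     (\<forall>x\<in>pts H. \<forall>y\<in>pts K. ip K (T x) y = ip H x (T' y)))"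

definition form_op :: "('a, 'm) cspace_scheme \<Rightarrow> ('a \<Rightarrow> 'a \<Rightarrow> complex) \<Rightarrow> 'a \<Rightarrow> 'a" where
  "form_op H b = (SOME T. bounded_op H H T \<and>
     (\<forall>x\<in>pts H. \<forall>y\<in>pts H. ip H (T x) y = b x y))"

definition sqrt_op :: "('a, 'm) cspace_scheme \<Rightarrow> ('a \<Rightarrow> 'a) \<Rightarrow> 'a \<Rightarrow> 'a" where
  "sqrt_op H P = (SOME Q. bounded_op H H Q \<and> nonneg_form H (\<lambda>x. ip H (Q x)) \<and>
     (\<forall>x\<in>pts H. Q (Q x) = P x))"

definition abs_op :: "('a, 'm) cspace_scheme \<Rightarrow> ('a \<Rightarrow> 'a) \<Rightarrow> 'a \<Rightarrow> 'a" where
  "abs_op H T = sqrt_op H (\<lambda>x. adjoint_op H H T (T x))"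

definition pos_part :: "('a, 'm) cspace_scheme \<Rightarrow> ('a \<Rightarrow> 'a) \<Rightarrow> 'a \<Rightarrow> 'a" where
  "pos_part H T = (\<lambda>x. scl H (1/2) (pls H (abs_op H T x) (T x)))"

definition orth_proj :: "('a, 'm) cspace_scheme \<Rightarrow> 'a set \<Rightarrow> 'a \<Rightarrow> 'a" where
  "orth_proj H W f = (THE w. w \<in> W \<and> (\<forall>v\<in>W. ip H (dif H f w) v = 0))"

section \<open>Quotients by null vectors and completions\<close>

definition cls :: "('a, 'm) cspace_scheme \<Rightarrow> 'a \<Rightarrow> 'a set" where
  "cls P x = {y \<in> pts P. nrm P (dif P x y) = 0}"

definition repr :: "'a set \<Rightarrow> 'a" where
  "repr X = (SOME x. x \<in> X)"

definition quotient_space :: "'a cspace \<Rightarrow> 'a set cspace" where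
  "quotient_space P =
     \<lparr>pts = cls P ` pts P, zer = cls P (zer P),
      pls = (\<lambda>X Y. cls P (pls P (repr X) (repr Y))),
      scl = (\<lambda>c X. cls P (scl P c (repr X))),
      ip = (\<lambda>X Y. ip P (repr X) (repr Y))\<rparr>"

definition cauchy_space :: "'a cspace \<Rightarrow> (nat \<Rightarrow> 'a) cspace" where
  "cauchy_space P =
     \<lparr>pts = {x. cauchy_seq P x}, zer = (\<lambda>_. zer P),
      pls = (\<lambda>x y k. pls P (x k) (y k)),
      scl = (\<lambda>c x k. scl P c (x k)),
      ip = (\<lambda>x y. lim (\<lambda>k. ip P (x k) (y k)))\<rparr>"

text \<open>For a semi-inner product this is the completion of the quotient by the null vectors.\<close>

definition completion :: "'a cspace \<Rightarrow> (nat \<Rightarrow> 'a) set cspace" where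
  "completion P = quotient_space (cauchy_space P)"

definition into_completion :: "'a cspace \<Rightarrow> 'a \<Rightarrow> (nat \<Rightarrow> 'a) set" where
  "into_completion P x = cls (cauchy_space P) (\<lambda>_. x)"

section \<open>The spaces $L^2$ and $H^8$\<close>

definition L2fun :: "real set \<Rightarrow> (real \<Rightarrow> complex) cspace" where
  "L2fun S =
     \<lparr>pts = {f. set_borel_measurable lborel S f \<and> set_integrable lborel S (\<lambda>x. (cmod (f x))\<^sup>2)},
      zer = (\<lambda>_. 0), pls = (\<lambda>f g x. f x + g x), scl = (\<lambda>c f x. c * f x),
      ip = (\<lambda>f g. LINT x:S|lborel. f x * cnj (g x))\<rparr>"

definition L2 :: "real set \<Rightarrow> (real \<Rightarrow> complex) set cspace" where
  "L2 S = quotient_space (L2fun S)"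

definition test_function :: "real \<Rightarrow> (real \<Rightarrow> real) \<Rightarrow> bool" where
  "test_function L \<phi> \<longleftrightarrow> (\<forall>k x. (deriv ^^ k) \<phi> differentiable (at x)) \<and>
     (\<exists>a b. 0 < a \<and> b < L \<and> (\<forall>x. x \<notin> {a..b} \<longrightarrow> \<phi> x = 0))"

definition is_weak_deriv ::
  "real \<Rightarrow> nat \<Rightarrow> (real \<Rightarrow> complex) set \<Rightarrow> (real \<Rightarrow> complex) set \<Rightarrow> bool" where
  "is_weak_deriv L k f g \<longleftrightarrow>
     f \<in> pts (L2 {0<..<L}) \<and> g \<in> pts (L2 {0<..<L}) \<and>
     (\<forall>\<phi>. test_function L \<phi> \<longrightarrow>
        (LINT x:{0<..<L}|lborel. repr f x * of_real ((deriv ^^ k) \<phi> x))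
          = (-1) ^ k * (LINT x:{0<..<L}|lborel. repr g x * of_real (\<phi> x)))"

definition wderiv :: "real \<Rightarrow> nat \<Rightarrow> (real \<Rightarrow> complex) set \<Rightarrow> (real \<Rightarrow> complex) set" where
  "wderiv L k f = (THE g. is_weak_deriv L k f g)"

definition H8 :: "real \<Rightarrow> (real \<Rightarrow> complex) set cspace" where
  "H8 L =
     \<lparr>pts = {f \<in> pts (L2 {0<..<L}). \<forall>k\<le>8. \<exists>g. is_weak_deriv L k f g},
      zer = zer (L2 {0<..<L}), pls = pls (L2 {0<..<L}), scl = scl (L2 {0<..<L}),
      ip = (\<lambda>f g. \<Sum>k\<le>8. ip (L2 {0<..<L}) (wderiv L k f) (wderiv L k g))\<rparr>"

text \<open>A Hilbert form space: a Hilbert space continuously embedded in $H^8(0,L)$.\<close>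

definition form_space :: "real \<Rightarrow> (real \<Rightarrow> complex) set cspace \<Rightarrow> bool" where
  "form_space L V \<longleftrightarrow> hilbert_space V \<and> pts V \<subseteq> pts (H8 L) \<and>
     zer V = zer (H8 L) \<and> pls V = pls (H8 L) \<and> scl V = scl (H8 L) \<and>
     (\<exists>B. \<forall>f\<in>pts V. nrm (H8 L) f \<le> B * nrm V f)"

section \<open>The endpoint kernel and the trace coefficients\<close>

text \<open>The values at \<open>s = 0\<close> are the limits of the generic formulas.\<close>

definition F_end :: "real \<Rightarrow> real \<Rightarrow> real" where
  "F_end s \<tau> = (if s = 0 then - \<tau> * exp (- pi * \<tau>)
     else (exp (- (pi * exp s) * \<tau>) - exp (- pi * \<tau>)) / (pi * exp s - pi))"

definition H_end :: "real \<Rightarrow> real \<Rightarrow> real" where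
  "H_end s \<tau> = (if s = 0 then exp (- pi * \<tau>) / pi
     else s * exp (- (pi * exp s) * \<tau>) / (pi * exp s - pi))"

definition D_end :: "(real \<Rightarrow> real) \<Rightarrow> real \<Rightarrow> real" where
  "D_end Y \<tau> = deriv (\<lambda>t. (1 + t) * Y t) \<tau>"

definition K_B :: "real \<Rightarrow> real \<Rightarrow> real" where
  "K_B s t = (LINT \<tau>:{0..}|lborel. (1 + \<tau>) powr (3/2) *
     (ln (1 + \<tau>) * D_end (F_end s) \<tau> * D_end (F_end t) \<tau>
      + 1/2 * D_end (F_end s) \<tau> * D_end (H_end t) \<tau>
      + 1/2 * D_end (H_end s) \<tau> * D_end (F_end t) \<tau>))"

definition J9 :: "real \<Rightarrow> real mat" where
  "J9 a = mat 9 9 (\<lambda>(i, j).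
     (deriv ^^ i) (\<lambda>s. (deriv ^^ j) (\<lambda>t. K_B s t) a) a / (fact i * fact j))"

definition lowest_ev :: "real \<Rightarrow> real" where
  "lowest_ev a = Min {\<mu>. eigenvalue (J9 a) \<mu>}"

definition trace_vector :: "real \<Rightarrow> real vec \<Rightarrow> bool" where
  "trace_vector a v \<longleftrightarrow>
     eigenvector (J9 a) v (lowest_ev a) \<and> scalar_prod v v = 1 \<and> vec_index v 0 < 0"

definition simple_eigenline :: "real \<Rightarrow> real vec \<Rightarrow> bool" where
  "simple_eigenline a v \<longleftrightarrow>
     (\<forall>w. eigenvector (J9 a) w (lowest_ev a) \<longrightarrow> (\<exists>c. w = c \<cdot>\<^sub>v v))"

definition crossing_point :: "real \<Rightarrow> bool" where
  "crossing_point s \<longleftrightarrow> 0 < s \<and> (\<forall>a\<in>{0..<s}. lowest_ev a < 0) \<and> lowest_ev s = 0 \<and>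
     (\<forall>\<^sub>F a in at_right s. 0 < lowest_ev a)"

definition trace_op ::
  "real \<Rightarrow> (real \<Rightarrow> real vec) \<Rightarrow> real \<Rightarrow> (real \<Rightarrow> complex) set \<Rightarrow> (real \<Rightarrow> complex) set" where
  "trace_op L e s f = cls (L2fun {0<..<s})
     (\<lambda>a. \<Sum>k\<le>8. of_real (vec_index (e a) k) * repr (wderiv L k f) a / fact k)"

definition trace_kernel ::
  "(real \<Rightarrow> complex) set cspace \<Rightarrow> real \<Rightarrow> ((real \<Rightarrow> complex) set \<Rightarrow> (real \<Rightarrow> complex) set)
     \<Rightarrow> (real \<Rightarrow> complex) set cspace" where
  "trace_kernel V s R = V\<lparr>pts := {f \<in> pts V. R f = zer (L2 {0<..<s})}\<rparr>"

definition orth_complement :: "'a cspace \<Rightarrow> 'a set \<Rightarrow> 'a cspace" where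
  "orth_complement V W = V\<lparr>pts := {u \<in> pts V. \<forall>n\<in>W. ip V u n = 0}\<rparr>"

definition transported_space ::
  "real \<Rightarrow> ((real \<Rightarrow> complex) set \<Rightarrow> (real \<Rightarrow> complex) set) \<Rightarrow> (real \<Rightarrow> complex) set cspace
     \<Rightarrow> (real \<Rightarrow> complex) set cspace" where
  "transported_space s R U = (L2 {0<..<s})
     \<lparr>pts := R ` pts U,
      ip := (\<lambda>x y. ip U (inv_into (pts U) R x) (inv_into (pts U) R y))\<rparr>"

section \<open>The Volterra moment form\<close>

definition phi :: "nat \<Rightarrow> real \<Rightarrow> real" where
  "phi n t = 2 * (2 * pi\<^sup>2 * real n ^ 4 * exp (9 * t / 2) - 3 * pi * (real n)\<^sup>2 * exp (5 * t / 2))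
     * exp (- pi * (real n)\<^sup>2 * exp (2 * t))"

definition phi'0 :: "nat \<Rightarrow> real" where
  "phi'0 n = vector_derivative (phi n) (at_right 0)"

definition alpha3 :: real where
  "alpha3 = - (phi'0 1 + phi'0 2) / phi'0 3"

definition Psi :: "real \<Rightarrow> real" where
  "Psi v = phi 1 (v / 2) + phi 2 (v / 2) + alpha3 * phi 3 (v / 2)"

definition B_ker :: "real \<Rightarrow> real \<Rightarrow> real \<Rightarrow> real \<Rightarrow> real" where
  "B_ker \<omega> \<sigma> s u = exp (\<sigma> * \<omega> * (s + u) / 2) * Psi (s + u) / Psi s"

definition m_mom :: "real \<Rightarrow> real \<Rightarrow> real \<Rightarrow> (real \<Rightarrow> complex) set \<Rightarrow> real \<Rightarrow> complex" where
  "m_mom \<omega> L \<sigma> f u = (LINT s:{0..L}|lborel. repr f s * of_real (B_ker \<omega> \<sigma> s u))"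

definition n_mom :: "real \<Rightarrow> real \<Rightarrow> real \<Rightarrow> (real \<Rightarrow> complex) set \<Rightarrow> real \<Rightarrow> complex" where
  "n_mom \<omega> L \<sigma> f u = (LINT s:{0..L}|lborel. of_real (s + u) * repr f s * of_real (B_ker \<omega> \<sigma> s u))"

text \<open>For real \<open>f\<close> both moments are real and the integrand is their product; the real part of
  the product with the conjugate is the Hermitian extension to complex \<open>f\<close>.\<close>

definition Q_Psi :: "real \<Rightarrow> real \<Rightarrow> (real \<Rightarrow> complex) set \<Rightarrow> real" where
  "Q_Psi \<omega> L f = 1/2 * (\<Sum>\<sigma>\<in>{1, -1}.
     (LINT u:{0..}|lborel. Re (m_mom \<omega> L \<sigma> f u * cnj (n_mom \<omega> L \<sigma> f u))))"

definition K_red :: "real \<Rightarrow> real \<Rightarrow> real \<Rightarrow> real" where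
  "K_red \<omega> s t = (LINT u:{0..}|lborel.
     (u + (s + t) / 2) * cosh (\<omega> * (u + (s + t) / 2))
       * (Psi (s + u) / Psi s) * (Psi (t + u) / Psi t))"

definition q_form ::
  "real \<Rightarrow> real \<Rightarrow> (real \<Rightarrow> complex) set \<Rightarrow> (real \<Rightarrow> complex) set \<Rightarrow> complex" where
  "q_form \<omega> L f g = (LINT s:{0..L}|lborel. LINT t:{0..L}|lborel.
     repr f s * of_real (K_red \<omega> s t) * cnj (repr g t))"

section \<open>Range condition and quotient factorizations\<close>

text \<open>\<open>\<H>\<^sub>A\<close>: when \<open>a\<close> is nonnegative, the null vectors of \<open>a\<close> are exactly \<open>ker A\<close> for the
  operator \<open>A\<close> representing \<open>a\<close>, so this is the completion of \<open>N / ker A\<close>; the map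
  \<open>n \<mapsto> A\<^sup>1\<^sup>/\<^sup>2 n\<close> is the canonical map into it.\<close>

definition H_A :: "'a cspace \<Rightarrow> ('a \<Rightarrow> 'a \<Rightarrow> complex) \<Rightarrow> (nat \<Rightarrow> 'a) set cspace" where
  "H_A N a = completion (N\<lparr>ip := a\<rparr>)"

definition A_half :: "'a cspace \<Rightarrow> ('a \<Rightarrow> 'a \<Rightarrow> complex) \<Rightarrow> 'a \<Rightarrow> (nat \<Rightarrow> 'a) set" where
  "A_half N a = into_completion (N\<lparr>ip := a\<rparr>)"

definition douglas_factor ::
  "('a \<Rightarrow> 'a \<Rightarrow> complex) \<Rightarrow> 'a cspace \<Rightarrow> 'a cspace \<Rightarrow> ('a \<Rightarrow> (nat \<Rightarrow> 'a) set) \<Rightarrow> bool" where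
  "douglas_factor q N U \<Gamma> \<longleftrightarrow> bounded_op U (H_A N q) \<Gamma> \<and>
     (\<forall>n\<in>pts N. \<forall>u\<in>pts U. q n u = ip (H_A N q) (A_half N q n) (\<Gamma> u))"

definition quotient_factorization ::
  "('a \<Rightarrow> real) \<Rightarrow> 'a cspace \<Rightarrow> ('a \<Rightarrow> 'b) \<Rightarrow> 'b cspace \<Rightarrow> 'h cspace \<Rightarrow> 'k cspace
     \<Rightarrow> ('a \<Rightarrow> 'h) \<Rightarrow> ('b \<Rightarrow> 'k) \<Rightarrow> bool" where
  "quotient_factorization Q V R X H K G S \<longleftrightarrow>
     hilbert_space H \<and> hilbert_space K \<and> linear_op V H G \<and> bounded_op X K S \<and>
     (\<forall>f\<in>pts V. Q f = (nrm H (G f))\<^sup>2 - (nrm K (S (R f)))\<^sup>2)"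

end

theory Submission
  imports Defs
begin

text \<open>
  The trace \<open>R\<close> is bounded because its coefficients are bounded and measurable: the entries of \<open>J9\<close> are derivatives
  of Laplace integrals, and the unit eigenvector is selected by closed conditions on a Euclidean space. Hence \<open>N\<close> is
  closed and \<open>V\<close> splits as \<open>N \<oplus> U\<close>. Positivity of \<open>\<Psi>\<close> on the half line makes \<open>q\<close> a bounded Hermitian form.

  With \<open>b(n,u) = \<langle>A\<^sup>1\<^sup>/\<^sup>2 n, \<Gamma> u\<rangle>\<close>, completing the square gives
  \<open>Q(n + u) = \<parallel>A\<^sup>1\<^sup>/\<^sup>2 n + \<Gamma> u\<parallel>\<^sup>2 - \<langle>T u, u\<rangle>\<close>, and \<open>T \<le> T\<^sub>+ = M\<close> allows one to write \<open>Q\<close> as a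
  nonnegative form minus \<open>\<parallel>M\<^sup>1\<^sup>/\<^sup>2 u\<parallel>\<^sup>2\<close>. Conversely, in a factorization \<open>S R\<close> vanishes on \<open>N\<close>, so polarization
  gives \<open>q(n,u) = \<langle>G n, G u\<rangle>\<close> with \<open>\<parallel>G n\<parallel>\<^sup>2 = a(n,n)\<close>, and the Riesz theorem in \<open>H_A\<close> yields \<open>\<Gamma>\<close>.
\<close>

section \<open>Complex inner product spaces\<close>

text \<open>Nothing is assumed about how \<open>e\<close> depends on the point, yet
  \<open>R f\<close> has to be measurable; simplicity, unit length and the negative component 0
  leave exactly one admissible vector at each point, and measurability is extracted from that
  uniqueness. The operators \<open>adjoint_op\<close>, \<open>form_op\<close> and
  \<open>sqrt_op\<close> in the conclusion are choices, so each acquires its properties only through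
  an existence proof: adjoints and form operators come from \<open>riesz_op\<close>, square roots
  from the binomial series. That series is summed as a series of forms, so that only convergence of
  complex numbers is involved. The kernel divides by \<open>Psi\<close>, and \<open>alpha3\<close>
  divides by \<open>phi'0 3\<close>, a multiple of \<open>exp (- (9 * pi))\<close>; positivity
  therefore rests on explicit numerical bounds. Finally, the target of \<open>G\<close> has to be
  constructed: it is the completion of \<open>V\<close> itself in a nonnegative Hermitian form whose
  diagonal is p, and \<open>G\<close> is the canonical map into it, which makes linearity
  automatic.\<close>

locale cvspace =
  fixes H :: "'a cspace"
  assumes vs: "vector_space_on H"
begin

lemma zer_in [simp, intro]: "zer H \<in> pts H"
  using vs by (simp add: vector_space_on_def)

lemma pls_in [simp, intro]: "x \<in> pts H \<Longrightarrow> y \<in> pts H \<Longrightarrow> pls H x y \<in> pts H"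
  using vs by (simp add: vector_space_on_def)

lemma scl_in [simp, intro]: "x \<in> pts H \<Longrightarrow> scl H c x \<in> pts H"
  using vs by (simp add: vector_space_on_def)

lemma dif_in [simp, intro]: "x \<in> pts H \<Longrightarrow> y \<in> pts H \<Longrightarrow> dif H x y \<in> pts H"
  by (simp add: dif_def)

lemma pls_comm: "x \<in> pts H \<Longrightarrow> y \<in> pts H \<Longrightarrow> pls H x y = pls H y x"
  using vs by (simp add: vector_space_on_def)

lemma pls_assoc: "x \<in> pts H \<Longrightarrow> y \<in> pts H \<Longrightarrow> z \<in> pts H \<Longrightarrow>
    pls H (pls H x y) z = pls H x (pls H y z)"
  using vs unfolding vector_space_on_def by blast

lemma pls_zer [simp]: "x \<in> pts H \<Longrightarrow> pls H x (zer H) = x"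
  using vs by (simp add: vector_space_on_def)

lemma dif_self [simp]: "x \<in> pts H \<Longrightarrow> dif H x x = zer H"
  using vs by (simp add: vector_space_on_def)

lemma scl_one [simp]: "x \<in> pts H \<Longrightarrow> scl H 1 x = x"
  using vs by (simp add: vector_space_on_def)

lemma scl_scl: "x \<in> pts H \<Longrightarrow> scl H c (scl H d x) = scl H (c * d) x"
  using vs by (simp add: vector_space_on_def)

lemma scl_add: "x \<in> pts H \<Longrightarrow> scl H (c + d) x = pls H (scl H c x) (scl H d x)"
  using vs by (simp add: vector_space_on_def)

lemma scl_pls: "x \<in> pts H \<Longrightarrow> y \<in> pts H \<Longrightarrow> scl H c (pls H x y) = pls H (scl H c x) (scl H c y)"
  using vs by (simp add: vector_space_on_def)

lemma pls_dif_cancel: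
  assumes "x \<in> pts H" "y \<in> pts H" shows "pls H y (dif H x y) = x"
proof -
  have "pls H y (dif H x y) = pls H (dif H x y) y" using assms by (simp add: pls_comm)
  also have "\<dots> = pls H x (pls H (scl H (-1) y) y)"
    using assms by (simp add: dif_def pls_assoc)
  also have "pls H (scl H (-1) y) y = dif H y y" using assms by (simp add: dif_def pls_comm)
  finally show ?thesis using assms by simp
qed

lemma scl_zero: assumes "x \<in> pts H" shows "scl H 0 x = zer H"
  using scl_add[of x 1 "-1"] assms by (simp flip: dif_def)

lemma dif_eq_zer: assumes "x \<in> pts H" "y \<in> pts H" "dif H x y = zer H" shows "x = y"
  using pls_dif_cancel[of x y] assms by simp

lemma scl_zer [simp]: "scl H c (zer H) = zer H"
  using scl_scl[of "zer H" c 0] scl_zero[of "zer H"] by simp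

lemma pls_cancel_right:
  assumes "x \<in> pts H" "y \<in> pts H" "z \<in> pts H" "pls H x z = pls H y z" shows "x = y"
proof -
  have "pls H (pls H x z) (scl H (-1) z) = pls H (pls H y z) (scl H (-1) z)" using assms by simp
  then have "pls H x (dif H z z) = pls H y (dif H z z)"
    using assms(1-3) by (simp add: pls_assoc dif_def)
  then show ?thesis using assms(1-3) by simp
qed

lemma pls_left_comm: "x \<in> pts H \<Longrightarrow> y \<in> pts H \<Longrightarrow> z \<in> pts H \<Longrightarrow>
    pls H x (pls H y z) = pls H y (pls H x z)"
  using pls_assoc[of x y z] pls_assoc[of y x z] pls_comm[of x y] by simp

lemma pls_interchange:
  assumes "x \<in> pts H" "y \<in> pts H" "z \<in> pts H" "w \<in> pts H"
  shows "pls H (pls H x y) (pls H z w) = pls H (pls H x z) (pls H y w)"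
proof -
  have "pls H y (pls H z w) = pls H z (pls H y w)"
    using assms by (metis pls_assoc pls_comm)
  then show ?thesis using assms by (simp add: pls_assoc)
qed

end

section \<open>Hermitian forms, polarization and Cauchy-Schwarz\<close>

locale hform = cvspace +
  fixes b :: "'a \<Rightarrow> 'a \<Rightarrow> complex"
  assumes hermb: "hermitian_form H b"
begin

lemma b_pls_left: "x \<in> pts H \<Longrightarrow> y \<in> pts H \<Longrightarrow> z \<in> pts H \<Longrightarrow> b (pls H x y) z = b x z + b y z"
  using hermb unfolding hermitian_form_def by blast

lemma b_scl_left: "x \<in> pts H \<Longrightarrow> z \<in> pts H \<Longrightarrow> b (scl H c x) z = c * b x z"
  using hermb unfolding hermitian_form_def by blast

lemma b_sym: "x \<in> pts H \<Longrightarrow> y \<in> pts H \<Longrightarrow> b y x = cnj (b x y)"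
  using hermb unfolding hermitian_form_def by blast

lemma b_pls_right:
  assumes "x \<in> pts H" "y \<in> pts H" "z \<in> pts H" shows "b z (pls H x y) = b z x + b z y"
proof -
  have "b z (pls H x y) = cnj (b (pls H x y) z)" using assms by (intro b_sym) auto
  also have "\<dots> = cnj (b x z) + cnj (b y z)" using assms by (simp add: b_pls_left)
  also have "cnj (b x z) = b z x" using b_sym[of x z] assms by simp
  also have "cnj (b y z) = b z y" using b_sym[of y z] assms by simp
  finally show ?thesis .
qed

lemma b_scl_right:
  assumes "x \<in> pts H" "z \<in> pts H" shows "b z (scl H c x) = cnj c * b z x"
proof -
  have "b z (scl H c x) = cnj (b (scl H c x) z)" using assms by (intro b_sym) auto
  also have "\<dots> = cnj c * cnj (b x z)" using assms by (simp add: b_scl_left)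
  also have "cnj (b x z) = b z x" using b_sym[of x z] assms by simp
  finally show ?thesis .
qed

lemma b_dif_left: "x \<in> pts H \<Longrightarrow> y \<in> pts H \<Longrightarrow> z \<in> pts H \<Longrightarrow> b (dif H x y) z = b x z - b y z"
  by (simp add: dif_def b_pls_left b_scl_left)

lemma b_dif_right: "x \<in> pts H \<Longrightarrow> y \<in> pts H \<Longrightarrow> z \<in> pts H \<Longrightarrow> b z (dif H x y) = b z x - b z y"
  by (simp add: dif_def b_pls_right b_scl_right)

lemma b_zer_left [simp]: "z \<in> pts H \<Longrightarrow> b (zer H) z = 0"
  using b_scl_left[of "zer H" z 0] scl_zer[of 0] by simp

lemma b_zer_right [simp]: "z \<in> pts H \<Longrightarrow> b z (zer H) = 0"
  using b_scl_right[of "zer H" z 0] scl_zer[of 0] by simp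

lemma b_self_real: "x \<in> pts H \<Longrightarrow> Im (b x x) = 0"
  using arg_cong[OF b_sym[of x x], of Im] by simp

lemmas b_simps = b_pls_left b_pls_right b_scl_left b_scl_right b_dif_left b_dif_right

lemma polarization:
  assumes "x \<in> pts H" "y \<in> pts H"
  shows "4 * b x y = b (pls H x y) (pls H x y) - b (dif H x y) (dif H x y)
     + \<i> * b (pls H x (scl H \<i> y)) (pls H x (scl H \<i> y))
     - \<i> * b (dif H x (scl H \<i> y)) (dif H x (scl H \<i> y))"
  using assms by (simp add: b_simps algebra_simps)

end

text \<open>By polarization. In \<open>converse\<close> it turns the factorization, which speaks
  only of the diagonal of \<open>q\<close>, into a formula for all values of \<open>q\<close>, the
  cross block included.\<close>

lemma hform_eq_from_diag:
  assumes "hform H b" "hform H b'" and d: "\<And>x. x \<in> pts H \<Longrightarrow> b x x = b' x x"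
    and xy: "x \<in> pts H" "y \<in> pts H"
  shows "b x y = b' x y"
proof -
  interpret b: hform H b by fact
  interpret b': hform H b' by fact
  have "4 * b x y = 4 * b' x y"
    unfolding b.polarization[OF xy] b'.polarization[OF xy] using xy by (simp add: d)
  then show ?thesis by simp
qed

text \<open>The discriminant of a nonnegative quadratic. Besides Cauchy-Schwarz it serves in
  \<open>riesz\<close>: with A = 0 it makes the linear coefficient vanish, which is the first-order
  condition at a minimum.\<close>

lemma re_quadratic_bound:
  fixes A B C :: real
  assumes "\<And>t::real. 0 \<le> A + 2 * t * B + t\<^sup>2 * C" "0 \<le> A" "0 \<le> C"
  shows "B\<^sup>2 \<le> A * C"
proof (cases "C = 0")
  case True
  have "B = 0"
  proof (rule ccontr)
    assume "B \<noteq> 0"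
    \<comment> \<open>For C = 0 the expression is affine in t, and at this t it equals -1.\<close>
    with assms(1)[of "- (A + 1) / (2 * B)"] True assms(2) show False by (simp add: field_simps)
  qed
  with assms show ?thesis by simp
next
  case False
  then have "C > 0" using assms by simp
  \<comment> \<open>The minimizer of the quadratic.\<close>
  from assms(1)[of "- B / C"] have "0 \<le> A - B\<^sup>2 / C"
    using \<open>C > 0\<close> by (simp add: power2_eq_square field_simps)
  then show ?thesis using \<open>C > 0\<close> by (simp add: field_simps)
qed

locale nnform = hform +
  assumes nnb: "nonneg_form H b"
begin

lemma b_nn: "x \<in> pts H \<Longrightarrow> 0 \<le> Re (b x x)"
  using nnb by (simp add: nonneg_form_def)

lemma cauchy_schwarz_sq:
  assumes x: "x \<in> pts H" and y: "y \<in> pts H"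
  shows "(cmod (b x y))\<^sup>2 \<le> Re (b x x) * Re (b y y)"
proof (cases "b x y = 0")
  case True then show ?thesis using b_nn[OF x] b_nn[OF y] by simp
next
  case False
  define r where "r = complex_of_real (cmod (b x y))"
  have r: "r \<noteq> 0" "cnj r = r" "b x y * cnj (b x y) = r * r"
    using False by (simp_all add: r_def power2_eq_square flip: complex_norm_square)
  \<comment> \<open>A unimodular factor: after y is multiplied by it the cross term becomes the real
    number |b x y|, so a real parameter t suffices below.\<close>
  define c where "c = b x y / r"
  have c: "c * cnj c = 1" using r by (simp add: c_def)
  have cb: "cnj c * b x y = of_real (cmod (b x y))"
    using r by (simp add: c_def mult.commute r_def)
  have "0 \<le> Re (b x x) + 2 * t * cmod (b x y) + t\<^sup>2 * Re (b y y)" for t :: real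
  proof -
    define z where "z = pls H x (scl H (of_real t * c) y)"
    have "b z z = b x x + of_real t * (cnj c * b x y) + of_real t * (c * b y x)
        + of_real (t\<^sup>2) * (c * cnj c) * b y y"
      using x y by (simp add: z_def b_simps algebra_simps power2_eq_square)
    also have "c * b y x = of_real (cmod (b x y))"
    proof -
      have "c * b y x = cnj (cnj c * b x y)" using b_sym[OF x y] by simp
      then show ?thesis by (simp add: cb)
    qed
    finally have "Re (b z z) = Re (b x x) + 2 * t * cmod (b x y) + t\<^sup>2 * Re (b y y)"
      by (simp add: cb c)
    moreover have "0 \<le> Re (b z z)" using x y by (auto simp: z_def intro!: b_nn)
    ultimately show ?thesis by simp
  qed
  then show ?thesis using b_nn[OF x] b_nn[OF y] by (intro re_quadratic_bound) auto
qed

lemma cauchy_schwarz_form: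
  assumes x: "x \<in> pts H" and y: "y \<in> pts H"
  shows "cmod (b x y) \<le> sqrt (Re (b x x)) * sqrt (Re (b y y))"
proof -
  have "cmod (b x y) = sqrt ((cmod (b x y))\<^sup>2)" by simp
  also have "\<dots> \<le> sqrt (Re (b x x) * Re (b y y))"
    using cauchy_schwarz_sq[OF x y] by (rule real_sqrt_le_mono)
  finally show ?thesis by (simp add: real_sqrt_mult)
qed

end

text \<open>Null vectors are allowed on purpose: square integrable functions before passing to
  classes, Cauchy sequences before passing to the completion, and \<open>N\<close> with the form
  \<open>q\<close> are all of this kind.\<close>

locale sip_space = cvspace +
  assumes herm: "hermitian_form H (ip H)" and nn: "nonneg_form H (ip H)"

sublocale sip_space \<subseteq> nnform H "ip H"
  by unfold_locales (fact herm nn)+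

context sip_space
begin

lemmas ip_simps = b_simps

lemma nrm_nonneg [simp]: "0 \<le> nrm H x" if "x \<in> pts H"
  using b_nn[OF that] by (simp add: nrm_def)

lemma nrm_sq: "x \<in> pts H \<Longrightarrow> (nrm H x)\<^sup>2 = Re (ip H x x)"
  using b_nn[of x] by (simp add: nrm_def)

lemma ip_self: "x \<in> pts H \<Longrightarrow> ip H x x = of_real ((nrm H x)\<^sup>2)"
  using b_nn[of x] b_self_real[of x] by (simp add: nrm_sq complex_eq_iff)

lemma cauchy_schwarz: "x \<in> pts H \<Longrightarrow> y \<in> pts H \<Longrightarrow> cmod (ip H x y) \<le> nrm H x * nrm H y"
  unfolding nrm_def by (rule cauchy_schwarz_form)

lemma nrm_zer [simp]: "nrm H (zer H) = 0"
  by (simp add: nrm_def)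

lemma nrm_scl:
  assumes "x \<in> pts H" shows "nrm H (scl H c x) = cmod c * nrm H x"
proof -
  have "(nrm H (scl H c x))\<^sup>2 = (cmod c * nrm H x)\<^sup>2"
  proof -
    have "ip H (scl H c x) (scl H c x) = (c * cnj c) * ip H x x"
      using assms by (simp add: ip_simps)
    then show ?thesis using assms
      by (simp add: nrm_sq power_mult_distrib complex_norm_square[symmetric] del: complex_cnj_cnj
          flip: of_real_power)
  qed
  then show ?thesis using assms by (simp add: power2_eq_iff_nonneg)
qed

lemma nrm_pls_sq: "x \<in> pts H \<Longrightarrow> y \<in> pts H \<Longrightarrow>
   (nrm H (pls H x y))\<^sup>2 = (nrm H x)\<^sup>2 + 2 * Re (ip H x y) + (nrm H y)\<^sup>2"
  using b_sym[of x y] by (simp add: nrm_sq ip_simps)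

lemma nrm_dif_sq: "x \<in> pts H \<Longrightarrow> y \<in> pts H \<Longrightarrow>
   (nrm H (dif H x y))\<^sup>2 = (nrm H x)\<^sup>2 - 2 * Re (ip H x y) + (nrm H y)\<^sup>2"
  using b_sym[of x y] by (simp add: nrm_sq ip_simps)

lemma nrm_triangle:
  assumes "x \<in> pts H" "y \<in> pts H" shows "nrm H (pls H x y) \<le> nrm H x + nrm H y"
proof -
  have "Re (ip H x y) \<le> nrm H x * nrm H y"
    using cauchy_schwarz[OF assms] complex_Re_le_cmod[of "ip H x y"] by linarith
  then have "(nrm H (pls H x y))\<^sup>2 \<le> (nrm H x + nrm H y)\<^sup>2"
    using nrm_pls_sq[OF assms] by (simp add: power2_sum)
  then show ?thesis using assms by (simp add: power2_le_iff_abs_le)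
qed

lemma dif_swap: "x \<in> pts H \<Longrightarrow> y \<in> pts H \<Longrightarrow> dif H x y = scl H (-1) (dif H y x)"
  by (simp add: dif_def scl_pls scl_scl pls_comm)

lemma nrm_dif_commute: "x \<in> pts H \<Longrightarrow> y \<in> pts H \<Longrightarrow> nrm H (dif H x y) = nrm H (dif H y x)"
  using dif_swap[of x y] by (simp add: nrm_scl)

lemma dif_telescope:
  assumes "x \<in> pts H" "y \<in> pts H" "z \<in> pts H"
  shows "dif H x z = pls H (dif H x y) (dif H y z)"
proof -
  have "pls H (scl H (-1) y) (pls H y (scl H (-1) z)) = scl H (-1) z"
    using pls_dif_cancel[of z y] assms
    by (metis dif_def dif_self pls_assoc pls_comm pls_zer scl_in zer_in)
  then show ?thesis using assms by (simp add: dif_def pls_assoc)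
qed

lemma nrm_dif_triangle:
  assumes "x \<in> pts H" "y \<in> pts H" "z \<in> pts H"
  shows "nrm H (dif H x z) \<le> nrm H (dif H x y) + nrm H (dif H y z)"
  using dif_telescope[OF assms] nrm_triangle[of "dif H x y" "dif H y z"] assms by simp

lemma nrm_dif_ge:
  assumes "x \<in> pts H" "y \<in> pts H" shows "\<bar>nrm H x - nrm H y\<bar> \<le> nrm H (dif H x y)"
proof -
  have "nrm H x \<le> nrm H y + nrm H (dif H x y)" if "x \<in> pts H" "y \<in> pts H" for x y
    using nrm_triangle[of y "dif H x y"] pls_dif_cancel[of x y] that by simp
  from this[of x y] this[of y x] show ?thesis using nrm_dif_commute[of x y] assms by simp
qed

lemma nrm_zero_ip: "x \<in> pts H \<Longrightarrow> y \<in> pts H \<Longrightarrow> nrm H x = 0 \<Longrightarrow> ip H x y = 0"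
  using cauchy_schwarz[of x y] by simp

lemma nrm_zero_ip': "x \<in> pts H \<Longrightarrow> y \<in> pts H \<Longrightarrow> nrm H x = 0 \<Longrightarrow> ip H y x = 0"
  using cauchy_schwarz[of y x] by simp

lemma parallelogram: "x \<in> pts H \<Longrightarrow> y \<in> pts H \<Longrightarrow>
   (nrm H (pls H x y))\<^sup>2 + (nrm H (dif H x y))\<^sup>2 = 2 * (nrm H x)\<^sup>2 + 2 * (nrm H y)\<^sup>2"
  by (simp add: nrm_pls_sq nrm_dif_sq)

lemma tendsto_ip_left:
  assumes "\<And>k. x k \<in> pts H" "l \<in> pts H" "y \<in> pts H" "tends H x l"
  shows "(\<lambda>k. ip H (x k) y) \<longlonglongrightarrow> ip H l y"
proof -
  have "(\<lambda>k. ip H (x k) y - ip H l y) \<longlonglongrightarrow> 0"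
  proof (rule Lim_null_comparison)
    have "cmod (ip H (x k) y - ip H l y) \<le> nrm H (dif H (x k) l) * nrm H y" for k
      using cauchy_schwarz[of "dif H (x k) l" y] assms by (simp add: ip_simps)
    then show "\<forall>\<^sub>F k in sequentially. cmod (ip H (x k) y - ip H l y) \<le> nrm H (dif H (x k) l) * nrm H y"
      by simp
    show "(\<lambda>k. nrm H (dif H (x k) l) * nrm H y) \<longlonglongrightarrow> 0"
      using assms(4) unfolding tends_def by (auto intro: tendsto_eq_intros)
  qed
  then show ?thesis by (simp add: LIM_zero_iff)
qed

lemma tendsto_nrm:
  assumes "\<And>k. x k \<in> pts H" "l \<in> pts H" "tends H x l"
  shows "(\<lambda>k. nrm H (x k)) \<longlonglongrightarrow> nrm H l"
proof -
  have "(\<lambda>k. nrm H (x k) - nrm H l) \<longlonglongrightarrow> 0"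
    by (rule Lim_null_comparison[OF _ assms(3)[unfolded tends_def]])
       (use nrm_dif_ge[of "x _" l] assms in simp)
  then show ?thesis by (simp add: LIM_zero_iff)
qed

end

locale ip_space = sip_space +
  assumes definite: "x \<in> pts H \<Longrightarrow> ip H x x = 0 \<Longrightarrow> x = zer H"
begin

lemma nrm_eq_zero: "x \<in> pts H \<Longrightarrow> nrm H x = 0 \<longleftrightarrow> x = zer H"
proof
  assume "x \<in> pts H" "nrm H x = 0"
  then show "x = zer H" using ip_self[of x] by (intro definite) auto
qed simp

lemma ip_eqI:
  assumes "x \<in> pts H" "y \<in> pts H" "\<And>z. z \<in> pts H \<Longrightarrow> ip H x z = ip H y z"
  shows "x = y"
proof (rule dif_eq_zer)
  have "ip H (dif H x y) (dif H x y) = 0"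
    using assms(3)[of x] assms(3)[of y] assms(1,2) by (simp add: ip_simps)
  then show "dif H x y = zer H" using assms(1,2) by (intro definite) auto
qed (fact assms)+

lemma nrm_dif_zero: "x \<in> pts H \<Longrightarrow> y \<in> pts H \<Longrightarrow> nrm H (dif H x y) = 0 \<Longrightarrow> x = y"
  using nrm_eq_zero[of "dif H x y"] dif_eq_zer[of x y] by blast

lemma tends_unique:
  assumes "\<And>k. x k \<in> pts H" "l \<in> pts H" "m \<in> pts H" "tends H x l" "tends H x m"
  shows "l = m"
proof (rule ip_eqI)
  fix z assume z: "z \<in> pts H"
  show "ip H l z = ip H m z"
    using tendsto_ip_left[OF assms(1,2) z assms(4)] tendsto_ip_left[OF assms(1,3) z assms(5)]
    by (rule LIMSEQ_unique)
qed (fact assms)+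

end

locale hilb = ip_space +
  assumes complete: "cauchy_seq H x \<Longrightarrow> \<exists>l\<in>pts H. tends H x l"

lemma hilb_iff: "hilb H \<longleftrightarrow> hilbert_space H"
  unfolding hilb_def hilb_axioms_def ip_space_def ip_space_axioms_def sip_space_def
    sip_space_axioms_def cvspace_def hilbert_space_def by (simp only: Ball_def conj_assoc)

section \<open>Linear and bounded operators\<close>

lemma linear_opD:
  assumes "linear_op H K T" "x \<in> pts H"
  shows "T x \<in> pts K" "y \<in> pts H \<Longrightarrow> T (pls H x y) = pls K (T x) (T y)"
    "T (scl H c x) = scl K c (T x)" "y \<in> pts H \<Longrightarrow> cvspace H \<Longrightarrow> T (dif H x y) = dif K (T x) (T y)"
proof -
  show "T x \<in> pts K" "T (scl H c x) = scl K c (T x)"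
    using assms by (simp_all add: linear_op_def)
  show pl: "T (pls H x y) = pls K (T x) (T y)" if "y \<in> pts H" for y
    using assms that by (simp add: linear_op_def)
  show "T (dif H x y) = dif K (T x) (T y)" if "y \<in> pts H" "cvspace H"
    using pl[of "scl H (-1) y"] assms that by (simp add: dif_def cvspace.scl_in linear_op_def)
qed

lemma linear_op_zer:
  assumes "linear_op H K T" "cvspace H" "cvspace K" shows "T (zer H) = zer K"
  using linear_opD(3)[OF assms(1), of "zer H" 0] linear_opD(1)[OF assms(1), of "zer H"]
    cvspace.scl_zero[OF assms(3)] cvspace.scl_zer[OF assms(2)] cvspace.zer_in[OF assms(2)] by metis

lemma bounded_op_linear: "bounded_op H K T \<Longrightarrow> linear_op H K T"
  by (simp add: bounded_op_def)

lemma bounded_op_nonneg: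
  assumes "bounded_op H K T" "sip_space H"
  obtains B where "0 \<le> B" "\<And>x. x \<in> pts H \<Longrightarrow> nrm K (T x) \<le> B * nrm H x"
proof -
  obtain B where B: "\<And>x. x \<in> pts H \<Longrightarrow> nrm K (T x) \<le> B * nrm H x"
    using assms(1) by (auto simp: bounded_op_def)
  have "nrm K (T x) \<le> max B 0 * nrm H x" if "x \<in> pts H" for x
    using B[OF that] sip_space.nrm_nonneg[OF assms(2) that]
    by (meson max.cobounded1 mult_right_mono order_trans)
  then show thesis using that[of "max B 0"] by simp
qed

lemma dif_upd [simp]: "dif (H\<lparr>pts := W\<rparr>) = dif H" "dif (H\<lparr>ip := b\<rparr>) = dif H"
  by (intro ext, simp add: dif_def)+

lemma nrm_upd [simp]: "nrm (H\<lparr>pts := W\<rparr>) = nrm H"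
  by (intro ext) (simp add: nrm_def)

lemma hermitian_form_ip_upd [simp]: "hermitian_form (H\<lparr>ip := c\<rparr>) b = hermitian_form H b"
  by (simp add: hermitian_form_def)

lemma nonneg_form_ip_upd [simp]: "nonneg_form (H\<lparr>ip := c\<rparr>) b = nonneg_form H b"
  by (simp add: nonneg_form_def)

lemma nrm_ip_upd: "nrm (H\<lparr>ip := b\<rparr>) x = sqrt (Re (b x x))"
  by (simp add: nrm_def)

lemma tends_upd [simp]: "tends (H\<lparr>pts := W\<rparr>) = tends H"
  by (intro ext) (simp add: tends_def)

section \<open>Subspaces, quotients and completions\<close>

definition csubspace :: "'a cspace \<Rightarrow> 'a set \<Rightarrow> bool" where
  "csubspace H W \<longleftrightarrow> W \<subseteq> pts H \<and> zer H \<in> W \<and> (\<forall>x\<in>W. \<forall>y\<in>W. pls H x y \<in> W) \<and>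
     (\<forall>c. \<forall>x\<in>W. scl H c x \<in> W)"

lemma csubspaceD:
  assumes "csubspace H W"
  shows "W \<subseteq> pts H" "x \<in> W \<Longrightarrow> x \<in> pts H" "zer H \<in> W" "x \<in> W \<Longrightarrow> y \<in> W \<Longrightarrow> pls H x y \<in> W"
    "x \<in> W \<Longrightarrow> scl H c x \<in> W" "x \<in> W \<Longrightarrow> y \<in> W \<Longrightarrow> dif H x y \<in> W"
  using assms by (auto simp: csubspace_def dif_def)

lemma hermitian_form_subset:
  "hermitian_form H b \<Longrightarrow> W \<subseteq> pts H \<Longrightarrow> hermitian_form (H\<lparr>pts := W\<rparr>) b"
proof -
  have e: "pts (H\<lparr>pts := W\<rparr>) = W" "pls (H\<lparr>pts := W\<rparr>) = pls H" "scl (H\<lparr>pts := W\<rparr>) = scl H"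
    by simp_all
  assume "hermitian_form H b" "W \<subseteq> pts H"
  then show ?thesis unfolding hermitian_form_def e by blast
qed

lemma nonneg_form_subset:
  "nonneg_form H b \<Longrightarrow> W \<subseteq> pts H \<Longrightarrow> nonneg_form (H\<lparr>pts := W\<rparr>) b"
  unfolding nonneg_form_def by (simp add: subset_iff)

lemma (in cvspace) subspace_cvspace:
  assumes W: "csubspace H W" shows "cvspace (H\<lparr>pts := W\<rparr>)"
  unfolding cvspace_def vector_space_on_def dif_upd
  using csubspaceD[OF W] by (auto simp: pls_comm pls_assoc pls_left_comm scl_scl scl_add scl_pls)

lemma (in ip_space) subspace_ip_space:
  assumes W: "csubspace H W" shows "ip_space (H\<lparr>pts := W\<rparr>)"
proof -
  interpret W: cvspace "H\<lparr>pts := W\<rparr>" by (rule subspace_cvspace[OF W])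
  show ?thesis
    by unfold_locales
      (use csubspaceD[OF W] hermitian_form_subset[OF herm] nonneg_form_subset[OF nn] definite in auto)
qed

lemma (in hilb) subspace_hilb:
  assumes W: "csubspace H W" and cl: "closed_subset H W" shows "hilb (H\<lparr>pts := W\<rparr>)"
proof -
  interpret W: ip_space "H\<lparr>pts := W\<rparr>" by (rule subspace_ip_space[OF W])
  show ?thesis
  proof unfold_locales
    fix x assume "cauchy_seq (H\<lparr>pts := W\<rparr>) x"
    then have x: "\<And>k. x k \<in> W" "cauchy_seq H x"
      using csubspaceD[OF W] unfolding cauchy_seq_def by auto
    obtain l where "l \<in> pts H" "tends H x l" using complete[OF x(2)] by blast
    moreover then have "l \<in> W" using cl x(1) unfolding closed_subset_def by blast
    ultimately show "\<exists>l\<in>pts (H\<lparr>pts := W\<rparr>). tends (H\<lparr>pts := W\<rparr>) x l" by auto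
  qed
qed

lemma (in hform) change_ip_cvspace: "cvspace (H\<lparr>ip := b\<rparr>)"
  unfolding cvspace_def vector_space_on_def dif_upd
  by (auto simp: pls_comm pls_assoc pls_left_comm scl_scl scl_add scl_pls)

lemma (in nnform) form_sip_space: "sip_space (H\<lparr>ip := b\<rparr>)"
proof -
  interpret cvspace "H\<lparr>ip := b\<rparr>" by (rule change_ip_cvspace)
  show ?thesis
    by unfold_locales (simp_all add: hermb nnb)
qed

section \<open>Quotients by null vectors\<close>

context sip_space
begin

lemma null_trans:
  assumes "x \<in> pts H" "y \<in> pts H" "z \<in> pts H" "nrm H (dif H x y) = 0" "nrm H (dif H y z) = 0"
  shows "nrm H (dif H x z) = 0"
  using nrm_dif_triangle[OF assms(1-3)] assms by (simp add: order_antisym)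

lemma cls_eq_iff:
  assumes x: "x \<in> pts H" and y: "y \<in> pts H"
  shows "cls H x = cls H y \<longleftrightarrow> nrm H (dif H x y) = 0"
proof
  assume "cls H x = cls H y"
  then have "y \<in> cls H x" using y by (simp add: cls_def)
  then show "nrm H (dif H x y) = 0" by (simp add: cls_def)
next
  assume a: "nrm H (dif H x y) = 0"
  then have a': "nrm H (dif H y x) = 0" using nrm_dif_commute x y by simp
  show "cls H x = cls H y"
    unfolding cls_def using null_trans[OF x y _ a] null_trans[OF y x _ a'] by blast
qed

text \<open>\<open>repr\<close> is an arbitrary choice, and a null distance is all that is known
  about it. Operations on classes are well defined because sums, multiples and inner products
  respect null distances.\<close>

lemma repr_cls:
  assumes x: "x \<in> pts H"
  shows "repr (cls H x) \<in> pts H" "nrm H (dif H (repr (cls H x)) x) = 0" "nrm H (dif H x (repr (cls H x))) = 0"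
proof -
  have "x \<in> cls H x" using x by (simp add: cls_def)
  then have "repr (cls H x) \<in> cls H x" unfolding repr_def by (rule someI)
  then show "repr (cls H x) \<in> pts H" "nrm H (dif H x (repr (cls H x))) = 0" by (auto simp: cls_def)
  then show "nrm H (dif H (repr (cls H x)) x) = 0" using nrm_dif_commute x by simp
qed

lemma cls_repr_cls: "x \<in> pts H \<Longrightarrow> cls H (repr (cls H x)) = cls H x"
  by (simp add: cls_eq_iff repr_cls)

lemma null_ip_left:
  "x \<in> pts H \<Longrightarrow> y \<in> pts H \<Longrightarrow> z \<in> pts H \<Longrightarrow> nrm H (dif H x y) = 0 \<Longrightarrow> ip H x z = ip H y z"
  using nrm_zero_ip[of "dif H x y" z] by (simp add: ip_simps)

lemma null_ip_right:
  "x \<in> pts H \<Longrightarrow> y \<in> pts H \<Longrightarrow> z \<in> pts H \<Longrightarrow> nrm H (dif H x y) = 0 \<Longrightarrow> ip H z x = ip H z y"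
  using nrm_zero_ip'[of "dif H x y" z] by (simp add: ip_simps)

lemma dif_pls_pls:
  assumes "x \<in> pts H" "y \<in> pts H" "z \<in> pts H" "w \<in> pts H"
  shows "dif H (pls H x y) (pls H z w) = pls H (dif H x z) (dif H y w)"
  using assms by (simp add: dif_def scl_pls pls_interchange)

lemma dif_scl_scl:
  assumes "x \<in> pts H" "y \<in> pts H"
  shows "dif H (scl H c x) (scl H c y) = scl H c (dif H x y)"
  using assms by (simp add: dif_def scl_pls scl_scl)

lemma null_pls:
  assumes "x \<in> pts H" "y \<in> pts H" "z \<in> pts H" "w \<in> pts H"
    "nrm H (dif H x z) = 0" "nrm H (dif H y w) = 0"
  shows "nrm H (dif H (pls H x y) (pls H z w)) = 0"
proof -
  have "nrm H (dif H (pls H x y) (pls H z w)) \<le> 0"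
    using nrm_triangle[of "dif H x z" "dif H y w"] assms by (simp add: dif_pls_pls)
  then show ?thesis using assms by (intro antisym) auto
qed

lemma null_scl:
  "x \<in> pts H \<Longrightarrow> y \<in> pts H \<Longrightarrow> nrm H (dif H x y) = 0 \<Longrightarrow> nrm H (dif H (scl H c x) (scl H c y)) = 0"
  by (simp add: dif_scl_scl nrm_scl)

lemma quot_pts: "pts (quotient_space H) = cls H ` pts H"
  by (simp add: quotient_space_def)

lemma quot_in [simp]: "x \<in> pts H \<Longrightarrow> cls H x \<in> pts (quotient_space H)"
  by (simp add: quot_pts)

lemma quot_repr: "X \<in> pts (quotient_space H) \<Longrightarrow> repr X \<in> pts H \<and> cls H (repr X) = X"
  by (auto simp: quot_pts repr_cls cls_repr_cls)

lemma quot_zer: "zer (quotient_space H) = cls H (zer H)"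
  by (simp add: quotient_space_def)

lemma quot_pls: "x \<in> pts H \<Longrightarrow> y \<in> pts H \<Longrightarrow>
    pls (quotient_space H) (cls H x) (cls H y) = cls H (pls H x y)"
  by (simp add: quotient_space_def cls_eq_iff repr_cls null_pls)

lemma quot_scl: "x \<in> pts H \<Longrightarrow> scl (quotient_space H) c (cls H x) = cls H (scl H c x)"
  by (simp add: quotient_space_def cls_eq_iff repr_cls null_scl)

lemma quot_ip: "x \<in> pts H \<Longrightarrow> y \<in> pts H \<Longrightarrow> ip (quotient_space H) (cls H x) (cls H y) = ip H x y"
  using null_ip_left[of "repr (cls H x)" x "repr (cls H y)"] null_ip_right[of "repr (cls H y)" y x]
  by (simp add: quotient_space_def repr_cls)

lemma quot_ip_repr: "ip (quotient_space H) X Y = ip H (repr X) (repr Y)"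
  by (simp add: quotient_space_def)

lemma quot_nrm_repr: "nrm (quotient_space H) X = nrm H (repr X)"
  by (simp add: nrm_def quot_ip_repr)

lemma quot_nrm: "x \<in> pts H \<Longrightarrow> nrm (quotient_space H) (cls H x) = nrm H x"
  by (simp add: nrm_def quot_ip)

lemma quot_dif: "x \<in> pts H \<Longrightarrow> y \<in> pts H \<Longrightarrow>
    dif (quotient_space H) (cls H x) (cls H y) = cls H (dif H x y)"
  by (simp add: dif_def quot_pls quot_scl)

lemma quot_cvspace: "cvspace (quotient_space H)"
  unfolding cvspace_def vector_space_on_def
  by (auto simp: quot_pts quot_zer quot_pls quot_scl quot_dif pls_comm scl_scl scl_add scl_pls pls_assoc pls_left_comm
      intro!: imageI)

lemma quot_ip_space: "ip_space (quotient_space H)"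
proof -
  interpret Q: cvspace "quotient_space H" by (rule quot_cvspace)
  show ?thesis
  proof unfold_locales
    show "hermitian_form (quotient_space H) (ip (quotient_space H))"
      unfolding hermitian_form_def
    proof (intro conjI ballI allI; unfold quot_pts; elim imageE; hypsubst)
      fix x y assume "x \<in> pts H" "y \<in> pts H"
      then show "ip (quotient_space H) (cls H y) (cls H x) = cnj (ip (quotient_space H) (cls H x) (cls H y))"
        by (simp add: quot_ip) (rule b_sym)
    qed (simp_all add: quot_pls quot_scl quot_ip ip_simps)
    show "nonneg_form (quotient_space H) (ip (quotient_space H))"
      unfolding nonneg_form_def
      by (auto simp: quot_pts quot_ip b_nn b_self_real)
    fix X assume "X \<in> pts (quotient_space H)" and z: "ip (quotient_space H) X X = 0"
    then obtain x where x: "x \<in> pts H" "X = cls H x" by (auto simp: quot_pts)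
    then have "nrm H x = 0" using z by (simp add: quot_ip nrm_def)
    moreover have "dif H x (zer H) = x" using x by (simp add: dif_def)
    ultimately show "X = zer (quotient_space H)" using x by (simp add: quot_zer cls_eq_iff)
  qed
qed

lemma quot_hilb:
  assumes "\<And>x. cauchy_seq H x \<Longrightarrow> \<exists>l\<in>pts H. tends H x l"
  shows "hilb (quotient_space H)"
proof -
  interpret Q: ip_space "quotient_space H" by (rule quot_ip_space)
  show ?thesis
  proof unfold_locales
    fix X assume X: "cauchy_seq (quotient_space H) X"
    define x where "x = (\<lambda>k. repr (X k))"
    have x: "x k \<in> pts H" "X k = cls H (x k)" for k
      using X quot_repr[of "X k"] by (auto simp: x_def cauchy_seq_def)
    have "cauchy_seq H x" using X x(1) unfolding cauchy_seq_def x(2)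
      by (simp add: quot_dif quot_nrm)
    then obtain l where l: "l \<in> pts H" "tends H x l" using assms by blast
    then have "tends (quotient_space H) X (cls H l)"
      unfolding tends_def x(2) using x(1) by (simp add: quot_dif quot_nrm)
    then show "\<exists>l\<in>pts (quotient_space H). tends (quotient_space H) X l" using l by auto
  qed
qed

section \<open>Cauchy sequences and the completion\<close>

lemma cauchy_seqD:
  assumes "cauchy_seq H x" shows "x k \<in> pts H"
    "\<epsilon> > 0 \<Longrightarrow> \<exists>K. \<forall>i\<ge>K. \<forall>j\<ge>K. nrm H (dif H (x i) (x j)) < \<epsilon>"
  using assms by (auto simp: cauchy_seq_def)

lemma cauchy_const [simp]: "x \<in> pts H \<Longrightarrow> cauchy_seq H (\<lambda>_. x)"
  by (simp add: cauchy_seq_def)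

lemma cauchy_pls:
  assumes x: "cauchy_seq H x" and y: "cauchy_seq H y"
  shows "cauchy_seq H (\<lambda>k. pls H (x k) (y k))"
  unfolding cauchy_seq_def
proof (intro conjI allI impI)
  fix \<epsilon> :: real assume "\<epsilon> > 0"
  obtain K1 where K1: "\<forall>i\<ge>K1. \<forall>j\<ge>K1. nrm H (dif H (x i) (x j)) < \<epsilon>/2"
    using cauchy_seqD(2)[OF x, of "\<epsilon>/2"] \<open>\<epsilon> > 0\<close> by auto
  obtain K2 where K2: "\<forall>i\<ge>K2. \<forall>j\<ge>K2. nrm H (dif H (y i) (y j)) < \<epsilon>/2"
    using cauchy_seqD(2)[OF y, of "\<epsilon>/2"] \<open>\<epsilon> > 0\<close> by auto
  have "nrm H (dif H (pls H (x i) (y i)) (pls H (x j) (y j))) < \<epsilon>"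
    if "i \<ge> max K1 K2" "j \<ge> max K1 K2" for i j
  proof -
    have "nrm H (dif H (x i) (x j)) < \<epsilon>/2" "nrm H (dif H (y i) (y j)) < \<epsilon>/2"
      using that K1 K2 by auto
    then show ?thesis
      using nrm_triangle[of "dif H (x i) (x j)" "dif H (y i) (y j)"]
        cauchy_seqD(1)[OF x] cauchy_seqD(1)[OF y]
      by (simp add: dif_pls_pls)
  qed
  then show "\<exists>K. \<forall>i\<ge>K. \<forall>j\<ge>K. nrm H (dif H (pls H (x i) (y i)) (pls H (x j) (y j))) < \<epsilon>" by blast
qed (use cauchy_seqD(1)[OF x] cauchy_seqD(1)[OF y] in auto)

lemma cauchy_scl:
  assumes x: "cauchy_seq H x" shows "cauchy_seq H (\<lambda>k. scl H c (x k))"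
  unfolding cauchy_seq_def
proof (intro conjI allI impI)
  fix \<epsilon> :: real assume "\<epsilon> > 0"
  then have p: "\<epsilon> / (cmod c + 1) > 0" by (auto intro!: divide_pos_pos add_nonneg_pos)
  obtain K where K: "\<forall>i\<ge>K. \<forall>j\<ge>K. nrm H (dif H (x i) (x j)) < \<epsilon> / (cmod c + 1)"
    using cauchy_seqD(2)[OF x p] by auto
  have "nrm H (dif H (scl H c (x i)) (scl H c (x j))) < \<epsilon>" if "i \<ge> K" "j \<ge> K" for i j
  proof -
    have n: "0 \<le> nrm H (dif H (x i) (x j))" using cauchy_seqD(1)[OF x] by auto
    have "cmod c * nrm H (dif H (x i) (x j)) \<le> (cmod c + 1) * nrm H (dif H (x i) (x j))"
      using n by (intro mult_right_mono) auto
    also have "\<dots> < (cmod c + 1) * (\<epsilon> / (cmod c + 1))"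
      using K that by (intro mult_strict_left_mono) (auto intro: add_nonneg_pos)
    also have "\<dots> = \<epsilon>" by (simp add: add_nonneg_eq_0_iff field_simps)
    finally show ?thesis using cauchy_seqD(1)[OF x] by (simp add: dif_scl_scl nrm_scl)
  qed
  then show "\<exists>K. \<forall>i\<ge>K. \<forall>j\<ge>K. nrm H (dif H (scl H c (x i)) (scl H c (x j))) < \<epsilon>" by blast
qed (use cauchy_seqD(1)[OF x] in auto)

lemma cauchy_bounded:
  assumes x: "cauchy_seq H x" obtains B where "B \<ge> 0" "\<And>k. nrm H (x k) \<le> B"
proof -
  have "Cauchy (\<lambda>k. nrm H (x k))"
  proof (rule metric_CauchyI)
    fix e :: real assume "e > 0"
    then obtain K where "\<forall>i\<ge>K. \<forall>j\<ge>K. nrm H (dif H (x i) (x j)) < e" using cauchy_seqD(2)[OF x] by blast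
    then show "\<exists>M. \<forall>m\<ge>M. \<forall>n\<ge>M. dist (nrm H (x m)) (nrm H (x n)) < e"
      using nrm_dif_ge cauchy_seqD(1)[OF x] unfolding dist_real_def by (meson order_le_less_trans)
  qed
  then have "Bseq (\<lambda>k. nrm H (x k))" by (rule Cauchy_Bseq)
  then obtain B where "B > 0" "\<And>k. norm (nrm H (x k)) \<le> B" unfolding Bseq_def by blast
  then show thesis using that[of B] by (simp add: abs_le_iff)
qed

lemma cauchy_ip_convergent:
  assumes x: "cauchy_seq H x" and y: "cauchy_seq H y"
  shows "convergent (\<lambda>k. ip H (x k) (y k))"
  unfolding Cauchy_convergent_iff[symmetric]
proof (rule metric_CauchyI)
  fix e :: real assume "e > 0"
  obtain Bx where Bx: "Bx \<ge> 0" "\<And>k. nrm H (x k) \<le> Bx" using cauchy_bounded[OF x] by blast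
  obtain By where By: "By \<ge> 0" "\<And>k. nrm H (y k) \<le> By" using cauchy_bounded[OF y] by blast
  define d where "d = e / (Bx + By + 1)"
  have d: "d > 0" using \<open>e > 0\<close> Bx By by (simp add: d_def)
  obtain K1 where K1: "\<forall>i\<ge>K1. \<forall>j\<ge>K1. nrm H (dif H (x i) (x j)) < d" using cauchy_seqD(2)[OF x d] by auto
  obtain K2 where K2: "\<forall>i\<ge>K2. \<forall>j\<ge>K2. nrm H (dif H (y i) (y j)) < d" using cauchy_seqD(2)[OF y d] by auto
  have "dist (ip H (x i) (y i)) (ip H (x j) (y j)) < e" if "i \<ge> max K1 K2" "j \<ge> max K1 K2" for i j
  proof -
    note in' = cauchy_seqD(1)[OF x] cauchy_seqD(1)[OF y]
    have "ip H (x i) (y i) - ip H (x j) (y j) = ip H (dif H (x i) (x j)) (y i) + ip H (x j) (dif H (y i) (y j))"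
      using in' by (simp add: ip_simps)
    then have "dist (ip H (x i) (y i)) (ip H (x j) (y j)) \<le>
        cmod (ip H (dif H (x i) (x j)) (y i)) + cmod (ip H (x j) (dif H (y i) (y j)))"
      by (simp add: dist_norm norm_triangle_ineq)
    also have "\<dots> \<le> nrm H (dif H (x i) (x j)) * nrm H (y i) + nrm H (x j) * nrm H (dif H (y i) (y j))"
      using in' by (intro add_mono cauchy_schwarz) auto
    also have "\<dots> \<le> d * By + Bx * d"
      using in' K1 K2 that Bx By d by (intro add_mono mult_mono) (auto intro: less_imp_le)
    also have "\<dots> < d * (Bx + By + 1)" using d by (simp add: algebra_simps)
    also have "\<dots> = e" using Bx By by (simp add: d_def field_simps add_nonneg_eq_0_iff)
    finally show ?thesis .
  qed
  then show "\<exists>M. \<forall>m\<ge>M. \<forall>n\<ge>M. dist (ip H (x m) (y m)) (ip H (x n) (y n)) < e" by blast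
qed

lemma cauchy_space_ip:
  assumes x: "cauchy_seq H x" and y: "cauchy_seq H y"
  shows "(\<lambda>k. ip H (x k) (y k)) \<longlonglongrightarrow> ip (cauchy_space H) x y"
  using cauchy_ip_convergent[OF assms] by (simp add: cauchy_space_def convergent_LIMSEQ_iff)

lemma cauchy_space_sel [simp]:
  "pts (cauchy_space H) = {x. cauchy_seq H x}" "zer (cauchy_space H) = (\<lambda>_. zer H)"
  "pls (cauchy_space H) = (\<lambda>x y k. pls H (x k) (y k))" "scl (cauchy_space H) = (\<lambda>c x k. scl H c (x k))"
  "dif (cauchy_space H) = (\<lambda>x y k. dif H (x k) (y k))"
  by (auto simp: cauchy_space_def dif_def fun_eq_iff)

lemma cauchy_space_cvspace: "cvspace (cauchy_space H)"
  unfolding cvspace_def vector_space_on_def cauchy_space_sel mem_Collect_eq Ball_def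
  by (auto simp: pls_comm pls_assoc pls_left_comm scl_scl scl_add scl_pls cauchy_seqD cauchy_pls cauchy_scl)

lemma cauchy_space_sip: "sip_space (cauchy_space H)"
proof -
  interpret C: cvspace "cauchy_space H" by (rule cauchy_space_cvspace)
  show ?thesis
  proof unfold_locales
    note lim = LIMSEQ_unique
    show "hermitian_form (cauchy_space H) (ip (cauchy_space H))"
      unfolding hermitian_form_def
    proof (intro conjI ballI allI; unfold cauchy_space_sel mem_Collect_eq)
      fix x y z assume x: "cauchy_seq H x" and y: "cauchy_seq H y" and z: "cauchy_seq H z"
      note i = cauchy_seqD(1)[OF x] cauchy_seqD(1)[OF y] cauchy_seqD(1)[OF z]
      show "ip (cauchy_space H) (\<lambda>k. pls H (x k) (y k)) z = ip (cauchy_space H) x z + ip (cauchy_space H) y z"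
        using cauchy_space_ip[OF cauchy_pls[OF x y] z]
          tendsto_add[OF cauchy_space_ip[OF x z] cauchy_space_ip[OF y z]] i
        by (intro lim[of "\<lambda>k. ip H (pls H (x k) (y k)) (z k)"]) (simp_all add: ip_simps)
    next
      fix x y c assume x: "cauchy_seq H x" and y: "cauchy_seq H y"
      note i = cauchy_seqD(1)[OF x] cauchy_seqD(1)[OF y]
      show "ip (cauchy_space H) (\<lambda>k. scl H c (x k)) y = c * ip (cauchy_space H) x y"
        using cauchy_space_ip[OF cauchy_scl[OF x] y]
          tendsto_mult_left[OF cauchy_space_ip[OF x y], of c] i
        by (intro lim[of "\<lambda>k. ip H (scl H c (x k)) (y k)"]) (simp_all add: ip_simps)
      have "(\<lambda>k. ip H (y k) (x k)) = (\<lambda>k. cnj (ip H (x k) (y k)))" by (intro ext b_sym i)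
      then show "ip (cauchy_space H) y x = cnj (ip (cauchy_space H) x y)"
        using cauchy_space_ip[OF y x] tendsto_cnj[OF cauchy_space_ip[OF x y]]
        by (intro lim[of "\<lambda>k. ip H (y k) (x k)"]) simp_all
    qed
    show "nonneg_form (cauchy_space H) (ip (cauchy_space H))"
      unfolding nonneg_form_def
    proof (intro ballI; unfold cauchy_space_sel mem_Collect_eq)
      fix x assume x: "cauchy_seq H x"
      note l = cauchy_space_ip[OF x x]
      have "(\<lambda>k. Im (ip H (x k) (x k))) \<longlonglongrightarrow> Im (ip (cauchy_space H) x x)" using l by (rule tendsto_Im)
      moreover have "(\<lambda>k. Im (ip H (x k) (x k))) \<longlonglongrightarrow> 0" using cauchy_seqD(1)[OF x] by (simp add: b_self_real)
      ultimately have 1: "Im (ip (cauchy_space H) x x) = 0" by (rule lim)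
      have "0 \<le> Re (ip (cauchy_space H) x x)"
        by (rule LIMSEQ_le_const[OF tendsto_Re[OF l]]) (use cauchy_seqD(1)[OF x] b_nn in auto)
      with 1 show "Im (ip (cauchy_space H) x x) = 0 \<and> 0 \<le> Re (ip (cauchy_space H) x x)" ..
    qed
  qed
qed

lemma cauchy_space_nrm:
  assumes x: "cauchy_seq H x" shows "(\<lambda>k. nrm H (x k)) \<longlonglongrightarrow> nrm (cauchy_space H) x"
  unfolding nrm_def by (intro tendsto_real_sqrt tendsto_Re cauchy_space_ip x)

lemma cauchy_space_const_nrm: "x \<in> pts H \<Longrightarrow> nrm (cauchy_space H) (\<lambda>_. x) = nrm H x"
  using LIMSEQ_unique[OF cauchy_space_nrm[OF cauchy_const, of x], of "nrm H x"] by simp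

lemma cauchy_dif: "cauchy_seq H x \<Longrightarrow> cauchy_seq H y \<Longrightarrow> cauchy_seq H (\<lambda>k. dif H (x k) (y k))"
  unfolding dif_def by (intro cauchy_pls cauchy_scl)

lemma cauchy_space_near:
  assumes x: "cauchy_seq H x" and K: "\<forall>i\<ge>K. nrm H (dif H a (x i)) \<le> \<epsilon>" and a: "a \<in> pts H"
  shows "nrm (cauchy_space H) (dif (cauchy_space H) (\<lambda>_. a) x) \<le> \<epsilon>"
  unfolding cauchy_space_sel
  by (rule LIMSEQ_le_const2[OF cauchy_space_nrm[OF cauchy_dif[OF cauchy_const[OF a] x]]]) (use K in blast)

text \<open>This is the density of \<open>H\<close> in its completion, at the level of sequences:
  the terms, viewed as constant sequences, approximate the sequence itself.\<close>

lemma cauchy_space_tends: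
  assumes x: "cauchy_seq H x" shows "tends (cauchy_space H) (\<lambda>i _. x i) x"
  unfolding tends_def
proof (rule LIMSEQ_I)
  fix r :: real assume "0 < r"
  then obtain K where K: "\<forall>i\<ge>K. \<forall>j\<ge>K. nrm H (dif H (x i) (x j)) < r/2" using cauchy_seqD(2)[OF x, of "r/2"] by auto
  interpret C: sip_space "cauchy_space H" by (rule cauchy_space_sip)
  have "norm (nrm (cauchy_space H) (dif (cauchy_space H) (\<lambda>_. x i) x) - 0) < r" if "i \<ge> K" for i
  proof -
    have "nrm (cauchy_space H) (dif (cauchy_space H) (\<lambda>_. x i) x) \<le> r/2"
      by (rule cauchy_space_near[OF x, of K]) (use K that cauchy_seqD(1)[OF x] in \<open>auto intro: less_imp_le\<close>)
    moreover have "0 \<le> nrm (cauchy_space H) (dif (cauchy_space H) (\<lambda>_. x i) x)"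
      using x cauchy_const[OF cauchy_seqD(1)[OF x]] by (intro C.nrm_nonneg C.dif_in) auto
    ultimately show ?thesis using \<open>r > 0\<close> by simp
  qed
  then show "\<exists>no. \<forall>n\<ge>no. norm (nrm (cauchy_space H) (dif (cauchy_space H) (\<lambda>_. x n) x) - 0) < r" by blast
qed

text \<open>Each \<open>X i\<close> lies within 1/(i+1) of a constant sequence with value
  \<open>l i\<close>. The distances between the \<open>l i\<close> are then controlled by those
  between the \<open>X i\<close>, so \<open>l\<close> is itself a Cauchy sequence, and it is the
  limit.\<close>

lemma cauchy_space_complete:
  assumes X: "cauchy_seq (cauchy_space H) X"
  shows "\<exists>l\<in>pts (cauchy_space H). tends (cauchy_space H) X l"
proof -
  let ?C = "cauchy_space H"
  interpret C: sip_space ?C by (rule cauchy_space_sip)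
  have Xc: "cauchy_seq H (X i)" for i using X by (auto simp: cauchy_seq_def[of ?C])
  have "\<exists>a\<in>pts H. nrm ?C (dif ?C (\<lambda>_. a) (X i)) \<le> 1 / Suc i" for i
  proof -
    obtain K where K: "\<forall>k\<ge>K. \<forall>j\<ge>K. nrm H (dif H (X i k) (X i j)) < 1 / Suc i"
      using cauchy_seqD(2)[OF Xc, of "1 / Suc i" i] by auto
    show ?thesis
      by (rule bexI[of _ "X i K"], rule cauchy_space_near[OF Xc, of K])
         (use K cauchy_seqD(1)[OF Xc] in \<open>auto intro: less_imp_le\<close>)
  qed
  then obtain l where l: "\<And>i. l i \<in> pts H" "\<And>i. nrm ?C (dif ?C (\<lambda>_. l i) (X i)) \<le> 1 / Suc i" by metis
  have lC: "(\<lambda>_. l i) \<in> pts ?C" for i using l(1) by simp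
  have XC: "X i \<in> pts ?C" for i using Xc by simp
  have lc: "cauchy_seq H l"
    unfolding cauchy_seq_def
  proof (intro conjI allI impI l(1))
    fix \<epsilon> :: real assume e: "\<epsilon> > 0"
    obtain K1 where K1: "\<forall>i\<ge>K1. \<forall>j\<ge>K1. nrm ?C (dif ?C (X i) (X j)) < \<epsilon> / 3"
      using C.cauchy_seqD(2)[OF X, of "\<epsilon>/3"] e by auto
    obtain K2 where K2: "1 / Suc K2 < \<epsilon> / 3" using nat_approx_posE[of "\<epsilon>/3"] e by auto
    have "nrm H (dif H (l i) (l j)) < \<epsilon>" if "i \<ge> max K1 K2" "j \<ge> max K1 K2" for i j
    proof -
      have "1 / Suc i \<le> 1 / Suc K2" "1 / Suc j \<le> 1 / Suc K2" using that by (auto simp: field_simps)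
      then have b: "nrm ?C (dif ?C (\<lambda>_. l i) (X i)) < \<epsilon> / 3" "nrm ?C (dif ?C (\<lambda>_. l j) (X j)) < \<epsilon> / 3"
        using l(2)[of i] l(2)[of j] K2 by linarith+
      have "nrm H (dif H (l i) (l j)) = nrm ?C (dif ?C (\<lambda>_. l i) (\<lambda>_. l j))"
        using cauchy_space_const_nrm[of "dif H (l i) (l j)"] l(1) by simp
      also have "\<dots> \<le> nrm ?C (dif ?C (\<lambda>_. l i) (X i)) + nrm ?C (dif ?C (X i) (\<lambda>_. l j))"
        using lC XC by (rule C.nrm_dif_triangle) (use lC in auto)
      also have "nrm ?C (dif ?C (X i) (\<lambda>_. l j)) \<le> nrm ?C (dif ?C (X i) (X j)) + nrm ?C (dif ?C (X j) (\<lambda>_. l j))"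
        by (rule C.nrm_dif_triangle) (fact XC lC)+
      also have "nrm ?C (dif ?C (X j) (\<lambda>_. l j)) = nrm ?C (dif ?C (\<lambda>_. l j) (X j))"
        by (rule C.nrm_dif_commute) (fact XC lC)+
      finally show ?thesis using b K1 that by fastforce
    qed
    then show "\<exists>K. \<forall>i\<ge>K. \<forall>j\<ge>K. nrm H (dif H (l i) (l j)) < \<epsilon>" by blast
  qed
  have lC': "l \<in> pts ?C" using lc by simp
  have "tends ?C X l"
    unfolding tends_def
  proof (rule Lim_null_comparison)
    have "norm (nrm ?C (dif ?C (X i) l)) \<le> 1 / Suc i + nrm ?C (dif ?C (\<lambda>_. l i) l)" for i
      using C.nrm_dif_triangle[OF XC[of i] lC[of i] lC'] C.nrm_dif_commute[OF XC[of i] lC[of i]] l(2)[of i]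
        C.nrm_nonneg[OF C.dif_in[OF XC[of i] lC']] by simp
    then show "\<forall>\<^sub>F i in sequentially. norm (nrm ?C (dif ?C (X i) l)) \<le> 1 / Suc i + nrm ?C (dif ?C (\<lambda>_. l i) l)"
      by simp
    have "(\<lambda>i. 1 / real (Suc i)) \<longlonglongrightarrow> 0" by (rule LIMSEQ_Suc[OF lim_1_over_n])
    then show "(\<lambda>i. 1 / Suc i + nrm ?C (dif ?C (\<lambda>_. l i) l)) \<longlonglongrightarrow> 0"
      using tendsto_add[OF _ cauchy_space_tends[OF lc, unfolded tends_def]] by fastforce
  qed
  then show ?thesis using lC' by blast
qed

lemma completion_hilb: "hilb (completion H)"
  unfolding completion_def by (rule sip_space.quot_hilb[OF cauchy_space_sip cauchy_space_complete])

lemma into_linear: "linear_op H (completion H) (into_completion H)"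
proof -
  interpret C: sip_space "cauchy_space H" by (rule cauchy_space_sip)
  show ?thesis unfolding linear_op_def completion_def into_completion_def
    by (auto simp: C.quot_pls C.quot_scl)
qed

lemma into_ip: "x \<in> pts H \<Longrightarrow> y \<in> pts H \<Longrightarrow>
    ip (completion H) (into_completion H x) (into_completion H y) = ip H x y"
  unfolding completion_def into_completion_def
  using LIMSEQ_unique[OF cauchy_space_ip[OF cauchy_const cauchy_const, of x y], of "ip H x y"]
  by (simp add: sip_space.quot_ip[OF cauchy_space_sip])

lemma into_nrm: "x \<in> pts H \<Longrightarrow> nrm (completion H) (into_completion H x) = nrm H x"
  by (simp add: nrm_def into_ip)

lemma into_in: "x \<in> pts H \<Longrightarrow> into_completion H x \<in> pts (completion H)"
  using into_linear by (simp add: linear_op_def)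

lemma into_dense:
  assumes "X \<in> pts (completion H)"
  shows "cauchy_seq H (repr X)" "tends (completion H) (\<lambda>k. into_completion H (repr X k)) X"
proof -
  interpret C: sip_space "cauchy_space H" by (rule cauchy_space_sip)
  have r: "repr X \<in> pts (cauchy_space H)" "cls (cauchy_space H) (repr X) = X"
    using C.quot_repr assms unfolding completion_def by auto
  then show c: "cauchy_seq H (repr X)" by simp
  have "(\<lambda>_. repr X k) \<in> pts (cauchy_space H)" for k using cauchy_seqD(1)[OF c] by simp
  then have "dif (completion H) (into_completion H (repr X k)) X =
     cls (cauchy_space H) (dif (cauchy_space H) (\<lambda>_. repr X k) (repr X))" for k
    using C.quot_dif[of "\<lambda>_. repr X k" "repr X"] r unfolding completion_def into_completion_def by simp
  moreover have "dif (cauchy_space H) (\<lambda>_. repr X k) (repr X) \<in> pts (cauchy_space H)" for k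
    using r(1) \<open>\<And>k. (\<lambda>_. repr X k) \<in> pts (cauchy_space H)\<close> by (intro C.dif_in) auto
  ultimately show "tends (completion H) (\<lambda>k. into_completion H (repr X k)) X"
    using cauchy_space_tends[OF c] unfolding tends_def completion_def by (simp add: C.quot_nrm del: cauchy_space_sel)
qed

end

section \<open>Riesz representation, adjoints and projections\<close>

definition bddfun :: "'a cspace \<Rightarrow> ('a \<Rightarrow> complex) \<Rightarrow> bool" where
  "bddfun H l \<longleftrightarrow> (\<forall>x\<in>pts H. \<forall>y\<in>pts H. l (pls H x y) = l x + l y) \<and>
     (\<forall>c. \<forall>x\<in>pts H. l (scl H c x) = c * l x) \<and> (\<exists>B. \<forall>x\<in>pts H. cmod (l x) \<le> B * nrm H x)"

context hilb
begin

text \<open>The representing vector minimizes \<open>\<parallel>x\<parallel>\<^sup>2 - 2 Re (l x)\<close>; the parallelogram law makes minimizing sequences Cauchy.\<close>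

theorem riesz:
  assumes l: "bddfun H l"
  obtains y where "y \<in> pts H" "\<And>x. x \<in> pts H \<Longrightarrow> l x = ip H x y"
proof -
  have lp: "\<And>x y. x \<in> pts H \<Longrightarrow> y \<in> pts H \<Longrightarrow> l (pls H x y) = l x + l y"
    and ls: "\<And>c x. x \<in> pts H \<Longrightarrow> l (scl H c x) = c * l x"
    using l unfolding bddfun_def by auto
  have ld: "l (dif H x y) = l x - l y" if "x \<in> pts H" "y \<in> pts H" for x y
    using that by (simp add: dif_def lp ls)
  obtain B where B: "\<And>x. x \<in> pts H \<Longrightarrow> cmod (l x) \<le> B * nrm H x"
    using l unfolding bddfun_def by blast
  define J where "J = (\<lambda>x. (nrm H x)\<^sup>2 - 2 * Re (l x))"
  have J_low: "- B\<^sup>2 \<le> J x" if x: "x \<in> pts H" for x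
  proof -
    have "Re (l x) \<le> B * nrm H x" using B[OF x] complex_Re_le_cmod[of "l x"] by linarith
    moreover have "0 \<le> (nrm H x - B)\<^sup>2" by simp
    ultimately show ?thesis unfolding J_def by (simp add: power2_diff algebra_simps)
  qed
  define m where "m = Inf (J ` pts H)"
  have bdd: "bdd_below (J ` pts H)" using J_low by (auto intro!: bdd_belowI)
  have ne: "J ` pts H \<noteq> {}" using zer_in by blast
  have Jm: "m \<le> J x" if "x \<in> pts H" for x
    unfolding m_def using bdd that by (intro cInf_lower) auto
  have "\<exists>x\<in>pts H. J x < m + 1 / Suc n" for n
    using cInf_lessD[OF ne, of "m + 1 / Suc n"] unfolding m_def by auto
  then obtain x where x: "\<And>n. x n \<in> pts H" "\<And>n. J (x n) < m + 1 / Suc n" by metis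
  have par: "(nrm H (dif H u v))\<^sup>2 \<le> 2 * J u + 2 * J v - 4 * m" if u: "u \<in> pts H" "v \<in> pts H" for u v
  proof -
    \<comment> \<open>At the midpoint of u and v the linear parts of \<open>J\<close> cancel, so the
      parallelogram law for the norm becomes one for \<open>J\<close>; the infimum \<open>m\<close>
      then bounds the midpoint value from below.\<close>
    have "(nrm H (dif H u v))\<^sup>2 = 2 * J u + 2 * J v - 4 * J (scl H (1/2) (pls H u v))"
      using parallelogram[OF u] u
      by (simp add: J_def lp ls nrm_scl power_mult_distrib power2_eq_square field_simps)
    then show ?thesis using Jm[of "scl H (1/2) (pls H u v)"] u by simp
  qed
  have "cauchy_seq H x"
    unfolding cauchy_seq_def
  proof (intro conjI allI impI x(1))
    fix \<epsilon> :: real assume e: "\<epsilon> > 0"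
    then have "\<epsilon>\<^sup>2 / 4 > 0" by simp
    then obtain K where K: "1 / Suc K < \<epsilon>\<^sup>2 / 4" using nat_approx_posE by metis
    have "nrm H (dif H (x i) (x j)) < \<epsilon>" if "i \<ge> K" "j \<ge> K" for i j
    proof -
      have "1 / Suc i \<le> 1 / Suc K" "1 / Suc j \<le> 1 / Suc K" using that by (auto simp: field_simps)
      then have "(nrm H (dif H (x i) (x j)))\<^sup>2 < \<epsilon>\<^sup>2"
        using par[OF x(1) x(1), of i j] x(2)[of i] x(2)[of j] K by linarith
      then show ?thesis using e by (intro power2_less_imp_less[of _ \<epsilon>]) auto
    qed
    then show "\<exists>K. \<forall>i\<ge>K. \<forall>j\<ge>K. nrm H (dif H (x i) (x j)) < \<epsilon>" by blast
  qed
  then obtain y where y: "y \<in> pts H" "tends H x y" using complete by blast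
  have "(\<lambda>k. l (x k)) \<longlonglongrightarrow> l y"
  proof (rule LIM_zero_cancel, rule Lim_null_comparison)
    have "cmod (l (x k) - l y) \<le> B * nrm H (dif H (x k) y)" for k
      using B[of "dif H (x k) y"] x(1)[of k] y(1) by (simp add: ld)
    then show "\<forall>\<^sub>F k in sequentially. norm (l (x k) - l y) \<le> B * nrm H (dif H (x k) y)"
      by simp
    show "(\<lambda>k. B * nrm H (dif H (x k) y)) \<longlonglongrightarrow> 0"
      using y(2) unfolding tends_def by (auto intro: tendsto_eq_intros)
  qed
  then have "(\<lambda>k. J (x k)) \<longlonglongrightarrow> J y"
    unfolding J_def by (intro tendsto_intros tendsto_nrm x y)
  moreover have "(\<lambda>k. J (x k)) \<longlonglongrightarrow> m"
  proof (rule tendsto_sandwich[OF _ _ tendsto_const])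
    have "(\<lambda>k. m + 1 / real (Suc k)) \<longlonglongrightarrow> m + 0"
      by (intro tendsto_add tendsto_const LIMSEQ_Suc[OF lim_1_over_n])
    then show "(\<lambda>k. m + 1 / real (Suc k)) \<longlonglongrightarrow> m" by simp
    show "\<forall>\<^sub>F k in sequentially. m \<le> J (x k)" using Jm x(1) by simp
    show "\<forall>\<^sub>F k in sequentially. J (x k) \<le> m + 1 / real (Suc k)" using x(2) by (simp add: less_imp_le)
  qed
  ultimately have Jy: "J y = m" by (rule LIMSEQ_unique)
  have re: "Re (l z) = Re (ip H z y)" if z: "z \<in> pts H" for z
  proof -
    \<comment> \<open>First variation: along the line y + t z the functional \<open>J\<close> stays
      above its minimum \<open>J y\<close>, which leaves a nonnegative quadratic in t without
      constant term.\<close>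
    have "0 \<le> 0 + 2 * t * (Re (ip H y z) - Re (l z)) + t\<^sup>2 * (nrm H z)\<^sup>2" for t :: real
      using Jm[of "pls H y (scl H t z)"] y(1) z Jy nrm_pls_sq[of y "scl H t z"]
      by (simp add: J_def lp ls ip_simps nrm_scl power_mult_distrib algebra_simps)
    from re_quadratic_bound[OF this] have "(Re (ip H y z) - Re (l z))\<^sup>2 \<le> 0" by simp
    then show ?thesis using arg_cong[OF b_sym[OF z y(1)], of Re] by simp
  qed
  \<comment> \<open>The identity of real parts, applied to i z, yields the imaginary parts.\<close>
  have "l z = ip H z y" if z: "z \<in> pts H" for z
    using re[OF z] re[of "scl H \<i> z"] z y(1) by (simp add: ls ip_simps complex_eq_iff)
  with y(1) show thesis using that by blast
qed

text \<open>Riesz is applied for each fixed second argument; conjugate-linearity there makes the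
  representing vector depend linearly on it. The size of the functional is measured by a separate
  function \<open>g\<close> because in \<open>converse\<close> it is the norm of \<open>G u\<close>,
  which is compared with the norm of u only afterwards.\<close>

lemma riesz_op:
  assumes K: "cvspace K"
    and lin1: "\<And>x y u. x \<in> pts H \<Longrightarrow> y \<in> pts H \<Longrightarrow> u \<in> pts K \<Longrightarrow> B (pls H x y) u = B x u + B y u"
    and lin2: "\<And>c x u. x \<in> pts H \<Longrightarrow> u \<in> pts K \<Longrightarrow> B (scl H c x) u = c * B x u"
    and con1: "\<And>x u v. x \<in> pts H \<Longrightarrow> u \<in> pts K \<Longrightarrow> v \<in> pts K \<Longrightarrow> B x (pls K u v) = B x u + B x v"
    and con2: "\<And>c x u. x \<in> pts H \<Longrightarrow> u \<in> pts K \<Longrightarrow> B x (scl K c u) = cnj c * B x u"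
    and bd: "\<And>x u. x \<in> pts H \<Longrightarrow> u \<in> pts K \<Longrightarrow> cmod (B x u) \<le> nrm H x * g u"
    and g: "\<And>u. u \<in> pts K \<Longrightarrow> 0 \<le> g u" "\<And>u. u \<in> pts K \<Longrightarrow> g u \<le> C * nrm K u"
  shows "\<exists>T. bounded_op K H T \<and> (\<forall>x\<in>pts H. \<forall>u\<in>pts K. ip H x (T u) = B x u)"
proof -
  interpret K: cvspace K by fact
  have "\<exists>y. y \<in> pts H \<and> (\<forall>x\<in>pts H. B x u = ip H x y)" if u: "u \<in> pts K" for u
  proof -
    have "bddfun H (\<lambda>x. B x u)"
      unfolding bddfun_def using lin1 lin2 bd u
      by (auto intro!: exI[of _ "g u"] simp: mult.commute)
    then show ?thesis using riesz by metis
  qed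
  then obtain T where T: "\<And>u. u \<in> pts K \<Longrightarrow> T u \<in> pts H" "\<And>u x. u \<in> pts K \<Longrightarrow> x \<in> pts H \<Longrightarrow> ip H x (T u) = B x u"
    by metis
  have eqI: "y = z" if "y \<in> pts H" "z \<in> pts H" "\<And>x. x \<in> pts H \<Longrightarrow> ip H x y = ip H x z" for y z
  proof (rule ip_eqI[OF that(1,2)])
    fix x assume x: "x \<in> pts H"
    have "ip H y x = cnj (ip H x y)" using x that(1) by (rule b_sym)
    also have "\<dots> = cnj (ip H x z)" using that(3)[OF x] by simp
    also have "\<dots> = ip H z x" using b_sym[OF x that(2)] by simp
    finally show "ip H y x = ip H z x" .
  qed
  have "linear_op K H T"
    unfolding linear_op_def
  proof (intro conjI ballI allI T(1))
    fix u v assume u: "u \<in> pts K" "v \<in> pts K"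
    show "T (pls K u v) = pls H (T u) (T v)"
      by (rule eqI) (use u in \<open>auto simp: T con1 b_pls_right\<close>)
  next
    fix c u assume u: "u \<in> pts K"
    show "T (scl K c u) = scl H c (T u)"
      by (rule eqI) (use u in \<open>auto simp: T con2 b_scl_right\<close>)
  qed
  moreover have "nrm H (T u) \<le> C * nrm K u" if u: "u \<in> pts K" for u
  proof (cases "nrm H (T u) = 0")
    case True
    then show ?thesis using g[OF u] by simp
  next
    case False
    then have p: "nrm H (T u) > 0" using nrm_nonneg[OF T(1)[OF u]] by linarith
    have "nrm H (T u) * nrm H (T u) = cmod (B (T u) u)"
      using ip_self[OF T(1)[OF u]] T(2)[OF u T(1)[OF u]] by (simp add: norm_mult power2_eq_square)
    also have "\<dots> \<le> nrm H (T u) * g u" by (rule bd[OF T(1)[OF u] u])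
    finally show ?thesis using p g(2)[OF u] by simp
  qed
  ultimately have "bounded_op K H T" unfolding bounded_op_def by blast
  then show ?thesis using T(2) by blast
qed

end

lemma adjoint_op:
  assumes H: "hilb H" and K: "sip_space K" and T: "bounded_op H K T"
  shows "bounded_op K H (adjoint_op H K T)"
    "\<And>x y. x \<in> pts H \<Longrightarrow> y \<in> pts K \<Longrightarrow> ip K (T x) y = ip H x (adjoint_op H K T y)"
proof -
  interpret H: hilb H by fact
  interpret K: sip_space K by fact
  note lin = bounded_op_linear[OF T]
  obtain C where C: "0 \<le> C" "\<And>x. x \<in> pts H \<Longrightarrow> nrm K (T x) \<le> C * nrm H x"
    using bounded_op_nonneg[OF T H.sip_space_axioms] by blast
  have Tin: "T x \<in> pts K" if "x \<in> pts H" for x using linear_opD(1)[OF lin that] .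
  have "\<exists>T'. bounded_op K H T' \<and> (\<forall>x\<in>pts H. \<forall>u\<in>pts K. ip H x (T' u) = ip K (T x) u)"
  proof (rule H.riesz_op)
    fix x u assume xu: "x \<in> pts H" "u \<in> pts K"
    have "cmod (ip K (T x) u) \<le> nrm K (T x) * nrm K u" using xu Tin by (intro K.cauchy_schwarz)
    also have "\<dots> \<le> (C * nrm H x) * nrm K u" using xu C by (intro mult_right_mono) auto
    finally show "cmod (ip K (T x) u) \<le> nrm H x * (C * nrm K u)" by (simp add: algebra_simps)
  next
    fix u assume "u \<in> pts K"
    then show "0 \<le> C * nrm K u" using C by simp
  qed (auto simp: linear_opD[OF lin] Tin K.ip_simps intro: K.cvspace_axioms)
  then have "\<exists>T'. bounded_op K H T' \<and> (\<forall>x\<in>pts H. \<forall>y\<in>pts K. ip K (T x) y = ip H x (T' y))"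
    by metis
  from someI_ex[OF this, folded adjoint_op_def]
  show "bounded_op K H (adjoint_op H K T)"
    "\<And>x y. x \<in> pts H \<Longrightarrow> y \<in> pts K \<Longrightarrow> ip K (T x) y = ip H x (adjoint_op H K T y)"
    by blast+
qed

context hilb
begin

text \<open>\<open>riesz_op\<close> delivers the operator in the second slot of the inner product;
  Hermitian symmetry of b moves it to the first, where \<open>form_op\<close> asks for it.\<close>

lemma form_op:
  assumes b: "hermitian_form H b" and bd: "\<And>x y. x \<in> pts H \<Longrightarrow> y \<in> pts H \<Longrightarrow> cmod (b x y) \<le> C * nrm H x * nrm H y"
    and C: "0 \<le> C"
  shows "bounded_op H H (form_op H b)"
    "\<And>x y. x \<in> pts H \<Longrightarrow> y \<in> pts H \<Longrightarrow> ip H (form_op H b x) y = b x y"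
proof -
  interpret b: hform H b by unfold_locales fact
  have "\<exists>T. bounded_op H H T \<and> (\<forall>x\<in>pts H. \<forall>u\<in>pts H. ip H x (T u) = b x u)"
    by (rule riesz_op[where g="\<lambda>u. C * nrm H u" and C=C])
      (use bd C in \<open>auto simp: b.b_simps algebra_simps intro: cvspace_axioms\<close>)
  then obtain T where T: "bounded_op H H T" "\<And>x u. x \<in> pts H \<Longrightarrow> u \<in> pts H \<Longrightarrow> ip H x (T u) = b x u"
    by blast
  have "ip H (T x) y = b x y" if xy: "x \<in> pts H" "y \<in> pts H" for x y
  proof -
    have Tx: "T x \<in> pts H" using linear_opD(1)[OF bounded_op_linear[OF T(1)] xy(1)] .
    have "ip H (T x) y = cnj (ip H y (T x))" by (rule b_sym[OF xy(2) Tx])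
    also have "\<dots> = cnj (b y x)" using T(2)[OF xy(2,1)] by simp
    also have "\<dots> = b x y" using b.b_sym[OF xy(2,1)] by simp
    finally show ?thesis .
  qed
  then have "\<exists>T. bounded_op H H T \<and> (\<forall>x\<in>pts H. \<forall>y\<in>pts H. ip H (T x) y = b x y)"
    using T(1) by blast
  from someI_ex[OF this, folded form_op_def]
  show "bounded_op H H (form_op H b)"
    "\<And>x y. x \<in> pts H \<Longrightarrow> y \<in> pts H \<Longrightarrow> ip H (form_op H b x) y = b x y"
    by blast+
qed

text \<open>The projection is the Riesz vector in \<open>W\<close> of the functional sending v to
  <v, f>; closedness of \<open>W\<close> supplies the completeness that Riesz needs.\<close>

theorem projection_exists:
  assumes W: "csubspace H W" "closed_subset H W" and f: "f \<in> pts H"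
  obtains w where "w \<in> W" "\<And>v. v \<in> W \<Longrightarrow> ip H (dif H f w) v = 0"
proof -
  let ?W = "H\<lparr>pts := W\<rparr>"
  interpret W: hilb ?W by (rule subspace_hilb[OF W])
  have "bddfun ?W (\<lambda>v. ip H v f)"
    unfolding bddfun_def using csubspaceD(2)[OF W(1)] f cauchy_schwarz[OF _ f]
    by (auto simp: ip_simps mult.commute intro!: exI[of _ "nrm H f"])
  from W.riesz[OF this] obtain w where w: "w \<in> pts ?W" "\<And>v. v \<in> pts ?W \<Longrightarrow> ip H v f = ip ?W v w"
    by blast
  then have w: "w \<in> W" "\<And>v. v \<in> W \<Longrightarrow> ip H v f = ip H v w" by simp_all
  have "ip H (dif H f w) v = 0" if v: "v \<in> W" for v
  proof -
    have i: "v \<in> pts H" "w \<in> pts H" using v w csubspaceD(2)[OF W(1)] by auto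
    have "ip H (dif H f w) v = cnj (ip H v (dif H f w))" using i f by (intro b_sym) auto
    also have "ip H v (dif H f w) = 0" using i f w(2)[OF v] by (simp add: ip_simps)
    finally show ?thesis by simp
  qed
  with w(1) show thesis using that by blast
qed

lemma orth_proj:
  assumes W: "csubspace H W" "closed_subset H W" and f: "f \<in> pts H"
  shows "orth_proj H W f \<in> W" "v \<in> W \<Longrightarrow> ip H (dif H f (orth_proj H W f)) v = 0"
    "w \<in> W \<Longrightarrow> (\<And>v. v \<in> W \<Longrightarrow> ip H (dif H f w) v = 0) \<Longrightarrow> orth_proj H W f = w"
proof -
  have uniq: "w = w'" if w: "w \<in> W" "w' \<in> W" "\<forall>v\<in>W. ip H (dif H f w) v = 0" "\<forall>v\<in>W. ip H (dif H f w') v = 0" for w w'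
  proof (rule dif_eq_zer)
    have i: "w \<in> pts H" "w' \<in> pts H" "dif H w w' \<in> W" using w csubspaceD[OF W(1)] by auto
    have "ip H (dif H f w) (dif H w w') = 0" "ip H (dif H f w') (dif H w w') = 0" using w i by auto
    then have "ip H f (dif H w w') = ip H w (dif H w w')" "ip H f (dif H w w') = ip H w' (dif H w w')"
      using i f csubspaceD(2)[OF W(1) i(3)] by (simp_all add: b_dif_left)
    then have "ip H (dif H w w') (dif H w w') = 0"
      using i f csubspaceD(2)[OF W(1) i(3)] by (simp add: b_dif_left)
    then show "dif H w w' = zer H" using i by (intro definite) auto
  qed (use w csubspaceD[OF W(1)] in auto)
  obtain w0 where w0: "w0 \<in> W" "\<And>v. v \<in> W \<Longrightarrow> ip H (dif H f w0) v = 0"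
    using projection_exists[OF W f] by blast
  have eq: "orth_proj H W f = w" if "w \<in> W" "\<And>v. v \<in> W \<Longrightarrow> ip H (dif H f w) v = 0" for w
    unfolding orth_proj_def using that uniq by (intro the_equality) blast+
  show "w \<in> W \<Longrightarrow> (\<And>v. v \<in> W \<Longrightarrow> ip H (dif H f w) v = 0) \<Longrightarrow> orth_proj H W f = w" by (rule eq)
  show "orth_proj H W f \<in> W" "v \<in> W \<Longrightarrow> ip H (dif H f (orth_proj H W f)) v = 0"
    using eq[OF w0] w0 by auto
qed

end

section \<open>Square roots and positive parts\<close>

text \<open>The Taylor coefficients of \<open>(1 - z)\<^sup>1\<^sup>/\<^sup>2\<close>. All but the first are nonpositive and their sum is nonnegative, so the series
  converges absolutely on contractions.\<close>

definition sqrt_coeff :: "nat \<Rightarrow> real" where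
  "sqrt_coeff k = (1/2 gchoose k) * (-1) ^ k"

lemma sqrt_coeff_0: "sqrt_coeff 0 = 1"
  by (simp add: sqrt_coeff_def)

lemma sqrt_coeff_Suc: "sqrt_coeff (Suc k) = sqrt_coeff k * ((real k - 1/2) / (real k + 1))"
proof -
  have "(1/2 gchoose Suc k) = (1/2 gchoose k) * ((1/2 - real k) / (real k + 1))" for k
    unfolding gbinomial_prod_rev by (simp add: atLeast0_lessThan_Suc field_simps)
  then have "sqrt_coeff (Suc k) = (1/2 gchoose k) * ((1/2 - real k) / (real k + 1)) * (-1) ^ Suc k"
    unfolding sqrt_coeff_def by simp
  also have "\<dots> = sqrt_coeff k * ((real k - 1/2) / (real k + 1))"
    unfolding sqrt_coeff_def by (simp add: diff_divide_distrib algebra_simps)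
  finally show ?thesis .
qed

lemma sqrt_coeff_nonpos: "k \<ge> 1 \<Longrightarrow> sqrt_coeff k \<le> 0"
proof (induction k rule: dec_induct)
  case base
  show ?case using sqrt_coeff_Suc[of 0] by (simp add: sqrt_coeff_0)
next
  case (step n)
  have "0 \<le> (real n - 1/2) / (real n + 1)" using step(1) by (intro divide_nonneg_nonneg) auto
  with step show ?case unfolding sqrt_coeff_Suc by (intro mult_nonpos_nonneg) auto
qed

text \<open>The partial sums have the closed form -2 (n+1) c_(n+1), and the sign of c_(n+1) is
  known. So no limit of the series at z = 1 has to be evaluated.\<close>

lemma sqrt_coeff_partial_sum: "(\<Sum>k\<le>n. sqrt_coeff k) \<ge> 0"
proof -
  have "(\<Sum>k\<le>n. sqrt_coeff k) = - (2 * (real n + 1)) * sqrt_coeff (Suc n)"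
  proof (induction n)
    case 0
    then show ?case by (simp add: sqrt_coeff_0 sqrt_coeff_Suc)
  next
    case (Suc n)
    have "sqrt_coeff (Suc (Suc n)) = sqrt_coeff (Suc n) * ((real n + 1/2) / (real n + 2))"
      by (subst sqrt_coeff_Suc) (simp add: field_simps)
    moreover have "(\<Sum>k\<le>Suc n. sqrt_coeff k) = - (2 * (real n + 1)) * sqrt_coeff (Suc n) + sqrt_coeff (Suc n)"
      using Suc by simp
    ultimately show ?case by (simp add: field_simps)
  qed
  moreover have "sqrt_coeff (Suc n) \<le> 0" by (rule sqrt_coeff_nonpos) simp
  ultimately show ?thesis by (simp add: mult_nonpos_nonpos)
qed

lemma sqrt_coeff_abs_sum: "(\<Sum>k<n. \<bar>sqrt_coeff (Suc k)\<bar>) \<le> 1"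
proof -
  have "(\<Sum>k\<le>n. sqrt_coeff k) = 1 - (\<Sum>k<n. \<bar>sqrt_coeff (Suc k)\<bar>)"
    using sqrt_coeff_nonpos by (induction n) (simp_all add: sqrt_coeff_0)
  then show ?thesis using sqrt_coeff_partial_sum[of n] by simp
qed

lemma sqrt_coeff_summable: "summable (\<lambda>k. \<bar>sqrt_coeff k\<bar>)"
proof -
  have "summable (\<lambda>k. \<bar>sqrt_coeff (Suc k)\<bar>)"
    by (rule summableI_nonneg_bounded[OF _ sqrt_coeff_abs_sum]) simp
  then show ?thesis by (simp only: summable_Suc_iff[of "\<lambda>k. \<bar>sqrt_coeff k\<bar>"])
qed

text \<open>The coefficients of the square of (1 - z)^(1/2), which is 1 - z; Vandermonde with 1/2 +
  1/2 = 1 computes them without power series.\<close>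

lemma sqrt_coeff_convolution: "(\<Sum>j\<le>n. sqrt_coeff j * sqrt_coeff (n - j)) = (if n = 0 then 1 else if n = 1 then -1 else 0)"
proof -
  have "(\<Sum>j\<le>n. sqrt_coeff j * sqrt_coeff (n - j)) = (\<Sum>j\<le>n. (1/2 gchoose j) * (1/2 gchoose (n - j))) * (-1) ^ n"
    unfolding sqrt_coeff_def sum_distrib_right
    by (intro sum.cong refl) (simp add: mult_ac flip: power_add)
  also have "(\<Sum>j\<le>n. (1/2 gchoose j) * (1/2 gchoose (n - j))) = ((1/2 + 1/2 :: real) gchoose n)"
    using gbinomial_Vandermonde[of "1/2::real" "1/2" n] by (simp add: atMost_atLeast0)
  also have "(1/2 + 1/2 :: real) gchoose n = of_nat (1 choose n)"
    using binomial_gbinomial[of 1 n, where ?'a=real] by simp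
  finally show ?thesis by (cases n rule: nat.exhaust; cases "n = 1") (auto simp: binomial_eq_0)
qed

text \<open>The squared series, regrouped along k + j = n, collapses by the convolution identity to
  n = 0 and n = 1. An arbitrary bounded \<open>g\<close> is allowed instead of powers of a number,
  because it will be applied to g k = <K^k x, y>.\<close>

lemma sqrt_coeff_double_sum:
  fixes g :: "nat \<Rightarrow> complex"
  assumes g: "\<And>k. cmod (g k) \<le> M"
  shows "(\<Sum>k. \<Sum>j. sqrt_coeff k * (sqrt_coeff j * g (k + j))) = g 0 - g 1"
proof -
  have M: "0 \<le> M" using g[of 0] norm_ge_zero order_trans by blast
  define s where "s = (\<Sum>k. \<bar>sqrt_coeff k\<bar>)"
  define f where "f = (\<lambda>(k, j). of_real (sqrt_coeff k) * (of_real (sqrt_coeff j) * g (k + j)))"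
  have fb: "cmod (f (k, j)) \<le> M * (\<bar>sqrt_coeff k\<bar> * \<bar>sqrt_coeff j\<bar>)" for k j
    using mult_left_mono[OF g[of "k + j"], of "\<bar>sqrt_coeff k\<bar> * \<bar>sqrt_coeff j\<bar>"] by (simp add: f_def norm_mult mult_ac)
  have sle: "(\<Sum>k<n. \<bar>sqrt_coeff k\<bar>) \<le> s" for n
    unfolding s_def by (rule sum_le_suminf[OF sqrt_coeff_summable]) auto
  \<comment> \<open>Every finite set of index pairs fits in a square, and sums over squares are at
    most M s^2; absolute summability licenses both orders of summation below.\<close>
  have "(\<lambda>x. norm (f x)) summable_on (UNIV \<times> UNIV)"
    unfolding abs_summable_iff_bdd_above
  proof (rule bdd_aboveI2[where M = "M * (s * s)"])
    fix F :: "(nat \<times> nat) set" assume "F \<in> {F. F \<subseteq> UNIV \<times> UNIV \<and> finite F}"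
    then have F: "finite F" by auto
    obtain n where n: "fst ` F \<union> snd ` F \<subseteq> {..<n}" using F finite_nat_iff_bounded[of "fst ` F \<union> snd ` F"] by auto
    have "sum (\<lambda>x. norm (f x)) F \<le> sum (\<lambda>x. norm (f x)) ({..<n} \<times> {..<n})"
      using n by (intro sum_mono2) auto
    also have "\<dots> \<le> (\<Sum>(k, j)\<in>{..<n} \<times> {..<n}. M * (\<bar>sqrt_coeff k\<bar> * \<bar>sqrt_coeff j\<bar>))"
      using fb by (intro sum_mono) auto
    also have "\<dots> = (\<Sum>k<n. \<Sum>j<n. M * (\<bar>sqrt_coeff k\<bar> * \<bar>sqrt_coeff j\<bar>))"
      by (simp add: sum.cartesian_product)
    also have "\<dots> = M * ((\<Sum>k<n. \<bar>sqrt_coeff k\<bar>) * (\<Sum>k<n. \<bar>sqrt_coeff k\<bar>))"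
      unfolding sum_product by (simp add: sum_distrib_left)
    also have "\<dots> \<le> M * (s * s)" using sle[of n] M
      by (intro mult_left_mono mult_mono order_trans[OF _ sle[of n]]) (auto intro: sum_nonneg)
    finally show "sum (\<lambda>x. norm (f x)) F \<le> M * (s * s)" .
  qed
  then have fs: "f summable_on (UNIV \<times> UNIV)" by (rule abs_summable_summable)
  have inner: "(\<Sum>\<^sub>\<infinity>j. f (k, j)) = (\<Sum>j. f (k, j))" and inner_s: "summable (\<lambda>j. norm (f (k, j)))" for k
  proof -
    show s: "summable (\<lambda>j. norm (f (k, j)))"
      by (rule summable_comparison_test'[of "\<lambda>j. M * \<bar>sqrt_coeff k\<bar> * \<bar>sqrt_coeff j\<bar>"])
        (use fb[of k] in \<open>auto intro!: summable_mult sqrt_coeff_summable simp: mult.assoc\<close>)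
    show "(\<Sum>\<^sub>\<infinity>j. f (k, j)) = (\<Sum>j. f (k, j))"
      using norm_summable_imp_has_sum[OF s summable_sums[OF summable_norm_cancel[OF s]]] by (rule infsumI)
  qed
  have outer: "(\<Sum>\<^sub>\<infinity>k. \<Sum>j. f (k, j)) = (\<Sum>k. \<Sum>j. f (k, j))"
  proof -
    have "cmod (\<Sum>j. f (k, j)) \<le> M * s * \<bar>sqrt_coeff k\<bar>" for k
    proof -
      have "cmod (\<Sum>j. f (k, j)) \<le> (\<Sum>j. norm (f (k, j)))" by (rule summable_norm[OF inner_s])
      also have "\<dots> \<le> (\<Sum>j. M * \<bar>sqrt_coeff k\<bar> * \<bar>sqrt_coeff j\<bar>)"
        by (rule suminf_le[OF _ inner_s]) (use fb[of k] in \<open>auto intro!: summable_mult sqrt_coeff_summable simp: mult.assoc\<close>)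
      also have "\<dots> = M * \<bar>sqrt_coeff k\<bar> * s" unfolding s_def by (rule suminf_mult[OF sqrt_coeff_summable])
      finally show ?thesis by (simp add: mult_ac)
    qed
    then have s: "summable (\<lambda>k. norm (\<Sum>j. f (k, j)))"
      using summable_comparison_test'[OF summable_mult[OF sqrt_coeff_summable, of "M * s"], of 0 "\<lambda>k. norm (\<Sum>j. f (k, j))"]
      by simp
    show ?thesis
      using norm_summable_imp_has_sum[OF s summable_sums[OF summable_norm_cancel[OF s]]] by (rule infsumI)
  qed
  \<comment> \<open>The triangle i <= n is mapped to the quadrant with k = i and j = n - i.\<close>
  have bij: "bij_betw (\<lambda>(n, i). (i, n - i)) (Sigma UNIV (\<lambda>n::nat. {..n})) (UNIV \<times> UNIV)"
    by (rule bij_betwI[where g="\<lambda>(k, j). (k + j, k)"]) auto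
  have fs': "(\<lambda>(n, i). f (i, n - i)) summable_on (Sigma UNIV (\<lambda>n::nat. {..n}))"
    using iffD2[OF summable_on_reindex_bij_betw[OF bij, of f] fs] by (simp only: case_prod_beta')
  have "(\<Sum>k. \<Sum>j. f (k, j)) = infsum f (UNIV \<times> UNIV)"
    using infsum_Sigma_banach[OF fs] by (simp add: inner outer)
  also have "\<dots> = infsum (\<lambda>(n, i). f (i, n - i)) (Sigma UNIV (\<lambda>n::nat. {..n}))"
    using infsum_reindex_bij_betw[OF bij, of f, symmetric] by (simp only: case_prod_beta')
  also have "\<dots> = (\<Sum>\<^sub>\<infinity>n. \<Sum>i\<le>n. f (i, n - i))"
    using infsum_Sigma_banach[OF fs'] by simp
  also have "\<dots> = (\<Sum>\<^sub>\<infinity>n\<in>{0, 1}. \<Sum>i\<le>n. f (i, n - i))"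
  proof (rule infsum_cong_neutral)
    fix n :: nat assume "n \<in> UNIV - {0, 1}"
    then have "0 = of_real (\<Sum>i\<le>n. sqrt_coeff i * sqrt_coeff (n - i)) * g n" using sqrt_coeff_convolution[of n] by simp
    also have "\<dots> = (\<Sum>i\<le>n. f (i, n - i))" by (simp add: f_def sum_distrib_right mult.assoc)
    finally show "(\<Sum>i\<le>n. f (i, n - i)) = 0" by simp
  qed auto
  also have "\<dots> = g 0 - g 1"
    using sqrt_coeff_Suc[of 0] sqrt_coeff_0 by (simp add: f_def)
  finally show ?thesis by (simp add: f_def)
qed

definition pos_op :: "'a cspace \<Rightarrow> ('a \<Rightarrow> 'a) \<Rightarrow> bool" where
  "pos_op H P \<longleftrightarrow> bounded_op H H P \<and> nonneg_form H (\<lambda>x y. ip H (P x) y)"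

section \<open>Bounded and positive operators and their square roots\<close>

context hilb
begin

lemma op_in: "bounded_op H H T \<Longrightarrow> x \<in> pts H \<Longrightarrow> T x \<in> pts H"
  using linear_opD(1)[OF bounded_op_linear] .

lemma op_pls: "bounded_op H H T \<Longrightarrow> x \<in> pts H \<Longrightarrow> y \<in> pts H \<Longrightarrow> T (pls H x y) = pls H (T x) (T y)"
  using linear_opD(2)[OF bounded_op_linear] .

lemma op_scl: "bounded_op H H T \<Longrightarrow> x \<in> pts H \<Longrightarrow> T (scl H c x) = scl H c (T x)"
  using linear_opD(3)[OF bounded_op_linear] .

lemma op_bound:
  assumes "bounded_op H H T" obtains B where "0 \<le> B" "\<And>x. x \<in> pts H \<Longrightarrow> nrm H (T x) \<le> B * nrm H x"
  using bounded_op_nonneg[OF assms sip_space_axioms] by blast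

text \<open>Over complex scalars a real diagonal forces symmetry: evaluating it at x + y and at x +
  i y gives the two parts of the identity.\<close>

lemma herm_of_real_diag:
  assumes T: "bounded_op H H T" and r: "\<And>x. x \<in> pts H \<Longrightarrow> Im (ip H (T x) x) = 0"
    and x: "x \<in> pts H" and y: "y \<in> pts H"
  shows "ip H (T x) y = ip H x (T y)"
proof -
  note i = x y op_in[OF T x] op_in[OF T y]
  have "Im (ip H (T x) y) + Im (ip H (T y) x) = 0"
    using r[of "pls H x y"] r[OF x] r[OF y] i by (simp add: ip_simps op_pls[OF T])
  moreover have "Re (ip H (T y) x) - Re (ip H (T x) y) = 0"
    using r[of "pls H x (scl H \<i> y)"] r[OF x] r[OF y] i by (simp add: ip_simps op_pls[OF T] op_scl[OF T])
  ultimately have "ip H (T x) y = cnj (ip H (T y) x)" by (intro complex_eqI) simp_all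
  also have "\<dots> = ip H x (T y)" by (rule b_sym[symmetric]) (use i in auto)
  finally show ?thesis .
qed

lemma pos_op_herm:
  "pos_op H P \<Longrightarrow> x \<in> pts H \<Longrightarrow> y \<in> pts H \<Longrightarrow> ip H (P x) y = ip H x (P y)"
  unfolding pos_op_def nonneg_form_def using herm_of_real_diag by blast

lemma op_form:
  assumes T: "bounded_op H H T" and s: "\<And>x y. x \<in> pts H \<Longrightarrow> y \<in> pts H \<Longrightarrow> ip H (T x) y = ip H x (T y)"
  shows "hermitian_form H (\<lambda>x y. ip H (T x) y)"
  unfolding hermitian_form_def
proof (intro conjI ballI allI)
  fix x y assume i: "x \<in> pts H" "y \<in> pts H"
  have "ip H (T y) x = ip H y (T x)" using s i by blast
  also have "\<dots> = cnj (ip H (T x) y)" by (rule b_sym) (use i op_in[OF T] in auto)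
  finally show "ip H (T y) x = cnj (ip H (T x) y)" .
qed (auto simp: op_in[OF T] op_pls[OF T] op_scl[OF T] ip_simps)

lemma pos_op_nnform:
  assumes P: "pos_op H P" shows "nnform H (\<lambda>x y. ip H (P x) y)"
proof -
  have "hermitian_form H (\<lambda>x y. ip H (P x) y)"
    by (rule op_form[OF _ pos_op_herm[OF P]]) (use P in \<open>simp_all add: pos_op_def\<close>)
  moreover have "nonneg_form H (\<lambda>x y. ip H (P x) y)" using P by (simp add: pos_op_def)
  ultimately show ?thesis by unfold_locales
qed

text \<open>Cauchy--Schwarz for the form \<open>\<langle>P\<cdot>,\<cdot>\<rangle>\<close> at \<open>x\<close>, \<open>P x\<close>.\<close>

lemma pos_op_nrm_sq_le:
  assumes P: "pos_op H P" and B: "0 \<le> B" "\<And>x. x \<in> pts H \<Longrightarrow> Re (ip H (P x) x) \<le> B * (nrm H x)\<^sup>2" and x: "x \<in> pts H"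
  shows "(nrm H (P x))\<^sup>2 \<le> B * Re (ip H (P x) x)"
proof -
  interpret P: nnform H "\<lambda>x y. ip H (P x) y" by (rule pos_op_nnform[OF P])
  have Px: "P x \<in> pts H" using P op_in x by (auto simp: pos_op_def)
  have "((nrm H (P x))\<^sup>2)\<^sup>2 = (cmod (ip H (P x) (P x)))\<^sup>2" using ip_self[OF Px] by (simp add: norm_power)
  also have "\<dots> \<le> Re (ip H (P x) x) * Re (ip H (P (P x)) (P x))" by (rule P.cauchy_schwarz_sq[OF x Px])
  also have "\<dots> \<le> Re (ip H (P x) x) * (B * (nrm H (P x))\<^sup>2)"
    using B(2)[OF Px] P.b_nn[OF x] by (intro mult_left_mono)
  finally have *: "(nrm H (P x))\<^sup>2 * (nrm H (P x))\<^sup>2 \<le> (B * Re (ip H (P x) x)) * (nrm H (P x))\<^sup>2"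
    by (simp add: power2_eq_square mult_ac)
  show ?thesis
  proof (cases "nrm H (P x) = 0")
    case True then show ?thesis using B(1) P.b_nn[OF x] by simp
  next
    case False
    then show ?thesis using mult_right_le_imp_le[OF *] by simp
  qed
qed

lemma op_lincomb:
  assumes S: "bounded_op H H S" and T: "bounded_op H H T"
  shows "bounded_op H H (\<lambda>x. pls H (scl H a (S x)) (scl H b (T x)))"
proof -
  obtain B where B: "0 \<le> B" "\<And>x. x \<in> pts H \<Longrightarrow> nrm H (S x) \<le> B * nrm H x" using op_bound[OF S] by blast
  obtain C where C: "0 \<le> C" "\<And>x. x \<in> pts H \<Longrightarrow> nrm H (T x) \<le> C * nrm H x" using op_bound[OF T] by blast
  have "nrm H (pls H (scl H a (S x)) (scl H b (T x))) \<le> (cmod a * B + cmod b * C) * nrm H x" if x: "x \<in> pts H" for x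
  proof -
    have "nrm H (pls H (scl H a (S x)) (scl H b (T x))) \<le> cmod a * nrm H (S x) + cmod b * nrm H (T x)"
      using nrm_triangle[of "scl H a (S x)" "scl H b (T x)"] x op_in[OF S] op_in[OF T] by (simp add: nrm_scl)
    also have "\<dots> \<le> cmod a * (B * nrm H x) + cmod b * (C * nrm H x)"
      using B(2)[OF x] C(2)[OF x] by (intro add_mono mult_left_mono) auto
    finally show ?thesis by (simp add: algebra_simps)
  qed
  moreover have "linear_op H H (\<lambda>x. pls H (scl H a (S x)) (scl H b (T x)))"
    unfolding linear_op_def
  proof (intro conjI ballI allI)
    fix x y assume "x \<in> pts H" "y \<in> pts H"
    then show "pls H (scl H a (S (pls H x y))) (scl H b (T (pls H x y))) =
        pls H (pls H (scl H a (S x)) (scl H b (T x))) (pls H (scl H a (S y)) (scl H b (T y)))"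
      using pls_interchange[of "scl H a (S x)" "scl H b (T x)" "scl H a (S y)" "scl H b (T y)"]
      by (simp add: op_in[OF S] op_in[OF T] op_pls[OF S] op_pls[OF T] scl_pls)
  qed (simp_all add: op_in[OF S] op_in[OF T] op_scl[OF S] op_scl[OF T] scl_pls scl_scl mult.commute)
  ultimately show ?thesis unfolding bounded_op_def by blast
qed

lemma op_dif_bounded:
  assumes S: "bounded_op H H S" and T: "bounded_op H H T"
  shows "bounded_op H H (\<lambda>x. dif H (S x) (T x))"
proof -
  have b: "bounded_op H H (\<lambda>x. pls H (scl H 1 (S x)) (scl H (-1) (T x)))" by (rule op_lincomb[OF S T])
  have "dif H (S x) (T x) = pls H (scl H 1 (S x)) (scl H (-1) (T x))" if "x \<in> pts H" for x
    using that op_in[OF S] by (simp add: dif_def)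
  then show ?thesis using b unfolding bounded_op_def linear_op_def by simp
qed

lemma op_comp:
  assumes S: "bounded_op H H S" and T: "bounded_op H H T"
  shows "bounded_op H H (\<lambda>x. S (T x))"
proof -
  obtain B where B: "0 \<le> B" "\<And>x. x \<in> pts H \<Longrightarrow> nrm H (S x) \<le> B * nrm H x" using op_bound[OF S] by blast
  obtain C where C: "0 \<le> C" "\<And>x. x \<in> pts H \<Longrightarrow> nrm H (T x) \<le> C * nrm H x" using op_bound[OF T] by blast
  have "nrm H (S (T x)) \<le> (B * C) * nrm H x" if x: "x \<in> pts H" for x
    using B(2)[OF op_in[OF T x]] mult_left_mono[OF C(2)[OF x] B(1)] by simp
  then show ?thesis unfolding bounded_op_def linear_op_def
    by (auto simp: op_in[OF S] op_in[OF T] op_pls[OF S] op_pls[OF T] op_scl[OF S] op_scl[OF T])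
qed

lemma op_id: "bounded_op H H (\<lambda>x. x)"
  by (auto simp: bounded_op_def linear_op_def intro!: exI[of _ 1])

text \<open>\<open>Q\<close> is the binomial series for (1 - K)^(1/2). It is summed as the form
  \<open>S x y\<close>, with terms c_k <K^k x, y>, which converges absolutely because the powers of
  K are contractions; \<open>form_op\<close> then converts the form into an operator.\<close>

lemma sqrt_contraction:
  assumes K: "bounded_op H H K" and k0: "pos_op H K" and k1: "\<And>x. x \<in> pts H \<Longrightarrow> Re (ip H (K x) x) \<le> (nrm H x)\<^sup>2"
  obtains Q where "pos_op H Q" "\<And>x. x \<in> pts H \<Longrightarrow> Q (Q x) = dif H x (K x)"
proof -
  have Kc: "nrm H (K x) \<le> nrm H x" if x: "x \<in> pts H" for x
  proof -
    have "(nrm H (K x))\<^sup>2 \<le> 1 * Re (ip H (K x) x)" by (rule pos_op_nrm_sq_le[OF k0]) (use k1 x in auto)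
    then have "(nrm H (K x))\<^sup>2 \<le> (nrm H x)\<^sup>2" using k1[OF x] by simp
    then show ?thesis using x by (simp add: power2_le_iff_abs_le op_in[OF K])
  qed
  define Kp where "Kp = (\<lambda>k::nat. K ^^ k)"
  have Kp0: "Kp 0 x = x" and KpS: "Kp (Suc k) x = K (Kp k x)" for k x by (simp_all add: Kp_def)
  have Kpa: "Kp (j + k) x = Kp j (Kp k x)" for j k x by (simp add: Kp_def funpow_add)
  have Kpb: "bounded_op H H (Kp k)" for k
  proof (induction k)
    case 0 then show ?case using op_id by (simp add: Kp_def id_def)
  next
    case (Suc k)
    have "Kp (Suc k) = (\<lambda>x. K (Kp k x))" by (auto simp: Kp_def)
    then show ?case using op_comp[OF K Suc] by simp
  qed
  note Kin = op_in[OF Kpb]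
  have Kpc: "nrm H (Kp k x) \<le> nrm H x" if x: "x \<in> pts H" for k x
  proof (induction k)
    case (Suc k) then show ?case using Kc[OF Kin[OF x], of k] by (simp add: KpS)
  qed (simp add: Kp0)
  have Kps: "ip H (Kp k x) y = ip H x (Kp k y)" if xy: "x \<in> pts H" "y \<in> pts H" for k x y
    using xy
  proof (induction k arbitrary: y)
    case (Suc k)
    have "ip H (K (Kp k x)) y = ip H (Kp k x) (K y)" by (rule pos_op_herm[OF k0]) (use Suc Kin in auto)
    also have "\<dots> = ip H x (Kp k (K y))" using Suc op_in[OF K] by simp
    finally show ?case by (simp add: Kp_def funpow_swap1)
  qed (simp add: Kp0)
  have ib: "cmod (ip H (Kp k x) y) \<le> nrm H x * nrm H y" if xy: "x \<in> pts H" "y \<in> pts H" for k x y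
    using cauchy_schwarz[OF Kin[OF xy(1), of k] xy(2)] mult_right_mono[OF Kpc[OF xy(1), of k], of "nrm H y"] xy(2) by simp
  define s where "s = (\<Sum>k. \<bar>sqrt_coeff k\<bar>)"
  define S where "S = (\<lambda>x y. \<Sum>k. of_real (sqrt_coeff k) * ip H (Kp k x) y)"
  have sm: "summable (\<lambda>k. norm (of_real (sqrt_coeff k) * ip H (Kp k x) y))" if xy: "x \<in> pts H" "y \<in> pts H" for x y
    by (rule summable_comparison_test'[OF summable_mult[OF sqrt_coeff_summable, of "nrm H x * nrm H y"]])
      (use ib[OF xy] in \<open>auto simp: norm_mult mult.commute intro!: mult_left_mono\<close>)
  note sm' = summable_norm_cancel[OF sm]
  have herm: "hermitian_form H S"
    unfolding hermitian_form_def S_def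
  proof (intro conjI ballI allI)
    fix x y assume i: "x \<in> pts H" "y \<in> pts H"
    have "of_real (sqrt_coeff k) * ip H (Kp k y) x = cnj (of_real (sqrt_coeff k) * ip H (Kp k x) y)" for k
      using Kps[OF i(2,1), of k] b_sym[OF Kin[OF i(1), of k] i(2)] by simp
    moreover have "(\<Sum>k. cnj (of_real (sqrt_coeff k) * ip H (Kp k x) y)) = cnj (\<Sum>k. of_real (sqrt_coeff k) * ip H (Kp k x) y)"
      using iffD2[OF sums_cnj summable_sums[OF sm'[OF i]]] by (rule sums_unique[symmetric])
    ultimately show "(\<Sum>k. of_real (sqrt_coeff k) * ip H (Kp k y) x) = cnj (\<Sum>k. of_real (sqrt_coeff k) * ip H (Kp k x) y)"
      by (simp only:)
  next
    fix x y z assume i: "x \<in> pts H" "y \<in> pts H" "z \<in> pts H"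
    show "(\<Sum>k. of_real (sqrt_coeff k) * ip H (Kp k (pls H x y)) z) =
       (\<Sum>k. of_real (sqrt_coeff k) * ip H (Kp k x) z) + (\<Sum>k. of_real (sqrt_coeff k) * ip H (Kp k y) z)"
      using i by (subst suminf_add[OF sm' sm']) (auto simp: op_pls[OF Kpb] ip_simps Kin algebra_simps)
  next
    fix c x y assume i: "x \<in> pts H" "y \<in> pts H"
    show "(\<Sum>k. of_real (sqrt_coeff k) * ip H (Kp k (scl H c x)) y) = c * (\<Sum>k. of_real (sqrt_coeff k) * ip H (Kp k x) y)"
      using i by (subst suminf_mult[OF sm', symmetric]) (auto simp: op_scl[OF Kpb] ip_simps Kin algebra_simps)
  qed
  have Sb: "cmod (S x y) \<le> s * nrm H x * nrm H y" if xy: "x \<in> pts H" "y \<in> pts H" for x y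
  proof -
    have "cmod (S x y) \<le> (\<Sum>k. norm (of_real (sqrt_coeff k) * ip H (Kp k x) y))"
      unfolding S_def by (rule summable_norm[OF sm[OF xy]])
    also have "\<dots> \<le> (\<Sum>k. nrm H x * nrm H y * \<bar>sqrt_coeff k\<bar>)"
      by (rule suminf_le[OF _ sm[OF xy] summable_mult[OF sqrt_coeff_summable]])
        (use ib[OF xy] in \<open>auto simp: norm_mult mult.commute intro!: mult_left_mono\<close>)
    also have "\<dots> = nrm H x * nrm H y * s" unfolding s_def by (rule suminf_mult[OF sqrt_coeff_summable])
    finally show ?thesis by (simp add: mult_ac)
  qed
  have s0: "0 \<le> s" unfolding s_def by (rule suminf_nonneg[OF sqrt_coeff_summable]) simp
  define Q where "Q = form_op H S"
  have Q: "bounded_op H H Q" "\<And>x y. x \<in> pts H \<Longrightarrow> y \<in> pts H \<Longrightarrow> ip H (Q x) y = S x y"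
    unfolding Q_def using form_op[OF herm Sb s0] by auto
  have "Im (S x x) = 0 \<and> 0 \<le> Re (S x x)" if x: "x \<in> pts H" for x
  proof -
    interpret S: hform H S by unfold_locales (fact herm)
    have r: "ip H (Kp k x) x = of_real (Re (ip H (Kp k x) x))" for k
    proof -
      have "Im (ip H x (Kp k x)) = - Im (ip H (Kp k x) x)" using arg_cong[OF b_sym[OF Kin[OF x, of k] x], of Im] by simp
      then show ?thesis using arg_cong[OF Kps[OF x x, of k], of Im] by (simp add: complex_eq_iff)
    qed
    have b1: "Re (ip H (Kp k x) x) \<le> (nrm H x)\<^sup>2" for k
      using ib[OF x x, of k] complex_Re_le_cmod[of "ip H (Kp k x) x"] by (simp add: power2_eq_square)
    have sr: "summable (\<lambda>k. sqrt_coeff k * Re (ip H (Kp k x) x))"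
      using summable_Re[OF sm'[OF x x]] by simp
    have "Re (S x x) = (\<Sum>k. sqrt_coeff k * Re (ip H (Kp k x) x))"
      using Re_suminf[OF sm'[OF x x]] by (simp add: S_def)
    also have "\<dots> \<ge> 0"
    proof (rule LIMSEQ_le_const[OF summable_LIMSEQ'[OF sr]], intro exI allI impI)
      fix n :: nat
      \<comment> \<open>For k >= 1 the coefficient is nonpositive and <K^k x, x> is at most |x|^2,
        so replacing the latter by |x|^2 only lowers the sum; for k = 0 the two agree.\<close>
      have "(nrm H x)\<^sup>2 * (\<Sum>k\<le>n. sqrt_coeff k) \<le> (\<Sum>k\<le>n. sqrt_coeff k * Re (ip H (Kp k x) x))"
        unfolding sum_distrib_left
      proof (rule sum_mono)
        fix k assume "k \<in> {..n}"
        show "(nrm H x)\<^sup>2 * sqrt_coeff k \<le> sqrt_coeff k * Re (ip H (Kp k x) x)"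
        proof (cases "k = 0")
          case True then show ?thesis using nrm_sq[OF x] by (simp add: sqrt_coeff_0 Kp0)
        next
          case False
          then show ?thesis using mult_left_mono_neg[OF b1[of k] sqrt_coeff_nonpos[of k]] by (simp add: mult.commute)
        qed
      qed
      then show "0 \<le> (\<Sum>k\<le>n. sqrt_coeff k * Re (ip H (Kp k x) x))"
        using sqrt_coeff_partial_sum[of n] by (meson order_trans mult_nonneg_nonneg zero_le_power2)
    qed
    finally show ?thesis using S.b_self_real[OF x] by simp
  qed
  then have pQ: "pos_op H Q" unfolding pos_op_def nonneg_form_def using Q by simp
  \<comment> \<open>The outer series is expanded first. Symmetry of \<open>Kp k\<close> moves it to
    the other argument, so that the inner series can be expanded as well, and the double sum
    collapses to the terms for 1 and K.\<close>
  have "Q (Q x) = dif H x (K x)" if x: "x \<in> pts H" for x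
  proof (rule ip_eqI)
    fix y assume y: "y \<in> pts H"
    have Qx: "Q x \<in> pts H" using op_in[OF Q(1) x] .
    have "ip H (Q (Q x)) y = (\<Sum>k. of_real (sqrt_coeff k) * ip H (Kp k (Q x)) y)"
      using Q(2)[OF Qx y] by (simp add: S_def)
    also have "\<dots> = (\<Sum>k. of_real (sqrt_coeff k) * (\<Sum>j. of_real (sqrt_coeff j) * ip H (Kp (k + j) x) y))"
    proof -
      have "ip H (Kp k (Q x)) y = (\<Sum>j. of_real (sqrt_coeff j) * ip H (Kp (k + j) x) y)" for k
      proof -
        have "ip H (Kp k (Q x)) y = S x (Kp k y)" using Kps[OF Qx y] Q(2)[OF x Kin[OF y]] by simp
        also have "\<dots> = (\<Sum>j. of_real (sqrt_coeff j) * ip H (Kp (k + j) x) y)"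
          unfolding S_def Kpa using Kps[OF Kin[OF x] y] by simp
        finally show ?thesis .
      qed
      then show ?thesis by simp
    qed
    also have "\<dots> = (\<Sum>k. \<Sum>j. of_real (sqrt_coeff k) * (of_real (sqrt_coeff j) * ip H (Kp (k + j) x) y))"
    proof (intro arg_cong[where f=suminf] ext suminf_mult[symmetric])
      fix k
      show "summable (\<lambda>j. of_real (sqrt_coeff j) * ip H (Kp (k + j) x) y)"
        using sm'[OF Kin[OF x, of k] y] by (simp add: Kpa[symmetric] add.commute)
    qed
    also have "\<dots> = ip H (Kp 0 x) y - ip H (Kp 1 x) y"
      by (rule sqrt_coeff_double_sum[OF ib[OF x y]])
    also have "\<dots> = ip H (dif H x (K x)) y" using x y op_in[OF K x] by (simp add: ip_simps Kp0 KpS[of 0, simplified])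
    finally show "ip H (Q (Q x)) y = ip H (dif H x (K x)) y" .
  qed (use x op_in[OF K] op_in[OF Q(1)] in auto)
  then show thesis using that pQ by blast
qed

end

context hilb
begin

text \<open>For c above the bound of P, the operator K = 1 - P/c satisfies 0 <= K <= 1. The square
  root of 1 - K = P/c, multiplied by the square root of c, is the one required.\<close>

lemma sqrt_op:
  assumes P: "pos_op H P"
  shows "pos_op H (sqrt_op H P)" "\<And>x. x \<in> pts H \<Longrightarrow> sqrt_op H P (sqrt_op H P x) = P x"
proof -
  have bP: "bounded_op H H P" and nP: "\<And>x. x \<in> pts H \<Longrightarrow> Im (ip H (P x) x) = 0 \<and> 0 \<le> Re (ip H (P x) x)"
    using P by (auto simp: pos_op_def nonneg_form_def)
  obtain B where B: "0 \<le> B" "\<And>x. x \<in> pts H \<Longrightarrow> nrm H (P x) \<le> B * nrm H x" using op_bound[OF bP] by blast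
  \<comment> \<open>The summand 1 keeps c positive even if the bound is 0.\<close>
  define c where "c = B + 1"
  have c: "c > 0" using B by (simp add: c_def)
  have up: "Re (ip H (P x) x) \<le> c * (nrm H x)\<^sup>2" if x: "x \<in> pts H" for x
  proof -
    have "Re (ip H (P x) x) \<le> nrm H (P x) * nrm H x"
      using cauchy_schwarz[OF op_in[OF bP x] x] complex_Re_le_cmod[of "ip H (P x) x"] by linarith
    also have "\<dots> \<le> (B * nrm H x) * nrm H x" using B(2)[OF x] x by (intro mult_right_mono) auto
    also have "\<dots> \<le> c * (nrm H x)\<^sup>2" by (simp add: c_def power2_eq_square algebra_simps)
    finally show ?thesis .
  qed
  define K where "K = (\<lambda>x. pls H (scl H 1 x) (scl H (- 1 / c) (P x)))"
  have K: "bounded_op H H K" unfolding K_def by (rule op_lincomb[OF op_id bP])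
  have ipK: "ip H (K x) x = of_real ((nrm H x)\<^sup>2 - Re (ip H (P x) x) / c)" if x: "x \<in> pts H" for x
  proof -
    have "ip H (K x) x = ip H x x - ip H (P x) x / c"
      using x op_in[OF bP x] by (simp add: K_def ip_simps)
    then show ?thesis using nP[OF x] c ip_self[OF x] by (simp add: complex_eq_iff)
  qed
  have pK: "pos_op H K" unfolding pos_op_def nonneg_form_def
    using K up c by (simp add: ipK field_simps)
  have k1: "Re (ip H (K x) x) \<le> (nrm H x)\<^sup>2" if "x \<in> pts H" for x
    using nP[OF that] c by (simp add: ipK[OF that])
  obtain Q where Q: "pos_op H Q" "\<And>x. x \<in> pts H \<Longrightarrow> Q (Q x) = dif H x (K x)"
    using sqrt_contraction[OF K pK k1] by blast
  have bQ: "bounded_op H H Q" using Q(1) by (simp add: pos_op_def)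
  \<comment> \<open>The zero multiple of the identity is added only to obtain the shape of
    \<open>op_lincomb\<close>.\<close>
  define W where "W = (\<lambda>x. pls H (scl H (sqrt c) (Q x)) (scl H 0 x))"
  have bW: "bounded_op H H W" unfolding W_def by (rule op_lincomb[OF bQ op_id])
  have Weq: "W x = scl H (sqrt c) (Q x)" if "x \<in> pts H" for x
    using that op_in[OF bQ that] by (simp add: W_def scl_zero)
  have "nonneg_form H (\<lambda>x y. ip H (W x) y)"
    using Q(1) op_in[OF bQ] c unfolding pos_op_def nonneg_form_def by (simp add: Weq ip_simps)
  moreover have "W (W x) = P x" if x: "x \<in> pts H" for x
  proof -
    have cc: "complex_of_real (sqrt c) * complex_of_real (sqrt c) = of_real c"
      using c by (simp flip: of_real_mult)
    have "W (W x) = scl H c (Q (Q x))"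
      using x op_in[OF bQ] by (simp add: Weq op_scl[OF bQ] scl_scl cc)
    also have "scl H c (Q (Q x)) = P x"
    proof (rule ip_eqI)
      fix z assume z: "z \<in> pts H"
      show "ip H (scl H c (Q (Q x))) z = ip H (P x) z"
        using x z c op_in[OF bP x] op_in[OF K x] by (simp add: Q(2) ip_simps) (simp add: K_def ip_simps)
    qed (use x op_in[OF bQ] op_in[OF bP] in auto)
    finally show ?thesis .
  qed
  ultimately have "\<exists>Q. bounded_op H H Q \<and> nonneg_form H (\<lambda>x. ip H (Q x)) \<and> (\<forall>x\<in>pts H. Q (Q x) = P x)"
    using bW by blast
  from someI_ex[OF this, folded sqrt_op_def]
  show "pos_op H (sqrt_op H P)" "\<And>x. x \<in> pts H \<Longrightarrow> sqrt_op H P (sqrt_op H P x) = P x"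
    unfolding pos_op_def by blast+
qed

lemma sqrt_op_nrm:
  assumes P: "pos_op H P" and x: "x \<in> pts H"
  shows "(nrm H (sqrt_op H P x))\<^sup>2 = Re (ip H (P x) x)"
proof -
  have i: "sqrt_op H P x \<in> pts H" using sqrt_op(1)[OF P] op_in x by (auto simp: pos_op_def)
  show ?thesis
    using nrm_sq[OF i] pos_op_herm[OF sqrt_op(1)[OF P] i x] sqrt_op(2)[OF P x] by simp
qed

text \<open>Operator monotonicity of the square root in the form \<open>T\<^sup>2 \<le> A\<^sup>2 \<Longrightarrow> T \<le> A\<close>: at an approximate
  eigenvector of \<open>A - T\<close> for its lowest spectral value \<open>\<lambda> < 0\<close> one has
  \<open>\<parallel>T x\<parallel>\<^sup>2 \<approx> \<parallel>A x - \<lambda> x\<parallel>\<^sup>2 \<ge> \<parallel>A x\<parallel>\<^sup>2 + \<lambda>\<^sup>2\<close>.\<close>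

lemma op_le_of_nrm_eq:
  assumes A: "pos_op H A" and T: "bounded_op H H T"
    and s: "\<And>x y. x \<in> pts H \<Longrightarrow> y \<in> pts H \<Longrightarrow> ip H (T x) y = ip H x (T y)"
    and eq: "\<And>x. x \<in> pts H \<Longrightarrow> nrm H (A x) = nrm H (T x)" and x: "x \<in> pts H"
  shows "Re (ip H (T x) x) \<le> Re (ip H (A x) x)"
proof (rule ccontr)
  assume neg: "\<not> ?thesis"
  have bA: "bounded_op H H A" using A by (simp add: pos_op_def)
  have nA: "0 \<le> Re (ip H (A x) x)" if "x \<in> pts H" for x using A that by (simp add: pos_op_def nonneg_form_def)
  define D where "D = (\<lambda>x. dif H (A x) (T x))"
  have D: "bounded_op H H D" unfolding D_def by (rule op_dif_bounded[OF bA T])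
  have ipD: "ip H (D x) y = ip H (A x) y - ip H (T x) y" if "x \<in> pts H" "y \<in> pts H" for x y
    using that op_in[OF bA] op_in[OF T] by (simp add: D_def ip_simps)
  have sD: "ip H (D x) y = ip H x (D y)" if "x \<in> pts H" "y \<in> pts H" for x y
    using that op_in[OF bA] op_in[OF T] pos_op_herm[OF A that] s[OF that] by (simp add: ipD) (simp add: D_def ip_simps)
  obtain d where d: "0 \<le> d" "\<And>x. x \<in> pts H \<Longrightarrow> nrm H (D x) \<le> d * nrm H x" using op_bound[OF D] by blast
  obtain a where a: "0 \<le> a" "\<And>x. x \<in> pts H \<Longrightarrow> nrm H (A x) \<le> a * nrm H x" using op_bound[OF bA] by blast
  define unit where "unit = {x \<in> pts H. nrm H x = 1}"
  have dabs: "\<bar>Re (ip H (D x) x)\<bar> \<le> d" if "x \<in> unit" for x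
    using cauchy_schwarz[OF op_in[OF D], of x x] d(2)[of x] that abs_Re_le_cmod[of "ip H (D x) x"] unfolding unit_def by auto
  define f where "f = (\<lambda>x. Re (ip H (D x) x))"
  \<comment> \<open>The lower end of the numerical range of A - T; the negated claim makes it
    negative.\<close>
  define l where "l = Inf (f ` unit)"
  have bdd: "bdd_below (f ` unit)" using dabs by (intro bdd_belowI[of _ "-d"]) (force simp: f_def abs_le_iff)
  have nz: "nrm H x > 0" and fneg: "f x < 0"
    using neg nrm_zero_ip'[OF x op_in[OF bA x]] nrm_zero_ip'[OF x op_in[OF T x]] nrm_nonneg[OF x] x
    by (auto simp: f_def ipD less_eq_real_def)
  have fs: "f (scl H c x) = (cmod c)\<^sup>2 * f x" if "x \<in> pts H" for c x
  proof -
    have "ip H (D (scl H c x)) (scl H c x) = (c * cnj c) * ip H (D x) x"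
      using that op_in[OF D that] by (simp add: op_scl[OF D] ip_simps)
    then show ?thesis by (simp add: f_def flip: complex_norm_square of_real_power)
  qed
  have norml: "scl H (1 / nrm H z) z \<in> unit" if "z \<in> pts H" "nrm H z > 0" for z
    using that by (simp add: unit_def nrm_scl norm_divide)
  have low: "l \<le> f z" if "z \<in> unit" for z unfolding l_def using bdd that by (intro cInf_lower) auto
  have lneg: "l < 0"
    using low[OF norml[OF x nz]] fs[OF x, of "1 / nrm H x"] nz fneg
    by (smt (verit) mult_pos_neg norm_divide norm_of_real norm_one zero_less_power divide_pos_pos)
  have flow: "l * (nrm H z)\<^sup>2 \<le> f z" if z: "z \<in> pts H" for z
  proof (cases "nrm H z = 0")
    case True
    then show ?thesis using nrm_zero_ip'[OF z op_in[OF D z]] by (simp add: f_def)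
  next
    case False
    then have p: "nrm H z > 0" using nrm_nonneg[OF z] by linarith
    have "l \<le> f z / (nrm H z)\<^sup>2"
      using low[OF norml[OF z p]] fs[OF z, of "1 / nrm H z"] p by (simp add: norm_divide power_divide)
    then show ?thesis using p by (simp add: pos_le_divide_eq)
  qed
  \<comment> \<open>E = D - l is positive since l is an infimum. A unit vector that almost attains l
    is therefore almost annihilated by E.\<close>
  define E where "E = (\<lambda>x. pls H (scl H 1 (D x)) (scl H (- l) x))"
  have bE: "bounded_op H H E" unfolding E_def using op_lincomb[OF D op_id] by simp
  have ipE: "ip H (E z) z = of_real (f z - l * (nrm H z)\<^sup>2)" if z: "z \<in> pts H" for z
  proof -
    have "Im (ip H z (D z)) = - Im (ip H (D z) z)" using arg_cong[OF b_sym[OF op_in[OF D z] z], of Im] by simp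
    then have "Im (ip H (D z) z) = 0" using arg_cong[OF sD[OF z z], of Im] by simp
    then show ?thesis using z op_in[OF D z] ip_self[OF z] by (simp add: E_def ip_simps f_def complex_eq_iff)
  qed
  have pE: "pos_op H E" unfolding pos_op_def nonneg_form_def using bE flow by (simp add: ipE)
  define b where "b = d - l"
  have b: "b > 0" using d(1) lneg by (simp add: b_def)
  have Eup: "Re (ip H (E z) z) \<le> b * (nrm H z)\<^sup>2" if z: "z \<in> pts H" for z
  proof -
    have "f z \<le> nrm H (D z) * nrm H z"
      unfolding f_def using cauchy_schwarz[OF op_in[OF D z] z] complex_Re_le_cmod[of "ip H (D z) z"] by linarith
    also have "\<dots> \<le> (d * nrm H z) * nrm H z" using d(2)[OF z] z by (intro mult_right_mono) auto
    finally show ?thesis by (simp add: ipE[OF z] b_def power2_eq_square algebra_simps)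
  qed
  \<comment> \<open>Chosen so that 2 a delta + delta^2 is at most l^2 / 2; the cap at 1 allows
    delta^2 to be replaced by delta. The estimate at the end bounds l^2 by the same expression, a
    contradiction.\<close>
  define \<delta> where "\<delta> = min 1 (l\<^sup>2 / (2 * (2 * a + 1)))"
  have \<delta>: "\<delta> > 0" "\<delta> \<le> 1" "(2 * a + 1) * \<delta> \<le> l\<^sup>2 / 2"
  proof -
    show "\<delta> > 0" "\<delta> \<le> 1" using a lneg by (auto simp: \<delta>_def)
    have "(2 * a + 1) * \<delta> \<le> (2 * a + 1) * (l\<^sup>2 / (2 * (2 * a + 1)))"
      using a by (intro mult_left_mono) (auto simp: \<delta>_def)
    also have "\<dots> = l\<^sup>2 / 2" using a by (simp add: field_simps add_nonneg_eq_0_iff)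
    finally show "(2 * a + 1) * \<delta> \<le> l\<^sup>2 / 2" .
  qed
  \<comment> \<open>The excess of f z over l is <E z, z>, and \<open>pos_op_nrm_sq_le\<close>
    multiplies it by b when bounding |E z|^2; the tolerance delta^2 / b thus yields |E z| <=
    delta.\<close>
  have "\<exists>z\<in>unit. f z < l + \<delta>\<^sup>2 / b"
  proof -
    have "f ` unit \<noteq> {}" using norml[OF x nz] by blast
    from cInf_lessD[OF this, of "l + \<delta>\<^sup>2 / b"] show ?thesis
      using \<delta>(1) b unfolding l_def by auto
  qed
  then obtain z where z: "z \<in> pts H" "nrm H z = 1" "f z < l + \<delta>\<^sup>2 / b" by (auto simp: unit_def)
  have "(nrm H (E z))\<^sup>2 \<le> b * Re (ip H (E z) z)" by (rule pos_op_nrm_sq_le[OF pE _ Eup z(1)]) (use b in auto)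
  also have "\<dots> \<le> b * (\<delta>\<^sup>2 / b)" using z b by (intro mult_left_mono) (auto simp: ipE)
  finally have "(nrm H (E z))\<^sup>2 \<le> \<delta>\<^sup>2" using b by simp
  then have E\<delta>: "nrm H (E z) \<le> \<delta>" using \<delta> by (simp add: power2_le_iff_abs_le)
  define y where "y = dif H (A z) (scl H l z)"
  have i: "A z \<in> pts H" "T z \<in> pts H" "E z \<in> pts H" "y \<in> pts H"
    using z op_in[OF bA] op_in[OF T] op_in[OF bE] by (auto simp: y_def)
  \<comment> \<open>Reading y as A z - l z gives a square of at least |A z|^2 + l^2, because l is
    negative; reading it as T z + E z, with |T z| = |A z|, gives hardly more than |A z|^2.\<close>
  have "y = pls H (T z) (E z)"
    by (rule ip_eqI) (use z i in \<open>auto simp: y_def E_def D_def ip_simps\<close>)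
  then have "nrm H y \<le> nrm H (A z) + nrm H (E z)" using nrm_triangle[OF i(2,3)] eq[OF z(1)] by simp
  then have "(nrm H y)\<^sup>2 \<le> (nrm H (A z) + \<delta>)\<^sup>2" using E\<delta> i by (intro power_mono) auto
  moreover have "(nrm H y)\<^sup>2 = (nrm H (A z))\<^sup>2 - 2 * l * Re (ip H (A z) z) + l\<^sup>2"
    using nrm_dif_sq[OF i(1), of "scl H l z"] z i by (simp add: y_def ip_simps nrm_scl power2_eq_square)
  moreover have "l * Re (ip H (A z) z) \<le> 0" using nA[OF z(1)] lneg by (simp add: mult_nonpos_nonneg)
  ultimately have "l\<^sup>2 \<le> 2 * nrm H (A z) * \<delta> + \<delta>\<^sup>2" by (simp add: power2_sum)
  also have "\<dots> \<le> 2 * a * \<delta> + 1 * \<delta>"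
  proof (rule add_mono)
    show "2 * nrm H (A z) * \<delta> \<le> 2 * a * \<delta>" using a(2)[OF z(1)] z \<delta> by (intro mult_right_mono) auto
    show "\<delta>\<^sup>2 \<le> 1 * \<delta>" unfolding power2_eq_square using \<delta> by (intro mult_right_mono) auto
  qed
  also have "\<dots> \<le> l\<^sup>2 / 2" using \<delta>(3) by (simp add: algebra_simps)
  finally show False using lneg by simp
qed

text \<open>|T| has the same norms as T, so \<open>op_le_of_nrm_eq\<close>, applied to T and to -T,
  gives -|T| <= T <= |T|. The first inequality makes (|T| + T)/2 positive, the second makes (|T| -
  T)/2, its difference from T, positive.\<close>

lemma pos_part:
  assumes T: "bounded_op H H T" and s: "\<And>x y. x \<in> pts H \<Longrightarrow> y \<in> pts H \<Longrightarrow> ip H (T x) y = ip H x (T y)"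
  shows "pos_op H (pos_part H T)" "\<And>x. x \<in> pts H \<Longrightarrow> Re (ip H (T x) x) \<le> Re (ip H (pos_part H T x) x)"
proof -
  note Tin = op_in[OF T]
  let ?T' = "adjoint_op H H T"
  note adj = adjoint_op[OF hilb_axioms sip_space_axioms T]
  have ipP: "ip H (?T' (T x)) y = ip H (T x) (T y)" if "x \<in> pts H" "y \<in> pts H" for x y
  proof -
    have "ip H (?T' (T x)) y = cnj (ip H y (?T' (T x)))"
      using that op_in[OF adj(1)] Tin by (intro b_sym) auto
    also have "\<dots> = cnj (ip H (T y) (T x))" using adj(2) that Tin by simp
    also have "\<dots> = ip H (T x) (T y)" using that Tin by (intro b_sym[symmetric]) auto
    finally show ?thesis .
  qed
  have P: "pos_op H (\<lambda>x. ?T' (T x))"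
    unfolding pos_op_def nonneg_form_def using op_comp[OF adj(1) T] Tin b_nn b_self_real by (simp add: ipP)
  define A where "A = abs_op H T"
  have A: "pos_op H A" unfolding A_def abs_op_def by (rule sqrt_op(1)[OF P])
  have bA: "bounded_op H H A" using A by (simp add: pos_op_def)
  have nA: "nrm H (A x) = nrm H (T x)" if x: "x \<in> pts H" for x
  proof -
    have "(nrm H (A x))\<^sup>2 = (nrm H (T x))\<^sup>2"
      using sqrt_op_nrm[OF P x] ipP[OF x x] nrm_sq[OF Tin[OF x]] by (simp add: A_def abs_op_def)
    then show ?thesis using x Tin op_in[OF bA] by (simp add: power2_eq_iff_nonneg)
  qed
  \<comment> \<open>This is -T, written in the shape of \<open>op_lincomb\<close>.\<close>
  define T2 where "T2 = (\<lambda>x. pls H (scl H (-1) (T x)) (scl H 0 x))"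
  have bT2: "bounded_op H H T2" unfolding T2_def by (rule op_lincomb[OF T op_id])
  have T2: "T2 x = scl H (-1) (T x)" if "x \<in> pts H" for x using that Tin by (simp add: T2_def scl_zero)
  have le1: "Re (ip H (T x) x) \<le> Re (ip H (A x) x)" if "x \<in> pts H" for x
    by (rule op_le_of_nrm_eq[OF A T s nA that])
  have "Re (ip H (T2 x) x) \<le> Re (ip H (A x) x)" if x: "x \<in> pts H" for x
    by (rule op_le_of_nrm_eq[OF A bT2 _ _ x]) (use Tin s nA in \<open>simp_all add: T2 ip_simps nrm_scl\<close>)
  then have le2: "- Re (ip H (T x) x) \<le> Re (ip H (A x) x)" if "x \<in> pts H" for x
    using that Tin by (simp add: T2 ip_simps)
  have Meq: "pos_part H T x = pls H (scl H (1/2) (A x)) (scl H (1/2) (T x))" if "x \<in> pts H" for x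
    using that Tin op_in[OF bA] by (simp add: pos_part_def A_def scl_pls)
  have bM: "bounded_op H H (pos_part H T)"
    using op_lincomb[OF bA T, of "1/2" "1/2"] Meq unfolding bounded_op_def linear_op_def by simp
  have ipM: "ip H (pos_part H T x) x = (ip H (A x) x + ip H (T x) x) / 2" if "x \<in> pts H" for x
    using that Tin op_in[OF bA] by (simp add: Meq ip_simps)
  have imT: "Im (ip H (T x) x) = 0" if x: "x \<in> pts H" for x
    using arg_cong[OF b_sym[OF Tin[OF x] x], of Im] arg_cong[OF s[OF x x], of Im] by simp
  show "pos_op H (pos_part H T)"
    unfolding pos_op_def nonneg_form_def
  proof (intro conjI ballI bM)
    fix x assume x: "x \<in> pts H"
    show "Im (ip H (pos_part H T x) x) = 0" "0 \<le> Re (ip H (pos_part H T x) x)"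
      using A x le2[OF x] imT[OF x] unfolding pos_op_def nonneg_form_def by (simp_all add: ipM)
  qed
  show "Re (ip H (T x) x) \<le> Re (ip H (pos_part H T x) x)" if "x \<in> pts H" for x
    using le1[OF that] by (simp add: ipM[OF that])
qed

end

context sip_space
begin

text \<open>The extension by continuity of a bounded functional. It is computed on the chosen
  representative, so that in \<open>converse\<close> limits for different u run along the same
  sequence.\<close>

lemma completion_extend:
  assumes lp: "\<And>x y. x \<in> pts H \<Longrightarrow> y \<in> pts H \<Longrightarrow> l (pls H x y) = l x + l y"
    and ls: "\<And>c x. x \<in> pts H \<Longrightarrow> l (scl H c x) = c * (l x :: complex)"
    and lb: "\<And>x. x \<in> pts H \<Longrightarrow> cmod (l x) \<le> g * nrm H x"
  defines "L \<equiv> (\<lambda>X. lim (\<lambda>k. l (repr X k)))"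
  shows "\<And>X. X \<in> pts (completion H) \<Longrightarrow> (\<lambda>k. l (repr X k)) \<longlonglongrightarrow> L X"
    "\<And>X Y. X \<in> pts (completion H) \<Longrightarrow> Y \<in> pts (completion H) \<Longrightarrow> L (pls (completion H) X Y) = L X + L Y"
    "\<And>c X. X \<in> pts (completion H) \<Longrightarrow> L (scl (completion H) c X) = c * L X"
    "\<And>X. X \<in> pts (completion H) \<Longrightarrow> cmod (L X) \<le> g * nrm (completion H) X"
    "\<And>x. x \<in> pts H \<Longrightarrow> L (into_completion H x) = l x"
proof -
  interpret C: sip_space "cauchy_space H" by (rule cauchy_space_sip)
  have ld: "l (dif H x y) = l x - l y" if "x \<in> pts H" "y \<in> pts H" for x y
    using that by (simp add: dif_def lp ls)
  have conv: "convergent (\<lambda>k. l (x k))" if x: "cauchy_seq H x" for x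
    unfolding Cauchy_convergent_iff[symmetric]
  proof (rule metric_CauchyI)
    fix e :: real assume e: "e > 0"
    define d where "d = e / (\<bar>g\<bar> + 1)"
    have d: "d > 0" using e by (simp add: d_def)
    obtain K where K: "\<forall>i\<ge>K. \<forall>j\<ge>K. nrm H (dif H (x i) (x j)) < d" using cauchy_seqD(2)[OF x d] by blast
    have "dist (l (x i)) (l (x j)) < e" if "i \<ge> K" "j \<ge> K" for i j
    proof -
      have n: "0 \<le> nrm H (dif H (x i) (x j))" using cauchy_seqD(1)[OF x] by auto
      have "dist (l (x i)) (l (x j)) \<le> g * nrm H (dif H (x i) (x j))"
        using lb[of "dif H (x i) (x j)"] cauchy_seqD(1)[OF x] by (simp add: ld dist_norm)
      also have "\<dots> \<le> \<bar>g\<bar> * nrm H (dif H (x i) (x j))" using n by (intro mult_right_mono) auto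
      also have "\<dots> \<le> \<bar>g\<bar> * d" using K that by (intro mult_left_mono) (auto intro: less_imp_le)
      also have "\<dots> < (\<bar>g\<bar> + 1) * d" using d by (simp add: algebra_simps)
      also have "\<dots> = e" by (simp add: d_def)
      finally show ?thesis .
    qed
    then show "\<exists>M. \<forall>m\<ge>M. \<forall>n\<ge>M. dist (l (x m)) (l (x n)) < e" by blast
  qed
  have rep: "cauchy_seq H (repr X)" "cls (cauchy_space H) (repr X) = X" if "X \<in> pts (completion H)" for X
    using C.quot_repr[of X] that unfolding completion_def by auto
  show lim: "(\<lambda>k. l (repr X k)) \<longlonglongrightarrow> L X" if "X \<in> pts (completion H)" for X
    using conv[OF rep(1)[OF that]] unfolding L_def by (simp add: convergent_LIMSEQ_iff)
  \<comment> \<open>Independence of the representative: any Cauchy sequence of the class gives the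
    same limit. Additivity and homogeneity follow by choosing convenient sequences.\<close>
  have key: "(\<lambda>k. l (x k)) \<longlonglongrightarrow> L (cls (cauchy_space H) x)" if x: "cauchy_seq H x" for x
  proof -
    let ?r = "repr (cls (cauchy_space H) x)"
    have X: "cls (cauchy_space H) x \<in> pts (completion H)" unfolding completion_def using x by (intro C.quot_in) simp
    note r = rep(1)[OF X]
    have "nrm (cauchy_space H) (dif (cauchy_space H) x ?r) = 0" using C.repr_cls(3)[of x] x by simp
    then have z: "(\<lambda>k. nrm H (dif H (x k) (?r k))) \<longlonglongrightarrow> 0"
      using cauchy_space_nrm[OF cauchy_dif[OF x r]] by simp
    have "(\<lambda>k. l (x k) - l (?r k)) \<longlonglongrightarrow> 0"
    proof (rule Lim_null_comparison)
      have "cmod (l (x k) - l (?r k)) \<le> g * nrm H (dif H (x k) (?r k))" for k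
        using lb[of "dif H (x k) (?r k)"] cauchy_seqD(1)[OF x] cauchy_seqD(1)[OF r] by (simp add: ld)
      then show "\<forall>\<^sub>F k in sequentially. cmod (l (x k) - l (?r k)) \<le> g * nrm H (dif H (x k) (?r k))" by simp
      show "(\<lambda>k. g * nrm H (dif H (x k) (?r k))) \<longlonglongrightarrow> 0" using tendsto_mult_left[OF z, of g] by simp
    qed
    from tendsto_add[OF this lim[OF X]] show ?thesis by simp
  qed
  show "L (pls (completion H) X Y) = L X + L Y" if X: "X \<in> pts (completion H)" and Y: "Y \<in> pts (completion H)" for X Y
  proof -
    let ?x = "repr X" and ?y = "repr Y"
    note c = rep[OF X] rep[OF Y]
    have e: "pls (completion H) X Y = cls (cauchy_space H) (\<lambda>k. pls H (?x k) (?y k))"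
      using C.quot_pls[of ?x ?y] c by (simp add: completion_def)
    have "(\<lambda>k. l (pls H (?x k) (?y k))) \<longlonglongrightarrow> L (pls (completion H) X Y)"
      unfolding e by (rule key[OF cauchy_pls[OF c(1,3)]])
    moreover have "(\<lambda>k. l (pls H (?x k) (?y k))) \<longlonglongrightarrow> L X + L Y"
      using tendsto_add[OF lim[OF X] lim[OF Y]] cauchy_seqD(1)[OF c(1)] cauchy_seqD(1)[OF c(3)] by (simp add: lp)
    ultimately show ?thesis by (rule LIMSEQ_unique)
  qed
  show "L (scl (completion H) c X) = c * L X" if X: "X \<in> pts (completion H)" for c X
  proof -
    let ?x = "repr X"
    note r = rep[OF X]
    have e: "scl (completion H) c X = cls (cauchy_space H) (\<lambda>k. scl H c (?x k))"
      using C.quot_scl[of ?x c] r by (simp add: completion_def)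
    have "(\<lambda>k. l (scl H c (?x k))) \<longlonglongrightarrow> L (scl (completion H) c X)"
      unfolding e by (rule key[OF cauchy_scl[OF r(1)]])
    moreover have "(\<lambda>k. l (scl H c (?x k))) \<longlonglongrightarrow> c * L X"
      using tendsto_mult_left[OF lim[OF X], of c] cauchy_seqD(1)[OF r(1)] by (simp add: ls)
    ultimately show ?thesis by (rule LIMSEQ_unique)
  qed
  show "cmod (L X) \<le> g * nrm (completion H) X" if X: "X \<in> pts (completion H)" for X
  proof -
    note r = rep(1)[OF X]
    have "nrm (completion H) X = nrm (cauchy_space H) (repr X)"
      unfolding completion_def by (rule C.quot_nrm_repr)
    then show ?thesis
      using LIMSEQ_le[OF tendsto_norm[OF lim[OF X]] tendsto_mult_left[OF cauchy_space_nrm[OF r], of g]]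
        lb[OF cauchy_seqD(1)[OF r]] by auto
  qed
  show "L (into_completion H x) = l x" if "x \<in> pts H" for x
    using key[OF cauchy_const[OF that]] unfolding into_completion_def by (simp add: LIMSEQ_const_iff)
qed

end

section \<open>Trace splittings and the range condition\<close>

lemma linear_op_upd [simp]:
  "linear_op (H\<lparr>ip := b\<rparr>) K T = linear_op H K T" "linear_op H (K\<lparr>ip := c\<rparr>) T = linear_op H K T"
  by (simp_all add: linear_op_def)

lemma cvspace_ip_upd: "cvspace (H\<lparr>ip := b\<rparr>) = cvspace H"
  by (simp add: cvspace_def vector_space_on_def)

text \<open>What the quotient argument takes from the concrete problem: a bounded trace into an
  inner product space and a bounded Hermitian form with diagonal \<open>Q\<close>.
  \<open>form_space_trace_split\<close> later supplies the instance built from \<open>Psi\<close>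
  and \<open>J9\<close>.\<close>

locale trace_split = V: hilb V + Y: ip_space Y + q: hform V q
  for V :: "'a cspace" and Y :: "'b cspace" and q :: "'a \<Rightarrow> 'a \<Rightarrow> complex" +
  fixes R :: "'a \<Rightarrow> 'b" and Q :: "'a \<Rightarrow> real" and N U :: "'a cspace" and X :: "'b cspace" and cq :: real
  assumes R: "bounded_op V Y R"
    and qQ: "\<And>f. f \<in> pts V \<Longrightarrow> q f f = of_real (Q f)"
    and qb: "\<And>f g. f \<in> pts V \<Longrightarrow> g \<in> pts V \<Longrightarrow> cmod (q f g) \<le> cq * nrm V f * nrm V g"
    and cq: "0 \<le> cq"
    and N_def: "N = V\<lparr>pts := {f \<in> pts V. R f = zer Y}\<rparr>"
    and U_def: "U = orth_complement V (pts N)"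
    and X_def: "X = Y\<lparr>pts := R ` pts U, ip := (\<lambda>x y. ip U (inv_into (pts U) R x) (inv_into (pts U) R y))\<rparr>"
begin

lemmas linR = bounded_op_linear[OF R]
lemmas R_in = linear_opD(1)[OF linR]
lemmas R_pls = linear_opD(2)[OF linR]
lemmas R_scl = linear_opD(3)[OF linR]

lemma R_dif: "x \<in> pts V \<Longrightarrow> y \<in> pts V \<Longrightarrow> R (dif V x y) = dif Y (R x) (R y)"
  by (rule linear_opD(4)[OF linR _ _ V.cvspace_axioms])

lemma R_zer: "R (zer V) = zer Y"
  by (rule linear_op_zer[OF linR V.cvspace_axioms Y.cvspace_axioms])

lemma N_sel: "pts N = {f \<in> pts V. R f = zer Y}" "pls N = pls V" "scl N = scl V" "zer N = zer V" "ip N = ip V"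
  "nrm N = nrm V" "dif N = dif V"
  by (simp_all add: N_def)

lemma U_sel: "pts U = {u \<in> pts V. \<forall>n\<in>pts N. ip V u n = 0}" "pls U = pls V" "scl U = scl V" "zer U = zer V"
  "ip U = ip V" "nrm U = nrm V" "dif U = dif V"
  by (simp_all add: U_def orth_complement_def)

lemma NV: "n \<in> pts N \<Longrightarrow> n \<in> pts V" and UV: "u \<in> pts U \<Longrightarrow> u \<in> pts V"
  by (simp_all add: N_sel U_sel)

lemma N_sub: "csubspace V (pts N)"
  unfolding csubspace_def N_sel by (auto simp: R_pls R_scl R_zer)

lemma R_tends:
  assumes "\<And>k. x k \<in> pts V" "f \<in> pts V" "tends V x f" shows "tends Y (\<lambda>k. R (x k)) (R f)"
proof -
  obtain B where B: "0 \<le> B" "\<And>x. x \<in> pts V \<Longrightarrow> nrm Y (R x) \<le> B * nrm V x"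
    using bounded_op_nonneg[OF R V.sip_space_axioms] by blast
  show ?thesis unfolding tends_def
  proof (rule Lim_null_comparison)
    have "norm (nrm Y (dif Y (R (x k)) (R f))) \<le> B * nrm V (dif V (x k) f)" for k
      using B(2)[of "dif V (x k) f"] assms(1)[of k] assms(2) R_in by (simp add: R_dif)
    then show "\<forall>\<^sub>F k in sequentially. norm (nrm Y (dif Y (R (x k)) (R f))) \<le> B * nrm V (dif V (x k) f)" by simp
    show "(\<lambda>k. B * nrm V (dif V (x k) f)) \<longlonglongrightarrow> 0"
      using tendsto_mult_left[OF assms(3)[unfolded tends_def], of B] by simp
  qed
qed

lemma R_closed: "closed_op V Y R"
  unfolding closed_op_def
proof (intro conjI allI impI linR)
  fix x f g assume a: "(\<forall>k. x k \<in> pts V) \<and> f \<in> pts V \<and> g \<in> pts Y \<and> tends V x f \<and> tends Y (\<lambda>k. R (x k)) g"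
  show "R f = g"
    by (rule Y.tends_unique[of "\<lambda>k. R (x k)"]) (use a R_in R_tends in auto)
qed

lemma N_closed: "closed_subset V (pts N)"
  unfolding closed_subset_def
proof (intro conjI allI impI)
  fix x f assume a: "(\<forall>k. x k \<in> pts N) \<and> f \<in> pts V \<and> tends V x f"
  have "R f = zer Y"
  proof (rule Y.tends_unique[of "\<lambda>k. R (x k)"])
    show "tends Y (\<lambda>k. R (x k)) (R f)" using a NV by (intro R_tends) auto
    show "tends Y (\<lambda>k. R (x k)) (zer Y)" using a by (simp add: tends_def N_sel)
  qed (use a NV R_in in auto)
  then show "f \<in> pts N" using a by (simp add: N_sel)
qed (use N_sub csubspaceD in blast)

lemma U_sub: "csubspace V (pts U)"
  unfolding csubspace_def U_sel by (auto simp: V.ip_simps NV)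

lemma U_closed: "closed_subset V (pts U)"
  unfolding closed_subset_def
proof (intro conjI allI impI)
  fix x f assume a: "(\<forall>k. x k \<in> pts U) \<and> f \<in> pts V \<and> tends V x f"
  have "ip V f n = 0" if n: "n \<in> pts N" for n
  proof -
    have "(\<lambda>k. ip V (x k) n) \<longlonglongrightarrow> ip V f n" using a n UV NV by (intro V.tendsto_ip_left) auto
    moreover have "(\<lambda>k. ip V (x k) n) = (\<lambda>k. 0)" using a n by (simp add: U_sel)
    ultimately show ?thesis by (simp add: LIMSEQ_const_iff)
  qed
  then show "f \<in> pts U" using a by (simp add: U_sel)
qed (use U_sub csubspaceD in blast)

lemma U_eq: "U = V\<lparr>pts := pts U\<rparr>"
  by (simp add: U_def orth_complement_def)

lemma N_eq: "N = V\<lparr>pts := pts N\<rparr>"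
  by (simp add: N_def)

lemma U_hilb: "hilb U"
  by (subst U_eq) (rule V.subspace_hilb[OF U_sub U_closed])

lemma N_hilb: "hilb N"
  by (subst N_eq) (rule V.subspace_hilb[OF N_sub N_closed])

sublocale U: hilb U by (rule U_hilb)
sublocale N: hilb N by (rule N_hilb)

section \<open>The orthogonal decomposition of V\<close>

lemma orth: "u \<in> pts U \<Longrightarrow> n \<in> pts N \<Longrightarrow> ip V u n = 0" "u \<in> pts U \<Longrightarrow> n \<in> pts N \<Longrightarrow> ip V n u = 0"
  using V.b_sym[of u n] by (auto simp: U_sel NV)

lemma NU_zero: "x \<in> pts N \<Longrightarrow> x \<in> pts U \<Longrightarrow> x = zer V"
  using orth(1)[of x x] V.definite[of x] NV by blast

abbreviation "projN \<equiv> orth_proj V (pts N)"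
abbreviation "projU \<equiv> orth_proj V (pts U)"

lemma proj:
  assumes f: "f \<in> pts V"
  shows "projN f \<in> pts N" "projU f \<in> pts U" "f = pls V (projN f) (projU f)"
proof -
  note p = V.orth_proj[OF N_sub N_closed f]
  show pn: "projN f \<in> pts N" by (rule p(1))
  have d: "dif V f (projN f) \<in> pts U" using p(1,2) f NV by (simp add: U_sel)
  have "projU f = dif V f (projN f)"
  proof (rule V.orth_proj(3)[OF U_sub U_closed f d])
    fix v assume v: "v \<in> pts U"
    have "ip V (dif V f (dif V f (projN f))) v = ip V (projN f) v" using f NV[OF pn] UV[OF v] by (simp add: V.ip_simps)
    then show "ip V (dif V f (dif V f (projN f))) v = 0" using orth(2)[OF v pn] by simp
  qed
  then show "projU f \<in> pts U" "f = pls V (projN f) (projU f)" using d V.pls_dif_cancel[OF f NV[OF pn]] by simp_all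
qed

lemma decomp_unique:
  assumes "n \<in> pts N" "m \<in> pts N" "u \<in> pts U" "v \<in> pts U" "pls V n u = pls V m v"
  shows "n = m" "u = v"
proof -
  have i: "n \<in> pts V" "m \<in> pts V" "u \<in> pts V" "v \<in> pts V" using assms NV UV by auto
  have "dif V (pls V n u) (pls V m v) = pls V (dif V n m) (dif V u v)" by (rule V.dif_pls_pls[OF i(1) i(3) i(2) i(4)])
  then have z: "pls V (dif V n m) (dif V u v) = zer V" using assms(5) i by simp
  have "ip V (dif V n m) (dif V n m) = ip V (pls V (dif V n m) (dif V u v)) (dif V n m)"
    using i orth[OF assms(3) assms(1)] orth[OF assms(3) assms(2)] orth[OF assms(4) assms(1)] orth[OF assms(4) assms(2)]
    by (simp add: V.ip_simps)
  then have "dif V n m = zer V" using i unfolding z by (intro V.definite) auto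
  then show 1: "n = m" using V.dif_eq_zer i by blast
  have "pls V u n = pls V v n" using assms(5) i unfolding 1 by (simp add: V.pls_comm)
  then show "u = v" using V.pls_cancel_right i by blast
qed

lemma proj_eq:
  assumes "n \<in> pts N" "u \<in> pts U" shows "projN (pls V n u) = n" "projU (pls V n u) = u"
proof -
  have f: "pls V n u \<in> pts V" using assms NV UV by auto
  note d = decomp_unique[OF proj(1)[OF f] assms(1) proj(2)[OF f] assms(2) proj(3)[OF f, symmetric]]
  show "projN (pls V n u) = n" by (rule d(1))
  show "projU (pls V n u) = u" by (rule d(2))
qed

lemma decomp: "\<forall>f\<in>pts V. \<exists>!z. fst z \<in> pts N \<and> snd z \<in> pts U \<and> f = pls V (fst z) (snd z)"
proof
  fix f assume f: "f \<in> pts V"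
  show "\<exists>!z. fst z \<in> pts N \<and> snd z \<in> pts U \<and> f = pls V (fst z) (snd z)"
  proof (rule ex1I[of _ "(projN f, projU f)"])
    fix z assume "fst z \<in> pts N \<and> snd z \<in> pts U \<and> f = pls V (fst z) (snd z)"
    then show "z = (projN f, projU f)" using proj_eq[of "fst z" "snd z"] by (simp add: prod_eq_iff)
  qed (use proj[OF f] in auto)
qed

lemma projU_linear: "linear_op V U projU"
  unfolding linear_op_def U_sel(2,3)
proof (intro conjI ballI allI)
  fix x y assume i: "x \<in> pts V" "y \<in> pts V"
  have "pls V x y = pls V (pls V (projN x) (projU x)) (pls V (projN y) (projU y))" using proj(3) i by simp
  also have "\<dots> = pls V (pls V (projN x) (projN y)) (pls V (projU x) (projU y))"
    using i proj NV UV by (intro V.pls_interchange) auto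
  finally show "projU (pls V x y) = pls V (projU x) (projU y)"
    using proj_eq(2)[of "pls V (projN x) (projN y)" "pls V (projU x) (projU y)"] csubspaceD(4)[OF N_sub] csubspaceD(4)[OF U_sub] proj i
    by simp
next
  fix c x assume i: "x \<in> pts V"
  have "scl V c x = scl V c (pls V (projN x) (projU x))" using proj(3) i by simp
  also have "\<dots> = pls V (scl V c (projN x)) (scl V c (projU x))" using i proj NV UV by (intro V.scl_pls) auto
  finally show "projU (scl V c x) = scl V c (projU x)"
    using proj_eq(2)[of "scl V c (projN x)" "scl V c (projU x)"] csubspaceD(5)[OF N_sub] csubspaceD(5)[OF U_sub] proj i
    by simp
qed (rule proj)

lemma projU_nrm: assumes f: "f \<in> pts V" shows "nrm V (projU f) \<le> nrm V f"
proof -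
  have "(nrm V f)\<^sup>2 = (nrm V (projN f))\<^sup>2 + (nrm V (projU f))\<^sup>2"
    using V.nrm_pls_sq[OF NV UV, of "projN f" "projU f"] proj[OF f] orth[of "projU f" "projN f"] by simp
  then have "(nrm V (projU f))\<^sup>2 \<le> (nrm V f)\<^sup>2" by simp
  then show ?thesis using f proj UV by (simp add: power2_le_iff_abs_le)
qed

lemma R_pU: assumes f: "f \<in> pts V" shows "R f = R (projU f)"
proof -
  have i: "projN f \<in> pts V" "projU f \<in> pts V" by (rule NV[OF proj(1)[OF f]], rule UV[OF proj(2)[OF f]])
  have z: "R (projN f) = zer Y" using proj(1)[OF f] by (simp add: N_sel(1))
  have "R f = R (pls V (projN f) (projU f))" using proj(3)[OF f] by simp
  also have "\<dots> = pls Y (R (projU f)) (zer Y)" using i R_in by (simp add: R_pls z Y.pls_comm)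
  finally show ?thesis using i R_in by simp
qed

lemma R_inj: "inj_on R (pts U)"
proof (rule inj_onI)
  fix x y assume a: "x \<in> pts U" "y \<in> pts U" "R x = R y"
  then have "dif V x y \<in> pts N" using UV R_in by (simp add: N_sel R_dif)
  moreover have "dif V x y \<in> pts U" using csubspaceD(6)[OF U_sub] a by blast
  ultimately have "dif V x y = zer V" by (rule NU_zero)
  then show "x = y" using V.dif_eq_zer a UV by blast
qed

lemma inv_R [simp]: "u \<in> pts U \<Longrightarrow> inv_into (pts U) R (R u) = u"
  by (rule inv_into_f_f[OF R_inj])

section \<open>The range of the trace with the transported norm\<close>

lemma X_sel: "pts X = R ` pts U" "pls X = pls Y" "scl X = scl Y" "zer X = zer Y" "dif X = dif Y"
  by (simp_all add: X_def dif_def fun_eq_iff)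

lemma X_ip: "u \<in> pts U \<Longrightarrow> v \<in> pts U \<Longrightarrow> ip X (R u) (R v) = ip U u v"
  by (simp add: X_def)

lemma X_nrm: "u \<in> pts U \<Longrightarrow> nrm X (R u) = nrm V u"
  by (simp add: nrm_def X_ip U_sel(5))

lemma RU_sub: "csubspace Y (R ` pts U)"
  unfolding csubspace_def
proof (intro conjI ballI allI)
  show "R ` pts U \<subseteq> pts Y" using R_in UV by auto
  show "zer Y \<in> R ` pts U" using csubspaceD(3)[OF U_sub] R_zer by (metis imageI)
  fix x y assume "x \<in> R ` pts U" "y \<in> R ` pts U"
  then obtain u v where "u \<in> pts U" "v \<in> pts U" "x = R u" "y = R v" by auto
  then show "pls Y x y \<in> R ` pts U" using R_pls UV csubspaceD(4)[OF U_sub] by (metis imageI)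
next
  fix c x assume "x \<in> R ` pts U"
  then obtain u where "u \<in> pts U" "x = R u" by auto
  then show "scl Y c x \<in> R ` pts U" using R_scl UV csubspaceD(5)[OF U_sub] by (metis imageI)
qed

text \<open>\<open>R\<close> is injective on \<open>U\<close> because \<open>U\<close> meets
  \<open>N\<close> only in zero, so the whole structure of \<open>U\<close> is carried over.
  Convergence in \<open>X\<close> is convergence of preimages in \<open>U\<close>, which is how
  completeness is inherited.\<close>

lemma X_hilb: "hilb X"
proof -
  interpret S: cvspace "Y\<lparr>pts := R ` pts U\<rparr>" by (rule Y.subspace_cvspace[OF RU_sub])
  interpret X: cvspace X
    unfolding X_def cvspace_ip_upd by (rule S.cvspace_axioms)
  have pl: "R (pls U u v) = pls X (R u) (R v)" if "u \<in> pts U" "v \<in> pts U" for u v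
    using that UV by (simp add: X_sel U_sel(2-7) R_pls)
  have sc: "R (scl U c u) = scl X c (R u)" if "u \<in> pts U" for c u
    using that UV by (simp add: X_sel U_sel(2-7) R_scl)
  have df: "R (dif U u v) = dif X (R u) (R v)" if "u \<in> pts U" "v \<in> pts U" for u v
    using that UV by (simp add: X_sel U_sel(2-7) R_dif)
  show ?thesis
  proof unfold_locales
    show "hermitian_form X (ip X)" unfolding hermitian_form_def X_sel(1)
    proof (intro conjI ballI allI; elim imageE; hypsubst)
      fix x y z assume "x \<in> pts U" "y \<in> pts U" "z \<in> pts U"
      then show "ip X (pls X (R x) (R y)) (R z) = ip X (R x) (R z) + ip X (R y) (R z)"
        by (simp add: pl[symmetric] X_ip U.ip_simps)
    next
      fix c x y assume "x \<in> pts U" "y \<in> pts U"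
      then show "ip X (scl X c (R x)) (R y) = c * ip X (R x) (R y)"
        by (simp add: sc[symmetric] X_ip U.ip_simps)
    next
      fix x y assume "x \<in> pts U" "y \<in> pts U"
      then show "ip X (R y) (R x) = cnj (ip X (R x) (R y))" by (simp only: X_ip) (rule U.b_sym)
    qed
    show "nonneg_form X (ip X)" unfolding nonneg_form_def X_sel(1)
      using U.b_nn U.b_self_real by (auto simp: X_ip)
    fix x assume "x \<in> pts X" "ip X x x = 0"
    then obtain u where u: "u \<in> pts U" "x = R u" "ip U u u = 0" by (auto simp: X_sel X_ip)
    then have "u = zer U" by (intro U.definite)
    then show "x = zer X" using u(2) R_zer by (simp add: X_sel U_sel(4))
  next
    fix x assume x: "cauchy_seq X x"
    define u where "u = (\<lambda>k. inv_into (pts U) R (x k))"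
    have u: "u k \<in> pts U" "x k = R (u k)" for k
      using x unfolding u_def cauchy_seq_def X_sel by (auto simp: inv_into_into f_inv_into_f)
    have "cauchy_seq U u"
      using x u(1) unfolding cauchy_seq_def u(2) by (simp add: df[symmetric] X_nrm U_sel(6))
    then obtain l where l: "l \<in> pts U" "tends U u l" using U.complete by blast
    have "tends X x (R l)" using l u(1) unfolding tends_def u(2) by (simp add: df[symmetric] X_nrm U_sel(6))
    then show "\<exists>l\<in>pts X. tends X x l" using l by (auto simp: X_sel)
  qed
qed

sublocale X: hilb X by (rule X_hilb)

lemma R_unitary: "unitary_op U X R"
  unfolding unitary_op_def linear_op_def bij_betw_def
  using R_inj X_ip UV by (auto simp: X_sel U_sel(2,3) R_pls R_scl)

lemma Q_nonneg_iff: "(\<forall>f\<in>pts V. R f = zer Y \<longrightarrow> 0 \<le> Q f) \<longleftrightarrow> nonneg_form N q"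
  unfolding nonneg_form_def N_sel using qQ by auto

lemma blocks:
  assumes "n \<in> pts N" "m \<in> pts N" "u \<in> pts U" "v \<in> pts U"
  shows "q (pls V n u) (pls V m v) = q n m + q n v + cnj (q m u) + q u v"
proof -
  have "n \<in> pts V" "m \<in> pts V" "u \<in> pts V" "v \<in> pts V" using assms NV UV by auto
  then show ?thesis using q.b_sym[of m u] by (simp add: q.b_simps)
qed

lemma qN: "hermitian_form N q"
  by (subst N_eq) (rule hermitian_form_subset[OF q.hermb csubspaceD(1)[OF N_sub]])

lemma qU: "hermitian_form U q"
  by (subst U_eq) (rule hermitian_form_subset[OF q.hermb csubspaceD(1)[OF U_sub]])

lemma HA_sip: assumes "nonneg_form N q" shows "sip_space (N\<lparr>ip := q\<rparr>)"
proof -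
  interpret nnform N q by unfold_locales (fact qN assms)+
  show ?thesis by (rule form_sip_space)
qed

text \<open>Adding the M-term to \<open>q\<close> gives the form \<open>PF\<close>. Its diagonal is
  p, a square plus <(M - T) u, u>, hence nonnegative; since the square of |S R f| is exactly the
  added M-term, subtracting it recovers \<open>Q\<close>.\<close>

theorem factorization:
  assumes nn: "nonneg_form N q" and dg: "douglas_factor q N U \<Gamma>"
  defines "C \<equiv> form_op U q" and "\<Gamma>\<Gamma> \<equiv> (\<lambda>u. adjoint_op U (H_A N q) \<Gamma> (\<Gamma> u))"
  defines "T \<equiv> (\<lambda>u. dif U (\<Gamma>\<Gamma> u) (C u))"
  defines "M \<equiv> pos_part U T"
  defines "S \<equiv> (\<lambda>x. sqrt_op U M (inv_into (pts U) R x))"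
  defines "p \<equiv> (\<lambda>f. (nrm (H_A N q) (pls (H_A N q) (A_half N q (projN f)) (\<Gamma> (projU f))))\<^sup>2
                  + Re (ip U (dif U (pls U (C (projU f)) (M (projU f))) (\<Gamma>\<Gamma> (projU f))) (projU f)))"
  shows "bounded_op X U S" "\<forall>u\<in>pts U. S (R u) = sqrt_op U M u" "\<forall>f\<in>pts V. 0 \<le> p f"
    "\<exists>(H :: (nat \<Rightarrow> 'a) set cspace) G. bounded_op V H G \<and> (\<forall>f\<in>pts V. (nrm H (G f))\<^sup>2 = p f) \<and>
       quotient_factorization Q V R X H U G S"
    "\<forall>f\<in>pts V. R f = zer Y \<longrightarrow> 0 \<le> Q f"
proof -
  let ?P = "N\<lparr>ip := q\<rparr>" and ?HA = "H_A N q"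
  interpret P: sip_space ?P by (rule HA_sip[OF nn])
  interpret HA: hilb ?HA unfolding H_A_def by (rule P.completion_hilb)
  have \<Gamma>: "bounded_op U ?HA \<Gamma>" and \<Gamma>q: "\<And>n u. n \<in> pts N \<Longrightarrow> u \<in> pts U \<Longrightarrow> q n u = ip ?HA (A_half N q n) (\<Gamma> u)"
    using dg by (auto simp: douglas_factor_def)
  have \<Gamma>in: "\<Gamma> u \<in> pts ?HA" if "u \<in> pts U" for u using linear_opD(1)[OF bounded_op_linear[OF \<Gamma>] that] .
  have Ain: "A_half N q n \<in> pts ?HA" and Aip: "ip ?HA (A_half N q n) (A_half N q n) = q n n" if "n \<in> pts N" for n
    using P.into_in[of n] P.into_ip[of n n] that by (simp_all add: H_A_def A_half_def)
  note adj = adjoint_op[OF U_hilb HA.sip_space_axioms \<Gamma>]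
  have GGb: "bounded_op U U \<Gamma>\<Gamma>"
  proof -
    obtain B where B: "0 \<le> B" "\<And>x. x \<in> pts U \<Longrightarrow> nrm ?HA (\<Gamma> x) \<le> B * nrm U x"
      using bounded_op_nonneg[OF \<Gamma> U.sip_space_axioms] by blast
    obtain D where D: "0 \<le> D" "\<And>x. x \<in> pts ?HA \<Longrightarrow> nrm U (adjoint_op U ?HA \<Gamma> x) \<le> D * nrm ?HA x"
      using bounded_op_nonneg[OF adj(1) HA.sip_space_axioms] by blast
    have "nrm U (\<Gamma>\<Gamma> u) \<le> (D * B) * nrm U u" if u: "u \<in> pts U" for u
      using D(2)[OF \<Gamma>in[OF u]] mult_left_mono[OF B(2)[OF u] D(1)] by (simp add: \<Gamma>\<Gamma>_def mult.assoc)
    then show ?thesis unfolding bounded_op_def linear_op_def \<Gamma>\<Gamma>_def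
      by (auto simp: linear_opD[OF bounded_op_linear[OF \<Gamma>]] linear_opD[OF bounded_op_linear[OF adj(1)]])
  qed
  have GGip: "ip U (\<Gamma>\<Gamma> u) v = ip ?HA (\<Gamma> u) (\<Gamma> v)" if uv: "u \<in> pts U" "v \<in> pts U" for u v
  proof -
    have "ip U (\<Gamma>\<Gamma> u) v = cnj (ip U v (\<Gamma>\<Gamma> u))" using uv U.op_in[OF GGb] by (intro U.b_sym) auto
    also have "\<dots> = cnj (ip ?HA (\<Gamma> v) (\<Gamma> u))" using adj(2)[OF uv(2) \<Gamma>in[OF uv(1)]] by (simp add: \<Gamma>\<Gamma>_def)
    also have "\<dots> = ip ?HA (\<Gamma> u) (\<Gamma> v)" using uv \<Gamma>in by (intro HA.b_sym[symmetric]) auto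
    finally show ?thesis .
  qed
  have C: "bounded_op U U C" "\<And>x y. x \<in> pts U \<Longrightarrow> y \<in> pts U \<Longrightarrow> ip U (C x) y = q x y"
    unfolding C_def using U.form_op[OF qU, of cq] qb cq UV by (auto simp: U_sel(6))
  have Tb: "bounded_op U U T" unfolding T_def by (rule U.op_dif_bounded[OF GGb C(1)])
  have Tip: "ip U (T u) v = ip ?HA (\<Gamma> u) (\<Gamma> v) - q u v" if "u \<in> pts U" "v \<in> pts U" for u v
    using that U.op_in[OF GGb] U.op_in[OF C(1)] by (simp add: T_def U.ip_simps GGip C(2))
  have Ts: "ip U (T u) v = ip U u (T v)" if uv: "u \<in> pts U" "v \<in> pts U" for u v
  proof -
    have "ip U u (T v) = cnj (ip U (T v) u)" using uv U.op_in[OF Tb] by (intro U.b_sym) auto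
    also have "\<dots> = cnj (ip ?HA (\<Gamma> v) (\<Gamma> u)) - cnj (q v u)" using uv by (simp add: Tip)
    also have "\<dots> = ip U (T u) v"
      using uv \<Gamma>in HA.b_sym[of "\<Gamma> v" "\<Gamma> u"] q.b_sym[of v u] UV by (simp add: Tip)
    finally show ?thesis by simp
  qed
  have M: "pos_op U M" "\<And>x. x \<in> pts U \<Longrightarrow> Re (ip U (T x) x) \<le> Re (ip U (M x) x)"
    using U.pos_part[OF Tb] Ts unfolding M_def by blast+
  have Mb: "bounded_op U U M" using M(1) by (simp add: pos_op_def)
  interpret M: nnform U "\<lambda>x y. ip U (M x) y" by (rule U.pos_op_nnform[OF M(1)])
  note sq = U.sqrt_op(1)[OF M(1)]
  have sqb: "bounded_op U U (sqrt_op U M)" using sq by (simp add: pos_op_def)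
  show SR: "\<forall>u\<in>pts U. S (R u) = sqrt_op U M u" by (simp add: S_def)
  show Sb: "bounded_op X U S"
  proof -
    obtain B where B: "\<And>x. x \<in> pts U \<Longrightarrow> nrm U (sqrt_op U M x) \<le> B * nrm U x"
      using U.op_bound[OF sqb] by blast
    have "linear_op X U S" unfolding linear_op_def X_sel(1)
    proof (intro conjI ballI allI; elim imageE; hypsubst)
      fix u v assume uv: "u \<in> pts U" "v \<in> pts U"
      have "pls X (R u) (R v) = R (pls U u v)" using uv UV by (simp add: X_sel U_sel(2-7) R_pls)
      then show "S (pls X (R u) (R v)) = pls U (S (R u)) (S (R v))"
        using uv SR U.op_pls[OF sqb] by simp
    next
      fix c u assume u: "u \<in> pts U"
      have "scl X c (R u) = R (scl U c u)" using u UV by (simp add: X_sel U_sel(2-7) R_scl)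
      then show "S (scl X c (R u)) = scl U c (S (R u))" using u SR U.op_scl[OF sqb] by simp
    qed (use SR U.op_in[OF sqb] in auto)
    moreover have "\<forall>x\<in>pts X. nrm U (S x) \<le> B * nrm X x"
      using B SR by (auto simp: X_sel X_nrm U_sel(6))
    ultimately show ?thesis unfolding bounded_op_def by blast
  qed
  define PF where "PF = (\<lambda>f g. q f g + ip U (M (projU f)) (projU g))"
  have Snorm: "(nrm U (S (R f)))\<^sup>2 = Re (ip U (M (projU f)) (projU f))" if f: "f \<in> pts V" for f
  proof -
    have "R f = R (projU f)" by (rule R_pU[OF f])
    then show ?thesis using SR U.sqrt_op_nrm[OF M(1)] proj(2)[OF f] by simp
  qed
  \<comment> \<open>The term |Gamma u|^2 in the expanded square cancels against the one subtracted
    in p, and the Douglas identity rewrites the cross term as q n u.\<close>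
  have pPF: "p f = Re (PF f f)" if f: "f \<in> pts V" for f
  proof -
    define n u where "n = projN f" and "u = projU f"
    have nu: "n \<in> pts N" "u \<in> pts U" "f = pls V n u" using proj[OF f] by (auto simp: n_def u_def)
    have "Re (ip U (dif U (pls U (C u) (M u)) (\<Gamma>\<Gamma> u)) u) = Re (q u u) + Re (ip U (M u) u) - Re (ip ?HA (\<Gamma> u) (\<Gamma> u))"
      using nu U.op_in[OF GGb] U.op_in[OF C(1)] U.op_in[OF Mb] by (simp add: U.ip_simps GGip C(2))
    moreover have "(nrm ?HA (pls ?HA (A_half N q n) (\<Gamma> u)))\<^sup>2 = Re (q n n) + 2 * Re (q n u) + Re (ip ?HA (\<Gamma> u) (\<Gamma> u))"
      using HA.nrm_pls_sq[OF Ain \<Gamma>in, of n u] nu by (simp add: HA.nrm_sq Ain \<Gamma>in Aip \<Gamma>q)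
    moreover have "Re (q f f) = Re (q n n) + 2 * Re (q n u) + Re (q u u)"
      using blocks[OF nu(1) nu(1) nu(2) nu(2)] nu(3) by simp
    ultimately show ?thesis unfolding p_def PF_def n_def[symmetric] u_def[symmetric] by simp
  qed
  show p0: "\<forall>f\<in>pts V. 0 \<le> p f"
  proof
    fix f assume f: "f \<in> pts V"
    define u where "u = projU f"
    have u: "u \<in> pts U" using proj[OF f] by (simp add: u_def)
    have "Re (ip U (dif U (pls U (C u) (M u)) (\<Gamma>\<Gamma> u)) u) = Re (ip U (M u) u) - Re (ip U (T u) u)"
      using u U.op_in[OF GGb] U.op_in[OF C(1)] U.op_in[OF Mb] by (simp add: U.ip_simps T_def)
    then show "0 \<le> p f" using M(2)[OF u] by (simp add: p_def u_def)
  qed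
  have Uin: "\<And>f. f \<in> pts V \<Longrightarrow> projU f \<in> pts U" by (rule proj)
  note pUl = linear_opD[OF projU_linear]
  have hPF: "hermitian_form V PF" unfolding hermitian_form_def PF_def
  proof (intro conjI ballI allI)
    fix x y assume i: "x \<in> pts V" "y \<in> pts V"
    show "q y x + ip U (M (projU y)) (projU x) = cnj (q x y + ip U (M (projU x)) (projU y))"
      using q.b_sym[OF i] M.b_sym[OF Uin[OF i(1)] Uin[OF i(2)]] by simp
  qed (simp_all add: q.b_simps pUl Uin M.b_simps algebra_simps)
  interpret PF: hform V PF by unfold_locales (fact hPF)
  have nPF: "nonneg_form V PF" unfolding nonneg_form_def using PF.b_self_real p0 pPF by simp
  interpret PF: nnform V PF by unfold_locales (fact nPF)
  let ?W = "V\<lparr>ip := PF\<rparr>"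
  interpret W: sip_space ?W by (rule PF.form_sip_space)
  let ?H = "completion ?W" and ?G = "into_completion ?W"
  have Gn: "(nrm ?H (?G f))\<^sup>2 = p f" if f: "f \<in> pts V" for f
    using W.into_nrm[of f] f p0[rule_format, OF f] pPF[OF f] by (simp add: nrm_ip_upd)
  have linG: "linear_op V ?H ?G" using W.into_linear by simp
  \<comment> \<open>Boundedness of \<open>G\<close>: the diagonal of \<open>PF\<close> is at most
    (cq + m) |f|^2, because projecting onto \<open>U\<close> does not increase the norm.\<close>
  obtain m where m: "0 \<le> m" "\<And>x. x \<in> pts U \<Longrightarrow> nrm U (M x) \<le> m * nrm U x" by (rule U.op_bound[OF Mb]) (rule that)
  have "nrm ?H (?G f) \<le> sqrt (cq + m) * nrm V f" if f: "f \<in> pts V" for f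
  proof -
    have u: "projU f \<in> pts U" by (rule Uin[OF f])
    have "Re (q f f) \<le> cq * nrm V f * nrm V f" using qb[OF f f] complex_Re_le_cmod[of "q f f"] by linarith
    moreover have "Re (ip U (M (projU f)) (projU f)) \<le> m * nrm V f * nrm V f"
    proof -
      have "Re (ip U (M (projU f)) (projU f)) \<le> nrm U (M (projU f)) * nrm U (projU f)"
        using U.cauchy_schwarz[OF U.op_in[OF Mb u] u] complex_Re_le_cmod order_trans by blast
      also have "\<dots> \<le> (m * nrm V (projU f)) * nrm V (projU f)"
        using m(2)[OF u] u UV by (intro mult_mono) (auto simp: U_sel(6) m)
      also have "\<dots> \<le> (m * nrm V f) * nrm V f"
        using projU_nrm[OF f] f u UV m(1) by (intro mult_mono mult_left_mono) auto
      finally show ?thesis .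
    qed
    ultimately have "(nrm ?H (?G f))\<^sup>2 \<le> (sqrt (cq + m) * nrm V f)\<^sup>2"
      unfolding Gn[OF f] pPF[OF f] using cq m(1) by (simp add: PF_def power_mult_distrib power2_eq_square algebra_simps)
    then show ?thesis using f cq m(1) by (intro power2_le_imp_le[of "nrm ?H (?G f)"]) auto
  qed
  then have bG: "bounded_op V ?H ?G" using linG unfolding bounded_op_def by blast
  have "quotient_factorization Q V R X ?H U ?G S"
    unfolding quotient_factorization_def
  proof (intro conjI ballI linG Sb)
    show "hilbert_space ?H" using W.completion_hilb by (simp add: hilb_iff)
    show "hilbert_space U" using U_hilb by (simp add: hilb_iff)
    fix f assume f: "f \<in> pts V"
    show "Q f = (nrm ?H (?G f))\<^sup>2 - (nrm U (S (R f)))\<^sup>2"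
    proof -
      have "Q f = p f - Re (ip U (M (projU f)) (projU f))" using qQ[OF f] pPF[OF f] by (simp add: PF_def)
      then show ?thesis by (simp only: Gn[OF f] Snorm[OF f])
    qed
  qed
  then show "\<exists>(H :: (nat \<Rightarrow> 'a) set cspace) G. bounded_op V H G \<and> (\<forall>f\<in>pts V. (nrm H (G f))\<^sup>2 = p f) \<and>
       quotient_factorization Q V R X H U G S"
    by (intro exI[of _ ?H] exI[of _ ?G] conjI ballI bG Gn)
  show "\<forall>f\<in>pts V. R f = zer Y \<longrightarrow> 0 \<le> Q f" using Q_nonneg_iff nn by blast
qed

text \<open>Boundedness of \<open>S\<close> on \<open>X\<close> is what controls \<open>G\<close> on
  \<open>U\<close>: the square of |G u| is Q u plus that of |S (R u)|, and \<open>R u\<close> has in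
  \<open>X\<close> the norm of u. Hence n -> q n u is bounded by |G u| in the seminorm of
  \<open>q\<close>, and the resulting operator Gamma is bounded too.\<close>

theorem converse:
  fixes H :: "'h cspace" and K :: "'k cspace"
  assumes qf: "quotient_factorization Q V R X H K G S"
  shows "nonneg_form N q" "\<exists>\<Gamma>. douglas_factor q N U \<Gamma>"
proof -
  have lG: "linear_op V H G" and bS: "bounded_op X K S" and hH: "hilb H" and hK: "hilb K"
    and QG: "\<And>f. f \<in> pts V \<Longrightarrow> Q f = (nrm H (G f))\<^sup>2 - (nrm K (S (R f)))\<^sup>2"
    using qf by (auto simp: quotient_factorization_def hilb_iff)
  interpret H: hilb H by fact
  interpret K: hilb K by fact
  note lS = bounded_op_linear[OF bS]
  have RX: "R f \<in> pts X" if f: "f \<in> pts V" for f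
  proof -
    have "R f = R (projU f)" by (rule R_pU[OF f])
    then show ?thesis using proj(2)[OF f] by (simp add: X_sel)
  qed
  have Gin: "G f \<in> pts H" and Sin: "S (R f) \<in> pts K" if "f \<in> pts V" for f
    using that linear_opD(1)[OF lG] linear_opD(1)[OF lS] RX by auto
  have Spls: "S (R (pls V f g)) = pls K (S (R f)) (S (R g))" if "f \<in> pts V" "g \<in> pts V" for f g
    using linear_opD(2)[OF lS RX RX] that by (simp add: R_pls X_sel)
  have Sscl: "S (R (scl V c f)) = scl K c (S (R f))" if "f \<in> pts V" for c f
    using linear_opD(3)[OF lS RX] that by (simp add: R_scl X_sel)
  define b where "b = (\<lambda>f g. ip H (G f) (G g) - ip K (S (R f)) (S (R g)))"
  have "hermitian_form V b" unfolding hermitian_form_def b_def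
  proof (intro conjI ballI allI)
    fix x y assume "x \<in> pts V" "y \<in> pts V"
    then show "ip H (G y) (G x) - ip K (S (R y)) (S (R x)) = cnj (ip H (G x) (G y) - ip K (S (R x)) (S (R y)))"
      using H.b_sym[OF Gin Gin, of x y] K.b_sym[OF Sin Sin, of x y] by simp
  qed (simp_all add: linear_opD[OF lG] Gin Sin Spls Sscl H.ip_simps K.ip_simps algebra_simps)
  then interpret b: hform V b by unfold_locales
  have qb': "q f g = b f g" if "f \<in> pts V" "g \<in> pts V" for f g
  proof (rule hform_eq_from_diag[OF q.hform_axioms b.hform_axioms _ that])
    fix x assume x: "x \<in> pts V"
    show "q x x = b x x" using qQ[OF x] QG[OF x] H.ip_self[OF Gin[OF x]] K.ip_self[OF Sin[OF x]] by (simp add: b_def)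
  qed
  have qN': "q n g = ip H (G n) (G g)" if n: "n \<in> pts N" and g: "g \<in> pts V" for n g
  proof -
    have "S (R n) = zer K"
      using linear_op_zer[OF lS X.cvspace_axioms K.cvspace_axioms] n by (simp add: N_sel X_sel)
    then show ?thesis using qb'[OF NV[OF n] g] Sin[OF g] by (simp add: b_def)
  qed
  show nn: "nonneg_form N q"
    unfolding nonneg_form_def using qN' NV Gin H.b_nn H.b_self_real by simp
  let ?P = "N\<lparr>ip := q\<rparr>" and ?HA = "H_A N q"
  interpret P: sip_space ?P by (rule HA_sip[OF nn])
  interpret HA: hilb ?HA unfolding H_A_def by (rule P.completion_hilb)
  obtain B where B: "0 \<le> B" "\<And>x. x \<in> pts X \<Longrightarrow> nrm K (S x) \<le> B * nrm X x"
    using bounded_op_nonneg[OF bS X.sip_space_axioms] by blast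
  have Gb: "nrm H (G u) \<le> sqrt (cq + B\<^sup>2) * nrm U u" if u: "u \<in> pts U" for u
  proof -
    have uV: "u \<in> pts V" by (rule UV[OF u])
    have "Re (q u u) \<le> cq * nrm V u * nrm V u" using qb[OF uV uV] complex_Re_le_cmod[of "q u u"] by linarith
    moreover have "(nrm K (S (R u)))\<^sup>2 \<le> (B * nrm V u)\<^sup>2"
      using B(2)[OF RX[OF uV]] Sin[OF uV] X_nrm[OF u] by (intro power_mono) auto
    moreover have "(nrm H (G u))\<^sup>2 = Re (q u u) + (nrm K (S (R u)))\<^sup>2" using QG[OF uV] qQ[OF uV] by simp
    ultimately have "(nrm H (G u))\<^sup>2 \<le> (sqrt (cq + B\<^sup>2) * nrm V u)\<^sup>2"
      using cq by (simp add: power_mult_distrib power2_eq_square algebra_simps)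
    then show ?thesis using uV cq unfolding U_sel(6) by (intro power2_le_imp_le[of "nrm H (G u)"]) auto
  qed
  have lb: "cmod (q n u) \<le> nrm H (G u) * nrm ?P n" if n: "n \<in> pts ?P" and u: "u \<in> pts U" for n u
  proof -
    have n': "n \<in> pts N" using n by simp
    have "nrm ?P n = nrm H (G n)" using qN'[OF n' NV[OF n']] by (simp add: nrm_def)
    then show ?thesis
      using H.cauchy_schwarz[OF Gin[OF NV[OF n']] Gin[OF UV[OF u]]] qN'[OF n' UV[OF u]] by (simp add: mult.commute)
  qed
  \<comment> \<open>The extension of n -> q n u to the completion, evaluated at Z. Linearity in Z is
    part of \<open>completion_extend\<close>; conjugate-linearity in u is obtained below by passing
    to the limit along the one representative of Z.\<close>
  define L where "L = (\<lambda>Z u. lim (\<lambda>k. q (repr Z k) u))"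
  have lp: "q (pls ?P x y) u = q x u + q y u" if "x \<in> pts ?P" "y \<in> pts ?P" "u \<in> pts U" for x y u
    using that NV UV by (simp add: N_sel(2) q.b_simps)
  have ls: "q (scl ?P c x) u = c * q x u" if "x \<in> pts ?P" "u \<in> pts U" for c x u
    using that NV UV by (simp add: N_sel(3) q.b_simps)
  have ext: "\<And>Z. Z \<in> pts ?HA \<Longrightarrow> (\<lambda>k. q (repr Z k) u) \<longlonglongrightarrow> L Z u"
    "\<And>Z Z'. Z \<in> pts ?HA \<Longrightarrow> Z' \<in> pts ?HA \<Longrightarrow> L (pls ?HA Z Z') u = L Z u + L Z' u"
    "\<And>c Z. Z \<in> pts ?HA \<Longrightarrow> L (scl ?HA c Z) u = c * L Z u"
    "\<And>Z. Z \<in> pts ?HA \<Longrightarrow> cmod (L Z u) \<le> nrm H (G u) * nrm ?HA Z"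
    "\<And>n. n \<in> pts N \<Longrightarrow> L (A_half N q n) u = q n u" if u: "u \<in> pts U" for u
    using P.completion_extend[of "\<lambda>n. q n u" "nrm H (G u)", OF lp[OF _ _ u] ls[OF _ u] lb[OF _ u]]
    unfolding H_A_def[symmetric] A_half_def[symmetric] L_def by simp_all
  have rin: "repr Z k \<in> pts V" if "Z \<in> pts ?HA" for Z k
    using P.cauchy_seqD(1)[OF P.into_dense(1)[of Z]] that NV by (simp add: H_A_def)
  have "\<exists>\<Gamma>. bounded_op U ?HA \<Gamma> \<and> (\<forall>Z\<in>pts ?HA. \<forall>u\<in>pts U. ip ?HA Z (\<Gamma> u) = L Z u)"
  proof (rule HA.riesz_op[where g="\<lambda>u. nrm H (G u)" and C="sqrt (cq + B\<^sup>2)"])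
    fix Z u v assume Z: "Z \<in> pts ?HA" and uv: "u \<in> pts U" "v \<in> pts U"
    have "(\<lambda>k. q (repr Z k) u + q (repr Z k) v) \<longlonglongrightarrow> L Z u + L Z v"
      using ext(1)[OF uv(1) Z] ext(1)[OF uv(2) Z] by (rule tendsto_add)
    moreover have "(\<lambda>k. q (repr Z k) (pls U u v)) \<longlonglongrightarrow> L Z (pls U u v)"
      using uv by (intro ext(1)[OF _ Z]) auto
    moreover have "(\<lambda>k. q (repr Z k) (pls U u v)) = (\<lambda>k. q (repr Z k) u + q (repr Z k) v)"
      using rin[OF Z] uv UV by (simp add: U_sel(2) q.b_simps)
    ultimately show "L Z (pls U u v) = L Z u + L Z v"
      by (metis LIMSEQ_unique)
  next
    fix c Z u assume Z: "Z \<in> pts ?HA" and u: "u \<in> pts U"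
    have "(\<lambda>k. cnj c * q (repr Z k) u) \<longlonglongrightarrow> cnj c * L Z u"
      using ext(1)[OF u Z] by (rule tendsto_mult_left)
    moreover have "(\<lambda>k. q (repr Z k) (scl U c u)) \<longlonglongrightarrow> L Z (scl U c u)"
      using u by (intro ext(1)[OF _ Z]) auto
    moreover have "(\<lambda>k. q (repr Z k) (scl U c u)) = (\<lambda>k. cnj c * q (repr Z k) u)"
      using rin[OF Z] u UV by (simp add: U_sel(3) q.b_simps)
    ultimately show "L Z (scl U c u) = cnj c * L Z u"
      by (metis LIMSEQ_unique)
  next
    fix Z u assume "Z \<in> pts ?HA" "u \<in> pts U"
    then show "cmod (L Z u) \<le> nrm ?HA Z * nrm H (G u)" using ext(4)[of u Z] by (simp add: mult.commute)
  next
    fix u assume "u \<in> pts U"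
    then show "0 \<le> nrm H (G u)" using Gin UV by simp
  qed (use ext(2,3) Gb U.cvspace_axioms in auto)
  then obtain \<Gamma> where \<Gamma>: "bounded_op U ?HA \<Gamma>" "\<And>Z u. Z \<in> pts ?HA \<Longrightarrow> u \<in> pts U \<Longrightarrow> ip ?HA Z (\<Gamma> u) = L Z u" by blast
  have "q n u = ip ?HA (A_half N q n) (\<Gamma> u)" if n: "n \<in> pts N" and u: "u \<in> pts U" for n u
    using \<Gamma>(2)[of "A_half N q n" u] P.into_in[of n] ext(5)[OF u n] n u by (simp add: H_A_def A_half_def)
  then show "\<exists>\<Gamma>. douglas_factor q N U \<Gamma>" using \<Gamma>(1) unfolding douglas_factor_def by blast
qed

theorem equivalence:
  "(\<exists>(H :: (nat \<Rightarrow> 'a) set cspace) G S. quotient_factorization Q V R X H U G S) \<longleftrightarrow>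
     (\<forall>f\<in>pts V. R f = zer Y \<longrightarrow> 0 \<le> Q f) \<and> (\<exists>\<Gamma>. douglas_factor q N U \<Gamma>)"
proof
  assume "\<exists>(H :: (nat \<Rightarrow> 'a) set cspace) G S. quotient_factorization Q V R X H U G S"
  then obtain H :: "(nat \<Rightarrow> 'a) set cspace" and G S where "quotient_factorization Q V R X H U G S"
    by (elim exE)
  from converse[OF this] show "(\<forall>f\<in>pts V. R f = zer Y \<longrightarrow> 0 \<le> Q f) \<and> (\<exists>\<Gamma>. douglas_factor q N U \<Gamma>)"
    unfolding Q_nonneg_iff by (rule conjI)
next
  assume "(\<forall>f\<in>pts V. R f = zer Y \<longrightarrow> 0 \<le> Q f) \<and> (\<exists>\<Gamma>. douglas_factor q N U \<Gamma>)"
  then obtain \<Gamma> where "nonneg_form N q" "douglas_factor q N U \<Gamma>" unfolding Q_nonneg_iff by (elim conjE exE)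
  from factorization(4)[OF this]
  show "\<exists>(H :: (nat \<Rightarrow> 'a) set cspace) G S. quotient_factorization Q V R X H U G S" by (elim exE conjE) (intro exI)
qed

end

section \<open>Completeness of $L^2$\<close>

text \<open>Cutting off to \<open>S\<close> makes integrals over \<open>S\<close> integrals over the
  line and isolates the only part of a representative that its class in \<open>L2 S\<close>
  sees.\<close>

definition restr :: "real set \<Rightarrow> (real \<Rightarrow> complex) \<Rightarrow> real \<Rightarrow> complex" where
  "restr S f = (\<lambda>x. indicator S x *\<^sub>R f x)"

lemma restr_simps [simp]:
  "restr S (\<lambda>x. f x + g x) = (\<lambda>x. restr S f x + restr S g x)"
  "restr S (\<lambda>x. c * f x) = (\<lambda>x. c * restr S f x)"
  "restr S (\<lambda>x. f x - g x) = (\<lambda>x. restr S f x - restr S g x)"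
  "restr S (\<lambda>_. 0) = (\<lambda>_. 0)"
  by (auto simp: restr_def fun_eq_iff indicator_def)

lemma L2fun_sel [simp]:
  "zer (L2fun S) = (\<lambda>_. 0)" "pls (L2fun S) = (\<lambda>f g x. f x + g x)" "scl (L2fun S) = (\<lambda>c f x. c * f x)"
  "dif (L2fun S) = (\<lambda>f g x. f x - g x)"
  by (auto simp: L2fun_def dif_def fun_eq_iff)

lemma L2fun_pts: "f \<in> pts (L2fun S) \<longleftrightarrow> restr S f \<in> borel_measurable borel \<and> integrable lborel (\<lambda>x. (cmod (restr S f x))\<^sup>2)"
proof -
  have "(\<lambda>x. indicator S x *\<^sub>R (cmod (f x))\<^sup>2) = (\<lambda>x. (cmod (restr S f x))\<^sup>2)"
    by (auto simp: restr_def fun_eq_iff indicator_def)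
  then show ?thesis by (simp add: L2fun_def set_borel_measurable_def set_integrable_def restr_def)
qed

lemma L2fun_ip: "ip (L2fun S) f g = (LINT x|lborel. restr S f x * cnj (restr S g x))"
  unfolding L2fun_def set_lebesgue_integral_def
  by (auto simp: restr_def fun_eq_iff indicator_def intro!: Bochner_Integration.integral_cong)

lemma L2fun_measurable: "f \<in> pts (L2fun S) \<Longrightarrow> restr S f \<in> borel_measurable borel"
  by (simp add: L2fun_pts)

lemma L2_prod_integrable:
  fixes F G :: "real \<Rightarrow> complex"
  assumes [measurable]: "F \<in> borel_measurable borel" "G \<in> borel_measurable borel"
    and F: "integrable lborel (\<lambda>x. (cmod (F x))\<^sup>2)" and G: "integrable lborel (\<lambda>x. (cmod (G x))\<^sup>2)"
  shows "integrable lborel (\<lambda>x. F x * G x)"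
proof (rule Bochner_Integration.integrable_bound[OF Bochner_Integration.integrable_add[OF F G]])
  show "AE x in lborel. norm (F x * G x) \<le> norm ((cmod (F x))\<^sup>2 + (cmod (G x))\<^sup>2)"
  proof (rule AE_I2)
    fix x
    have "0 \<le> (cmod (F x) - cmod (G x))\<^sup>2" "0 \<le> cmod (F x) * cmod (G x)" by auto
    then show "norm (F x * G x) \<le> norm ((cmod (F x))\<^sup>2 + (cmod (G x))\<^sup>2)"
      unfolding norm_mult power2_diff real_norm_def by linarith
  qed
qed simp

lemma measurable_cnj [measurable]: "cnj \<in> borel_measurable borel"
  by (intro borel_measurable_continuous_onI continuous_intros)

lemma L2fun_prod_integrable:
  "f \<in> pts (L2fun S) \<Longrightarrow> g \<in> pts (L2fun S) \<Longrightarrow> integrable lborel (\<lambda>x. restr S f x * cnj (restr S g x))"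
  by (rule L2_prod_integrable) (auto simp: L2fun_pts)

lemma L2fun_pls_in:
  assumes "f \<in> pts (L2fun S)" "g \<in> pts (L2fun S)" shows "(\<lambda>x. f x + g x) \<in> pts (L2fun S)"
proof -
  have m [measurable]: "restr S f \<in> borel_measurable borel" "restr S g \<in> borel_measurable borel"
    using assms by (auto simp: L2fun_pts)
  have i: "integrable lborel (\<lambda>x. 2 * (cmod (restr S f x))\<^sup>2 + 2 * (cmod (restr S g x))\<^sup>2)"
    using assms by (auto simp: L2fun_pts)
  have "integrable lborel (\<lambda>x. (cmod (restr S f x + restr S g x))\<^sup>2)"
  proof (rule Bochner_Integration.integrable_bound[OF i])
    show "AE x in lborel. norm ((cmod (restr S f x + restr S g x))\<^sup>2) \<le> norm (2 * (cmod (restr S f x))\<^sup>2 + 2 * (cmod (restr S g x))\<^sup>2)"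
    proof (rule AE_I2)
      fix x
      have "(cmod (restr S f x + restr S g x))\<^sup>2 \<le> (cmod (restr S f x) + cmod (restr S g x))\<^sup>2"
        by (intro power_mono norm_triangle_ineq) auto
      also have "\<dots> \<le> 2 * (cmod (restr S f x))\<^sup>2 + 2 * (cmod (restr S g x))\<^sup>2"
        using zero_le_power2[of "cmod (restr S f x) - cmod (restr S g x)"] by (simp add: power2_sum power2_diff)
      finally show "norm ((cmod (restr S f x + restr S g x))\<^sup>2) \<le> norm (2 * (cmod (restr S f x))\<^sup>2 + 2 * (cmod (restr S g x))\<^sup>2)"
        by simp
    qed
  qed simp
  then show ?thesis by (simp add: L2fun_pts)
qed

lemma L2fun_scl_in: "f \<in> pts (L2fun S) \<Longrightarrow> (\<lambda>x. c * f x) \<in> pts (L2fun S)"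
  by (auto simp: L2fun_pts norm_mult power_mult_distrib)

lemma L2fun_ip_self: "ip (L2fun S) f f = of_real (LINT x|lborel. (cmod (restr S f x))\<^sup>2)"
  unfolding L2fun_ip integral_complex_of_real[symmetric]
  by (intro Bochner_Integration.integral_cong refl) (simp only: complex_norm_square)

lemma L2fun_sip: "sip_space (L2fun S)"
proof -
  interpret cvspace "L2fun S"
    unfolding cvspace_def vector_space_on_def
    by (auto simp: L2fun_pls_in L2fun_scl_in algebra_simps) (simp add: L2fun_pts)
  show ?thesis
  proof unfold_locales
    show "hermitian_form (L2fun S) (ip (L2fun S))"
      unfolding hermitian_form_def L2fun_ip
    proof (intro conjI ballI allI)
      fix x y z assume "x \<in> pts (L2fun S)" "y \<in> pts (L2fun S)" "z \<in> pts (L2fun S)"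
      then show "(LINT t|lborel. restr S (pls (L2fun S) x y) t * cnj (restr S z t)) =
        (LINT t|lborel. restr S x t * cnj (restr S z t)) + (LINT t|lborel. restr S y t * cnj (restr S z t))"
        using L2fun_prod_integrable[of x S z] L2fun_prod_integrable[of y S z] by (simp add: distrib_right)
    next
      fix c x y assume "x \<in> pts (L2fun S)" "y \<in> pts (L2fun S)"
      show "(LINT t|lborel. restr S (scl (L2fun S) c x) t * cnj (restr S y t)) =
        c * (LINT t|lborel. restr S x t * cnj (restr S y t))"
        by (simp add: mult.assoc)
      show "(LINT t|lborel. restr S y t * cnj (restr S x t)) = cnj (LINT t|lborel. restr S x t * cnj (restr S y t))"
        by (simp add: mult.commute flip: Bochner_Integration.integral_cnj)
    qed
    show "nonneg_form (L2fun S) (ip (L2fun S))" by (simp add: nonneg_form_def L2fun_ip_self)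
  qed
qed

interpretation L2fun: sip_space "L2fun S" for S by (rule L2fun_sip)

lemma L2fun_nrm_sq: "(nrm (L2fun S) f)\<^sup>2 = (LINT x|lborel. (cmod (restr S f x))\<^sup>2)"
  by (simp add: nrm_def L2fun_ip_self)

lemma L2fun_null_iff:
  assumes "f \<in> pts (L2fun S)"
  shows "nrm (L2fun S) f = 0 \<longleftrightarrow> (AE x in lborel. restr S f x = 0)"
proof -
  have "nrm (L2fun S) f = 0 \<longleftrightarrow> (LINT x|lborel. (cmod (restr S f x))\<^sup>2) = 0"
    unfolding L2fun_nrm_sq[symmetric] by simp
  also have "\<dots> \<longleftrightarrow> (AE x in lborel. (cmod (restr S f x))\<^sup>2 = 0)"
    using assms by (intro integral_nonneg_eq_0_iff_AE) (auto simp: L2fun_pts)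
  finally show ?thesis by simp
qed

locale fin_set =
  fixes S :: "real set"
  assumes S_borel [measurable]: "S \<in> sets borel" and S_fin: "emeasure lborel S < \<infinity>"
begin

lemma bounded_in_L2:
  assumes m: "restr S f \<in> borel_measurable borel" and b: "\<And>x. x \<in> S \<Longrightarrow> cmod (f x) \<le> B"
  shows "f \<in> pts (L2fun S)"
proof -
  have "integrable lborel (\<lambda>x. indicator S x *\<^sub>R (B\<^sup>2))"
    using S_fin by (auto intro!: integrable_real_indicator)
  then have "integrable lborel (\<lambda>x. (cmod (restr S f x))\<^sup>2)"
  proof (rule Bochner_Integration.integrable_bound)
    show "(\<lambda>x. (cmod (restr S f x))\<^sup>2) \<in> borel_measurable lborel" using m by simp
    show "AE x in lborel. norm ((cmod (restr S f x))\<^sup>2) \<le> norm (indicator S x *\<^sub>R B\<^sup>2)"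
      using b by (auto simp: restr_def indicator_def power_mono intro!: AE_I2)
  qed
  then show ?thesis using m by (simp add: L2fun_pts)
qed

text \<open>Cauchy-Schwarz against the constant 1. It converts the Cauchy property in L2 into the
  one in L1, from which an almost everywhere convergent subsequence is drawn.\<close>

lemma L1_le_L2:
  assumes f: "f \<in> pts (L2fun S)"
  shows "integrable lborel (\<lambda>x. restr S f x)"
    "(LINT x|lborel. cmod (restr S f x)) \<le> sqrt (measure lborel S) * nrm (L2fun S) f"
proof -
  have m [measurable]: "restr S f \<in> borel_measurable borel" using f by (simp add: L2fun_pts)
  have one: "(\<lambda>_. 1) \<in> pts (L2fun S)" by (rule bounded_in_L2[where B=1]) (auto simp: restr_def)
  have a: "(\<lambda>x. of_real (cmod (f x))) \<in> pts (L2fun S)"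
  proof -
    have "restr S (\<lambda>x. of_real (cmod (f x))) = (\<lambda>x. of_real (cmod (restr S f x)))"
      by (auto simp: restr_def fun_eq_iff indicator_def)
    then show ?thesis using f by (simp add: L2fun_pts)
  qed
  have e: "restr S (\<lambda>x. of_real (cmod (f x))) x * cnj (restr S (\<lambda>_. 1) x) = of_real (cmod (restr S f x))" for x
    by (simp add: restr_def indicator_def)
  have i: "integrable lborel (\<lambda>x. complex_of_real (cmod (restr S f x)))"
    using L2fun_prod_integrable[OF a one] unfolding e .
  then have "integrable lborel (\<lambda>x. cmod (restr S f x))" by (simp only: complex_of_real_integrable_eq)
  then show "integrable lborel (\<lambda>x. restr S f x)" by (subst integrable_norm_iff[symmetric]) auto
  have n1: "(nrm (L2fun S) (\<lambda>_. 1))\<^sup>2 = measure lborel S"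
  proof -
    have "(cmod (restr S (\<lambda>_. 1) x))\<^sup>2 = indicator S x" for x by (simp add: restr_def indicator_def)
    then show ?thesis unfolding L2fun_nrm_sq by simp
  qed
  have na: "nrm (L2fun S) (\<lambda>x. of_real (cmod (f x))) = nrm (L2fun S) f"
  proof -
    have "(nrm (L2fun S) (\<lambda>x. of_real (cmod (f x))))\<^sup>2 = (nrm (L2fun S) f)\<^sup>2"
      unfolding L2fun_nrm_sq by (intro Bochner_Integration.integral_cong) (auto simp: restr_def)
    then show ?thesis using a f by (simp add: power2_eq_iff_nonneg)
  qed
  have "complex_of_real (LINT x|lborel. cmod (restr S f x)) = ip (L2fun S) (\<lambda>x. of_real (cmod (f x))) (\<lambda>_. 1)"
    unfolding L2fun_ip e by simp
  then have "(LINT x|lborel. cmod (restr S f x)) \<le> cmod (ip (L2fun S) (\<lambda>x. of_real (cmod (f x))) (\<lambda>_. 1))"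
    by (metis abs_ge_self norm_of_real)
  also have "\<dots> \<le> nrm (L2fun S) f * nrm (L2fun S) (\<lambda>_. 1)"
    using L2fun.cauchy_schwarz[OF a one] by (simp add: na)
  also have "nrm (L2fun S) (\<lambda>_. 1) = sqrt (measure lborel S)"
    using n1 L2fun.nrm_nonneg[OF one] by (metis real_sqrt_abs abs_of_nonneg)
  finally show "(LINT x|lborel. cmod (restr S f x)) \<le> sqrt (measure lborel S) * nrm (L2fun S) f"
    by (simp add: mult.commute)
qed

text \<open>An almost everywhere limit of a subsequence is the limit in norm by Fatou's lemma.\<close>

theorem L2fun_complete:
  assumes f: "cauchy_seq (L2fun S) f"
  shows "\<exists>l\<in>pts (L2fun S). tends (L2fun S) f l"
proof -
  note fin = L2fun.cauchy_seqD(1)[OF f]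
  have m [measurable]: "restr S (f k) \<in> borel_measurable borel" for k using fin by (simp add: L2fun_pts)
  have dm: "(\<lambda>x. f i x - f j x) \<in> pts (L2fun S)" for i j using L2fun.dif_in[OF fin fin, of i j] by simp
  have L1: "\<exists>N. \<forall>i\<ge>N. \<forall>j\<ge>N. LINT x|lborel. norm (restr S (f i) x - restr S (f j) x) < e" if e: "e > 0" for e :: real
  proof -
    define d where "d = e / (sqrt (measure lborel S) + 1)"
    have d: "d > 0" using e by (auto simp: d_def intro!: divide_pos_pos add_nonneg_pos)
    obtain K where K: "\<forall>i\<ge>K. \<forall>j\<ge>K. nrm (L2fun S) (dif (L2fun S) (f i) (f j)) < d"
      using L2fun.cauchy_seqD(2)[OF f d] by blast
    have "LINT x|lborel. norm (restr S (f i) x - restr S (f j) x) < e" if "i \<ge> K" "j \<ge> K" for i j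
    proof -
      have "LINT x|lborel. norm (restr S (f i) x - restr S (f j) x) \<le> sqrt (measure lborel S) * nrm (L2fun S) (dif (L2fun S) (f i) (f j))"
        using L1_le_L2(2)[OF dm, of i j] by simp
      also have "\<dots> \<le> sqrt (measure lborel S) * d" using K that by (intro mult_left_mono) (auto intro: less_imp_le)
      also have "\<dots> < (sqrt (measure lborel S) + 1) * d" using d by (simp add: algebra_simps)
      also have "\<dots> = e" by (simp add: d_def add_nonneg_eq_0_iff)
      finally show ?thesis .
    qed
    then show ?thesis by blast
  qed
  obtain r where r: "strict_mono r" "AE x in lborel. Cauchy (\<lambda>i. restr S (f (r i)) x)"
    using cauchy_L1_AE_cauchy_subseq[of lborel "\<lambda>k. restr S (f k)", OF L1_le_L2(1)[OF fin] L1] by blast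
  define l where "l = (\<lambda>x. lim (\<lambda>i. restr S (f (r i)) x))"
  have ml [measurable]: "l \<in> borel_measurable borel" unfolding l_def by measurable
  have lim: "AE x in lborel. (\<lambda>i. restr S (f (r i)) x) \<longlonglongrightarrow> l x"
    using r(2) by eventually_elim (simp add: l_def convergent_LIMSEQ_iff[symmetric] Cauchy_convergent_iff)
  \<comment> \<open>Off \<open>S\<close> all terms are 0, so the pointwise limit vanishes there by
    itself.\<close>
  have rl: "restr S l = l"
    by (auto simp: fun_eq_iff restr_def l_def indicator_def)
  \<comment> \<open>Stated for the nonnegative integral, as the integrability of the limit is only
    deduced from it.\<close>
  have bound: "(\<integral>\<^sup>+x. ennreal ((cmod (restr S (f k) x - l x))\<^sup>2) \<partial>lborel) \<le> ennreal (\<epsilon>\<^sup>2)"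
    if K: "\<forall>i\<ge>K. \<forall>j\<ge>K. nrm (L2fun S) (dif (L2fun S) (f i) (f j)) < \<epsilon>" and "k \<ge> K" for K k and \<epsilon> :: real
  proof -
    have "(\<integral>\<^sup>+x. ennreal ((cmod (restr S (f k) x - l x))\<^sup>2) \<partial>lborel)
        = (\<integral>\<^sup>+x. liminf (\<lambda>i. ennreal ((cmod (restr S (f k) x - restr S (f (r i)) x))\<^sup>2)) \<partial>lborel)"
    proof (rule nn_integral_cong_AE)
      show "AE x in lborel. ennreal ((cmod (restr S (f k) x - l x))\<^sup>2) =
          liminf (\<lambda>i. ennreal ((cmod (restr S (f k) x - restr S (f (r i)) x))\<^sup>2))"
        using lim
      proof eventually_elim
        case (elim x)
        then have "(\<lambda>i. ennreal ((cmod (restr S (f k) x - restr S (f (r i)) x))\<^sup>2)) \<longlonglongrightarrow> ennreal ((cmod (restr S (f k) x - l x))\<^sup>2)"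
          by (intro tendsto_intros tendsto_ennrealI)
        then show ?case by (intro lim_imp_Liminf[symmetric]) auto
      qed
    qed
    also have "\<dots> \<le> liminf (\<lambda>i. \<integral>\<^sup>+x. ennreal ((cmod (restr S (f k) x - restr S (f (r i)) x))\<^sup>2) \<partial>lborel)"
      by (rule nn_integral_liminf) measurable
    also have "\<dots> \<le> ennreal (\<epsilon>\<^sup>2)"
    proof -
      have "(\<integral>\<^sup>+x. ennreal ((cmod (restr S (f k) x - restr S (f (r i)) x))\<^sup>2) \<partial>lborel) \<le> ennreal (\<epsilon>\<^sup>2)" if "i \<ge> K" for i
      proof -
        have "r i \<ge> K" using seq_suble[OF r(1), of i] that by linarith
        then have "nrm (L2fun S) (\<lambda>x. f k x - f (r i) x) \<le> \<epsilon>" using K \<open>k \<ge> K\<close> by (auto intro: less_imp_le)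
        then have "(nrm (L2fun S) (\<lambda>x. f k x - f (r i) x))\<^sup>2 \<le> \<epsilon>\<^sup>2" using dm by (intro power_mono) auto
        then have "(LINT x|lborel. (cmod (restr S (f k) x - restr S (f (r i)) x))\<^sup>2) \<le> \<epsilon>\<^sup>2"
          by (simp add: L2fun_nrm_sq)
        moreover have "integrable lborel (\<lambda>x. (cmod (restr S (f k) x - restr S (f (r i)) x))\<^sup>2)"
          using dm[of k "r i"] by (simp add: L2fun_pts)
        ultimately show ?thesis by (subst nn_integral_eq_integral) (auto intro!: ennreal_leI)
      qed
      then show ?thesis by (intro Liminf_le) (auto simp: eventually_sequentially)
    qed
    finally show ?thesis .
  qed
  have din: "(\<lambda>x. f k x - l x) \<in> pts (L2fun S)" and dn: "nrm (L2fun S) (\<lambda>x. f k x - l x) \<le> \<epsilon>"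
    if K: "\<forall>i\<ge>K. \<forall>j\<ge>K. nrm (L2fun S) (dif (L2fun S) (f i) (f j)) < \<epsilon>" and "k \<ge> K" and e: "\<epsilon> > 0" for K k and \<epsilon> :: real
  proof -
    have i: "integrable lborel (\<lambda>x. (cmod (restr S (f k) x - l x))\<^sup>2)"
      by (rule integrableI_bounded) (use bound[OF K \<open>k \<ge> K\<close>] in \<open>auto simp: ennreal_power[symmetric] intro: order_le_less_trans\<close>)
    then show 1: "(\<lambda>x. f k x - l x) \<in> pts (L2fun S)" by (simp add: L2fun_pts rl)
    have "ennreal (LINT x|lborel. (cmod (restr S (f k) x - l x))\<^sup>2) \<le> ennreal (\<epsilon>\<^sup>2)"
      using bound[OF K \<open>k \<ge> K\<close>] nn_integral_eq_integral[OF i] by simp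
    then have "(nrm (L2fun S) (\<lambda>x. f k x - l x))\<^sup>2 \<le> \<epsilon>\<^sup>2" by (simp add: L2fun_nrm_sq rl)
    then show "nrm (L2fun S) (\<lambda>x. f k x - l x) \<le> \<epsilon>" using 1 e by (simp add: power2_le_iff_abs_le)
  qed
  \<comment> \<open>l = f K - (f K - l), and both terms are already known to lie in the
    space.\<close>
  have lin: "l \<in> pts (L2fun S)"
  proof -
    obtain K where K: "\<forall>i\<ge>K. \<forall>j\<ge>K. nrm (L2fun S) (dif (L2fun S) (f i) (f j)) < 1"
      using L2fun.cauchy_seqD(2)[OF f, of 1] by auto
    have "dif (L2fun S) (f K) (\<lambda>x. f K x - l x) \<in> pts (L2fun S)"
      using din[OF K order_refl] fin by (intro L2fun.dif_in) auto
    then show ?thesis by simp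
  qed
  have "tends (L2fun S) f l"
    unfolding tends_def
  proof (rule LIMSEQ_I)
    fix e :: real assume e: "0 < e"
    obtain K where K: "\<forall>i\<ge>K. \<forall>j\<ge>K. nrm (L2fun S) (dif (L2fun S) (f i) (f j)) < e/2"
      using L2fun.cauchy_seqD(2)[OF f, of "e/2"] e by auto
    have "norm (nrm (L2fun S) (dif (L2fun S) (f k) l) - 0) < e" if "k \<ge> K" for k
      using dn[OF K that] L2fun.nrm_nonneg[OF din[OF K that]] e by simp
    then show "\<exists>no. \<forall>n\<ge>no. norm (nrm (L2fun S) (dif (L2fun S) (f n) l) - 0) < e" by blast
  qed
  then show ?thesis using lin by blast
qed

lemma L2_hilb: "hilb (L2 S)"
  unfolding L2_def by (rule L2fun.quot_hilb[OF L2fun_complete])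

end

lemma fin_set_interval: "fin_set {a<..<b::real}"
  by unfold_locales (auto intro!: emeasure_bounded_finite[simplified])

lemma L2_repr: "f \<in> pts (L2 S) \<Longrightarrow> repr f \<in> pts (L2fun S) \<and> cls (L2fun S) (repr f) = f"
  unfolding L2_def by (rule L2fun.quot_repr)

lemma L2_ip_cls: "f \<in> pts (L2 S) \<Longrightarrow> h \<in> pts (L2fun S) \<Longrightarrow> ip (L2 S) f (cls (L2fun S) h) = ip (L2fun S) (repr f) h"
  using L2fun.quot_ip[of "repr f" S h] L2_repr[of f S] by (simp add: L2_def)

lemma L2_repr_pls:
  assumes "f \<in> pts (L2 S)" "g \<in> pts (L2 S)"
  shows "AE x in lborel. restr S (repr (pls (L2 S) f g)) x = restr S (repr f) x + restr S (repr g) x"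
proof -
  note r = L2_repr[OF assms(1)] L2_repr[OF assms(2)]
  have i: "(\<lambda>x. repr f x + repr g x) \<in> pts (L2fun S)" using r by (auto intro: L2fun_pls_in)
  have "pls (L2 S) f g = cls (L2fun S) (\<lambda>x. repr f x + repr g x)"
    using L2fun.quot_pls[of "repr f" S "repr g"] r by (simp add: L2_def)
  then have "nrm (L2fun S) (dif (L2fun S) (repr (pls (L2 S) f g)) (\<lambda>x. repr f x + repr g x)) = 0"
    and "repr (pls (L2 S) f g) \<in> pts (L2fun S)"
    using L2fun.repr_cls(1,2)[OF i] by simp_all
  then show ?thesis using L2fun_null_iff[OF L2fun.dif_in[OF _ i]] by simp
qed

lemma L2_repr_scl:
  assumes "f \<in> pts (L2 S)"
  shows "AE x in lborel. restr S (repr (scl (L2 S) c f)) x = c * restr S (repr f) x"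
proof -
  note r = L2_repr[OF assms(1)]
  have i: "(\<lambda>x. c * repr f x) \<in> pts (L2fun S)" using r by (auto intro: L2fun_scl_in)
  have "scl (L2 S) c f = cls (L2fun S) (\<lambda>x. c * repr f x)"
    using L2fun.quot_scl[of "repr f" S c] r by (simp add: L2_def)
  then have "nrm (L2fun S) (dif (L2fun S) (repr (scl (L2 S) c f)) (\<lambda>x. c * repr f x)) = 0"
    and "repr (scl (L2 S) c f) \<in> pts (L2fun S)"
    using L2fun.repr_cls(1,2)[OF i] by simp_all
  then show ?thesis using L2fun_null_iff[OF L2fun.dif_in[OF _ i]] by simp
qed

section \<open>Test functions and $H^8$\<close>

text \<open>The derivatives of order 0 to n are differentiable, that is, n + 1 differentiations are
  possible. Peeling off the first derivative, rather than the last, lets the product rule be used in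
  an induction.\<close>

primrec diffn :: "nat \<Rightarrow> (real \<Rightarrow> real) \<Rightarrow> bool" where
  "diffn 0 f = (\<forall>x. f differentiable (at x))"
| "diffn (Suc n) f = ((\<forall>x. f differentiable (at x)) \<and> diffn n (deriv f))"

lemma diffn_differentiable: "diffn n f \<Longrightarrow> f differentiable (at x)"
  by (cases n) auto

lemma diffn_Suc_imp: "diffn (Suc n) f \<Longrightarrow> diffn n f"
  by (induction n arbitrary: f) auto

lemma diffn_higher: "diffn n f \<Longrightarrow> k \<le> n \<Longrightarrow> (deriv ^^ k) f differentiable (at x)"
proof (induction n arbitrary: f k)
  case (Suc n)
  then show ?case by (cases k) (auto simp: funpow_Suc_right simp del: funpow.simps)
qed auto

lemma diffn_deriv: "diffn n f \<Longrightarrow> (f has_real_derivative deriv f x) (at x)"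
  using diffn_differentiable DERIV_deriv_iff_real_differentiable by blast

lemma diffn_const: "diffn n (\<lambda>_. c)"
  by (induction n arbitrary: c) (auto simp: fun_eq_iff)

lemma diffn_add: "diffn n f \<Longrightarrow> diffn n g \<Longrightarrow> diffn n (\<lambda>x. f x + g x)"
proof (induction n arbitrary: f g)
  case (Suc n)
  have "deriv (\<lambda>x. f x + g x) = (\<lambda>x. deriv f x + deriv g x)"
    using diffn_deriv[OF Suc.prems(1)] diffn_deriv[OF Suc.prems(2)]
    by (intro ext DERIV_imp_deriv derivative_intros) auto
  then show ?case using Suc by auto
qed auto

lemma diffn_mult: "diffn n f \<Longrightarrow> diffn n g \<Longrightarrow> diffn n (\<lambda>x. f x * g x)"
proof (induction n arbitrary: f g)
  case (Suc n)
  have "deriv (\<lambda>x. f x * g x) = (\<lambda>x. deriv f x * g x + f x * deriv g x)"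
  proof (intro ext DERIV_imp_deriv)
    fix x show "((\<lambda>x. f x * g x) has_real_derivative deriv f x * g x + f x * deriv g x) (at x)"
      using DERIV_mult[OF diffn_deriv[OF Suc.prems(1), of x] diffn_deriv[OF Suc.prems(2), of x]]
      by (simp add: mult.commute add.commute)
  qed
  then show ?case using Suc diffn_Suc_imp[OF Suc.prems(1)] diffn_Suc_imp[OF Suc.prems(2)] by (auto intro: diffn_add)
qed auto

lemma diffn_affine: "diffn n f \<Longrightarrow> diffn n (\<lambda>x. f (a * x + b))"
proof (induction n arbitrary: f)
  case 0
  show ?case unfolding diffn.simps
  proof
    fix x
    have "((\<lambda>x. f (a * x + b)) has_real_derivative deriv f (a * x + b) * a) (at x)"
      by (rule DERIV_chain2[OF diffn_deriv[OF 0]]) (auto intro!: derivative_eq_intros)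
    then show "(\<lambda>x. f (a * x + b)) differentiable (at x)" by (rule differentiableI[unfolded has_field_derivative_def real_differentiable_def] | auto simp: real_differentiable_def)+
  qed
next
  case (Suc n)
  have d: "((\<lambda>x. f (a * x + b)) has_real_derivative a * deriv f (a * x + b)) (at x)" for x
    by (subst mult.commute, rule DERIV_chain2[OF diffn_deriv[OF Suc.prems]]) (auto intro!: derivative_eq_intros)
  then have "deriv (\<lambda>x. f (a * x + b)) = (\<lambda>x. a * deriv f (a * x + b))" by (intro ext DERIV_imp_deriv)
  moreover have "diffn n (\<lambda>x. a * deriv f (a * x + b))" using Suc by (intro diffn_mult diffn_const) auto
  ultimately show ?case using d by (auto simp: real_differentiable_def)
qed

text \<open>Functions \<open>p (1/x) e\<^sup>-\<^sup>1\<^sup>/\<^sup>x\<close>, extended by zero, are closed under differentiation.\<close>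

definition flat :: "real poly \<Rightarrow> real \<Rightarrow> real" where
  "flat p x = (if x > 0 then poly p (1 / x) * exp (- (1 / x)) else 0)"

lemma poly_exp_tendsto: "((\<lambda>t. poly p t * exp (- t)) \<longlongrightarrow> (0::real)) at_top"
proof (induction p)
  case 0 then show ?case by simp
next
  case (pCons a p)
  have "((\<lambda>t. t * (poly p t * exp (- t))) \<longlongrightarrow> (0::real)) at_top" for p
  proof -
    have "((\<lambda>t. \<Sum>i\<le>degree p. coeff p i * (t ^ Suc i / exp t)) \<longlongrightarrow> (\<Sum>i\<le>degree p. coeff p i * 0)) at_top"
      by (intro tendsto_intros tendsto_power_div_exp_0)
    then show ?thesis by (simp add: poly_altdef exp_minus divide_inverse sum_distrib_left sum_distrib_right mult_ac)
  qed
  moreover have "((\<lambda>t. a * (t ^ 0 / exp t)) \<longlongrightarrow> a * 0) at_top" by (intro tendsto_intros tendsto_power_div_exp_0)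
  ultimately have "((\<lambda>t. a * (t ^ 0 / exp t) + t * (poly p t * exp (- t))) \<longlongrightarrow> a * 0 + 0) at_top"
    by (intro tendsto_add)
  then show ?case by (simp add: algebra_simps exp_minus divide_inverse)
qed

text \<open>With t = 1/x the derivative of p(t) exp(-t) is t^2 (p - p')(t) exp(-t), again of the
  same kind. Only the origin needs a limit.\<close>

lemma flat_deriv: "(flat p has_real_derivative flat (monom 1 2 * (p - pderiv p)) x) (at x)"
proof (cases x "0::real" rule: linorder_cases)
  case less
  have "((\<lambda>_. 0) has_real_derivative 0) (at x)" by simp
  then show ?thesis
    by (rule has_field_derivative_transform_within_open[of _ _ _ "{..<0}", THEN DERIV_cong])
       (use less in \<open>auto simp: flat_def\<close>)
next
  case greater
  have "((\<lambda>x. poly p (1 / x) * exp (- (1 / x))) has_real_derivative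
      poly (pderiv p) (1 / x) * (- (1 / x\<^sup>2)) * exp (- (1 / x)) + poly p (1 / x) * (exp (- (1 / x)) * (1 / x\<^sup>2))) (at x)"
    using greater by (auto intro!: derivative_eq_intros DERIV_chain2[OF poly_DERIV] simp: power2_eq_square divide_simps)
  then have "(flat p has_real_derivative
      poly (pderiv p) (1 / x) * (- (1 / x\<^sup>2)) * exp (- (1 / x)) + poly p (1 / x) * (exp (- (1 / x)) * (1 / x\<^sup>2))) (at x)"
    by (rule has_field_derivative_transform_within_open[of _ _ _ "{0<..}"]) (use greater in \<open>auto simp: flat_def\<close>)
  moreover have "poly (pderiv p) (1 / x) * (- (1 / x\<^sup>2)) * exp (- (1 / x)) + poly p (1 / x) * (exp (- (1 / x)) * (1 / x\<^sup>2))
      = flat (monom 1 2 * (p - pderiv p)) x"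
    using greater by (simp add: flat_def poly_monom power_divide algebra_simps)
  ultimately show ?thesis by simp
next
  case equal
  \<comment> \<open>Substituting t = 1/h, the right difference quotient is t p(t) exp(-t), a
    polynomial against a decaying exponential.\<close>
  have "((\<lambda>h. flat p h / h) \<longlongrightarrow> 0) (at_right 0)"
  proof (rule Lim_transform_eventually)
    have "((\<lambda>t. poly (pCons 0 p) t * exp (- t)) \<longlongrightarrow> (0::real)) at_top" by (rule poly_exp_tendsto)
    then show "((\<lambda>h. poly (pCons 0 p) (inverse h) * exp (- (inverse h))) \<longlongrightarrow> (0::real)) (at_right 0)"
      by (rule filterlim_compose) (rule filterlim_inverse_at_top_right)
    show "\<forall>\<^sub>F h in at_right 0. poly (pCons 0 p) (inverse h) * exp (- (inverse h)) = flat p h / h"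
      using eventually_at_right_less[of "0::real"] by eventually_elim (simp add: flat_def divide_simps)
  qed
  moreover have "((\<lambda>h. flat p h / h) \<longlongrightarrow> 0) (at_left 0)"
  proof (rule Lim_transform_eventually[OF tendsto_const])
    show "\<forall>\<^sub>F h in at_left 0. 0 = flat p h / h"
      using eventually_at_left_real[of "-1" "0::real"] by (auto elim!: eventually_mono simp: flat_def)
  qed
  ultimately have "((\<lambda>h. flat p h / h) \<longlongrightarrow> 0) (at 0)" by (simp add: filterlim_split_at)
  then show ?thesis using equal by (simp add: has_field_derivative_iff flat_def)
qed

lemma flat_diffn: "diffn n (flat p)"
proof (induction n arbitrary: p)
  case 0 show ?case using flat_deriv by (auto simp: real_differentiable_def)
next
  case (Suc n)
  have "deriv (flat p) = flat (monom 1 2 * (p - pderiv p))" by (intro ext DERIV_imp_deriv flat_deriv)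
  then show ?case using Suc flat_deriv by (auto simp: real_differentiable_def)
qed

text \<open>The two arguments are n (x - a) - 1 and n (b - x) - 1, in affine form for
  \<open>diffn_affine\<close>. The shift by 1 moves the support into [a + 1/n, b - 1/n], strictly
  inside the interval, while the limit is still the indicator of the open interval.\<close>

definition bump :: "real \<Rightarrow> real \<Rightarrow> nat \<Rightarrow> real \<Rightarrow> real" where
  "bump a b n x = flat 1 (real n * x + (- real n * a - 1)) * flat 1 (- real n * x + (real n * b - 1))"

lemma flat1_bounds: "0 \<le> flat 1 x" "flat 1 x \<le> 1"
  by (auto simp: flat_def)

lemma flat1_tendsto: "(flat 1 \<longlongrightarrow> 1) at_top"
proof (rule Lim_transform_eventually)
  have "((\<lambda>x. exp (- inverse x)) \<longlongrightarrow> exp (- (0::real))) at_top"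
    by (intro tendsto_intros tendsto_inverse_0_at_top filterlim_ident)
  then show "((\<lambda>x. exp (- inverse x)) \<longlongrightarrow> (1::real)) at_top" by simp
  show "\<forall>\<^sub>F x in at_top. exp (- inverse x) = flat 1 x"
    using eventually_gt_at_top[of "0::real"] by eventually_elim (simp add: flat_def inverse_eq_divide)
qed

lemma bump_test:
  assumes "0 \<le> a" "b \<le> L" "n > 0"
  shows "test_function L (bump a b n)"
  unfolding test_function_def
proof (intro conjI allI)
  fix k x
  have "diffn k (bump a b n)" unfolding bump_def by (intro diffn_mult diffn_affine flat_diffn)
  then show "(deriv ^^ k) (bump a b n) differentiable (at x)" by (rule diffn_higher) simp
next
  show "\<exists>a' b'. 0 < a' \<and> b' < L \<and> (\<forall>x. x \<notin> {a'..b'} \<longrightarrow> bump a b n x = 0)"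
  proof (intro exI conjI allI impI)
    have "1 / real n > 0" using assms by simp
    then show "0 < a + 1 / real n" "b - 1 / real n < L" using assms(1,2) by linarith+
    fix x assume "x \<notin> {a + 1 / real n..b - 1 / real n}"
    then have "real n * x + (- real n * a - 1) \<le> 0 \<or> - real n * x + (real n * b - 1) \<le> 0"
      using assms(3) by (auto simp: field_simps not_le)
    then show "bump a b n x = 0" by (auto simp: bump_def flat_def)
  qed
qed

lemma bump_bounds: "0 \<le> bump a b n x" "bump a b n x \<le> 1"
  using flat1_bounds by (auto simp: bump_def intro: mult_le_one)

lemma bump_tendsto:
  shows "(\<lambda>n. bump a b n x) \<longlonglongrightarrow> indicator {a<..<b} x"
proof (cases "a < x \<and> x < b")
  case True
  have "filterlim (\<lambda>n. real n * x + (- real n * a - 1)) at_top sequentially"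
  proof -
    have "filterlim (\<lambda>n. -1 + (x - a) * real n) at_top sequentially"
      using True by (intro filterlim_tendsto_add_at_top[OF tendsto_const] filterlim_tendsto_pos_mult_at_top[OF tendsto_const] filterlim_real_sequentially) auto
    then show ?thesis by (simp add: algebra_simps)
  qed
  moreover have "filterlim (\<lambda>n. - real n * x + (real n * b - 1)) at_top sequentially"
  proof -
    have "filterlim (\<lambda>n. -1 + (b - x) * real n) at_top sequentially"
      using True by (intro filterlim_tendsto_add_at_top[OF tendsto_const] filterlim_tendsto_pos_mult_at_top[OF tendsto_const] filterlim_real_sequentially) auto
    then show ?thesis by (simp add: algebra_simps)
  qed
  ultimately have "(\<lambda>n. bump a b n x) \<longlonglongrightarrow> 1 * 1"
    unfolding bump_def by (intro tendsto_mult filterlim_compose[OF flat1_tendsto])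
  then show ?thesis using True by simp
next
  case False
  have "bump a b n x = 0" for n
  proof -
    have "real n * (x - a) \<le> 0 \<or> real n * (b - x) \<le> 0" using False by (auto simp: mult_nonneg_nonpos)
    then have "real n * x + (- real n * a - 1) \<le> 0 \<or> - real n * x + (real n * b - 1) \<le> 0" by (auto simp: algebra_simps)
    then show ?thesis by (auto simp: bump_def flat_def)
  qed
  then show ?thesis using False by simp
qed

lemma test_function_continuous: "test_function L \<phi> \<Longrightarrow> continuous_on UNIV ((deriv ^^ k) \<phi>)"
  unfolding test_function_def
  by (intro continuous_at_imp_continuous_on ballI differentiable_imp_continuous_within) auto

lemma test_function_L2:
  assumes "test_function L \<phi>"
  shows "(\<lambda>x. complex_of_real ((deriv ^^ k) \<phi> x)) \<in> pts (L2fun {0<..<L})"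
proof -
  interpret fin_set "{0<..<L}" by (rule fin_set_interval)
  note c = test_function_continuous[OF assms, of k]
  have [measurable]: "(deriv ^^ k) \<phi> \<in> borel_measurable borel" using c by (rule borel_measurable_continuous_onI)
  have "compact ((deriv ^^ k) \<phi> ` {0..L})"
    by (intro compact_continuous_image continuous_on_subset[OF c]) auto
  then have "bounded ((deriv ^^ k) \<phi> ` {0..L})" by (rule compact_imp_bounded)
  then obtain B where B: "\<And>x. x \<in> {0..L} \<Longrightarrow> \<bar>(deriv ^^ k) \<phi> x\<bar> \<le> B"
    unfolding bounded_iff by (metis imageI real_norm_def)
  show ?thesis by (rule bounded_in_L2[where B=B]) (auto simp: restr_def intro: B)
qed

text \<open>Rays are stable under intersection and generate the Borel sets; the total integral takes
  care of complements. So all set integrals vanish, and with them the density.\<close>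

lemma zero_from_rays:
  fixes G :: "real \<Rightarrow> complex"
  assumes G: "integrable lborel G" and z: "\<And>a. set_lebesgue_integral lborel {a<..} G = 0"
    and tot: "integral\<^sup>L lborel G = 0"
  shows "AE x in lborel. G x = 0"
proof -
  have Gs: "set_integrable lborel A G" if "A \<in> sets borel" for A
    using G that unfolding set_integrable_def by (intro integrable_mult_indicator) auto
  have "set_lebesgue_integral lborel A G = 0" if "A \<in> sets borel" for A
  proof -
    have b: "sets borel = sigma_sets UNIV (range (\<lambda>a::real. {a<..}))"
      by (subst borel_Ioi) simp
    have i: "Int_stable (range (\<lambda>a::real. {a<..}))"
    proof -
      have "{a<..} \<inter> {b<..} = {max a b<..}" for a b :: real by auto
      then show ?thesis by (auto simp: Int_stable_def)
    qed
    have "range (\<lambda>a::real. {a<..}) \<subseteq> Pow UNIV" by simp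
    from i this that[unfolded b] show ?thesis
    proof (induction rule: sigma_sets_induct_disjoint)
      case (basic A) then show ?case using z by auto
    next
      case empty then show ?case by (simp add: set_lebesgue_integral_def)
    next
      case (compl A)
      then have A: "A \<in> sets borel" by (simp add: b)
      have "set_lebesgue_integral lborel (UNIV - A) G + set_lebesgue_integral lborel A G = integral\<^sup>L lborel G"
      proof -
        have "integral\<^sup>L lborel G = (LINT x|lborel. indicat_real (UNIV - A) x *\<^sub>R G x + indicat_real A x *\<^sub>R G x)"
          by (intro Bochner_Integration.integral_cong) (auto simp: indicator_def)
        also have "\<dots> = set_lebesgue_integral lborel (UNIV - A) G + set_lebesgue_integral lborel A G"
          unfolding set_lebesgue_integral_def
          by (rule Bochner_Integration.integral_add) (use Gs[OF A] Gs[of "UNIV - A"] A in \<open>auto simp: set_integrable_def\<close>)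
        finally show ?thesis by simp
      qed
      then show ?case using compl tot by simp
    next
      case (union A)
      have A: "A i \<in> sets borel" for i using union by (auto simp: b)
      have "set_lebesgue_integral lborel (\<Union>i. A i) G = (\<Sum>i. set_lebesgue_integral lborel (A i) G)"
        using union(1) A by (intro lebesgue_integral_countable_add Gs) (auto simp: disjoint_family_on_def)
      then show ?case using union by simp
    qed
  qed
  then show ?thesis
    by (intro sigma_finite_measure.density_zero[OF sigma_finite_lborel G]) auto
qed

text \<open>Bumps converge boundedly to indicators of intervals, so testing against them shows that
  the integrals over all subintervals, and hence over all rays, vanish.\<close>

theorem fundamental_lemma:
  assumes L: "L > 0" and g: "g \<in> pts (L2fun {0<..<L})"
    and z: "\<And>\<phi>. test_function L \<phi> \<Longrightarrow> ip (L2fun {0<..<L}) g (\<lambda>x. of_real (\<phi> x)) = 0"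
  shows "nrm (L2fun {0<..<L}) g = 0"
proof -
  let ?S = "{0<..<L}"
  interpret fin_set ?S by (rule fin_set_interval)
  have G: "integrable lborel (restr ?S g)" by (rule L1_le_L2[OF g])
  have m [measurable]: "restr ?S g \<in> borel_measurable borel" using g by (simp add: L2fun_pts)
  have sub: "set_lebesgue_integral lborel {a<..<b} (restr ?S g) = 0" if "0 \<le> a" "b \<le> L" for a b
  proof -
    \<comment> \<open>The sequence is shifted to \<open>Suc n\<close> because
      \<open>bump_test\<close> asks for a positive scale.\<close>
    have "(\<lambda>n. LINT x|lborel. restr ?S g x * of_real (bump a b (Suc n) x)) \<longlonglongrightarrow> (LINT x|lborel. restr ?S g x * of_real (indicator {a<..<b} x))"
    proof (rule integral_dominated_convergence[where w="\<lambda>x. cmod (restr ?S g x)"])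
      show "(\<lambda>x. restr ?S g x * of_real (bump a b (Suc n) x)) \<in> borel_measurable lborel" for n
      proof -
        have [measurable]: "bump a b (Suc n) \<in> borel_measurable borel"
          using test_function_continuous[OF bump_test[OF that], of "Suc n" 0] by (auto intro: borel_measurable_continuous_onI)
        show ?thesis by measurable
      qed
      show "integrable lborel (\<lambda>x. cmod (restr ?S g x))" using G by (rule integrable_norm)
      show "AE x in lborel. (\<lambda>n. restr ?S g x * of_real (bump a b (Suc n) x)) \<longlonglongrightarrow> restr ?S g x * of_real (indicator {a<..<b} x)"
        by (intro AE_I2 tendsto_intros LIMSEQ_Suc[OF bump_tendsto])
      show "AE x in lborel. norm (restr ?S g x * of_real (bump a b (Suc n) x)) \<le> cmod (restr ?S g x)" for n
        using bump_bounds[of a b "Suc n"] by (intro AE_I2) (auto simp: norm_mult intro!: mult_left_le)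
    qed simp
    moreover have "(LINT x|lborel. restr ?S g x * of_real (bump a b (Suc n) x)) = 0" for n
    proof -
      have "restr ?S g x * cnj (restr ?S (\<lambda>x. of_real (bump a b (Suc n) x)) x) = restr ?S g x * of_real (bump a b (Suc n) x)" for x
        by (auto simp: restr_def indicator_def)
      then show ?thesis using z[OF bump_test[OF that, of "Suc n"]] by (simp only: L2fun_ip)
    qed
    ultimately have "(LINT x|lborel. restr ?S g x * of_real (indicator {a<..<b} x)) = 0" by (simp add: LIMSEQ_const_iff)
    moreover have "restr ?S g x * of_real (indicator {a<..<b} x) = indicator {a<..<b} x *\<^sub>R restr ?S g x" for x
      by (simp add: indicator_def)
    ultimately show ?thesis by (simp add: set_lebesgue_integral_def)
  qed
  have all: "set_lebesgue_integral lborel {a<..} (restr ?S g) = 0" for a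
  proof -
    have "set_lebesgue_integral lborel {a<..} (restr ?S g) = set_lebesgue_integral lborel {max a 0<..<L} (restr ?S g)"
      unfolding set_lebesgue_integral_def by (intro Bochner_Integration.integral_cong refl) (auto simp: restr_def indicator_def)
    then show ?thesis using sub[of "max a 0" L] by simp
  qed
  have "integral\<^sup>L lborel (restr ?S g) = set_lebesgue_integral lborel {0<..<L} (restr ?S g)"
    unfolding set_lebesgue_integral_def by (intro Bochner_Integration.integral_cong refl) (auto simp: restr_def indicator_def)
  then have "AE x in lborel. restr ?S g x = 0" using zero_from_rays[OF G all] sub[of 0 L] by simp
  then show ?thesis using L2fun_null_iff[OF g] by simp
qed

text \<open>Test functions as vectors of \<open>L2\<close>: the defining identity of a weak
  derivative becomes one between inner products, from which linearity and stability under limits are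
  immediate.\<close>

definition test_class :: "real \<Rightarrow> nat \<Rightarrow> (real \<Rightarrow> real) \<Rightarrow> (real \<Rightarrow> complex) set" where
  "test_class L k \<phi> = cls (L2fun {0<..<L}) (\<lambda>x. complex_of_real ((deriv ^^ k) \<phi> x))"

lemma test_class_in: "test_function L \<phi> \<Longrightarrow> test_class L k \<phi> \<in> pts (L2 {0<..<L})"
  unfolding test_class_def L2_def by (intro L2fun.quot_in test_function_L2)

lemma set_integral_ip:
  "(LINT x:S|lborel. f x * of_real (h x)) = ip (L2fun S) f (\<lambda>x. of_real (h x))"
  unfolding L2fun_ip set_lebesgue_integral_def
  by (intro Bochner_Integration.integral_cong refl) (auto simp: restr_def indicator_def)

lemma is_weak_deriv_iff:
  "is_weak_deriv L k f g \<longleftrightarrow> f \<in> pts (L2 {0<..<L}) \<and> g \<in> pts (L2 {0<..<L}) \<and>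
     (\<forall>\<phi>. test_function L \<phi> \<longrightarrow> ip (L2 {0<..<L}) f (test_class L k \<phi>) = (-1) ^ k * ip (L2 {0<..<L}) g (test_class L 0 \<phi>))"
proof -
  have "ip (L2 {0<..<L}) f (test_class L k \<phi>) = (LINT x:{0<..<L}|lborel. repr f x * of_real ((deriv ^^ k) \<phi> x))"
    if "f \<in> pts (L2 {0<..<L})" "test_function L \<phi>" for f \<phi> k
    using L2_ip_cls[OF that(1) test_function_L2[OF that(2)], of k] by (simp only: test_class_def set_integral_ip)
  from this[of _ _ 0] this[of _ _ k] show ?thesis unfolding is_weak_deriv_def by (auto simp del: funpow.simps(2))
qed

section \<open>Weak derivatives and completeness of the Sobolev space\<close>

locale interval_space =
  fixes L :: real assumes L: "L > 0"
begin

abbreviation "E \<equiv> L2 {0<..<L}"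

sublocale E: hilb E
  by (rule fin_set.L2_hilb[OF fin_set_interval])

lemma weak_deriv_unique:
  assumes "is_weak_deriv L k f g" "is_weak_deriv L k f h" shows "g = h"
proof (rule E.nrm_dif_zero)
  show i: "g \<in> pts E" "h \<in> pts E" using assms by (auto simp: is_weak_deriv_iff)
  let ?d = "dif E g h"
  have d: "?d \<in> pts E" using i by simp
  have "ip E ?d (test_class L 0 \<phi>) = 0" if t: "test_function L \<phi>" for \<phi>
    using assms t i test_class_in[OF t, of 0] by (simp add: is_weak_deriv_iff E.ip_simps)
  then have "ip (L2fun {0<..<L}) (repr ?d) (\<lambda>x. of_real (\<phi> x)) = 0" if t: "test_function L \<phi>" for \<phi>
    using L2_ip_cls[OF d test_function_L2[OF t, of 0]] t by (simp add: test_class_def)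
  then have "nrm (L2fun {0<..<L}) (repr ?d) = 0"
    using L L2_repr[OF d] by (intro fundamental_lemma) auto
  then show "nrm E ?d = 0" by (simp add: L2_def L2fun.quot_nrm_repr)
qed

lemma wderiv_eq: "is_weak_deriv L k f g \<Longrightarrow> wderiv L k f = g"
  unfolding wderiv_def using weak_deriv_unique by (intro the_equality)

lemma H8_pts: "f \<in> pts (H8 L) \<longleftrightarrow> f \<in> pts E \<and> (\<forall>k\<le>8. \<exists>g. is_weak_deriv L k f g)"
  by (simp add: H8_def)

lemma H8_sel: "zer (H8 L) = zer E" "pls (H8 L) = pls E" "scl (H8 L) = scl E" "dif (H8 L) = dif E"
  "ip (H8 L) = (\<lambda>f g. \<Sum>k\<le>8. ip E (wderiv L k f) (wderiv L k g))"
  by (simp_all add: H8_def dif_def fun_eq_iff)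

lemma H8_wderiv: "f \<in> pts (H8 L) \<Longrightarrow> k \<le> 8 \<Longrightarrow> is_weak_deriv L k f (wderiv L k f)"
  using wderiv_eq unfolding H8_pts by metis

lemma wderiv_in: "f \<in> pts (H8 L) \<Longrightarrow> k \<le> 8 \<Longrightarrow> wderiv L k f \<in> pts E"
  using H8_wderiv by (auto simp: is_weak_deriv_iff)

lemma weak_deriv_0: "f \<in> pts E \<Longrightarrow> is_weak_deriv L 0 f f"
  by (simp add: is_weak_deriv_iff)

lemma wderiv_0: "f \<in> pts E \<Longrightarrow> wderiv L 0 f = f"
  by (rule wderiv_eq[OF weak_deriv_0])

lemma weak_deriv_pls:
  assumes "is_weak_deriv L k f g" "is_weak_deriv L k f' g'"
  shows "is_weak_deriv L k (pls E f f') (pls E g g')"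
  using assms test_class_in unfolding is_weak_deriv_iff by (simp add: E.ip_simps distrib_left)

lemma weak_deriv_scl:
  assumes "is_weak_deriv L k f g" shows "is_weak_deriv L k (scl E c f) (scl E c g)"
  using assms test_class_in unfolding is_weak_deriv_iff by (simp add: E.ip_simps)

lemma weak_deriv_zer: "is_weak_deriv L k (zer E) (zer E)"
  using test_class_in unfolding is_weak_deriv_iff by simp

lemma weak_deriv_closed:
  assumes d: "\<And>n. is_weak_deriv L k (f n) (g n)" and "f' \<in> pts E" "g' \<in> pts E" and t: "tends E f f'" "tends E g g'"
  shows "is_weak_deriv L k f' g'"
  unfolding is_weak_deriv_iff
proof (intro conjI allI impI)
  fix \<phi> assume \<phi>: "test_function L \<phi>"
  have i: "f n \<in> pts E" "g n \<in> pts E" for n using d[of n] by (auto simp: is_weak_deriv_iff)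
  have e: "ip E (f n) (test_class L k \<phi>) = (-1) ^ k * ip E (g n) (test_class L 0 \<phi>)" for n
    using d[of n] \<phi> by (auto simp: is_weak_deriv_iff)
  have 1: "(\<lambda>n. ip E (f n) (test_class L k \<phi>)) \<longlonglongrightarrow> ip E f' (test_class L k \<phi>)"
    by (rule E.tendsto_ip_left) (use i assms test_class_in \<phi> in auto)
  have 2: "(\<lambda>n. (-1) ^ k * ip E (g n) (test_class L 0 \<phi>)) \<longlonglongrightarrow> (-1) ^ k * ip E g' (test_class L 0 \<phi>)"
    by (rule tendsto_mult_left, rule E.tendsto_ip_left) (use i assms test_class_in \<phi> in auto)
  show "ip E f' (test_class L k \<phi>) = (-1) ^ k * ip E g' (test_class L 0 \<phi>)"
    using LIMSEQ_unique[OF 1[unfolded e] 2] .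
qed (use assms in auto)

lemma wderiv_linear:
  assumes "f \<in> pts (H8 L)" "g \<in> pts (H8 L)" "k \<le> 8"
  shows "wderiv L k (pls E f g) = pls E (wderiv L k f) (wderiv L k g)"
    "wderiv L k (scl E c f) = scl E c (wderiv L k f)" "wderiv L k (dif E f g) = dif E (wderiv L k f) (wderiv L k g)"
proof -
  note f = H8_wderiv[OF assms(1,3)] and g = H8_wderiv[OF assms(2,3)]
  show "wderiv L k (pls E f g) = pls E (wderiv L k f) (wderiv L k g)" by (rule wderiv_eq[OF weak_deriv_pls[OF f g]])
  show "wderiv L k (scl E c f) = scl E c (wderiv L k f)" by (rule wderiv_eq[OF weak_deriv_scl[OF f]])
  show "wderiv L k (dif E f g) = dif E (wderiv L k f) (wderiv L k g)"
    unfolding dif_def by (rule wderiv_eq[OF weak_deriv_pls[OF f weak_deriv_scl[OF g]]])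
qed

lemma H8_sub: "csubspace E (pts (H8 L))"
  unfolding csubspace_def
proof (intro conjI ballI allI)
  show "pts (H8 L) \<subseteq> pts E" by (auto simp: H8_pts)
  show "zer E \<in> pts (H8 L)" using weak_deriv_zer by (auto simp: H8_pts)
  fix x y assume x: "x \<in> pts (H8 L)" and y: "y \<in> pts (H8 L)"
  show "pls E x y \<in> pts (H8 L)"
    unfolding H8_pts using weak_deriv_pls[OF H8_wderiv[OF x] H8_wderiv[OF y]] x y by (auto simp: H8_pts)
next
  fix c x assume x: "x \<in> pts (H8 L)"
  show "scl E c x \<in> pts (H8 L)"
    unfolding H8_pts using weak_deriv_scl[OF H8_wderiv[OF x]] x by (auto simp: H8_pts)
qed

lemma H8_nrm_sq: "(nrm (H8 L) f)\<^sup>2 = (\<Sum>k\<le>8. (nrm E (wderiv L k f))\<^sup>2)" if "f \<in> pts (H8 L)"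
proof -
  have "(\<Sum>k\<le>8. (nrm E (wderiv L k f))\<^sup>2) = Re (ip (H8 L) f f)"
    using wderiv_in[OF that] by (simp add: H8_sel(5) E.nrm_sq)
  then show ?thesis by (metis nrm_def real_sqrt_pow2 sum_nonneg zero_le_power2)
qed

lemma H8_wderiv_le:
  assumes "f \<in> pts (H8 L)" "k \<le> 8" shows "nrm E (wderiv L k f) \<le> nrm (H8 L) f"
proof -
  have "(nrm E (wderiv L k f))\<^sup>2 \<le> (\<Sum>k\<le>8. (nrm E (wderiv L k f))\<^sup>2)"
    using assms by (intro member_le_sum) auto
  then have "(nrm E (wderiv L k f))\<^sup>2 \<le> (nrm (H8 L) f)\<^sup>2" using H8_nrm_sq[OF assms(1)] by simp
  moreover have "0 \<le> nrm (H8 L) f"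
    using wderiv_in[OF assms(1)] E.b_nn unfolding nrm_def H8_sel(5) by (auto intro!: sum_nonneg)
  ultimately show ?thesis by (rule power2_le_imp_le)
qed

text \<open>For a Cauchy sequence all nine derivatives converge in \<open>E\<close>, and
  \<open>weak_deriv_closed\<close> identifies their limits as the weak derivatives of the limit of
  order 0.\<close>

theorem H8_hilb: "hilb (H8 L)"
proof -
  interpret S: cvspace "E\<lparr>pts := pts (H8 L)\<rparr>" by (rule E.subspace_cvspace[OF H8_sub])
  interpret H: cvspace "H8 L"
  proof -
    have "H8 L = E\<lparr>pts := pts (H8 L), ip := ip (H8 L)\<rparr>" by (simp add: H8_def)
    then have "cvspace (H8 L) = cvspace (E\<lparr>pts := pts (H8 L)\<rparr>)" by (metis cvspace_ip_upd)
    then show "cvspace (H8 L)" using S.cvspace_axioms by simp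
  qed
  show ?thesis
  proof unfold_locales
    show "hermitian_form (H8 L) (ip (H8 L))" unfolding hermitian_form_def H8_sel
    proof (intro conjI ballI allI)
      fix x y assume x: "x \<in> pts (H8 L)" and y: "y \<in> pts (H8 L)"
      have "ip E (wderiv L k y) (wderiv L k x) = cnj (ip E (wderiv L k x) (wderiv L k y))" if "k \<le> 8" for k
        by (rule E.b_sym[OF wderiv_in[OF x that] wderiv_in[OF y that]])
      then show "(\<Sum>k\<le>8. ip E (wderiv L k y) (wderiv L k x)) = cnj (\<Sum>k\<le>8. ip E (wderiv L k x) (wderiv L k y))"
        unfolding cnj_sum by (intro sum.cong) auto
    qed (simp_all add: wderiv_linear wderiv_in E.ip_simps sum.distrib sum_distrib_left)
    show "nonneg_form (H8 L) (ip (H8 L))" unfolding nonneg_form_def H8_sel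
      using wderiv_in E.b_nn E.b_self_real by (auto intro!: sum_nonneg)
    fix x assume x: "x \<in> pts (H8 L)" and z: "ip (H8 L) x x = 0"
    have "nrm E (wderiv L 0 x) \<le> 0" using H8_wderiv_le[OF x, of 0] z by (simp add: nrm_def)
    moreover have "x \<in> pts E" using x by (simp add: H8_pts)
    ultimately have "nrm E x = 0" using wderiv_0[of x] E.nrm_nonneg[of x] by (intro antisym) auto
    then show "x = zer (H8 L)" using x E.nrm_eq_zero by (simp add: H8_sel H8_pts)
  next
    fix x assume x: "cauchy_seq (H8 L) x"
    then have xi: "x n \<in> pts (H8 L)" for n by (simp add: cauchy_seq_def)
    have "cauchy_seq E (\<lambda>n. wderiv L k (x n))" if k: "k \<le> 8" for k
      unfolding cauchy_seq_def
    proof (intro conjI allI impI wderiv_in xi k)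
      fix e :: real assume "e > 0"
      then obtain K where K: "\<forall>i\<ge>K. \<forall>j\<ge>K. nrm (H8 L) (dif (H8 L) (x i) (x j)) < e" using x by (auto simp: cauchy_seq_def)
      have "nrm E (dif E (wderiv L k (x i)) (wderiv L k (x j))) < e" if "i \<ge> K" "j \<ge> K" for i j
        using H8_wderiv_le[OF _ k, of "dif E (x i) (x j)"] csubspaceD(6)[OF H8_sub xi xi, of i j] K that
          wderiv_linear(3)[OF xi xi k, of i j] by (fastforce simp: H8_sel(4))
      then show "\<exists>K. \<forall>i\<ge>K. \<forall>j\<ge>K. nrm E (dif E (wderiv L k (x i)) (wderiv L k (x j))) < e" by blast
    qed
    then have "\<forall>k. \<exists>l. k \<le> 8 \<longrightarrow> l \<in> pts E \<and> tends E (\<lambda>n. wderiv L k (x n)) l" using E.complete by blast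
    then obtain l where l: "\<And>k. k \<le> 8 \<Longrightarrow> l k \<in> pts E" "\<And>k. k \<le> 8 \<Longrightarrow> tends E (\<lambda>n. wderiv L k (x n)) (l k)" by metis
    have x0: "wderiv L 0 (x n) = x n" for n using xi wderiv_0 by (auto simp: H8_pts)
    have t0: "tends E x (l 0)" using l(2)[of 0] by (simp add: x0)
    have d: "is_weak_deriv L k (l 0) (l k)" if k: "k \<le> 8" for k
      by (rule weak_deriv_closed[OF H8_wderiv[OF xi k] l(1) l(1)[OF k] t0 l(2)[OF k]]) simp
    have l0: "l 0 \<in> pts (H8 L)" using d l(1) by (auto simp: H8_pts)
    have "tends (H8 L) x (l 0)" unfolding tends_def H8_sel(4)
    proof -
      have e: "nrm (H8 L) (dif E (x n) (l 0)) = sqrt (\<Sum>k\<le>8. (nrm E (dif E (wderiv L k (x n)) (l k)))\<^sup>2)" for n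
      proof -
        have i: "dif E (x n) (l 0) \<in> pts (H8 L)" by (rule csubspaceD(6)[OF H8_sub xi l0])
        have "0 \<le> nrm (H8 L) (dif E (x n) (l 0))"
          using E.nrm_nonneg[OF wderiv_in[OF i, of 0]] H8_wderiv_le[OF i, of 0] by linarith
        then have "nrm (H8 L) (dif E (x n) (l 0)) = sqrt (\<Sum>k\<le>8. (nrm E (wderiv L k (dif E (x n) (l 0))))\<^sup>2)"
          using H8_nrm_sq[OF i] by (metis real_sqrt_abs abs_of_nonneg)
        also have "(\<Sum>k\<le>8. (nrm E (wderiv L k (dif E (x n) (l 0))))\<^sup>2) = (\<Sum>k\<le>8. (nrm E (dif E (wderiv L k (x n)) (l k)))\<^sup>2)"
          using wderiv_linear(3)[OF xi l0] wderiv_eq[OF d] by (intro sum.cong) auto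
        finally show ?thesis .
      qed
      have "(\<lambda>n. sqrt (\<Sum>k\<le>8. (nrm E (dif E (wderiv L k (x n)) (l k)))\<^sup>2)) \<longlonglongrightarrow> sqrt (\<Sum>k\<le>(8::nat). 0\<^sup>2)"
        using l(2) unfolding tends_def by (intro tendsto_intros) auto
      then show "(\<lambda>n. nrm (H8 L) (dif E (x n) (l 0))) \<longlonglongrightarrow> 0" by (simp add: e)
    qed
    then show "\<exists>l\<in>pts (H8 L). tends (H8 L) x l" using l0 by blast
  qed
qed

lemma H8_form_space: "form_space L (H8 L)"
  unfolding form_space_def using H8_hilb by (auto simp: hilb_iff intro!: exI[of _ 1])

end

section \<open>The function $\Psi$\<close>

lemma phi_alt:
  "phi n t = 2 * pi * (real n)\<^sup>2 * exp (5 * t / 2) * (2 * (pi * (real n)\<^sup>2) * exp (2 * t) - 3) * exp (- (pi * (real n)\<^sup>2) * exp (2 * t))"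
proof -
  have "exp (9 * t / 2) = exp (5 * t / 2) * exp (2 * t)" by (simp flip: exp_add)
  then show ?thesis by (simp add: phi_def power2_eq_square power4_eq_xxxx algebra_simps)
qed

lemma phi_pos:
  assumes "n \<ge> 1" "t \<ge> 0" shows "phi n t > 0"
proof -
  have "1 \<le> (real n)\<^sup>2" using assms by simp
  then have "3 * 1 < pi * (real n)\<^sup>2" using pi_gt3 by (intro mult_less_le_imp_less) auto
  moreover have "pi * (real n)\<^sup>2 * 1 \<le> pi * (real n)\<^sup>2 * exp (2 * t)" using assms by (intro mult_left_mono) auto
  ultimately have "0 < 2 * (pi * (real n)\<^sup>2) * exp (2 * t) - 3" by linarith
  then show ?thesis using assms unfolding phi_alt by (intro mult_pos_pos) auto
qed

lemma phi'0_eq: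
  fixes n defines "y \<equiv> pi * (real n)\<^sup>2"
  shows "phi'0 n = 2 * exp (- y) * y * (15 * y - 4 * y\<^sup>2 - 15/2)"
proof -
  have "phi n = (\<lambda>t. 2 * (2 * y\<^sup>2 * exp (9 * t / 2) - 3 * y * exp (5 * t / 2)) * exp (- y * exp (2 * t)))"
    by (auto simp: phi_def y_def fun_eq_iff power_mult_distrib)
  moreover have "((\<lambda>t. 2 * (2 * y\<^sup>2 * exp (9 * t / 2) - 3 * y * exp (5 * t / 2)) * exp (- y * exp (2 * t)))
      has_real_derivative 2 * exp (- y) * y * (15 * y - 4 * y\<^sup>2 - 15/2)) (at 0 within {0<..})"
    by (auto intro!: derivative_eq_intros simp: algebra_simps power2_eq_square)
  ultimately have "(phi n has_vector_derivative 2 * exp (- y) * y * (15 * y - 4 * y\<^sup>2 - 15/2)) (at_right 0)"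
    by (simp add: has_real_derivative_iff_has_vector_derivative)
  then show ?thesis unfolding phi'0_def by (intro vector_derivative_within) simp_all
qed

text \<open>From e >= 5/2, since (5/2)^3 = 15.625 and (5/2)^12 > 59000. The exponents 3 and 12 are
  the lower bounds used for pi and 4 pi.\<close>

lemma exp_lower: "exp (3::real) \<ge> 15" "exp (12::real) \<ge> 50000"
proof -
  have e: "exp (1::real) \<ge> 5/2" using exp_lower_Taylor_quadratic[of "1::real"] by simp
  have "exp (real k) \<ge> (5/2) ^ k" for k
    using power_mono[OF e, of k] by (simp flip: exp_of_nat_mult)
  from this[of 3] this[of 12] show "exp (3::real) \<ge> 15" "exp (12::real) \<ge> 50000" by (simp_all add: power_divide)
qed

text \<open>The parabola has its vertex at 15/8, so it decreases from 2 on.\<close>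

lemma neg_quad_le:
  fixes y :: real assumes "2 \<le> y" "y \<le> b" shows "15 * b - 4 * b\<^sup>2 - 15/2 \<le> 15 * y - 4 * y\<^sup>2 - 15/2"
proof -
  have "0 \<le> (b - y) * (4 * (b + y) - 15)" using assms by (intro mult_nonneg_nonneg) auto
  then show ?thesis by (simp add: power2_eq_square algebra_simps)
qed

text \<open>On an interval [a, b] with a >= 2 the polynomial factor is worst at b and the
  exponential at a. For pi in [3, 4] this gives at most 92/15 < 31/5 in absolute value, for 4 pi in
  [12, 16] at most 25328/50000 < 4/5, and 31/5 + 4/5 = 7.\<close>

lemma phi'0_12: "- 7 \<le> phi'0 1 + phi'0 2"
proof -
  have *: "- c \<le> 2 * exp (- y) * y * (15 * y - 4 * y\<^sup>2 - 15/2)"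
    if y: "a \<le> y" "y \<le> b" "2 \<le> a" and ex: "exp a \<ge> x" "x > 0" and c: "2 * b * (4 * b\<^sup>2 + 15/2 - 15 * b) \<le> c * x" "0 \<le> 4 * b\<^sup>2 + 15/2 - 15 * b" for a b c x y :: real
  proof -
    have "y * (4 * y\<^sup>2 + 15/2 - 15 * y) \<le> b * (4 * b\<^sup>2 + 15/2 - 15 * b)"
    proof -
      have "y * (4 * y\<^sup>2 + 15/2 - 15 * y) \<le> y * (4 * b\<^sup>2 + 15/2 - 15 * b)"
        using neg_quad_le[of y b] y by (intro mult_left_mono) auto
      also have "\<dots> \<le> b * (4 * b\<^sup>2 + 15/2 - 15 * b)" using y c by (intro mult_right_mono) auto
      finally show ?thesis .
    qed
    then have "2 * (y * (4 * y\<^sup>2 + 15/2 - 15 * y)) \<le> c * x" using c by simp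
    also have "\<dots> \<le> c * exp y"
    proof (rule mult_left_mono)
      show "x \<le> exp y" using ex y by (meson exp_le_cancel_iff order_trans)
      have "0 \<le> c * x" using c y order_trans[OF _ c(1), of 0] by (auto intro!: mult_nonneg_nonneg)
      then show "0 \<le> c" using ex by (simp add: zero_le_mult_iff)
    qed
    finally have "2 * (y * (4 * y\<^sup>2 + 15/2 - 15 * y)) * exp (- y) \<le> c * exp y * exp (- y)" by (intro mult_right_mono) auto
    then show ?thesis by (simp add: algebra_simps exp_minus)
  qed
  have "- (31/5) \<le> phi'0 1"
    unfolding phi'0_eq by (rule *[of 3 _ 4 15]) (use pi_gt3 pi_less_4 exp_lower in auto)
  moreover have "- (4/5) \<le> phi'0 2"
    unfolding phi'0_eq by (rule *[of 12 _ 16 50000]) (use pi_gt3 pi_less_4 exp_lower in auto)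
  ultimately show ?thesis by simp
qed

text \<open>The polynomial factor is increasing for y >= 27, where it already equals 67999.5; twice
  the rounded value 65000 is the constant.\<close>

lemma phi'0_3: "phi'0 3 \<le> - 130000 * exp (- (9 * pi))"
proof -
  define y where "y = 9 * pi"
  have y: "27 \<le> y" using pi_gt3 by (simp add: y_def)
  have "27 * (4 * 27\<^sup>2 + 15/2 - 15 * 27) \<le> y * (4 * y\<^sup>2 + 15/2 - 15 * y)"
    using y neg_quad_le[of 27 y] by (intro mult_mono) auto
  then have "65000 \<le> y * (4 * y\<^sup>2 + 15/2 - 15 * y)" by simp
  then have "65000 * (2 * exp (- y)) \<le> y * (4 * y\<^sup>2 + 15/2 - 15 * y) * (2 * exp (- y))" by (intro mult_right_mono) auto
  moreover have "phi'0 3 = - (y * (4 * y\<^sup>2 + 15/2 - 15 * y) * (2 * exp (- y)))"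
    unfolding phi'0_eq y_def by (simp add: algebra_simps)
  ultimately show ?thesis by (simp add: y_def)
qed

text \<open>The factor \<open>e\<^sup>-\<^sup>9\<^sup>\<pi>\<close> of \<open>\<phi>\<^sub>3'(0)\<close> beats \<open>\<phi>\<^sub>3/\<phi>\<^sub>1 = O(e\<^sup>-\<^sup>8\<^sup>\<pi>\<^sup>x)\<close>, \<open>x = e\<^sup>2\<^sup>t \<ge> 1\<close>, up to the constant \<open>e\<^sup>\<pi> \<le> 81\<close>.\<close>

theorem Psi_pos:
  assumes "v \<ge> 0" shows "Psi v > 0"
proof -
  define t where "t = v / 2"
  have t: "t \<ge> 0" using assms by (simp add: t_def)
  define x where "x = exp (2 * t)"
  have x: "x \<ge> 1" using t by (simp add: x_def)
  have px: "pi * x \<ge> 3" using mult_mono[of 3 pi 1 x] x pi_gt3 by simp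
  have p3: "phi'0 3 < 0" using phi'0_3 by (smt (verit) exp_gt_zero mult_neg_pos)
  have "phi 1 t + alpha3 * phi 3 t > 0"
  proof -
    define c where "c = 2 * pi * exp (5 * t / 2)"
    have c: "c > 0" by (simp add: c_def)
    have p1: "phi 1 t = c * (2 * (pi * x) - 3) * exp (- (pi * x))" by (simp add: phi_alt c_def x_def mult_ac)
    have ph3: "phi 3 t = c * (9 * (18 * (pi * x) - 3)) * exp (- (9 * (pi * x)))" by (simp add: phi_alt c_def x_def mult_ac)
    have e4: "exp pi \<le> 81"
    proof -
      have "exp pi \<le> exp (4::real)" using pi_less_4 by simp
      also have "\<dots> = exp 1 ^ 4" by (simp flip: exp_of_nat_mult)
      also have "\<dots> \<le> 3 ^ 4" by (intro power_mono exp_le) auto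
      finally show ?thesis by simp
    qed
    have ex: "exp (- (9 * (pi * x))) \<le> exp (- (pi * x)) * (81 * exp (- (9 * pi)))"
    proof -
      have "- (9 * (pi * x)) \<le> - (pi * x) + pi - 9 * pi" using x by simp
      then have "exp (- (9 * (pi * x))) \<le> exp (- (pi * x) + pi - 9 * pi)" by simp
      also have "\<dots> = exp (- (pi * x)) * (exp pi * exp (- (9 * pi)))" by (simp add: algebra_simps flip: exp_add)
      also have "\<dots> \<le> exp (- (pi * x)) * (81 * exp (- (9 * pi)))" using e4 by (intro mult_left_mono mult_right_mono) auto
      finally show ?thesis .
    qed
    \<comment> \<open>From pi x >= 3 follows 18 pi x - 3 <= 17 (2 pi x - 3), with equality at 3.
      Collecting constants gives 7 * 9 * 17 * 81 = 86751, which stays below the 130000 of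
      \<open>phi'0_3\<close>.\<close>
    have "7 * phi 3 t \<le> 7 * (c * (9 * (17 * (2 * (pi * x) - 3))) * (exp (- (pi * x)) * (81 * exp (- (9 * pi)))))"
      unfolding ph3 using c px ex by (intro mult_left_mono mult_mono) auto
    also have "\<dots> = phi 1 t * (86751 * exp (- (9 * pi)))" unfolding p1 by (simp add: algebra_simps)
    also have "\<dots> < phi 1 t * (- phi'0 3)"
      using phi'0_3 phi_pos[of 1 t] t by (intro mult_strict_left_mono) (auto intro: order_less_le_trans[of _ "130000 * exp (- (9 * pi))"])
    finally have less: "7 * phi 3 t < phi 1 t * (- phi'0 3)" .
    have "- (phi'0 1 + phi'0 2) * phi 3 t \<le> 7 * phi 3 t"
      using phi'0_12 phi_pos[of 3 t] t by (intro mult_right_mono) auto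
    then have "- (phi'0 1 + phi'0 2) * phi 3 t < phi 1 t * (- phi'0 3)" using less by linarith
    then have "0 < phi 1 t * (- phi'0 3) - (- (phi'0 1 + phi'0 2) * phi 3 t)" by linarith
    then have "0 < phi 1 t * (- phi'0 3) + (phi'0 1 + phi'0 2) * phi 3 t" by (simp only: minus_mult_left[symmetric] diff_minus_eq_add)
    then have "0 < (phi 1 t * (- phi'0 3) + (phi'0 1 + phi'0 2) * phi 3 t) / (- phi'0 3)"
      using p3 by (intro divide_pos_pos) auto
    also have "\<dots> = phi 1 t + alpha3 * phi 3 t" using p3 by (simp add: alpha3_def field_simps)
    finally show ?thesis .
  qed
  then show ?thesis using phi_pos[of 2 t] t by (simp add: Psi_def t_def)
qed

lemma Psi_continuous: "continuous_on A Psi"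
  unfolding Psi_def phi_def by (intro continuous_intros) auto

lemma Psi_measurable [measurable]: "Psi \<in> borel_measurable borel"
  by (intro borel_measurable_continuous_onI Psi_continuous)

text \<open>exp (2 t) >= 1 + 2 t weakens the double exponential to exp(-6 t), and 9/2 - 6 = -3/2. In
  the variable v = 2 t of \<open>Psi\<close> the rate is 3/4, enough to absorb the growth exp(v/4)
  permitted by |omega| < 1/2.\<close>

lemma phi_decay:
  assumes "n \<ge> 1" shows "\<exists>c. \<forall>t\<ge>0. phi n t \<le> c * exp (- 3 * t / 2)"
proof (intro exI allI impI)
  fix t :: real assume t: "t \<ge> 0"
  have "1 \<le> (real n)\<^sup>2" using assms by simp
  then have n: "3 * 1 \<le> pi * (real n)\<^sup>2" using pi_gt3 by (intro mult_mono) auto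
  have "3 * (1 + 2 * t) \<le> pi * (real n)\<^sup>2 * exp (2 * t)"
    using n t exp_ge_add_one_self[of "2 * t"] by (intro mult_mono) auto
  then have e: "exp (- pi * (real n)\<^sup>2 * exp (2 * t)) \<le> exp (- 6 * t)" by simp
  have "phi n t \<le> 2 * (2 * pi\<^sup>2 * real n ^ 4 * exp (9 * t / 2)) * exp (- pi * (real n)\<^sup>2 * exp (2 * t))"
    unfolding phi_def by (intro mult_right_mono mult_left_mono) auto
  also have "\<dots> \<le> 2 * (2 * pi\<^sup>2 * real n ^ 4 * exp (9 * t / 2)) * exp (- 6 * t)"
    using e by (intro mult_left_mono) auto
  also have "\<dots> = (4 * pi\<^sup>2 * real n ^ 4) * exp (- 3 * t / 2)"
  proof -
    have "exp (9 * t / 2) * exp (- 6 * t) = exp (- 3 * t / 2)" by (simp flip: exp_add)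
    then show ?thesis by simp
  qed
  finally show "phi n t \<le> (4 * pi\<^sup>2 * real n ^ 4) * exp (- 3 * t / 2)" .
qed

lemma Psi_decay: obtains c where "c > 0" "\<And>v. v \<ge> 0 \<Longrightarrow> Psi v \<le> c * exp (- 3 * v / 4)"
proof -
  obtain c1 c2 c3 where c: "\<forall>t\<ge>0. phi 1 t \<le> c1 * exp (- 3 * t / 2)" "\<forall>t\<ge>0. phi 2 t \<le> c2 * exp (- 3 * t / 2)"
    "\<forall>t\<ge>0. phi 3 t \<le> c3 * exp (- 3 * t / 2)"
    using phi_decay[of 1] phi_decay[of 2] phi_decay[of 3] by auto
  define c where "c = \<bar>c1\<bar> + \<bar>c2\<bar> + \<bar>alpha3\<bar> * \<bar>c3\<bar> + 1"
  have "Psi v \<le> c * exp (- 3 * v / 4)" if v: "v \<ge> 0" for v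
  proof -
    define E where "E = exp (- 3 * v / 4)"
    have E: "E > 0" by (simp add: E_def)
    have b: "phi 1 (v / 2) \<le> c1 * E" "phi 2 (v / 2) \<le> c2 * E" "phi 3 (v / 2) \<le> c3 * E"
      using c[rule_format, of "v / 2"] v by (simp_all add: E_def)
    have "alpha3 * phi 3 (v / 2) \<le> \<bar>alpha3\<bar> * phi 3 (v / 2)"
      using phi_pos[of 3 "v / 2"] v by (intro mult_right_mono) auto
    also have "\<dots> \<le> \<bar>alpha3\<bar> * (\<bar>c3\<bar> * E)"
      using order_trans[OF b(3) mult_right_mono[of c3 "\<bar>c3\<bar>" E]] E by (intro mult_left_mono) auto
    finally have "alpha3 * phi 3 (v / 2) \<le> \<bar>alpha3\<bar> * \<bar>c3\<bar> * E" by simp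
    moreover have "c1 * E \<le> \<bar>c1\<bar> * E" "c2 * E \<le> \<bar>c2\<bar> * E" using E by (auto intro: mult_right_mono)
    ultimately have "Psi v \<le> \<bar>c1\<bar> * E + \<bar>c2\<bar> * E + \<bar>alpha3\<bar> * \<bar>c3\<bar> * E + E"
      unfolding Psi_def using b E by linarith
    then show ?thesis by (simp add: c_def E_def algebra_simps)
  qed
  moreover have "c > 0" unfolding c_def by (intro add_nonneg_pos) auto
  ultimately show thesis using that by blast
qed

lemma integrable_exp_decay:
  assumes a: "a > 0" shows "integrable lborel (\<lambda>u::real. indicator {0..} u *\<^sub>R exp (- (a * u)))"
proof -
  have "((\<lambda>x. exp (- a * x)) has_integral exp (- a * 0) / a) {0..}"
    using has_integral_exp_minus_to_infinity[OF a, of 0] by simp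
  then have "(\<lambda>x. exp (- a * x)) integrable_on {0..}" by blast
  then have "(\<lambda>x. exp (- a * x)) absolutely_integrable_on {0..}"
    by (intro nonnegative_absolutely_integrable_1) auto
  then have "integrable (Complete_Measure.completion lborel) (\<lambda>u. indicator {0..} u *\<^sub>R exp (- (a * u)))"
    by (simp add: set_integrable_def)
  then show ?thesis by (subst (asm) integrable_completion) auto
qed

section \<open>The Volterra moment form\<close>

text \<open>The moments integrate over a closed interval, whereas classes in \<open>E\<close> live
  on the open one; the two endpoints are negligible.\<close>

lemma borel_integral_eq:
  fixes f g :: "real \<Rightarrow> complex"
  assumes "\<And>x. x \<notin> {a, b} \<Longrightarrow> f x = g x"
  shows "integral\<^sup>L lborel f = integral\<^sup>L lborel g"
  by (rule integral_discrete_difference[where X="{a, b}"]) (use assms in auto)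

text \<open>A majorant of product form is integrable over the plane, so Fubini applies to h.\<close>

lemma fubini_dominated:
  fixes h :: "real \<Rightarrow> real \<Rightarrow> complex"
  assumes [measurable]: "case_prod h \<in> borel_measurable (borel \<Otimes>\<^sub>M borel)"
    and A: "integrable lborel A" and w: "integrable lborel (w :: real \<Rightarrow> real)"
    and b: "\<And>s u. cmod (h s u) \<le> A s * w u" and nn: "\<And>s. 0 \<le> A s" "\<And>u. 0 \<le> w u"
  shows "(LINT s|lborel. LINT u|lborel. h s u) = (LINT u|lborel. LINT s|lborel. h s u)"
    "integrable lborel (\<lambda>u. LINT s|lborel. h s u)"
    "integrable lborel (\<lambda>s. LINT u|lborel. h s u)"
proof -
  have [measurable]: "A \<in> borel_measurable borel" "w \<in> borel_measurable borel" using A w by auto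
  have "integrable (lborel \<Otimes>\<^sub>M lborel) (case_prod h)"
  proof (rule Bochner_Integration.integrable_bound)
    show "integrable (lborel \<Otimes>\<^sub>M lborel) (\<lambda>(s, u). A s * w u)"
    proof (rule lborel_pair.Fubini_integrable)
      show "integrable lborel (\<lambda>x. LINT y|lborel. norm (case (x, y) of (s, u) \<Rightarrow> A s * w u))"
        using A by (simp add: abs_mult)
      show "AE x in lborel. integrable lborel (\<lambda>y. case (x, y) of (s, u) \<Rightarrow> A s * w u)" using w by simp
    qed measurable
    show "case_prod h \<in> borel_measurable (lborel \<Otimes>\<^sub>M lborel)" by measurable
    show "AE x in lborel \<Otimes>\<^sub>M lborel. norm (case_prod h x) \<le> norm (case x of (s, u) \<Rightarrow> A s * w u)"
      using b nn by (intro AE_I2) (simp add: abs_mult split: prod.split)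
  qed
  note i = this
  show "(LINT s|lborel. LINT u|lborel. h s u) = (LINT u|lborel. LINT s|lborel. h s u)"
    using lborel_pair.Fubini_integral[OF i] by simp
  show "integrable lborel (\<lambda>u. LINT s|lborel. h s u)" using lborel_pair.integrable_snd[OF i] by simp
  show "integrable lborel (\<lambda>s. LINT u|lborel. h s u)" using lborel_pair.integrable_fst[OF i] by simp
qed

locale red_form = interval_space +
  fixes \<omega> :: real
  assumes \<omega>: "\<bar>\<omega>\<bar> < 1/2"
begin

text \<open>The kernel is kept only on the strip where \<open>Psi\<close> is known to be positive
  and is extended by zero, so that it is bounded, jointly measurable and can be integrated over the
  whole line.\<close>

definition cut_kernel :: "real \<Rightarrow> real \<Rightarrow> real \<Rightarrow> real" where
  "cut_kernel \<sigma> s u = (if 0 < s \<and> s < L \<and> 0 \<le> u then B_ker \<omega> \<sigma> s u else 0)"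

lemma cut_kernel_measurable [measurable]: "(\<lambda>(s, u). cut_kernel \<sigma> s u) \<in> borel_measurable (borel \<Otimes>\<^sub>M borel)"
  unfolding cut_kernel_def B_ker_def by measurable

text \<open>\<open>Psi\<close> decays at rate 3/4 and the exponential factor grows at rate at most
  1/4, which leaves 1/2; the weight s + u costs another 1/4. Division by \<open>Psi s\<close> is
  harmless because \<open>Psi\<close> has a positive minimum on [0, L].\<close>

lemma cut_kernel_bound:
  obtains c d where "c > 0" "d > 0" "\<And>\<sigma> s u. \<bar>\<sigma>\<bar> = 1 \<Longrightarrow> \<bar>cut_kernel \<sigma> s u\<bar> \<le> c * (indicator {0..} u * exp (- (1/2 * u)))"
    "\<And>\<sigma> s u. \<bar>\<sigma>\<bar> = 1 \<Longrightarrow> \<bar>(s + u) * cut_kernel \<sigma> s u\<bar> \<le> d * (indicator {0..} u * exp (- (1/4 * u)))"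
proof -
  obtain C where C: "C > 0" "\<And>v. v \<ge> 0 \<Longrightarrow> Psi v \<le> C * exp (- 3 * v / 4)" using Psi_decay by blast
  have "\<exists>x\<in>{0..L}. \<forall>y\<in>{0..L}. Psi x \<le> Psi y"
    using L by (intro continuous_attains_inf Psi_continuous) auto
  then obtain x0 where x0: "x0 \<in> {0..L}" "\<And>y. y \<in> {0..L} \<Longrightarrow> Psi x0 \<le> Psi y" by blast
  define m where "m = Psi x0"
  have m: "m > 0" using Psi_pos[of x0] x0 by (simp add: m_def)
  define c where "c = exp (L / 4) * C / m"
  have c: "c > 0" using C m by (simp add: c_def)
  have 1: "\<bar>cut_kernel \<sigma> s u\<bar> \<le> c * (indicator {0..} u * exp (- (1/2 * u)))" if \<sigma>: "\<bar>\<sigma>\<bar> = 1" for \<sigma> s u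
  proof (cases "0 < s \<and> s < L \<and> 0 \<le> u")
    case True
    have "\<sigma> * \<omega> * (s + u) / 2 \<le> \<bar>\<sigma> * \<omega> * (s + u) / 2\<bar>" by simp
    also have "\<dots> = \<bar>\<omega>\<bar> * (s + u) / 2" using True \<sigma> by (simp add: abs_mult)
    also have "\<dots> \<le> 1/2 * (s + u) / 2" using \<omega> True by (intro divide_right_mono mult_right_mono) auto
    finally have e1: "exp (\<sigma> * \<omega> * (s + u) / 2) \<le> exp ((s + u) / 4)" by simp
    have P: "Psi (s + u) \<le> C * exp (- 3 * (s + u) / 4)" by (rule C(2)) (use True in auto)
    have Q: "1 / Psi s \<le> 1 / m" using x0(2)[of s] True m by (intro divide_left_mono) (auto simp: m_def)
    have pos: "Psi s > 0" "Psi (s + u) > 0" using True Psi_pos by auto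
    have "\<bar>cut_kernel \<sigma> s u\<bar> = exp (\<sigma> * \<omega> * (s + u) / 2) * Psi (s + u) * (1 / Psi s)"
      using True pos by (simp add: cut_kernel_def B_ker_def abs_mult)
    also have "\<dots> \<le> exp ((s + u) / 4) * (C * exp (- 3 * (s + u) / 4)) * (1 / m)"
      by (intro mult_mono e1 P Q) (use pos C m in auto)
    also have "\<dots> = C / m * (exp ((s + u) / 4) * exp (- 3 * (s + u) / 4))" by simp
    also have "exp ((s + u) / 4) * exp (- 3 * (s + u) / 4) = exp (- (s + u) / 2)"
      unfolding exp_add[symmetric] by (simp add: field_simps)
    also have "C / m * exp (- (s + u) / 2) \<le> C / m * (exp (L/4) * exp (- (1/2 * u)))"
    proof (rule mult_left_mono)
      show "exp (- (s + u) / 2) \<le> exp (L/4) * exp (- (1/2 * u))"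
        unfolding exp_add[symmetric] using L True by simp
    qed (use C m in auto)
    finally show ?thesis using True by (simp add: c_def mult_ac)
  qed (auto simp: cut_kernel_def c less_imp_le)
  \<comment> \<open>Here s <= L and u <= 4 exp (u/4), so s + u is at most (L + 4) exp (u/4).\<close>
  define d where "d = (L + 4) * c"
  have 2: "\<bar>(s + u) * cut_kernel \<sigma> s u\<bar> \<le> d * (indicator {0..} u * exp (- (1/4 * u)))" if \<sigma>: "\<bar>\<sigma>\<bar> = 1" for \<sigma> s u
  proof (cases "0 < s \<and> s < L \<and> 0 \<le> u")
    case True
    have "s + u \<le> (L + 4) * exp (u / 4)"
    proof -
      have "u / 4 \<le> exp (u / 4)" using exp_ge_add_one_self[of "u / 4"] by linarith
      moreover have "L * 1 \<le> L * exp (u / 4)" using L True by (intro mult_left_mono) auto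
      ultimately show ?thesis using True unfolding distrib_right by linarith
    qed
    then have "\<bar>(s + u) * cut_kernel \<sigma> s u\<bar> \<le> ((L + 4) * exp (u / 4)) * (c * (indicator {0..} u * exp (- (1/2 * u))))"
      unfolding abs_mult using 1[OF \<sigma>, of s u] True by (intro mult_mono) auto
    also have "\<dots> = d * (indicator {0..} u * (exp (u / 4) * exp (- (1/2 * u))))" by (simp add: d_def mult_ac)
    also have "exp (u / 4) * exp (- (1/2 * u)) = exp (- (1/4 * u))" by (simp flip: exp_add)
    finally show ?thesis .
  qed (use c L in \<open>auto simp: cut_kernel_def d_def\<close>)
  have "d > 0" using c L by (simp add: d_def)
  then show thesis using that[OF c _ 1 2] by blast
qed

definition F :: "(real \<Rightarrow> complex) set \<Rightarrow> real \<Rightarrow> complex" where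
  "F f = restr {0<..<L} (repr f)"

lemma F_L1: assumes "f \<in> pts E" shows "integrable lborel (F f)"
    "(LINT x|lborel. cmod (F f x)) \<le> sqrt L * nrm E f"
proof -
  interpret fin_set "{0<..<L}" by (rule fin_set_interval)
  have r: "repr f \<in> pts (L2fun {0<..<L})" using L2_repr[OF assms] by simp
  show "integrable lborel (F f)" unfolding F_def by (rule L1_le_L2[OF r])
  have "measure lborel {0<..<L} = L" using L by simp
  then show "(LINT x|lborel. cmod (F f x)) \<le> sqrt L * nrm E f"
    using L1_le_L2(2)[OF r] by (simp add: F_def L2_def L2fun.quot_nrm_repr)
qed

lemma F_measurable [measurable]: "f \<in> pts E \<Longrightarrow> F f \<in> borel_measurable borel"
  using F_L1(1) by auto

lemma F_pls: "f \<in> pts E \<Longrightarrow> g \<in> pts E \<Longrightarrow> AE x in lborel. F (pls E f g) x = F f x + F g x"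
  unfolding F_def by (rule L2_repr_pls)

lemma F_scl: "f \<in> pts E \<Longrightarrow> AE x in lborel. F (scl E c f) x = c * F f x"
  unfolding F_def by (rule L2_repr_scl)

definition mom :: "real \<Rightarrow> (real \<Rightarrow> complex) set \<Rightarrow> real \<Rightarrow> complex" where
  "mom \<sigma> f u = (LINT s|lborel. F f s * of_real (cut_kernel \<sigma> s u))"

definition mom1 :: "real \<Rightarrow> (real \<Rightarrow> complex) set \<Rightarrow> real \<Rightarrow> complex" where
  "mom1 \<sigma> f u = (LINT s|lborel. F f s * of_real ((s + u) * cut_kernel \<sigma> s u))"

lemma m_mom_eq: "u \<ge> 0 \<Longrightarrow> m_mom \<omega> L \<sigma> f u = mom \<sigma> f u"
  unfolding m_mom_def mom_def set_lebesgue_integral_def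
  by (rule borel_integral_eq[of 0 L]) (auto simp: F_def restr_def cut_kernel_def indicator_def)

lemma n_mom_eq: "u \<ge> 0 \<Longrightarrow> n_mom \<omega> L \<sigma> f u = mom1 \<sigma> f u"
  unfolding n_mom_def mom1_def set_lebesgue_integral_def
  by (rule borel_integral_eq[of 0 L]) (auto simp: F_def restr_def cut_kernel_def indicator_def)

lemma moment_kernel:
  fixes k :: "real \<Rightarrow> real \<Rightarrow> real"
  assumes f: "f \<in> pts E" and k [measurable]: "case_prod k \<in> borel_measurable (borel \<Otimes>\<^sub>M borel)"
    and b: "\<And>s. \<bar>k s u\<bar> \<le> B"
  shows "integrable lborel (\<lambda>s. F f s * of_real (k s u))"
    "cmod (LINT s|lborel. F f s * of_real (k s u)) \<le> B * (LINT s|lborel. cmod (F f s))"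
proof -
  have B: "B \<ge> 0" using b[of 0] by linarith
  note Fi = integrable_norm[OF F_L1(1)[OF f]]
  have [measurable]: "F f \<in> borel_measurable borel" using f by (rule F_measurable)
  have bd: "cmod (F f s * of_real (k s u)) \<le> B * cmod (F f s)" for s
    using mult_right_mono[OF b[of s], of "cmod (F f s)"] by (simp add: norm_mult mult.commute)
  show i: "integrable lborel (\<lambda>s. F f s * of_real (k s u))"
  proof (rule Bochner_Integration.integrable_bound[OF integrable_mult_right[OF Fi, of B]])
    show "(\<lambda>s. F f s * of_real (k s u)) \<in> borel_measurable lborel" by measurable
    show "AE s in lborel. norm (F f s * of_real (k s u)) \<le> norm (B * norm (F f s))"
      using bd B by (intro AE_I2) (simp add: abs_mult)
  qed
  have "cmod (LINT s|lborel. F f s * of_real (k s u)) \<le> (LINT s|lborel. cmod (F f s * of_real (k s u)))"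
    by (rule integral_norm_bound)
  also have "\<dots> \<le> (LINT s|lborel. B * cmod (F f s))"
    using bd by (intro integral_mono integrable_norm i integrable_mult_right Fi)
  finally show "cmod (LINT s|lborel. F f s * of_real (k s u)) \<le> B * (LINT s|lborel. cmod (F f s))" by simp
qed

lemma moments:
  obtains c d where "c > 0" "d > 0"
    "\<And>\<sigma> f u. \<bar>\<sigma>\<bar> = 1 \<Longrightarrow> f \<in> pts E \<Longrightarrow> cmod (mom \<sigma> f u) \<le> c * (indicator {0..} u * exp (- (1/2 * u))) * (LINT s|lborel. cmod (F f s))"
    "\<And>\<sigma> f u. \<bar>\<sigma>\<bar> = 1 \<Longrightarrow> f \<in> pts E \<Longrightarrow> cmod (mom1 \<sigma> f u) \<le> d * (indicator {0..} u * exp (- (1/4 * u))) * (LINT s|lborel. cmod (F f s))"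
proof -
  obtain c d where cd: "c > 0" "d > 0" "\<And>\<sigma> s u. \<bar>\<sigma>\<bar> = 1 \<Longrightarrow> \<bar>cut_kernel \<sigma> s u\<bar> \<le> c * (indicator {0..} u * exp (- (1/2 * u)))"
    "\<And>\<sigma> s u. \<bar>\<sigma>\<bar> = 1 \<Longrightarrow> \<bar>(s + u) * cut_kernel \<sigma> s u\<bar> \<le> d * (indicator {0..} u * exp (- (1/4 * u)))"
    using cut_kernel_bound by blast
  show thesis
  proof (rule that[OF cd(1,2)])
    fix \<sigma> f u assume \<sigma>: "\<bar>\<sigma>\<bar> = (1::real)" and f: "f \<in> pts E"
    show "cmod (mom \<sigma> f u) \<le> c * (indicator {0..} u * exp (- (1/2 * u))) * (LINT s|lborel. cmod (F f s))"
      unfolding mom_def using cd(3)[OF \<sigma>] by (intro moment_kernel(2)[OF f, where k="\<lambda>s u. cut_kernel \<sigma> s u"]) auto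
    show "cmod (mom1 \<sigma> f u) \<le> d * (indicator {0..} u * exp (- (1/4 * u))) * (LINT s|lborel. cmod (F f s))"
      unfolding mom1_def using cd(4)[OF \<sigma>] by (intro moment_kernel(2)[OF f, where k="\<lambda>s u. (s + u) * cut_kernel \<sigma> s u"]) auto
  qed
qed

lemma moment_integrable:
  assumes "\<bar>\<sigma>\<bar> = 1" "f \<in> pts E"
  shows "integrable lborel (\<lambda>s. F f s * of_real (cut_kernel \<sigma> s u))" "integrable lborel (\<lambda>s. F f s * of_real ((s + u) * cut_kernel \<sigma> s u))"
proof -
  obtain c d where cd: "c > 0" "d > 0" "\<And>\<sigma> s u. \<bar>\<sigma>\<bar> = 1 \<Longrightarrow> \<bar>cut_kernel \<sigma> s u\<bar> \<le> c * (indicator {0..} u * exp (- (1/2 * u)))"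
    "\<And>\<sigma> s u. \<bar>\<sigma>\<bar> = 1 \<Longrightarrow> \<bar>(s + u) * cut_kernel \<sigma> s u\<bar> \<le> d * (indicator {0..} u * exp (- (1/4 * u)))"
    using cut_kernel_bound by blast
  show "integrable lborel (\<lambda>s. F f s * of_real (cut_kernel \<sigma> s u))"
    using cd(3)[OF assms(1)] by (intro moment_kernel(1)[OF assms(2), where k="\<lambda>s u. cut_kernel \<sigma> s u"]) auto
  show "integrable lborel (\<lambda>s. F f s * of_real ((s + u) * cut_kernel \<sigma> s u))"
    using cd(4)[OF assms(1)] by (intro moment_kernel(1)[OF assms(2), where k="\<lambda>s u. (s + u) * cut_kernel \<sigma> s u"]) auto
qed

lemma mom_measurable [measurable]:
  assumes "f \<in> pts E" shows "mom \<sigma> f \<in> borel_measurable borel" "mom1 \<sigma> f \<in> borel_measurable borel"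
proof -
  have [measurable]: "F f \<in> borel_measurable borel" using assms by (rule F_measurable)
  show "mom \<sigma> f \<in> borel_measurable borel" unfolding mom_def by measurable
  show "mom1 \<sigma> f \<in> borel_measurable borel" unfolding mom1_def by measurable
qed

lemma mom_pls: "\<bar>\<sigma>\<bar> = 1 \<Longrightarrow> f \<in> pts E \<Longrightarrow> g \<in> pts E \<Longrightarrow> mom \<sigma> (pls E f g) u = mom \<sigma> f u + mom \<sigma> g u"
  and mom1_pls: "\<bar>\<sigma>\<bar> = 1 \<Longrightarrow> f \<in> pts E \<Longrightarrow> g \<in> pts E \<Longrightarrow> mom1 \<sigma> (pls E f g) u = mom1 \<sigma> f u + mom1 \<sigma> g u"
proof -
  assume a: "\<bar>\<sigma>\<bar> = 1" "f \<in> pts E" "g \<in> pts E"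
  note [measurable] = F_measurable[OF a(2)] F_measurable[OF a(3)] F_measurable[OF E.pls_in[OF a(2,3)]]
  have "mom \<sigma> (pls E f g) u = (LINT s|lborel. F f s * of_real (cut_kernel \<sigma> s u) + F g s * of_real (cut_kernel \<sigma> s u))"
    unfolding mom_def using F_pls[OF a(2,3)] by (intro integral_cong_AE) (measurable, auto simp: algebra_simps)
  then show "mom \<sigma> (pls E f g) u = mom \<sigma> f u + mom \<sigma> g u"
    using moment_integrable[OF a(1,2)] moment_integrable[OF a(1,3)] by (simp add: mom_def)
  have "mom1 \<sigma> (pls E f g) u = (LINT s|lborel. F f s * of_real ((s + u) * cut_kernel \<sigma> s u) + F g s * of_real ((s + u) * cut_kernel \<sigma> s u))"
    unfolding mom1_def using F_pls[OF a(2,3)] by (intro integral_cong_AE) (measurable, auto simp: algebra_simps)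
  then show "mom1 \<sigma> (pls E f g) u = mom1 \<sigma> f u + mom1 \<sigma> g u"
    unfolding mom1_def using moment_integrable(2)[OF a(1,2), of u] moment_integrable(2)[OF a(1,3), of u]
    by (simp only: Bochner_Integration.integral_add)
qed

lemma mom_scl: "f \<in> pts E \<Longrightarrow> mom \<sigma> (scl E c f) u = c * mom \<sigma> f u"
  and mom1_scl: "f \<in> pts E \<Longrightarrow> mom1 \<sigma> (scl E c f) u = c * mom1 \<sigma> f u"
proof -
  assume a: "f \<in> pts E"
  note [measurable] = F_measurable[OF a] F_measurable[OF E.scl_in[OF a]]
  have "mom \<sigma> (scl E c f) u = (LINT s|lborel. c * (F f s * of_real (cut_kernel \<sigma> s u)))"
    unfolding mom_def using F_scl[OF a, of c] by (intro integral_cong_AE) (measurable, auto simp: algebra_simps)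
  then show "mom \<sigma> (scl E c f) u = c * mom \<sigma> f u" by (simp add: mom_def)
  have "mom1 \<sigma> (scl E c f) u = (LINT s|lborel. c * (F f s * of_real ((s + u) * cut_kernel \<sigma> s u)))"
    unfolding mom1_def using F_scl[OF a, of c] by (intro integral_cong_AE) (measurable, auto simp: algebra_simps)
  then show "mom1 \<sigma> (scl E c f) u = c * mom1 \<sigma> f u" unfolding mom1_def by (simp only: integral_mult_right_zero)
qed

text \<open>Splitting the hyperbolic cosine in \<open>K_red\<close> into its two exponentials turns the double integral over \<open>s\<close>, \<open>t\<close>
  into products of single moments, so that \<open>q_form\<close> is the integral of this density over \<open>u\<close>.\<close>

definition form_density :: "(real \<Rightarrow> complex) set \<Rightarrow> (real \<Rightarrow> complex) set \<Rightarrow> real \<Rightarrow> complex" where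
  "form_density f g u = 1/4 * (\<Sum>\<sigma>\<in>{1, -1}. mom1 \<sigma> f u * cnj (mom \<sigma> g u) + mom \<sigma> f u * cnj (mom1 \<sigma> g u))"

lemma form_density_integrable:
  obtains C where "C > 0" "\<And>f g. f \<in> pts E \<Longrightarrow> g \<in> pts E \<Longrightarrow> integrable lborel (form_density f g)"
    "\<And>f g. f \<in> pts E \<Longrightarrow> g \<in> pts E \<Longrightarrow> cmod (integral\<^sup>L lborel (form_density f g)) \<le> C * nrm E f * nrm E g"
proof -
  obtain c d where cd: "c > 0" "d > 0"
    "\<And>\<sigma> f u. \<bar>\<sigma>\<bar> = 1 \<Longrightarrow> f \<in> pts E \<Longrightarrow> cmod (mom \<sigma> f u) \<le> c * (indicator {0..} u * exp (- (1/2 * u))) * (LINT s|lborel. cmod (F f s))"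
    "\<And>\<sigma> f u. \<bar>\<sigma>\<bar> = 1 \<Longrightarrow> f \<in> pts E \<Longrightarrow> cmod (mom1 \<sigma> f u) \<le> d * (indicator {0..} u * exp (- (1/4 * u))) * (LINT s|lborel. cmod (F f s))"
    using moments by blast
  \<comment> \<open>The rate 3/4 is the sum of the rates 1/2 of \<open>mom\<close> and 1/4 of
    \<open>mom1\<close>.\<close>
  define w where "w = (\<lambda>u::real. indicator {0..} u *\<^sub>R exp (- (3/4 * u)))"
  have w: "integrable lborel w" unfolding w_def by (rule integrable_exp_decay) simp
  have w0: "0 \<le> w u" for u by (simp add: w_def)
  let ?N = "\<lambda>f. LINT s|lborel. cmod (F f s)"
  have N0: "0 \<le> ?N f" for f by (rule Bochner_Integration.integral_nonneg) simp
  have bd: "cmod (form_density f g u) \<le> c * d * ?N f * ?N g * w u" if f: "f \<in> pts E" and g: "g \<in> pts E" for f g u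
  proof -
    have p: "cmod (mom1 \<sigma> f u * cnj (mom \<sigma> g u)) \<le> c * d * ?N f * ?N g * w u" if f: "f \<in> pts E" and g: "g \<in> pts E" and \<sigma>: "\<bar>\<sigma>\<bar> = 1" for f g \<sigma>
    proof -
      have "cmod (mom1 \<sigma> f u * cnj (mom \<sigma> g u)) \<le> (d * (indicator {0..} u * exp (- (1/4 * u))) * ?N f) * (c * (indicator {0..} u * exp (- (1/2 * u))) * ?N g)"
        unfolding norm_mult complex_mod_cnj using cd(3)[OF \<sigma> g, of u] cd(4)[OF \<sigma> f, of u] N0 cd(1,2) by (intro mult_mono) auto
      also have "\<dots> = c * d * ?N f * ?N g * (indicator {0..} u * (exp (- (1/4 * u)) * exp (- (1/2 * u))))"
        by (simp add: mult_ac indicator_def)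
      also have "exp (- (1/4 * u)) * exp (- (1/2 * u)) = exp (- (3/4 * u))" by (simp flip: exp_add)
      finally show ?thesis by (simp add: w_def)
    qed
    have "cmod (form_density f g u) \<le> 1/4 * (\<Sum>\<sigma>\<in>{1, -1}. cmod (mom1 \<sigma> f u * cnj (mom \<sigma> g u)) + cmod (mom1 \<sigma> g u * cnj (mom \<sigma> f u)))"
    proof -
      have "cmod (form_density f g u) \<le> 1/4 * (\<Sum>\<sigma>\<in>{1, -1}. cmod (mom1 \<sigma> f u * cnj (mom \<sigma> g u) + mom \<sigma> f u * cnj (mom1 \<sigma> g u)))"
        unfolding form_density_def norm_mult by (intro mult_mono norm_sum) auto
      also have "\<dots> \<le> 1/4 * (\<Sum>\<sigma>\<in>{1, -1}. cmod (mom1 \<sigma> f u * cnj (mom \<sigma> g u)) + cmod (mom1 \<sigma> g u * cnj (mom \<sigma> f u)))"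
      proof (intro mult_left_mono sum_mono)
        fix \<sigma> :: real
        show "cmod (mom1 \<sigma> f u * cnj (mom \<sigma> g u) + mom \<sigma> f u * cnj (mom1 \<sigma> g u)) \<le> cmod (mom1 \<sigma> f u * cnj (mom \<sigma> g u)) + cmod (mom1 \<sigma> g u * cnj (mom \<sigma> f u))"
          using norm_triangle_ineq[of "mom1 \<sigma> f u * cnj (mom \<sigma> g u)" "mom \<sigma> f u * cnj (mom1 \<sigma> g u)"] by (simp add: norm_mult mult.commute)
      qed simp
      finally show ?thesis .
    qed
    also have "\<dots> \<le> 1/4 * (\<Sum>\<sigma>\<in>{1, -1::real}. c * d * ?N f * ?N g * w u + c * d * ?N f * ?N g * w u)"
      using p[OF f g] p[OF g f] by (intro mult_left_mono sum_mono add_mono) (auto simp: mult_ac)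
    also have "\<dots> = c * d * ?N f * ?N g * w u" by simp
    finally show ?thesis .
  qed
  have i: "integrable lborel (form_density f g)" if f: "f \<in> pts E" and g: "g \<in> pts E" for f g
  proof (rule Bochner_Integration.integrable_bound[OF integrable_mult_right[OF w, of "c * d * ?N f * ?N g"]])
    show "form_density f g \<in> borel_measurable lborel" unfolding form_density_def using mom_measurable[OF f] mom_measurable[OF g] by measurable
    show "AE u in lborel. norm (form_density f g u) \<le> norm (c * d * ?N f * ?N g * w u)"
      using order_trans[OF bd[OF f g] abs_ge_self] by (intro AE_I2) simp
  qed
  define C where "C = c * d * L * integral\<^sup>L lborel w + 1"
  have iw: "0 \<le> integral\<^sup>L lborel w" using w0 by (intro Bochner_Integration.integral_nonneg) auto
  have "cmod (integral\<^sup>L lborel (form_density f g)) \<le> C * nrm E f * nrm E g" if f: "f \<in> pts E" and g: "g \<in> pts E" for f g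
  proof -
    have "cmod (integral\<^sup>L lborel (form_density f g)) \<le> (LINT u|lborel. cmod (form_density f g u))" by (rule integral_norm_bound)
    also have "\<dots> \<le> (LINT u|lborel. c * d * ?N f * ?N g * w u)"
      using bd[OF f g] by (intro integral_mono integrable_norm i f g integrable_mult_right w)
    also have "\<dots> = c * d * (?N f * ?N g) * integral\<^sup>L lborel w" by simp
    also have "\<dots> \<le> c * d * ((sqrt L * nrm E f) * (sqrt L * nrm E g)) * integral\<^sup>L lborel w"
      using F_L1(2)[OF f] F_L1(2)[OF g] N0 cd f g L iw by (intro mult_right_mono mult_left_mono mult_mono) auto
    also have "\<dots> = (C - 1) * (nrm E f * nrm E g)"
    proof -
      have "c * d * ((sqrt L * nrm E f) * (sqrt L * nrm E g)) * integral\<^sup>L lborel w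
        = c * d * (sqrt L * sqrt L) * integral\<^sup>L lborel w * (nrm E f * nrm E g)" by (simp only: mult_ac)
      then show ?thesis using L by (simp add: C_def)
    qed
    also have "\<dots> \<le> C * (nrm E f * nrm E g)" using f g by (intro mult_right_mono mult_nonneg_nonneg) auto
    finally show ?thesis by (simp add: mult_ac)
  qed
  moreover have "C > 0" unfolding C_def using cd L iw by (intro add_nonneg_pos mult_nonneg_nonneg) auto
  ultimately show thesis using that i by blast
qed

text \<open>The kernel belonging to \<open>form_density\<close>. The weights s + u and t + u add up
  to 2 y with y = u + (s + t)/2, and the two exponentials exp(sigma omega y) to 2 cosh (omega y);
  the factor 1/4 leaves y cosh (omega y), the integrand of \<open>K_red\<close>.\<close>

definition kernel_density :: "real \<Rightarrow> real \<Rightarrow> real \<Rightarrow> real" where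
  "kernel_density s t u = 1/4 * (\<Sum>\<sigma>\<in>{1, -1}. ((s + u) * cut_kernel \<sigma> s u) * cut_kernel \<sigma> t u + cut_kernel \<sigma> s u * ((t + u) * cut_kernel \<sigma> t u))"

lemma K_red_kap:
  assumes s: "0 < s" "s < L" and t: "0 < t" "t < L"
  shows "K_red \<omega> s t = (LINT u|lborel. kernel_density s t u)"
  unfolding K_red_def set_lebesgue_integral_def
proof (intro Bochner_Integration.integral_cong refl)
  fix u :: real
  show "indicat_real {0..} u *\<^sub>R ((u + (s + t) / 2) * cosh (\<omega> * (u + (s + t) / 2)) * (Psi (s + u) / Psi s) * (Psi (t + u) / Psi t)) = kernel_density s t u"
  proof (cases "u \<ge> 0")
    case True
    define y where "y = u + (s + t) / 2"
    define P where "P = (Psi (s + u) / Psi s) * (Psi (t + u) / Psi t)"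
    have b: "cut_kernel \<sigma> s u * cut_kernel \<sigma> t u = exp (\<sigma> * (\<omega> * y)) * P" for \<sigma>
    proof -
      have "exp (\<sigma> * \<omega> * (s + u) / 2) * exp (\<sigma> * \<omega> * (t + u) / 2) = exp (\<sigma> * (\<omega> * y))"
        unfolding exp_add[symmetric] y_def by (simp add: field_simps)
      then show ?thesis using s t True by (simp add: cut_kernel_def B_ker_def P_def)
    qed
    have "kernel_density s t u = 1/4 * (\<Sum>\<sigma>\<in>{1, -1}. (2 * y) * (cut_kernel \<sigma> s u * cut_kernel \<sigma> t u))"
      unfolding kernel_density_def y_def by (intro arg_cong2[where f="(*)"] sum.cong refl) (simp add: algebra_simps)
    also have "\<dots> = y * cosh (\<omega> * y) * P" by (simp add: b cosh_def algebra_simps)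
    finally show ?thesis using True by (simp add: y_def P_def)
  qed (simp add: kernel_density_def cut_kernel_def)
qed

text \<open>Two exchanges of integrals bring u outermost: t with u for fixed s, then s with u. Both
  are justified by the majorant |F f s| |F g t| c d w(u). The remaining integrals over t and s
  factor into moments.\<close>

theorem q_form_eq:
  assumes f: "f \<in> pts E" and g: "g \<in> pts E"
  shows "q_form \<omega> L f g = integral\<^sup>L lborel (form_density f g)"
proof -
  obtain c d where cd: "c > 0" "d > 0" "\<And>\<sigma> s u. \<bar>\<sigma>\<bar> = 1 \<Longrightarrow> \<bar>cut_kernel \<sigma> s u\<bar> \<le> c * (indicator {0..} u * exp (- (1/2 * u)))"
    "\<And>\<sigma> s u. \<bar>\<sigma>\<bar> = 1 \<Longrightarrow> \<bar>(s + u) * cut_kernel \<sigma> s u\<bar> \<le> d * (indicator {0..} u * exp (- (1/4 * u)))"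
    using cut_kernel_bound by blast
  note [measurable] = F_measurable[OF f] F_measurable[OF g]
  note Fi = integrable_norm[OF F_L1(1)[OF f]] integrable_norm[OF F_L1(1)[OF g]]
  have [measurable]: "(\<lambda>(t, u). kernel_density s t u) \<in> borel_measurable (borel \<Otimes>\<^sub>M borel)" for s
    unfolding kernel_density_def by measurable
  define w where "w = (\<lambda>u::real. indicator {0..} u *\<^sub>R exp (- (3/4 * u)))"
  have w: "integrable lborel (\<lambda>u. c * d * w u)" unfolding w_def by (intro integrable_mult_right integrable_exp_decay) simp
  have kb: "\<bar>kernel_density s t u\<bar> \<le> c * d * w u" for s t u
  proof -
    have p: "\<bar>((s + u) * cut_kernel \<sigma> s u) * cut_kernel \<sigma> t u\<bar> \<le> c * d * w u" if \<sigma>: "\<bar>\<sigma>\<bar> = 1" for s t \<sigma>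
    proof -
      have "\<bar>((s + u) * cut_kernel \<sigma> s u) * cut_kernel \<sigma> t u\<bar> \<le> (d * (indicator {0..} u * exp (- (1/4 * u)))) * (c * (indicator {0..} u * exp (- (1/2 * u))))"
        unfolding abs_mult[of "(s + u) * cut_kernel \<sigma> s u"] using cd(3)[OF \<sigma>, of t u] cd(4)[OF \<sigma>, of s u] cd(1,2) by (intro mult_mono) auto
      also have "\<dots> = c * d * (indicator {0..} u * (exp (- (1/4 * u)) * exp (- (1/2 * u))))"
        by (simp add: mult_ac indicator_def)
      also have "exp (- (1/4 * u)) * exp (- (1/2 * u)) = exp (- (3/4 * u))" by (simp flip: exp_add)
      finally show ?thesis by (simp add: w_def)
    qed
    have "\<bar>kernel_density s t u\<bar> \<le> 1/4 * (\<Sum>\<sigma>\<in>{1, -1}. \<bar>((s + u) * cut_kernel \<sigma> s u) * cut_kernel \<sigma> t u\<bar> + \<bar>((t + u) * cut_kernel \<sigma> t u) * cut_kernel \<sigma> s u\<bar>)"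
      unfolding kernel_density_def abs_mult[of "1/4"]
      by (intro mult_mono order_trans[OF sum_abs] sum_mono order_trans[OF abs_triangle_ineq]) (auto simp: mult_ac)
    also have "\<dots> \<le> 1/4 * (\<Sum>\<sigma>\<in>{1, -1::real}. c * d * w u + c * d * w u)"
      using p by (intro mult_left_mono sum_mono add_mono) auto
    finally show ?thesis by simp
  qed
  have cdw: "0 \<le> c * d * w u" for u using cd by (simp add: w_def)
  let ?a = "\<lambda>s t u. F f s * cnj (F g t) * of_real (kernel_density s t u)"
  have inner: "(LINT t|lborel. ?a s t u) = 1/4 * (\<Sum>\<sigma>\<in>{1, -1}. (F f s * of_real ((s + u) * cut_kernel \<sigma> s u)) * cnj (mom \<sigma> g u) + (F f s * of_real (cut_kernel \<sigma> s u)) * cnj (mom1 \<sigma> g u))" for s u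
  proof -
    have "?a s t u = (\<Sum>\<sigma>\<in>{1, -1}. 1/4 * (F f s * of_real ((s + u) * cut_kernel \<sigma> s u)) * cnj (F g t * of_real (cut_kernel \<sigma> t u))
        + 1/4 * (F f s * of_real (cut_kernel \<sigma> s u)) * cnj (F g t * of_real ((t + u) * cut_kernel \<sigma> t u)))" for t
      by (simp add: kernel_density_def algebra_simps)
    moreover have "(LINT t|lborel. (\<Sum>\<sigma>\<in>{1, -1}. 1/4 * (F f s * of_real ((s + u) * cut_kernel \<sigma> s u)) * cnj (F g t * of_real (cut_kernel \<sigma> t u))
        + 1/4 * (F f s * of_real (cut_kernel \<sigma> s u)) * cnj (F g t * of_real ((t + u) * cut_kernel \<sigma> t u))))
      = (\<Sum>\<sigma>\<in>{1, -1}. 1/4 * (F f s * of_real ((s + u) * cut_kernel \<sigma> s u)) * cnj (mom \<sigma> g u)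
        + 1/4 * (F f s * of_real (cut_kernel \<sigma> s u)) * cnj (mom1 \<sigma> g u))"
    proof (subst Bochner_Integration.integral_sum)
      fix \<sigma> :: real assume "\<sigma> \<in> {1, -1}"
      then have \<sigma>: "\<bar>\<sigma>\<bar> = 1" by auto
      note i = moment_integrable[OF \<sigma> g, of u, THEN integrable_cnj]
      show "integrable lborel (\<lambda>t. 1/4 * (F f s * of_real ((s + u) * cut_kernel \<sigma> s u)) * cnj (F g t * of_real (cut_kernel \<sigma> t u))
        + 1/4 * (F f s * of_real (cut_kernel \<sigma> s u)) * cnj (F g t * of_real ((t + u) * cut_kernel \<sigma> t u)))"
        using i by (intro Bochner_Integration.integrable_add integrable_mult_right)
    next
      show "(\<Sum>\<sigma>\<in>{1, -1}. LINT t|lborel. 1/4 * (F f s * of_real ((s + u) * cut_kernel \<sigma> s u)) * cnj (F g t * of_real (cut_kernel \<sigma> t u))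
        + 1/4 * (F f s * of_real (cut_kernel \<sigma> s u)) * cnj (F g t * of_real ((t + u) * cut_kernel \<sigma> t u)))
        = (\<Sum>\<sigma>\<in>{1, -1}. 1/4 * (F f s * of_real ((s + u) * cut_kernel \<sigma> s u)) * cnj (mom \<sigma> g u)
        + 1/4 * (F f s * of_real (cut_kernel \<sigma> s u)) * cnj (mom1 \<sigma> g u))"
      proof (rule sum.cong[OF refl])
        fix \<sigma> :: real assume "\<sigma> \<in> {1, -1}"
        then have \<sigma>: "\<bar>\<sigma>\<bar> = 1" by auto
        note i = moment_integrable[OF \<sigma> g, of u, THEN integrable_cnj]
        show "(LINT t|lborel. 1/4 * (F f s * of_real ((s + u) * cut_kernel \<sigma> s u)) * cnj (F g t * of_real (cut_kernel \<sigma> t u))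
          + 1/4 * (F f s * of_real (cut_kernel \<sigma> s u)) * cnj (F g t * of_real ((t + u) * cut_kernel \<sigma> t u)))
          = 1/4 * (F f s * of_real ((s + u) * cut_kernel \<sigma> s u)) * cnj (mom \<sigma> g u)
          + 1/4 * (F f s * of_real (cut_kernel \<sigma> s u)) * cnj (mom1 \<sigma> g u)"
          unfolding mom_def mom1_def Bochner_Integration.integral_cnj[symmetric]
          using i by (subst Bochner_Integration.integral_add) (auto intro!: integrable_mult_right simp only: integral_mult_right_zero)
      qed
    qed
    ultimately show ?thesis by (simp add: sum_distrib_left algebra_simps)
  qed
  have "q_form \<omega> L f g = (LINT s|lborel. LINT t|lborel. LINT u|lborel. ?a s t u)"
    unfolding q_form_def set_lebesgue_integral_def
  proof (rule borel_integral_eq[of 0 L])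
    fix s :: real assume s: "s \<notin> {0, L}"
    show "indicat_real {0..L} s *\<^sub>R (LINT t|lborel. indicat_real {0..L} t *\<^sub>R (repr f s * of_real (K_red \<omega> s t) * cnj (repr g t))) =
      (LINT t|lborel. LINT u|lborel. ?a s t u)"
    proof (cases "0 < s \<and> s < L")
      case True
      have "(LINT t|lborel. indicat_real {0..L} t *\<^sub>R (repr f s * of_real (K_red \<omega> s t) * cnj (repr g t))) = (LINT t|lborel. LINT u|lborel. ?a s t u)"
      proof (rule borel_integral_eq[of 0 L])
        fix t :: real assume t: "t \<notin> {0, L}"
        show "indicat_real {0..L} t *\<^sub>R (repr f s * of_real (K_red \<omega> s t) * cnj (repr g t)) = (LINT u|lborel. ?a s t u)"
        proof (cases "0 < t \<and> t < L")
          case 2: True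
          have "(LINT u|lborel. ?a s t u) = F f s * cnj (F g t) * of_real (LINT u|lborel. kernel_density s t u)" by simp
          then show ?thesis using True 2 K_red_kap[of s t] by (simp add: F_def restr_def mult_ac)
        next
          case False
          then have "F g t = 0" "t \<notin> {0..L}" using t by (auto simp: F_def restr_def)
          then show ?thesis by simp
        qed
      qed
      then show ?thesis using True by simp
    next
      case False
      then have "F f s = 0" "s \<notin> {0..L}" using s by (auto simp: F_def restr_def)
      then show ?thesis by simp
    qed
  qed
  also have "\<dots> = (LINT s|lborel. LINT u|lborel. LINT t|lborel. ?a s t u)"
  proof (rule Bochner_Integration.integral_cong[OF refl])
    fix s
    show "(LINT t|lborel. LINT u|lborel. ?a s t u) = (LINT u|lborel. LINT t|lborel. ?a s t u)"
    proof (rule fubini_dominated(1)[of _ "\<lambda>t. cmod (F f s) * cmod (F g t)" "\<lambda>u. c * d * w u"])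
      show "cmod (?a s t u) \<le> cmod (F f s) * cmod (F g t) * (c * d * w u)" for t u
        using kb[of s t u] unfolding norm_mult complex_mod_cnj norm_of_real by (intro mult_left_mono) auto
      show "integrable lborel (\<lambda>t. cmod (F f s) * cmod (F g t))" using Fi(2) by (rule integrable_mult_right)
      show "(\<lambda>(t, u). ?a s t u) \<in> borel_measurable (borel \<Otimes>\<^sub>M borel)" by measurable
      show "integrable lborel (\<lambda>u. c * d * w u)" by (rule w)
      show "0 \<le> c * d * w u" for u by (rule cdw)
    qed simp
  qed
  also have "\<dots> = (LINT u|lborel. LINT s|lborel. LINT t|lborel. ?a s t u)"
  proof (rule fubini_dominated(1)[of _ "\<lambda>s. cmod (F f s) * (LINT t|lborel. cmod (F g t))" "\<lambda>u. c * d * w u"])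
    show "cmod (LINT t|lborel. ?a s t u) \<le> cmod (F f s) * (LINT t|lborel. cmod (F g t)) * (c * d * w u)" for s u
    proof -
      have i: "integrable lborel (\<lambda>t. cmod (F f s) * cmod (F g t) * (c * d * w u))"
        by (intro integrable_mult_left integrable_mult_right Fi)
      have le: "cmod (?a s t u) \<le> cmod (F f s) * cmod (F g t) * (c * d * w u)" for t
        using kb[of s t u] unfolding norm_mult complex_mod_cnj norm_of_real by (intro mult_left_mono) auto
      have a: "integrable lborel (\<lambda>t. ?a s t u)"
      proof (rule Bochner_Integration.integrable_bound[OF i])
        show "(\<lambda>t. ?a s t u) \<in> borel_measurable lborel" unfolding kernel_density_def by measurable
        show "AE t in lborel. norm (?a s t u) \<le> norm (cmod (F f s) * cmod (F g t) * (c * d * w u))"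
          by (intro AE_I2) (use order_trans[OF le abs_ge_self] in simp)
      qed
      have "cmod (LINT t|lborel. ?a s t u) \<le> (LINT t|lborel. cmod (?a s t u))" by (rule integral_norm_bound)
      also have "\<dots> \<le> (LINT t|lborel. cmod (F f s) * cmod (F g t) * (c * d * w u))"
        using le by (intro integral_mono integrable_norm a i)
      finally show ?thesis by simp
    qed
    show "integrable lborel (\<lambda>s. cmod (F f s) * (LINT t|lborel. cmod (F g t)))" using Fi(1) by (rule integrable_mult_left)
    show "0 \<le> cmod (F f s) * (LINT t|lborel. cmod (F g t))" for s by (intro mult_nonneg_nonneg Bochner_Integration.integral_nonneg) auto
    show "(\<lambda>(s, u). LINT t|lborel. ?a s t u) \<in> borel_measurable (borel \<Otimes>\<^sub>M borel)"
      unfolding inner using mom_measurable[OF g] by measurable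
  qed (use w cdw in auto)
  also have "\<dots> = integral\<^sup>L lborel (form_density f g)"
  proof (rule Bochner_Integration.integral_cong[OF refl])
    fix u
    have "(LINT s|lborel. (\<Sum>\<sigma>\<in>{1, -1}. (F f s * of_real ((s + u) * cut_kernel \<sigma> s u)) * cnj (mom \<sigma> g u) + (F f s * of_real (cut_kernel \<sigma> s u)) * cnj (mom1 \<sigma> g u)))
      = (\<Sum>\<sigma>\<in>{1, -1}. mom1 \<sigma> f u * cnj (mom \<sigma> g u) + mom \<sigma> f u * cnj (mom1 \<sigma> g u))"
    proof (subst Bochner_Integration.integral_sum)
      fix \<sigma> :: real assume "\<sigma> \<in> {1, -1}"
      then have \<sigma>: "\<bar>\<sigma>\<bar> = 1" by auto
      show "integrable lborel (\<lambda>s. (F f s * of_real ((s + u) * cut_kernel \<sigma> s u)) * cnj (mom \<sigma> g u) + (F f s * of_real (cut_kernel \<sigma> s u)) * cnj (mom1 \<sigma> g u))"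
        by (intro Bochner_Integration.integrable_add integrable_mult_left moment_integrable \<sigma> f)
    next
      show "(\<Sum>\<sigma>\<in>{1, -1}. LINT s|lborel. (F f s * of_real ((s + u) * cut_kernel \<sigma> s u)) * cnj (mom \<sigma> g u) + (F f s * of_real (cut_kernel \<sigma> s u)) * cnj (mom1 \<sigma> g u))
        = (\<Sum>\<sigma>\<in>{1, -1}. mom1 \<sigma> f u * cnj (mom \<sigma> g u) + mom \<sigma> f u * cnj (mom1 \<sigma> g u))"
      proof (rule sum.cong[OF refl])
        fix \<sigma> :: real assume "\<sigma> \<in> {1, -1}"
        then have \<sigma>: "\<bar>\<sigma>\<bar> = 1" by auto
        show "(LINT s|lborel. (F f s * of_real ((s + u) * cut_kernel \<sigma> s u)) * cnj (mom \<sigma> g u) + (F f s * of_real (cut_kernel \<sigma> s u)) * cnj (mom1 \<sigma> g u))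
          = mom1 \<sigma> f u * cnj (mom \<sigma> g u) + mom \<sigma> f u * cnj (mom1 \<sigma> g u)"
          by (subst Bochner_Integration.integral_add)
            (intro integrable_mult_left moment_integrable \<sigma> f, intro integrable_mult_left moment_integrable \<sigma> f, simp only: integral_mult_left_zero mom_def mom1_def)
      qed
    qed
    then show "(LINT s|lborel. LINT t|lborel. ?a s t u) = form_density f g u"
      unfolding inner form_density_def by (simp only: integral_mult_right_zero)
  qed
  finally show ?thesis .
qed

section \<open>The Hermitian form on square integrable classes and its diagonal\<close>

lemma form_density_sym: "form_density g f u = cnj (form_density f g u)"
  by (simp add: form_density_def algebra_simps)

lemma form_density_pls: "f \<in> pts E \<Longrightarrow> g \<in> pts E \<Longrightarrow> form_density (pls E f g) h u = form_density f h u + form_density g h u"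
  by (simp add: form_density_def mom_pls mom1_pls algebra_simps)

lemma form_density_scl: "f \<in> pts E \<Longrightarrow> form_density (scl E c f) h u = c * form_density f h u"
  by (simp add: form_density_def mom_scl mom1_scl algebra_simps)

theorem q_form_hermitian: "hermitian_form E (q_form \<omega> L)"
proof -
  obtain C where C: "\<And>f g. f \<in> pts E \<Longrightarrow> g \<in> pts E \<Longrightarrow> integrable lborel (form_density f g)" using form_density_integrable by blast
  show ?thesis unfolding hermitian_form_def
  proof (intro conjI ballI allI)
    fix x y z assume i: "x \<in> pts E" "y \<in> pts E" "z \<in> pts E"
    have "form_density (pls E x y) z = (\<lambda>u. form_density x z u + form_density y z u)" using form_density_pls i by auto
    then show "q_form \<omega> L (pls E x y) z = q_form \<omega> L x z + q_form \<omega> L y z"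
      using i C by (simp add: q_form_eq)
  next
    fix c x y assume i: "x \<in> pts E" "y \<in> pts E"
    have "form_density (scl E c x) y = (\<lambda>u. c * form_density x y u)" using form_density_scl i by auto
    then show "q_form \<omega> L (scl E c x) y = c * q_form \<omega> L x y" using i by (simp add: q_form_eq)
    have "form_density y x = (\<lambda>u. cnj (form_density x y u))" by (intro ext form_density_sym)
    then show "q_form \<omega> L y x = cnj (q_form \<omega> L x y)" using i by (simp add: q_form_eq)
  qed
qed

theorem q_form_bound:
  obtains C where "C > 0" "\<And>f g. f \<in> pts E \<Longrightarrow> g \<in> pts E \<Longrightarrow> cmod (q_form \<omega> L f g) \<le> C * nrm E f * nrm E g"
proof (rule form_density_integrable)
  fix C :: real
  assume "C > 0" "\<And>f g. f \<in> pts E \<Longrightarrow> g \<in> pts E \<Longrightarrow> cmod (integral\<^sup>L lborel (form_density f g)) \<le> C * nrm E f * nrm E g"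
  then show thesis using that[of C] by (simp add: q_form_eq)
qed

text \<open>For f = g the two products in \<open>form_density\<close> are conjugate to each other,
  so their sum is twice the real part that \<open>Q_Psi\<close> integrates.\<close>

theorem q_form_diag:
  assumes f: "f \<in> pts E" shows "q_form \<omega> L f f = of_real (Q_Psi \<omega> L f)"
proof -
  obtain c d where cd: "c > 0" "d > 0"
    "\<And>\<sigma> f u. \<bar>\<sigma>\<bar> = 1 \<Longrightarrow> f \<in> pts E \<Longrightarrow> cmod (mom \<sigma> f u) \<le> c * (indicator {0..} u * exp (- (1/2 * u))) * (LINT s|lborel. cmod (F f s))"
    "\<And>\<sigma> f u. \<bar>\<sigma>\<bar> = 1 \<Longrightarrow> f \<in> pts E \<Longrightarrow> cmod (mom1 \<sigma> f u) \<le> d * (indicator {0..} u * exp (- (1/4 * u))) * (LINT s|lborel. cmod (F f s))"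
    using moments by blast
  let ?N = "LINT s|lborel. cmod (F f s)"
  have N0: "0 \<le> ?N" by (rule Bochner_Integration.integral_nonneg) simp
  define w where "w = (\<lambda>u::real. indicator {0..} u *\<^sub>R exp (- (3/4 * u)))"
  have w: "integrable lborel w" unfolding w_def by (rule integrable_exp_decay) simp
  note [measurable] = mom_measurable[OF f]
  have i: "integrable lborel (\<lambda>u. Re (mom \<sigma> f u * cnj (mom1 \<sigma> f u)))" if \<sigma>: "\<bar>\<sigma>\<bar> = 1" for \<sigma>
  proof (rule Bochner_Integration.integrable_bound[OF integrable_mult_right[OF w, of "c * d * ?N * ?N"]])
    have "norm (Re (mom \<sigma> f u * cnj (mom1 \<sigma> f u))) \<le> norm (c * d * ?N * ?N * w u)" for u
    proof -
      have "norm (Re (mom \<sigma> f u * cnj (mom1 \<sigma> f u))) \<le> cmod (mom \<sigma> f u) * cmod (mom1 \<sigma> f u)"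
        using abs_Re_le_cmod[of "mom \<sigma> f u * cnj (mom1 \<sigma> f u)"] by (simp add: norm_mult)
      also have "\<dots> \<le> (c * (indicator {0..} u * exp (- (1/2 * u))) * ?N) * (d * (indicator {0..} u * exp (- (1/4 * u))) * ?N)"
        using cd(3)[OF \<sigma> f, of u] cd(4)[OF \<sigma> f, of u] N0 cd(1,2) by (intro mult_mono) auto
      also have "\<dots> = c * d * ?N * ?N * (indicator {0..} u * (exp (- (1/4 * u)) * exp (- (1/2 * u))))"
        by (simp add: mult_ac indicator_def)
      also have "exp (- (1/4 * u)) * exp (- (1/2 * u)) = exp (- (3/4 * u))" by (simp flip: exp_add)
      finally show ?thesis using cd(1,2) N0 by (simp add: w_def abs_mult)
    qed
    then show "AE u in lborel. norm (Re (mom \<sigma> f u * cnj (mom1 \<sigma> f u))) \<le> norm (c * d * ?N * ?N * w u)" by simp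
  qed measurable
  have "form_density f f = (\<lambda>u. of_real (\<Sum>\<sigma>\<in>{1, -1}. 1/2 * Re (mom \<sigma> f u * cnj (mom1 \<sigma> f u))))"
    by (intro ext complex_eqI) (simp_all add: form_density_def field_simps)
  then have "q_form \<omega> L f f = of_real (LINT u|lborel. (\<Sum>\<sigma>\<in>{1, -1}. 1/2 * Re (mom \<sigma> f u * cnj (mom1 \<sigma> f u))))"
    using q_form_eq[OF f f] by (simp only: integral_complex_of_real)
  also have "(LINT u|lborel. (\<Sum>\<sigma>\<in>{1, -1}. 1/2 * Re (mom \<sigma> f u * cnj (mom1 \<sigma> f u))))
    = (\<Sum>\<sigma>\<in>{1, -1}. 1/2 * (LINT u|lborel. Re (mom \<sigma> f u * cnj (mom1 \<sigma> f u))))"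
    using i by (subst Bochner_Integration.integral_sum) (auto intro!: integrable_mult_right simp del: times_complex.sel)
  also have "\<dots> = Q_Psi \<omega> L f"
  proof -
    have "(LINT u:{0..}|lborel. Re (m_mom \<omega> L \<sigma> f u * cnj (n_mom \<omega> L \<sigma> f u))) = (LINT u|lborel. Re (mom \<sigma> f u * cnj (mom1 \<sigma> f u)))" for \<sigma>
      unfolding set_lebesgue_integral_def
    proof (intro Bochner_Integration.integral_cong refl)
      fix u :: real
      have "mom \<sigma> f u = 0" if "u < 0" using that by (simp add: mom_def cut_kernel_def)
      then show "indicat_real {0..} u *\<^sub>R Re (m_mom \<omega> L \<sigma> f u * cnj (n_mom \<omega> L \<sigma> f u)) = Re (mom \<sigma> f u * cnj (mom1 \<sigma> f u))"
        using m_mom_eq[of u \<sigma> f] n_mom_eq[of u \<sigma> f] by (cases "u \<ge> 0") auto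
    qed
    then show ?thesis unfolding Q_Psi_def by (simp only: sum_distrib_left)
  qed
  finally show ?thesis .
qed

end

section \<open>The endpoint kernel\<close>

text \<open>The weights (1 + tau)^(3/2) and log (1 + tau) are no polynomials, and every
  differentiation of a Laplace integral multiplies the integrand by -tau. Polynomial growth covers
  both and is stable under products.\<close>

definition poly_bounded :: "(real \<Rightarrow> real) \<Rightarrow> bool" where
  "poly_bounded g \<longleftrightarrow> g \<in> borel_measurable borel \<and> (\<exists>C n. \<forall>\<tau>\<ge>0. \<bar>g \<tau>\<bar> \<le> C * (1 + \<tau>) ^ n)"

definition laplace :: "(real \<Rightarrow> real) \<Rightarrow> real \<Rightarrow> real" where
  "laplace g \<theta> = (LINT \<tau>|lborel. indicator {0..} \<tau> * (g \<tau> * exp (- (\<theta> * \<tau>))))"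

lemma poly_bounded_measurable: "poly_bounded g \<Longrightarrow> g \<in> borel_measurable borel"
  by (simp add: poly_bounded_def)

lemma poly_bounded_mult:
  assumes "poly_bounded g" "poly_bounded h" shows "poly_bounded (\<lambda>\<tau>. g \<tau> * h \<tau>)"
proof -
  note [measurable] = poly_bounded_measurable[OF assms(1)] poly_bounded_measurable[OF assms(2)]
  obtain C n D m where g: "\<And>\<tau>. \<tau> \<ge> 0 \<Longrightarrow> \<bar>g \<tau>\<bar> \<le> C * (1 + \<tau>) ^ n" and h: "\<And>\<tau>. \<tau> \<ge> 0 \<Longrightarrow> \<bar>h \<tau>\<bar> \<le> D * (1 + \<tau>) ^ m"
    using assms unfolding poly_bounded_def by blast
  have "\<bar>g \<tau> * h \<tau>\<bar> \<le> (C * D) * (1 + \<tau>) ^ (n + m)" if "\<tau> \<ge> 0" for \<tau>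
  proof -
    have "\<bar>g \<tau> * h \<tau>\<bar> \<le> (C * (1 + \<tau>) ^ n) * (D * (1 + \<tau>) ^ m)"
      unfolding abs_mult using g[OF that] h[OF that] by (intro mult_mono) (auto intro: order_trans[OF abs_ge_zero])
    then show ?thesis by (simp add: power_add mult_ac)
  qed
  moreover have "(\<lambda>\<tau>. g \<tau> * h \<tau>) \<in> borel_measurable borel" by measurable
  ultimately show ?thesis unfolding poly_bounded_def by blast
qed

lemma poly_bounded_x: "poly_bounded (\<lambda>\<tau>. 1 + \<tau>)"
  unfolding poly_bounded_def by (intro conjI exI[of _ 1]) auto

lemma poly_bounded_minus_id: "poly_bounded (\<lambda>\<tau>. - \<tau>)"
  unfolding poly_bounded_def by (intro conjI exI[of _ 1]) auto

lemma poly_bounded_powr: "poly_bounded (\<lambda>\<tau>. (1 + \<tau>) powr (3/2))"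
proof -
  have "(1 + \<tau>) powr (3/2) \<le> 1 * (1 + \<tau>) ^ 2" if "\<tau> \<ge> 0" for \<tau> :: real
    using powr_mono[of "3/2" 2 "1 + \<tau>"] that by (simp add: powr_numeral)
  then show ?thesis unfolding poly_bounded_def by (intro conjI exI[of _ 1] exI[of _ 2]) auto
qed

lemma poly_bounded_ln: "poly_bounded (\<lambda>\<tau>. ln (1 + \<tau>))"
proof -
  have "\<bar>ln (1 + \<tau>)\<bar> \<le> 1 * (1 + \<tau>) ^ 1" if "\<tau> \<ge> 0" for \<tau> :: real
    using ln_bound[of "1 + \<tau>"] that by simp
  then show ?thesis unfolding poly_bounded_def by (intro conjI exI[of _ 1] exI[of _ 1]) auto
qed

lemma laplace_integrable:
  assumes g: "poly_bounded g" and \<theta>: "\<theta> > 0"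
  shows "integrable lborel (\<lambda>\<tau>. indicator {0..} \<tau> * (g \<tau> * exp (- (\<theta> * \<tau>))))"
proof -
  note [measurable] = poly_bounded_measurable[OF g]
  obtain C n where C: "\<And>\<tau>. \<tau> \<ge> 0 \<Longrightarrow> \<bar>g \<tau>\<bar> \<le> C * (1 + \<tau>) ^ n" using g unfolding poly_bounded_def by blast
  have C0: "C \<ge> 0" using C[of 0] by simp
  \<comment> \<open>Each factor 1 + tau is traded for M exp (epsilon tau); n of them cost at most
    half of theta, and the other half keeps the integrand integrable. The 2 in the denominator
    covers n = 0.\<close>
  define \<epsilon> where "\<epsilon> = \<theta> / (2 * real n + 2)"
  have \<epsilon>: "\<epsilon> > 0" "real n * \<epsilon> \<le> \<theta> / 2" using \<theta> by (auto simp: \<epsilon>_def field_simps)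
  define M where "M = max 1 (1 / \<epsilon>)"
  have M: "M \<ge> 1" "M * \<epsilon> \<ge> 1" using \<epsilon> by (auto simp: M_def max_def field_simps)
  have bd: "\<bar>g \<tau> * exp (- (\<theta> * \<tau>))\<bar> \<le> C * M ^ n * exp (- (\<theta> / 2 * \<tau>))" if \<tau>: "\<tau> \<ge> 0" for \<tau>
  proof -
    have "1 + \<tau> \<le> M * (1 + \<epsilon> * \<tau>)"
    proof -
      have "1 * \<tau> \<le> (M * \<epsilon>) * \<tau>" using M \<tau> by (intro mult_right_mono) auto
      then show ?thesis using M by (simp add: algebra_simps)
    qed
    also have "\<dots> \<le> M * exp (\<epsilon> * \<tau>)" using M exp_ge_add_one_self[of "\<epsilon> * \<tau>"] by (intro mult_left_mono) auto
    finally have "(1 + \<tau>) ^ n \<le> (M * exp (\<epsilon> * \<tau>)) ^ n" using \<tau> by (intro power_mono) auto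
    also have "\<dots> = M ^ n * exp (real n * \<epsilon> * \<tau>)" by (simp add: power_mult_distrib mult.assoc flip: exp_of_nat_mult)
    also have "\<dots> \<le> M ^ n * exp (\<theta> / 2 * \<tau>)"
      using M mult_right_mono[OF \<epsilon>(2) \<tau>] by (intro mult_left_mono) auto
    finally have "C * (1 + \<tau>) ^ n \<le> C * (M ^ n * exp (\<theta> / 2 * \<tau>))" using C0 by (intro mult_left_mono)
    then have "\<bar>g \<tau>\<bar> * exp (- (\<theta> * \<tau>)) \<le> C * (M ^ n * exp (\<theta> / 2 * \<tau>)) * exp (- (\<theta> * \<tau>))"
      using C[OF \<tau>] by (intro mult_right_mono) auto
    also have "\<dots> = C * M ^ n * (exp (\<theta> / 2 * \<tau>) * exp (- (\<theta> * \<tau>)))" by simp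
    also have "exp (\<theta> / 2 * \<tau>) * exp (- (\<theta> * \<tau>)) = exp (- (\<theta> / 2 * \<tau>))" unfolding exp_add[symmetric] by (simp add: field_simps)
    finally show ?thesis by (simp add: abs_mult)
  qed
  have i: "integrable lborel (\<lambda>\<tau>. C * M ^ n * (indicator {0..} \<tau> *\<^sub>R exp (- (\<theta> / 2 * \<tau>))))"
    using \<theta> by (intro integrable_mult_right integrable_exp_decay) auto
  show ?thesis
  proof (rule Bochner_Integration.integrable_bound[OF i])
    show "AE \<tau> in lborel. norm (indicator {0..} \<tau> * (g \<tau> * exp (- (\<theta> * \<tau>)))) \<le> norm (C * M ^ n * (indicator {0..} \<tau> *\<^sub>R exp (- (\<theta> / 2 * \<tau>))))"
      using order_trans[OF bd abs_ge_self] by (intro AE_I2) (auto simp: indicator_def)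
  qed measurable
qed

text \<open>Mean value inequality on x >= theta/2: a majorant of the difference quotients that does
  not depend on h.\<close>

lemma exp_quotient_bound:
  fixes \<theta> h \<tau> :: real
  assumes "\<bar>h\<bar> \<le> \<theta> / 2" "h \<noteq> 0" "\<tau> \<ge> 0"
  shows "\<bar>(exp (- ((\<theta> + h) * \<tau>)) - exp (- (\<theta> * \<tau>))) / h\<bar> \<le> \<tau> * exp (- (\<theta> / 2 * \<tau>))"
proof -
  have "\<bar>exp (- ((\<theta> + h) * \<tau>)) - exp (- (\<theta> * \<tau>))\<bar> \<le> (\<tau> * exp (- (\<theta> / 2 * \<tau>))) * \<bar>(\<theta> + h) - \<theta>\<bar>"
  proof (rule field_differentiable_bound[of "{\<theta> / 2..}" "\<lambda>x. exp (- (x * \<tau>))" "\<lambda>x. - \<tau> * exp (- (x * \<tau>))", unfolded real_norm_def])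
    show "((\<lambda>x. exp (- (x * \<tau>))) has_field_derivative - \<tau> * exp (- (x * \<tau>))) (at x within {\<theta> / 2..})" for x
      by (auto intro!: derivative_eq_intros)
    show "\<bar>- \<tau> * exp (- (x * \<tau>))\<bar> \<le> \<tau> * exp (- (\<theta> / 2 * \<tau>))" if "x \<in> {\<theta> / 2..}" for x
      using mult_right_mono[of "\<theta> / 2" x \<tau>] that assms by (auto simp: abs_mult intro!: mult_left_mono)
  qed (use assms in auto)
  then show ?thesis using assms(2) by (simp add: abs_divide divide_le_eq)
qed

lemma laplace_deriv:
  assumes g: "poly_bounded g" and \<theta>: "\<theta> > 0"
  shows "(laplace g has_real_derivative laplace (\<lambda>\<tau>. g \<tau> * (- \<tau>)) \<theta>) (at \<theta>)"
  unfolding DERIV_def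
proof (subst tendsto_at_iff_sequentially, intro allI impI)
  note [measurable] = poly_bounded_measurable[OF g]
  fix X :: "nat \<Rightarrow> real" assume X: "\<forall>i. X i \<in> UNIV - {0}" and X0: "X \<longlonglongrightarrow> 0"
  have "\<forall>\<^sub>F i in sequentially. \<bar>X i\<bar> < \<theta> / 2" using tendsto_rabs[OF X0] \<theta> by (intro order_tendstoD(2)[of _ "\<bar>0\<bar>"]) auto
  \<comment> \<open>Dropping finitely many terms keeps theta + X i above theta/2, where one majorant
    serves all difference quotients.\<close>
  then obtain N where N: "\<And>i. i \<ge> N \<Longrightarrow> \<bar>X i\<bar> < \<theta> / 2" unfolding eventually_sequentially by blast
  let ?q = "\<lambda>i \<tau>. indicator {0..} \<tau> * (g \<tau> * ((exp (- ((\<theta> + X (i + N)) * \<tau>)) - exp (- (\<theta> * \<tau>))) / X (i + N)))"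
  have "(\<lambda>i. LINT \<tau>|lborel. ?q i \<tau>) \<longlonglongrightarrow> (LINT \<tau>|lborel. indicator {0..} \<tau> * (g \<tau> * (- \<tau>) * exp (- (\<theta> * \<tau>))))"
  proof (rule integral_dominated_convergence[where w="\<lambda>\<tau>. \<bar>indicator {0..} \<tau> * (g \<tau> * (- \<tau>) * exp (- (\<theta> / 2 * \<tau>)))\<bar>"])
    show "integrable lborel (\<lambda>\<tau>. \<bar>indicator {0..} \<tau> * (g \<tau> * (- \<tau>) * exp (- (\<theta> / 2 * \<tau>)))\<bar>)"
      using \<theta> by (intro integrable_abs laplace_integrable poly_bounded_mult g poly_bounded_minus_id) auto
    show "AE \<tau> in lborel. norm (?q i \<tau>) \<le> \<bar>indicator {0..} \<tau> * (g \<tau> * (- \<tau>) * exp (- (\<theta> / 2 * \<tau>)))\<bar>" for i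
    proof (intro AE_I2)
      fix \<tau> :: real
      have "\<bar>g \<tau>\<bar> * \<bar>(exp (- ((\<theta> + X (i + N)) * \<tau>)) - exp (- (\<theta> * \<tau>))) / X (i + N)\<bar> \<le> \<bar>g \<tau>\<bar> * (\<tau> * exp (- (\<theta> / 2 * \<tau>)))" if "\<tau> \<ge> 0"
        using N[of "i + N"] X that by (intro mult_left_mono exp_quotient_bound) (auto intro: less_imp_le)
      then show "norm (?q i \<tau>) \<le> \<bar>indicator {0..} \<tau> * (g \<tau> * (- \<tau>) * exp (- (\<theta> / 2 * \<tau>)))\<bar>"
        by (cases "\<tau> \<ge> 0") (simp_all add: abs_mult mult.assoc)
    qed
    show "AE \<tau> in lborel. (\<lambda>i. ?q i \<tau>) \<longlonglongrightarrow> indicator {0..} \<tau> * (g \<tau> * (- \<tau>) * exp (- (\<theta> * \<tau>)))"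
    proof (intro AE_I2)
      fix \<tau> :: real
      have "((\<lambda>x. exp (- (x * \<tau>))) has_real_derivative - \<tau> * exp (- (\<theta> * \<tau>))) (at \<theta>)" by (auto intro!: derivative_eq_intros)
      then have "((\<lambda>h. (exp (- ((\<theta> + h) * \<tau>)) - exp (- (\<theta> * \<tau>))) / h) \<longlongrightarrow> - \<tau> * exp (- (\<theta> * \<tau>))) (at 0)"
        by (simp add: DERIV_def)
      moreover have "filterlim (\<lambda>i. X (i + N)) (at 0) sequentially"
        using X LIMSEQ_ignore_initial_segment[OF X0, of N] by (simp add: filterlim_at)
      ultimately have "(\<lambda>i. (exp (- ((\<theta> + X (i + N)) * \<tau>)) - exp (- (\<theta> * \<tau>))) / X (i + N)) \<longlonglongrightarrow> - \<tau> * exp (- (\<theta> * \<tau>))"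
        by (rule filterlim_compose)
      then have "(\<lambda>i. ?q i \<tau>) \<longlonglongrightarrow> indicator {0..} \<tau> * (g \<tau> * (- \<tau> * exp (- (\<theta> * \<tau>))))" by (intro tendsto_intros)
      then show "(\<lambda>i. ?q i \<tau>) \<longlonglongrightarrow> indicator {0..} \<tau> * (g \<tau> * (- \<tau>) * exp (- (\<theta> * \<tau>)))" by (simp only: mult.assoc)
    qed
  qed measurable
  moreover have "(LINT \<tau>|lborel. ?q i \<tau>) = (laplace g (\<theta> + X (i + N)) - laplace g \<theta>) / X (i + N)" for i
  proof -
    have p: "\<theta> + X (i + N) > 0" using N[of "i + N"] \<theta> by (auto simp: abs_less_iff)
    have "?q i \<tau> = (indicator {0..} \<tau> * (g \<tau> * exp (- ((\<theta> + X (i + N)) * \<tau>))) - indicator {0..} \<tau> * (g \<tau> * exp (- (\<theta> * \<tau>)))) / X (i + N)" for \<tau>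
      by (simp add: diff_divide_distrib right_diff_distrib)
    then show ?thesis
      unfolding laplace_def by (simp only: integral_divide_zero Bochner_Integration.integral_diff[OF laplace_integrable[OF g p] laplace_integrable[OF g \<theta>]])
  qed
  ultimately have "(\<lambda>i. (laplace g (\<theta> + X (i + N)) - laplace g \<theta>) / X (i + N)) \<longlonglongrightarrow> laplace (\<lambda>\<tau>. g \<tau> * (- \<tau>)) \<theta>"
    by (simp only: laplace_def)
  then show "((\<lambda>h. (laplace g (\<theta> + h) - laplace g \<theta>) / h) \<circ> X) \<longlonglongrightarrow> laplace (\<lambda>\<tau>. g \<tau> * (- \<tau>)) \<theta>"
    unfolding o_def by (rule LIMSEQ_offset)
qed

text \<open>A class of functions on the open quadrant \<open>s, t > 0\<close> that contains \<open>K_B\<close> and is closed under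
  both partial derivatives.\<close>

inductive symb :: "(real \<Rightarrow> real \<Rightarrow> real) \<Rightarrow> bool" where
  symb_const: "symb (\<lambda>s t. c)"
| symb_s: "symb (\<lambda>s t. s)"
| symb_t: "symb (\<lambda>s t. t)"
| symb_es: "symb (\<lambda>s t. exp s)"
| symb_et: "symb (\<lambda>s t. exp t)"
| symb_cs: "symb (\<lambda>s t. 1 / (pi * exp s - pi))"
| symb_ct: "symb (\<lambda>s t. 1 / (pi * exp t - pi))"
| symb_add: "symb f \<Longrightarrow> symb g \<Longrightarrow> symb (\<lambda>s t. f s t + g s t)"
| symb_mult: "symb f \<Longrightarrow> symb g \<Longrightarrow> symb (\<lambda>s t. f s t * g s t)"
| symb_laplace: "poly_bounded g \<Longrightarrow> a \<ge> 0 \<Longrightarrow> b \<ge> 0 \<Longrightarrow> c \<ge> 0 \<Longrightarrow> a + b + c > 0 \<Longrightarrow>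
    symb (\<lambda>s t. laplace g (a * exp s + b * exp t + c))"

lemma symb_diff: "symb f \<Longrightarrow> symb g \<Longrightarrow> symb (\<lambda>s t. f s t - g s t)"
  using symb_add[of f "\<lambda>s t. (-1) * g s t"] symb_mult[OF symb_const[of "-1"], of g] by simp

lemma laplace_arg_pos:
  fixes a b c :: real
  assumes "a \<ge> 0" "b \<ge> 0" "c \<ge> 0" "a + b + c > 0" shows "a * exp s + b * exp t + c > 0"
  using assms by (smt (verit) exp_gt_zero mult_nonneg_nonneg mult_pos_pos)

lemma symb_deriv_s:
  "symb f \<Longrightarrow> \<exists>f'. symb f' \<and> (\<forall>s>0. \<forall>t>0. ((\<lambda>s. f s t) has_real_derivative f' s t) (at s))"
proof (induction rule: symb.induct)
  case (symb_const c)
  show ?case by (rule exI[of _ "\<lambda>s t. 0"]) (auto intro: symb.symb_const)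
next
  case symb_s
  show ?case by (rule exI[of _ "\<lambda>s t. 1"]) (auto intro: symb.symb_const)
next
  case symb_t
  show ?case by (rule exI[of _ "\<lambda>s t. 0"]) (auto intro: symb.symb_const)
next
  case symb_es
  show ?case by (rule exI[of _ "\<lambda>s t. exp s"]) (auto intro: symb.symb_es)
next
  case symb_et
  show ?case by (rule exI[of _ "\<lambda>s t. 0"]) (auto intro: symb.symb_const)
next
  case symb_cs
  have "symb (\<lambda>s t. (-pi) * exp s * (1 / (pi * exp s - pi)) * (1 / (pi * exp s - pi)))"
    by (intro symb.symb_mult symb.symb_const symb.symb_es symb.symb_cs)
  moreover have "((\<lambda>s. 1 / (pi * exp s - pi)) has_real_derivative (-pi) * exp s * (1 / (pi * exp s - pi)) * (1 / (pi * exp s - pi))) (at s)"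
    if "s > 0" for s :: real
    using that by (auto intro!: derivative_eq_intros simp: power2_eq_square)
  ultimately show ?case by blast
next
  case symb_ct
  show ?case by (rule exI[of _ "\<lambda>s t. 0"]) (auto intro: symb.symb_const)
next
  case (symb_add f g)
  then obtain f' g' where "symb f'" "symb g'" "\<forall>s>0. \<forall>t>0. ((\<lambda>s. f s t) has_real_derivative f' s t) (at s)"
    "\<forall>s>0. \<forall>t>0. ((\<lambda>s. g s t) has_real_derivative g' s t) (at s)" by blast
  then show ?case by (intro exI[of _ "\<lambda>s t. f' s t + g' s t"]) (auto intro: symb.symb_add DERIV_add)
next
  case (symb_mult f g)
  then obtain f' g' where d: "symb f'" "symb g'" "\<forall>s>0. \<forall>t>0. ((\<lambda>s. f s t) has_real_derivative f' s t) (at s)"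
    "\<forall>s>0. \<forall>t>0. ((\<lambda>s. g s t) has_real_derivative g' s t) (at s)" by blast
  have "symb (\<lambda>s t. f' s t * g s t + g' s t * f s t)" using d(1,2) symb_mult(1,2) by (intro symb.intros)
  moreover have "((\<lambda>s. f s t * g s t) has_real_derivative f' s t * g s t + g' s t * f s t) (at s)" if "s > 0" "t > 0" for s t
    using DERIV_mult[of "\<lambda>s. f s t" "f' s t" s UNIV "\<lambda>s. g s t" "g' s t"] d(3,4) that by simp
  ultimately show ?case by (intro exI[of _ "\<lambda>s t. f' s t * g s t + g' s t * f s t"]) simp
next
  case (symb_laplace g a b c)
  have "symb (\<lambda>s t. laplace (\<lambda>\<tau>. g \<tau> * (- \<tau>)) (a * exp s + b * exp t + c) * (a * exp s))"
    using symb_laplace by (intro symb.intros poly_bounded_mult poly_bounded_minus_id)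
  moreover have "((\<lambda>s. laplace g (a * exp s + b * exp t + c)) has_real_derivative
      laplace (\<lambda>\<tau>. g \<tau> * (- \<tau>)) (a * exp s + b * exp t + c) * (a * exp s)) (at s)" for s t
  proof -
    have p: "a * exp s + b * exp t + c > 0" by (rule laplace_arg_pos[OF symb_laplace(2-5)])
    have "((\<lambda>s. a * exp s + b * exp t + c) has_real_derivative a * exp s) (at s)"
      by (auto intro!: derivative_eq_intros)
    from DERIV_chain2[OF laplace_deriv[OF symb_laplace(1) p] this] show ?thesis .
  qed
  ultimately show ?case
    by (intro exI[of _ "\<lambda>s t. laplace (\<lambda>\<tau>. g \<tau> * (- \<tau>)) (a * exp s + b * exp t + c) * (a * exp s)"] conjI allI impI)
qed

lemma symb_swap: "symb f \<Longrightarrow> symb (\<lambda>s t. f t s)"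
proof (induction rule: symb.induct)
  case (symb_laplace g a b c)
  have "symb (\<lambda>s t. laplace g (b * exp s + a * exp t + c))" using symb_laplace by (intro symb.symb_laplace) auto
  then show ?case by (simp add: add.commute)
qed (auto intro: symb.intros)

lemma symb_deriv_t:
  assumes "symb f" shows "\<exists>f'. symb f' \<and> (\<forall>s>0. \<forall>t>0. ((\<lambda>t. f s t) has_real_derivative f' s t) (at t))"
proof -
  obtain f' where "symb f'" "\<forall>s>0. \<forall>t>0. ((\<lambda>s. f t s) has_real_derivative f' s t) (at s)"
    using symb_deriv_s[OF symb_swap[OF assms]] by blast
  then show ?thesis using symb_swap[of f'] by blast
qed

lemma laplace_measurable [measurable]: "poly_bounded g \<Longrightarrow> laplace g \<in> borel_measurable borel"
proof -
  assume "poly_bounded g"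
  note [measurable] = poly_bounded_measurable[OF this]
  show ?thesis unfolding laplace_def by measurable
qed

lemma symb_diag_measurable: "symb f \<Longrightarrow> (\<lambda>a. f a a) \<in> borel_measurable borel"
proof (induction rule: symb.induct)
  case (symb_laplace g a b c)
  note [measurable] = laplace_measurable[OF symb_laplace(1)]
  show ?case by measurable
next
  case (symb_add f g)
  note [measurable] = symb_add.IH
  show ?case by measurable
next
  case (symb_mult f g)
  note [measurable] = symb_mult.IH
  show ?case by measurable
qed measurable

text \<open>An identity on the open quadrant survives differentiation because \<open>deriv\<close>
  at an interior point depends only on nearby values, and the class \<open>symb\<close> takes up
  each further derivative.\<close>

lemma symb_higher_t:
  assumes "symb f" and "\<And>s t. s > 0 \<Longrightarrow> t > 0 \<Longrightarrow> K s t = f s t"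
  shows "\<exists>g. symb g \<and> (\<forall>s>0. \<forall>t>0. (deriv ^^ j) (\<lambda>t. K s t) t = g s t)"
proof (induction j)
  case 0
  then show ?case using assms by auto
next
  case (Suc j)
  then obtain g where g: "symb g" "\<forall>s>0. \<forall>t>0. (deriv ^^ j) (\<lambda>t. K s t) t = g s t" by blast
  obtain g' where g': "symb g'" "\<forall>s>0. \<forall>t>0. ((\<lambda>t. g s t) has_real_derivative g' s t) (at t)"
    using symb_deriv_t[OF g(1)] by blast
  have "(deriv ^^ Suc j) (\<lambda>t. K s t) t = g' s t" if st: "s > 0" "t > 0" for s t
  proof -
    have "((deriv ^^ j) (\<lambda>t. K s t) has_real_derivative g' s t) (at t)"
      by (rule has_field_derivative_transform_within_open[of "\<lambda>t. g s t" _ _ "{0<..}"]) (use st g g' in auto)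
    then show ?thesis by (simp add: DERIV_imp_deriv)
  qed
  with g' show ?case by blast
qed

text \<open>The inner t-derivative is again in the class; with the variables swapped the outer
  s-derivative becomes a second case of \<open>symb_higher_t\<close>, and restriction to the
  diagonal is measurable.\<close>

lemma symb_mixed:
  assumes "symb f" and "\<And>s t. s > 0 \<Longrightarrow> t > 0 \<Longrightarrow> K s t = f s t"
  shows "\<exists>G. G \<in> borel_measurable borel \<and> (\<forall>a>0. (deriv ^^ i) (\<lambda>s. (deriv ^^ j) (\<lambda>t. K s t) a) a = G a)"
proof -
  obtain g where g: "symb g" "\<forall>s>0. \<forall>t>0. (deriv ^^ j) (\<lambda>t. K s t) t = g s t"
    using symb_higher_t[OF assms] by blast
  have "\<exists>h. symb h \<and> (\<forall>s>0. \<forall>t>0. (deriv ^^ i) (\<lambda>t. (\<lambda>s t. (deriv ^^ j) (\<lambda>t'. K t t') s) s t) t = h s t)"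
    by (rule symb_higher_t[OF symb_swap[OF g(1)]]) (use g(2) in auto)
  then obtain h where h: "symb h" "\<forall>s>0. \<forall>t>0. (deriv ^^ i) (\<lambda>t. (deriv ^^ j) (\<lambda>t'. K t t') s) t = h s t" by auto
  then show ?thesis using symb_diag_measurable[OF h(1)] by (intro exI[of _ "\<lambda>a. h a a"]) auto
qed

section \<open>Reduction of the endpoint kernel to Laplace integrals\<close>

definition D_exp :: "real \<Rightarrow> real \<Rightarrow> real" where
  "D_exp l \<tau> = (1 - l * (1 + \<tau>)) * exp (- (l * \<tau>))"

lemma D_exp_deriv: "((\<lambda>t. (1 + t) * exp (- (l * t))) has_real_derivative D_exp l \<tau>) (at \<tau>)"
  by (auto intro!: derivative_eq_intros simp: D_exp_def algebra_simps)

lemma D_F: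
  assumes "s > 0" shows "D_end (F_end s) \<tau> = 1 / (pi * exp s - pi) * (D_exp (pi * exp s) \<tau> - D_exp pi \<tau>)"
proof -
  have "(1 + t) * F_end s t = 1 / (pi * exp s - pi) * ((1 + t) * exp (- (pi * exp s * t)) - (1 + t) * exp (- (pi * t)))" for t
    using assms by (simp add: F_end_def right_diff_distrib diff_divide_distrib)
  then show ?thesis
    unfolding D_end_def by (simp only:) (intro DERIV_imp_deriv DERIV_cmult DERIV_diff D_exp_deriv)
qed

lemma D_H:
  assumes "s > 0" shows "D_end (H_end s) \<tau> = s * (1 / (pi * exp s - pi)) * D_exp (pi * exp s) \<tau>"
proof -
  have "(1 + t) * H_end s t = s * (1 / (pi * exp s - pi)) * ((1 + t) * exp (- (pi * exp s * t)))" for t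
    using assms by (simp add: H_end_def)
  then show ?thesis
    unfolding D_end_def by (simp only:) (intro DERIV_imp_deriv DERIV_cmult D_exp_deriv)
qed

text \<open>The integral of w times D_exp l times D_exp m over the half line: with x = 1 + tau the
  product of the polynomial factors is 1 - (l + m) x + l m x^2.\<close>

definition laplace_pair :: "(real \<Rightarrow> real) \<Rightarrow> real \<Rightarrow> real \<Rightarrow> real" where
  "laplace_pair w l m = laplace w (l + m) + (-1) * (l + m) * laplace (\<lambda>\<tau>. w \<tau> * (1 + \<tau>)) (l + m)
     + l * m * laplace (\<lambda>\<tau>. w \<tau> * (1 + \<tau>) * (1 + \<tau>)) (l + m)"

lemma laplace_pair_has:
  assumes w: "poly_bounded w" and lm: "l > 0" "m > 0"
  shows "has_bochner_integral lborel (\<lambda>\<tau>. indicator {0..} \<tau> * (w \<tau> * D_exp l \<tau> * D_exp m \<tau>)) (laplace_pair w l m)"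
proof -
  have p: "l + m > 0" using lm by simp
  have 1: "has_bochner_integral lborel (\<lambda>\<tau>. indicator {0..} \<tau> * (g \<tau> * exp (- ((l + m) * \<tau>)))) (laplace g (l + m))" if "poly_bounded g" for g
    using laplace_integrable[OF that p] unfolding laplace_def by (rule has_bochner_integral_integrable)
  have "has_bochner_integral lborel (\<lambda>\<tau>. indicator {0..} \<tau> * (w \<tau> * exp (- ((l + m) * \<tau>)))
      + (-1) * (l + m) * (indicator {0..} \<tau> * (w \<tau> * (1 + \<tau>) * exp (- ((l + m) * \<tau>))))
      + l * m * (indicator {0..} \<tau> * (w \<tau> * (1 + \<tau>) * (1 + \<tau>) * exp (- ((l + m) * \<tau>))))) (laplace_pair w l m)"
    unfolding laplace_pair_def by (intro has_bochner_integral_add has_bochner_integral_mult_right 1 poly_bounded_mult w poly_bounded_x)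
  moreover have "exp (- ((l + m) * \<tau>)) = exp (- (l * \<tau>)) * exp (- (m * \<tau>))" for \<tau>
    by (simp add: algebra_simps flip: exp_add)
  ultimately show ?thesis by (elim has_bochner_integral_cong[THEN iffD1, rotated -1]) (auto simp: D_exp_def algebra_simps)
qed

lemma laplace_pair_symb:
  assumes w: "poly_bounded w" and "a \<ge> 0" "c \<ge> 0" "a + c > 0" "b \<ge> 0" "d \<ge> 0" "b + d > 0"
  shows "symb (\<lambda>s t. laplace_pair w (a * exp s + c) (b * exp t + d))"
proof -
  have e: "(a * exp s + c) + (b * exp t + d) = a * exp s + b * exp t + (c + d)" for s t :: real by simp
  show ?thesis unfolding laplace_pair_def e using assms
    by (intro symb_add symb_mult symb_const symb_es symb_et symb_laplace poly_bounded_mult poly_bounded_x w) auto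
qed

text \<open>The endpoint kernel with all products of differences multiplied out. The padded
  arguments, such as \<open>pi * exp s + 0\<close> and \<open>0 * exp s + pi\<close>, fit the
  pattern of \<open>laplace_pair_symb\<close>.\<close>

definition K_sym :: "real \<Rightarrow> real \<Rightarrow> real" where
  "K_sym s t = (1 / (pi * exp s - pi)) * (1 / (pi * exp t - pi)) *
    (laplace_pair (\<lambda>\<tau>. (1 + \<tau>) powr (3/2) * ln (1 + \<tau>)) (pi * exp s + 0) (pi * exp t + 0)
     - laplace_pair (\<lambda>\<tau>. (1 + \<tau>) powr (3/2) * ln (1 + \<tau>)) (pi * exp s + 0) (0 * exp t + pi)
     - laplace_pair (\<lambda>\<tau>. (1 + \<tau>) powr (3/2) * ln (1 + \<tau>)) (0 * exp s + pi) (pi * exp t + 0)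
     + laplace_pair (\<lambda>\<tau>. (1 + \<tau>) powr (3/2) * ln (1 + \<tau>)) (0 * exp s + pi) (0 * exp t + pi)
     + 1/2 * t * (laplace_pair (\<lambda>\<tau>. (1 + \<tau>) powr (3/2)) (pi * exp s + 0) (pi * exp t + 0)
                  - laplace_pair (\<lambda>\<tau>. (1 + \<tau>) powr (3/2)) (0 * exp s + pi) (pi * exp t + 0))
     + 1/2 * s * (laplace_pair (\<lambda>\<tau>. (1 + \<tau>) powr (3/2)) (pi * exp s + 0) (pi * exp t + 0)
                  - laplace_pair (\<lambda>\<tau>. (1 + \<tau>) powr (3/2)) (pi * exp s + 0) (0 * exp t + pi)))"

lemma K_sym_symb: "symb K_sym"
proof -
  have "symb (\<lambda>s t. K_sym s t)"
    unfolding K_sym_def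
    by (intro symb_add symb_mult symb_diff symb_const symb_cs symb_ct symb_s symb_t laplace_pair_symb poly_bounded_mult poly_bounded_powr poly_bounded_ln) auto
  then show ?thesis by simp
qed

lemma K_B_eq:
  assumes s: "s > 0" and t: "t > 0" shows "K_B s t = K_sym s t"
proof -
  let ?w = "\<lambda>\<tau>. (1 + \<tau>) powr (3/2) * ln (1 + \<tau>)" and ?v = "\<lambda>\<tau>::real. (1 + \<tau>) powr (3/2)"
  let ?l = "pi * exp s" and ?m = "pi * exp t"
  have w: "poly_bounded ?w" "poly_bounded ?v" by (intro poly_bounded_mult poly_bounded_powr poly_bounded_ln)+
  have p: "?l > 0" "?m > 0" "pi > 0" by auto
  have "has_bochner_integral lborel (\<lambda>\<tau>. (1 / (pi * exp s - pi)) * (1 / (pi * exp t - pi)) *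
    (indicator {0..} \<tau> * (?w \<tau> * D_exp ?l \<tau> * D_exp ?m \<tau>) - indicator {0..} \<tau> * (?w \<tau> * D_exp ?l \<tau> * D_exp pi \<tau>)
     - indicator {0..} \<tau> * (?w \<tau> * D_exp pi \<tau> * D_exp ?m \<tau>) + indicator {0..} \<tau> * (?w \<tau> * D_exp pi \<tau> * D_exp pi \<tau>)
     + 1/2 * t * (indicator {0..} \<tau> * (?v \<tau> * D_exp ?l \<tau> * D_exp ?m \<tau>) - indicator {0..} \<tau> * (?v \<tau> * D_exp pi \<tau> * D_exp ?m \<tau>))
     + 1/2 * s * (indicator {0..} \<tau> * (?v \<tau> * D_exp ?l \<tau> * D_exp ?m \<tau>) - indicator {0..} \<tau> * (?v \<tau> * D_exp ?l \<tau> * D_exp pi \<tau>)))) (K_sym s t)"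
    unfolding K_sym_def mult_zero_left add_0_left add_0_right
    by (intro has_bochner_integral_add has_bochner_integral_diff has_bochner_integral_mult_right laplace_pair_has w p)
  then have "K_sym s t = (LINT \<tau>|lborel. (1 / (pi * exp s - pi)) * (1 / (pi * exp t - pi)) *
    (indicator {0..} \<tau> * (?w \<tau> * D_exp ?l \<tau> * D_exp ?m \<tau>) - indicator {0..} \<tau> * (?w \<tau> * D_exp ?l \<tau> * D_exp pi \<tau>)
     - indicator {0..} \<tau> * (?w \<tau> * D_exp pi \<tau> * D_exp ?m \<tau>) + indicator {0..} \<tau> * (?w \<tau> * D_exp pi \<tau> * D_exp pi \<tau>)
     + 1/2 * t * (indicator {0..} \<tau> * (?v \<tau> * D_exp ?l \<tau> * D_exp ?m \<tau>) - indicator {0..} \<tau> * (?v \<tau> * D_exp pi \<tau> * D_exp ?m \<tau>))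
     + 1/2 * s * (indicator {0..} \<tau> * (?v \<tau> * D_exp ?l \<tau> * D_exp ?m \<tau>) - indicator {0..} \<tau> * (?v \<tau> * D_exp ?l \<tau> * D_exp pi \<tau>))))"
    by (simp only: has_bochner_integral_integral_eq)
  also have "\<dots> = K_B s t"
    unfolding K_B_def set_lebesgue_integral_def D_F[OF s] D_F[OF t] D_H[OF s] D_H[OF t]
  proof (rule Bochner_Integration.integral_cong[OF refl], goal_cases)
    case (1 \<tau>)
    have key: "c * d * ((v * l) * A * B - (v * l) * A * P - (v * l) * P * B + (v * l) * P * P + 1/2 * t * (v * A * B - v * P * B) + 1/2 * s * (v * A * B - v * A * P))
      = v * (l * (c * (A - P)) * (d * (B - P)) + 1/2 * (c * (A - P)) * (t * d * B) + 1/2 * (s * c * A) * (d * (B - P)))"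
      for v l A B P c d :: real by (simp add: field_simps)
    show ?case
    proof (cases "\<tau> \<ge> 0")
      case True
      then have i: "indicat_real {0..} \<tau> = 1" by simp
      show ?thesis unfolding i by (simp only: mult_1_left scaleR_one key)
    qed simp
  qed
  finally show ?thesis by simp
qed

lemma J9_measurable:
  obtains G where "\<And>i j. G i j \<in> borel_measurable borel" "\<And>a i j. a > 0 \<Longrightarrow> i < 9 \<Longrightarrow> j < 9 \<Longrightarrow> J9 a $$ (i, j) = G i j a"
proof -
  have "\<forall>i j. \<exists>G. G \<in> borel_measurable borel \<and> (\<forall>a>0. (deriv ^^ i) (\<lambda>s. (deriv ^^ j) (\<lambda>t. K_B s t) a) a = G a)"
    by (intro allI symb_mixed[OF K_sym_symb K_B_eq])
  then obtain G where G: "\<And>i j. G i j \<in> borel_measurable borel"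
    "\<And>i j a. a > 0 \<Longrightarrow> (deriv ^^ i) (\<lambda>s. (deriv ^^ j) (\<lambda>t. K_B s t) a) a = G i j a" by metis
  show thesis
  proof (rule that[of "\<lambda>i j a. G i j a / (fact i * fact j)"])
    show "(\<lambda>a. G i j a / (fact i * fact j)) \<in> borel_measurable borel" for i j using G(1)[of i j] by measurable
    show "J9 a $$ (i, j) = G i j a / (fact i * fact j)" if "a > 0" "i < 9" "j < 9" for a i j
      using that G(2)[of a i j] by (simp add: J9_def)
  qed
qed

section \<open>Measurability of the trace coefficients\<close>

text \<open>Zeros of a Caratheodory function on a compact set are tested on a countable dense subset.\<close>

lemma measurable_ex_compact:
  fixes F :: "real \<Rightarrow> 'b::euclidean_space \<Rightarrow> real"
  assumes K: "compact K" and m: "\<And>v. (\<lambda>a. F a v) \<in> borel_measurable borel"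
    and c: "\<And>a. continuous_on UNIV (F a)" and nn: "\<And>a v. F a v \<ge> 0"
  shows "{a. \<exists>v\<in>K. F a v = 0} \<in> sets borel"
proof -
  obtain D where D: "countable D" "D \<subseteq> K" "K \<subseteq> closure D" using separable[of K] by blast
  have "{a. \<exists>v\<in>K. F a v = 0} = (\<Inter>n. \<Union>d\<in>D. {a. F a d < 1 / Suc n})"
  proof (intro equalityI subsetI)
    fix a assume "a \<in> {a. \<exists>v\<in>K. F a v = 0}"
    then obtain v where v: "v \<in> K" "F a v = 0" by blast
    have "\<exists>d\<in>D. F a d < 1 / Suc n" for n
    proof -
      have "open (F a -` {..<1 / Suc n})" using c[of a] by (intro open_vimage) auto
      moreover have "v \<in> F a -` {..<1 / Suc n}" using v by simp
      moreover have "v \<in> closure D" using v D by auto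
      ultimately have "F a -` {..<1 / Suc n} \<inter> D \<noteq> {}" by (metis IntI closure_iff_nhds_not_empty order_refl empty_iff Int_commute)
      then show ?thesis by auto
    qed
    then show "a \<in> (\<Inter>n. \<Union>d\<in>D. {a. F a d < 1 / Suc n})" by simp
  next
    fix a assume a: "a \<in> (\<Inter>n. \<Union>d\<in>D. {a. F a d < 1 / Suc n})"
    then have "K \<noteq> {}" using D(2) by fastforce
    then obtain v where v: "v \<in> K" "\<And>w. w \<in> K \<Longrightarrow> F a v \<le> F a w"
      using continuous_attains_inf[OF K _ continuous_on_subset[OF c]] by blast
    have "F a v < 1 / Suc n" for n
    proof -
      obtain d where "d \<in> D" "F a d < 1 / Suc n" using a by auto
      then show ?thesis using v(2)[of d] D(2) by force
    qed
    then have "\<not> F a v > 0" using nat_approx_posE[of "F a v"] by (metis less_asym)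
    then show "a \<in> {a. \<exists>v\<in>K. F a v = 0}" using nn[of a v] v(1) by (auto intro: antisym)
  qed
  also have "\<dots> \<in> sets borel" using D(1) m by (intro sets.countable_INT'' sets.countable_UN'') auto
  finally show ?thesis .
qed

text \<open>A closed set is a countable union of compact ones. The constraint sets in
  \<open>trace_vector_measurable\<close> are half spaces and slabs, hence unbounded.\<close>

lemma measurable_ex_closed:
  fixes F :: "real \<Rightarrow> 'b::euclidean_space \<Rightarrow> real"
  assumes K: "closed K" and m: "\<And>v. (\<lambda>a. F a v) \<in> borel_measurable borel"
    and c: "\<And>a. continuous_on UNIV (F a)" and nn: "\<And>a v. F a v \<ge> 0"
  shows "{a. \<exists>v\<in>K. F a v = 0} \<in> sets borel"
proof -
  have "{a. \<exists>v\<in>K. F a v = 0} = (\<Union>n. {a. \<exists>v\<in>K \<inter> cball 0 (real n). F a v = 0})"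
  proof (intro equalityI subsetI)
    fix a assume "a \<in> {a. \<exists>v\<in>K. F a v = 0}"
    then obtain v where v: "v \<in> K" "F a v = 0" by blast
    obtain n where "norm v \<le> real n" using real_arch_simple by blast
    then show "a \<in> (\<Union>n. {a. \<exists>v\<in>K \<inter> cball 0 (real n). F a v = 0})" using v by (intro UN_I[of n]) auto
  qed auto
  also have "\<dots> \<in> sets borel"
    using K by (intro sets.countable_UN'' measurable_ex_compact m c nn closed_Int_compact) auto
  finally show ?thesis .
qed

text \<open>Compactness arguments take place in the Euclidean type \<open>real ^ 9\<close>, whereas matrices act on vectors indexed
  by natural numbers.\<close>

definition index9 :: "nat \<Rightarrow> 9" where
  "index9 = (SOME h. bij_betw h {..<9} UNIV)"

lemma index9_bij: "bij_betw index9 {..<9} UNIV"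
proof -
  have "\<exists>h. bij_betw h {0..<card (UNIV :: 9 set)} (UNIV :: 9 set)" by (rule ex_bij_betw_nat_finite) simp
  then have "\<exists>h. bij_betw h {..<9::nat} (UNIV :: 9 set)" by (simp add: atLeast0LessThan)
  then show ?thesis unfolding index9_def by (rule someI_ex)
qed

definition tovec :: "real ^ 9 \<Rightarrow> real Matrix.vec" where
  "tovec x = Matrix.vec 9 (\<lambda>i. x $ index9 i)"

lemma tovec_dim [simp]: "dim_vec (tovec x) = 9" "tovec x \<in> carrier_vec 9"
  by (auto simp: tovec_def)

lemma tovec_index [simp]: "i < 9 \<Longrightarrow> vec_index (tovec x) i = x $ index9 i"
  by (simp add: tovec_def)

lemma tovec_surj:
  assumes "v \<in> carrier_vec 9" obtains x where "v = tovec x"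
proof (rule that[of "\<chi> k. vec_index v (inv_into {..<9} index9 k)"])
  show "v = tovec (\<chi> k. vec_index v (inv_into {..<9} index9 k))"
  proof (rule eq_vecI)
    fix i assume "i < dim_vec (tovec (\<chi> k. vec_index v (inv_into {..<9} index9 k)))"
    then have "i < 9" by simp
    then show "vec_index v i = vec_index (tovec (\<chi> k. vec_index v (inv_into {..<9} index9 k))) i"
      using index9_bij by (simp add: bij_betw_def inv_into_f_f)
  qed (use assms in auto)
qed

text \<open>Being a unit eigenvector, expressed as a zero of one nonnegative function that is
  continuous in the vector and measurable in the matrix entries, as
  \<open>measurable_ex_closed\<close> requires.\<close>

definition eigen_defect :: "(nat \<Rightarrow> nat \<Rightarrow> real) \<Rightarrow> real \<Rightarrow> real ^ 9 \<Rightarrow> real" where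
  "eigen_defect A \<mu> x = (\<Sum>i<9. ((\<Sum>j<9. A i j * x $ index9 j) - \<mu> * x $ index9 i)\<^sup>2) + ((\<Sum>i<9. x $ index9 i * x $ index9 i) - 1)\<^sup>2"

lemma eigen_defect_nonneg: "eigen_defect A \<mu> x \<ge> 0"
  by (simp add: eigen_defect_def sum_nonneg)

lemma eigen_defect_zero_iff:
  assumes A: "\<And>i j. i < 9 \<Longrightarrow> j < 9 \<Longrightarrow> M $$ (i, j) = A i j" and M: "M \<in> carrier_mat 9 9"
  shows "eigen_defect A \<mu> x = 0 \<longleftrightarrow> eigenvector M (tovec x) \<mu> \<and> scalar_prod (tovec x) (tovec x) = 1"
proof -
  have sp: "scalar_prod (tovec x) (tovec x) = (\<Sum>i<9. x $ index9 i * x $ index9 i)"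
    by (simp add: scalar_prod_def lessThan_atLeast0)
  have row: "vec_index (M *\<^sub>v tovec x) i = (\<Sum>j<9. A i j * x $ index9 j)" if "i < 9" for i
    using M that A by (simp add: scalar_prod_def lessThan_atLeast0)
  have "eigen_defect A \<mu> x = 0 \<longleftrightarrow> (\<forall>i<9. (\<Sum>j<9. A i j * x $ index9 j) = \<mu> * x $ index9 i) \<and> (\<Sum>i<9. x $ index9 i * x $ index9 i) = 1"
    unfolding eigen_defect_def by (subst add_nonneg_eq_0_iff) (auto simp: sum_nonneg sum_nonneg_eq_0_iff)
  moreover have "(\<forall>i<9. (\<Sum>j<9. A i j * x $ index9 j) = \<mu> * x $ index9 i) \<longleftrightarrow> M *\<^sub>v tovec x = \<mu> \<cdot>\<^sub>v tovec x"
  proof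
    assume "\<forall>i<9. (\<Sum>j<9. A i j * x $ index9 j) = \<mu> * x $ index9 i"
    then show "M *\<^sub>v tovec x = \<mu> \<cdot>\<^sub>v tovec x" using M row by (intro eq_vecI) auto
  next
    assume e: "M *\<^sub>v tovec x = \<mu> \<cdot>\<^sub>v tovec x"
    show "\<forall>i<9. (\<Sum>j<9. A i j * x $ index9 j) = \<mu> * x $ index9 i"
    proof (intro allI impI)
      fix i :: nat assume i: "i < 9"
      then show "(\<Sum>j<9. A i j * x $ index9 j) = \<mu> * x $ index9 i" using arg_cong[OF e, of "\<lambda>v. vec_index v i"] row[OF i] by simp
    qed
  qed
  moreover have "tovec x \<noteq> 0\<^sub>v 9" if "scalar_prod (tovec x) (tovec x) = 1" using that by auto
  ultimately show ?thesis using M sp unfolding eigenvector_def by auto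
qed

lemma eigen_defect_continuous: "continuous_on UNIV (\<lambda>p. eigen_defect A (fst p) (snd p))" "continuous_on UNIV (eigen_defect A \<mu>)"
  unfolding eigen_defect_def by (intro continuous_intros)+

lemma eigenvector_unit:
  fixes M :: "real mat"
  assumes "eigenvector M v \<mu>" "M \<in> carrier_mat 9 9"
  obtains x where "eigenvector M (tovec x) \<mu>" "scalar_prod (tovec x) (tovec x) = 1"
proof -
  have v: "v \<in> carrier_vec 9" "v \<noteq> 0\<^sub>v 9" "M *\<^sub>v v = \<mu> \<cdot>\<^sub>v v" using assms by (auto simp: eigenvector_def)
  define r where "r = scalar_prod v v"
  have r: "r > 0"
  proof -
    obtain i where i: "i < 9" "vec_index v i \<noteq> 0" using v(1,2) by (metis carrier_vecD eq_vecI index_zero_vec)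
    have "0 < (\<Sum>i<9. vec_index v i * vec_index v i)"
      using i by (intro sum_pos2[of _ i]) (auto simp: zero_less_mult_iff)
    then show ?thesis using v(1) by (simp add: r_def scalar_prod_def lessThan_atLeast0)
  qed
  define w where "w = (1 / sqrt r) \<cdot>\<^sub>v v"
  have w: "w \<in> carrier_vec 9" "scalar_prod w w = 1"
  proof -
    show "w \<in> carrier_vec 9" using v by (simp add: w_def)
    have "scalar_prod w w = (1 / sqrt r) * (1 / sqrt r) * r" using v(1) by (simp add: w_def r_def)
    then show "scalar_prod w w = 1" using r by (simp add: field_simps)
  qed
  have "M *\<^sub>v w = \<mu> \<cdot>\<^sub>v w"
    unfolding w_def using v assms(2) by (simp add: mult_mat_vec smult_smult_assoc mult.commute)
  moreover have "w \<noteq> 0\<^sub>v 9" using w(2) by auto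
  ultimately have "eigenvector M w \<mu>" using w assms(2) by (auto simp: eigenvector_def)
  then show thesis using that tovec_surj[OF w(1)] w(2) by metis
qed

text \<open>Makes \<open>Min\<close> in \<open>lowest_ev\<close> a genuine minimum.\<close>

lemma finite_eigenvalues:
  fixes M :: "real mat" assumes "M \<in> carrier_mat 9 9" shows "finite {\<mu>. eigenvalue M \<mu>}"
proof -
  have "char_poly M \<noteq> 0" using degree_monic_char_poly[OF assms] by auto
  then show ?thesis unfolding eigenvalue_root_char_poly[OF assms] by (rule poly_roots_finite)
qed

text \<open>Two passes. First, the lowest eigenvalue is at most c exactly if some unit eigenvector
  has an eigenvalue at most c, which makes it measurable. Then it enters the defect as a measurable
  parameter, and level sets of a component of \<open>e\<close> become existence statements about
  unit eigenvectors with that component.\<close>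

theorem trace_vector_measurable:
  assumes tv: "\<And>a. a \<in> {0<..<s} \<Longrightarrow> trace_vector a (e a)" and si: "\<And>a. a \<in> {0<..<s} \<Longrightarrow> simple_eigenline a (e a)"
    and k: "k < 9"
  shows "(\<lambda>a. indicator {0<..<s} a * vec_index (e a) k) \<in> borel_measurable borel"
proof -
  obtain G where G: "\<And>i j. G i j \<in> borel_measurable borel" "\<And>a i j. a > 0 \<Longrightarrow> i < 9 \<Longrightarrow> j < 9 \<Longrightarrow> J9 a $$ (i, j) = G i j a"
    using J9_measurable by blast
  note [measurable] = G(1)
  define A where "A = (\<lambda>a i j. G i j a)"
  have J: "J9 a \<in> carrier_mat 9 9" for a by (simp add: J9_def)
  have zero: "eigen_defect (A a) \<mu> x = 0 \<longleftrightarrow> eigenvector (J9 a) (tovec x) \<mu> \<and> scalar_prod (tovec x) (tovec x) = 1" if "a > 0" for a \<mu> x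
    using G(2)[OF that] J by (intro eigen_defect_zero_iff) (auto simp: A_def)
  have ev: "eigenvector (J9 a) (e a) (lowest_ev a)" "scalar_prod (e a) (e a) = 1" "vec_index (e a) 0 < 0" if "a \<in> {0<..<s}" for a
    using tv[OF that] by (auto simp: trace_vector_def)
  have le_iff: "lowest_ev a \<le> c \<longleftrightarrow> (\<exists>v\<in>{p. fst p \<le> c}. eigen_defect (A a) (fst v) (snd v) = 0)" if a: "a \<in> {0<..<s}" for a c
  proof
    assume l: "lowest_ev a \<le> c"
    have a0: "a > 0" using a by simp
    obtain x where "eigenvector (J9 a) (tovec x) (lowest_ev a)" "scalar_prod (tovec x) (tovec x) = 1"
      using eigenvector_unit[OF ev(1)[OF a] J] by blast
    then have "eigen_defect (A a) (lowest_ev a) x = 0" using zero[OF a0] by blast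
    then show "\<exists>v\<in>{p. fst p \<le> c}. eigen_defect (A a) (fst v) (snd v) = 0" using l by (intro bexI[of _ "(lowest_ev a, x)"]) auto
  next
    assume "\<exists>v\<in>{p. fst p \<le> c}. eigen_defect (A a) (fst v) (snd v) = 0"
    then obtain \<mu> x where "\<mu> \<le> c" "eigen_defect (A a) \<mu> x = 0" by auto
    then have "eigenvalue (J9 a) \<mu>" using zero[of a \<mu> x] a by (auto simp: eigenvalue_def)
    then have "lowest_ev a \<le> \<mu>" unfolding lowest_ev_def using finite_eigenvalues[OF J] by (intro Min_le) auto
    then show "lowest_ev a \<le> c" using \<open>\<mu> \<le> c\<close> by simp
  qed
  define l where "l = (\<lambda>a. indicator {0<..<s} a * lowest_ev a)"
  have [measurable]: "l \<in> borel_measurable borel"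
  proof (rule borel_measurableI_le)
    fix c
    let ?S = "{a. \<exists>v\<in>{p. fst p \<le> c}. eigen_defect (A a) (fst v) (snd v) = 0}"
    have "?S \<in> sets borel"
    proof (rule measurable_ex_closed)
      show "closed {p :: real \<times> (real ^ 9). fst p \<le> c}" by (intro closed_Collect_le continuous_intros)
      show "(\<lambda>a. eigen_defect (A a) (fst v) (snd v)) \<in> borel_measurable borel" for v :: "real \<times> (real ^ 9)"
        unfolding eigen_defect_def A_def by measurable
    qed (auto simp: eigen_defect_nonneg eigen_defect_continuous)
    moreover have "{a \<in> space borel. l a \<le> c} = ({0<..<s} \<inter> ?S) \<union> (if 0 \<le> c then - {0<..<s} else {})"
      using le_iff by (auto simp: l_def indicator_def)
    ultimately show "{a \<in> space borel. l a \<le> c} \<in> sets borel" by auto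
  qed
  \<comment> \<open>A simple eigenline contains only the unit vectors e a and -e a, and the sign of
    component 0 decides between them.\<close>
  have uniq: "tovec x = e a" if a: "a \<in> {0<..<s}" and x: "eigen_defect (A a) (l a) x = 0" "x $ index9 0 < 0" for a x
  proof -
    have "l a = lowest_ev a" using a by (simp add: l_def)
    then have x': "eigenvector (J9 a) (tovec x) (lowest_ev a)" "scalar_prod (tovec x) (tovec x) = 1"
      using zero[of a "l a" x] x(1) a by auto
    obtain c where c: "tovec x = c \<cdot>\<^sub>v e a" using si[OF a] x'(1) by (auto simp: simple_eigenline_def)
    have ec: "e a \<in> carrier_vec 9" using ev(1)[OF a] J[of a] by (auto simp: eigenvector_def)
    have "c * c = 1" using x'(2) ev(2)[OF a] ec by (simp add: c)
    then have "c = 1 \<or> c = - 1" by (simp add: square_eq_1_iff)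
    moreover have "c * vec_index (e a) 0 < 0" using x(2) arg_cong[OF c, of "\<lambda>v. vec_index v 0"] ec by simp
    ultimately have "c = 1" using ev(3)[OF a] by auto
    then show ?thesis using c ec by simp
  qed
  show ?thesis
  proof (rule borel_measurableI_ge)
    fix c
    \<comment> \<open>The sign condition is open; it is exhausted by the closed conditions with
      margin 1/(n + 1).\<close>
    let ?T = "\<lambda>n. {a. \<exists>x\<in>{x. x $ index9 0 \<le> - (1 / Suc n) \<and> c \<le> x $ index9 k}. eigen_defect (A a) (l a) x = 0}"
    have T: "?T n \<in> sets borel" for n
    proof (rule measurable_ex_closed)
      show "closed {x :: real ^ 9. x $ index9 0 \<le> - (1 / Suc n) \<and> c \<le> x $ index9 k}"
        by (intro closed_Collect_conj closed_Collect_le continuous_intros)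
      show "(\<lambda>a. eigen_defect (A a) (l a) v) \<in> borel_measurable borel" for v
        unfolding eigen_defect_def A_def by measurable
    qed (auto simp: eigen_defect_nonneg eigen_defect_continuous)
    have iff: "c \<le> vec_index (e a) k \<longleftrightarrow> (\<exists>n. a \<in> ?T n)" if a: "a \<in> {0<..<s}" for a
    proof
      assume ck: "c \<le> vec_index (e a) k"
      have ec: "e a \<in> carrier_vec 9" using ev(1)[OF a] J[of a] by (auto simp: eigenvector_def)
      obtain x where x: "e a = tovec x" using tovec_surj[OF ec] by blast
      have "l a = lowest_ev a" using a by (simp add: l_def)
      then have z: "eigen_defect (A a) (l a) x = 0" using zero[of a "l a" x] ev[OF a] a x by auto
      have "- vec_index (e a) 0 > 0" using ev(3)[OF a] by simp
      then obtain n where "1 / Suc n < - vec_index (e a) 0" using nat_approx_posE by metis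
      then have "x $ index9 0 \<le> - (1 / Suc n)" "c \<le> x $ index9 k" using ck k by (simp_all add: x)
      then show "\<exists>n. a \<in> ?T n" using z by blast
    next
      assume "\<exists>n. a \<in> ?T n"
      then obtain n x where x: "x $ index9 0 \<le> - (1 / Suc n)" "c \<le> x $ index9 k" "eigen_defect (A a) (l a) x = 0" by blast
      have "0 < 1 / real (Suc n)" by simp
      then have "x $ index9 0 < 0" using x(1) by linarith
      then have "tovec x = e a" by (rule uniq[OF a x(3)])
      then show "c \<le> vec_index (e a) k" using x(2) k by (metis tovec_index)
    qed
    have "{a \<in> space borel. c \<le> indicator {0<..<s} a * vec_index (e a) k} = ({0<..<s} \<inter> (\<Union>n. ?T n)) \<union> (if c \<le> 0 then - {0<..<s} else {})"
      using iff by (auto simp: indicator_def)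
    also have "\<dots> \<in> sets borel" using T by (intro sets.Un sets.Int sets.countable_UN'') auto
    finally show "{a \<in> space borel. c \<le> indicator {0<..<s} a * vec_index (e a) k} \<in> sets borel" .
  qed
qed

section \<open>The trace operator\<close>

lemma restr_subset: "S \<subseteq> S' \<Longrightarrow> restr S f = (\<lambda>x. indicator S x *\<^sub>R restr S' f x)"
  by (auto simp: restr_def indicator_def fun_eq_iff)

lemma L2fun_subset:
  assumes S: "S \<subseteq> S'" "S \<in> sets borel" and f: "f \<in> pts (L2fun S')"
  shows "f \<in> pts (L2fun S)" "nrm (L2fun S) f \<le> nrm (L2fun S') f"
proof -
  have [measurable]: "restr S' f \<in> borel_measurable borel" "S \<in> sets borel" using f S by (auto simp: L2fun_pts)
  have i: "integrable lborel (\<lambda>x. (cmod (restr S' f x))\<^sup>2)" using f by (simp add: L2fun_pts)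
  have le: "(cmod (restr S f x))\<^sup>2 \<le> (cmod (restr S' f x))\<^sup>2" for x
    unfolding restr_subset[OF S(1)] by (simp add: indicator_def)
  have m: "restr S f \<in> borel_measurable borel" unfolding restr_subset[OF S(1)] by measurable
  have j: "integrable lborel (\<lambda>x. (cmod (restr S f x))\<^sup>2)"
    using m le by (intro Bochner_Integration.integrable_bound[OF i]) auto
  show 1: "f \<in> pts (L2fun S)" using m j by (simp add: L2fun_pts)
  have "(nrm (L2fun S) f)\<^sup>2 \<le> (nrm (L2fun S') f)\<^sup>2"
    unfolding L2fun_nrm_sq using i j le by (intro integral_mono)
  then show "nrm (L2fun S) f \<le> nrm (L2fun S') f" using f 1 by (simp add: power2_le_iff_abs_le)
qed

lemma L2fun_bounded_mult:
  assumes m: "(\<lambda>x. indicator S x * m x) \<in> borel_measurable borel" and b: "\<And>x. x \<in> S \<Longrightarrow> \<bar>m x\<bar> \<le> B" and B: "0 \<le> B"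
    and f: "f \<in> pts (L2fun S)"
  shows "(\<lambda>x. of_real (m x) * f x) \<in> pts (L2fun S)" "nrm (L2fun S) (\<lambda>x. of_real (m x) * f x) \<le> B * nrm (L2fun S) f"
proof -
  note [measurable] = m L2fun_measurable[OF f]
  have e: "restr S (\<lambda>x. of_real (m x) * f x) = (\<lambda>x. of_real (indicator S x * m x) * restr S f x)"
    by (auto simp: restr_def indicator_def fun_eq_iff)
  have i: "integrable lborel (\<lambda>x. B\<^sup>2 * (cmod (restr S f x))\<^sup>2)" using f by (simp add: L2fun_pts)
  have le: "(cmod (restr S (\<lambda>x. of_real (m x) * f x) x))\<^sup>2 \<le> B\<^sup>2 * (cmod (restr S f x))\<^sup>2" for x
  proof -
    have "\<bar>indicator S x * m x\<bar> \<le> B" using b B by (auto simp: indicator_def)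
    then have "cmod (of_real (indicator S x * m x) * restr S f x) \<le> B * cmod (restr S f x)"
      unfolding norm_mult norm_of_real by (intro mult_right_mono) auto
    then show ?thesis unfolding e power_mult_distrib[symmetric] by (intro power_mono) auto
  qed
  have mom: "restr S (\<lambda>x. of_real (m x) * f x) \<in> borel_measurable borel" unfolding e by measurable
  have j: "integrable lborel (\<lambda>x. (cmod (restr S (\<lambda>x. of_real (m x) * f x) x))\<^sup>2)"
    using mom le by (intro Bochner_Integration.integrable_bound[OF i]) (auto intro!: AE_I2)
  show 1: "(\<lambda>x. of_real (m x) * f x) \<in> pts (L2fun S)" using mom j by (simp add: L2fun_pts)
  have "(nrm (L2fun S) (\<lambda>x. of_real (m x) * f x))\<^sup>2 \<le> (LINT x|lborel. B\<^sup>2 * (cmod (restr S f x))\<^sup>2)"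
    unfolding L2fun_nrm_sq using i j le by (intro integral_mono)
  also have "\<dots> = (B * nrm (L2fun S) f)\<^sup>2" by (simp add: power_mult_distrib L2fun_nrm_sq)
  finally show "nrm (L2fun S) (\<lambda>x. of_real (m x) * f x) \<le> B * nrm (L2fun S) f"
    using f B by (intro power2_le_imp_le[of "nrm (L2fun S) (\<lambda>x. of_real (m x) * f x)"]) auto
qed

lemma L2fun_sum:
  assumes "finite A" "\<And>k. k \<in> A \<Longrightarrow> f k \<in> pts (L2fun S)"
  shows "(\<lambda>x. \<Sum>k\<in>A. f k x) \<in> pts (L2fun S) \<and> nrm (L2fun S) (\<lambda>x. \<Sum>k\<in>A. f k x) \<le> (\<Sum>k\<in>A. nrm (L2fun S) (f k))"
  using assms
proof (induction A rule: finite_induct)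
  case empty
  show ?case using L2fun.zer_in[of S] L2fun.nrm_zer[of S] by simp
next
  case (insert a A)
  have i: "f a \<in> pts (L2fun S)" "(\<lambda>x. \<Sum>k\<in>A. f k x) \<in> pts (L2fun S)" using insert by auto
  show ?case using insert L2fun_pls_in[OF i] L2fun.nrm_triangle[OF i] by simp
qed

section \<open>The trace map as an instance of the abstract splitting\<close>

locale trace_setup = red_form +
  fixes s :: real and e :: "real \<Rightarrow> real Matrix.vec"
  assumes s: "0 < s" "s < L"
    and tv: "\<forall>a\<in>{0..<s}. trace_vector a (e a)"
    and simple: "\<forall>a\<in>{0..<s}. simple_eigenline a (e a)"
    and bounded: "\<exists>B. \<forall>a\<in>{0..<s}. \<forall>k<9. \<bar>vec_index (e a) k\<bar> \<le> B"
begin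

abbreviation "R \<equiv> trace_op L e s"
abbreviation "Y \<equiv> L2 {0<..<s}"
abbreviation "YF \<equiv> L2fun {0<..<s}"

sublocale Y: hilb Y
  by (rule fin_set.L2_hilb[OF fin_set_interval])

definition trace_term :: "nat \<Rightarrow> (real \<Rightarrow> complex) \<Rightarrow> real \<Rightarrow> complex" where
  "trace_term k h = (\<lambda>a. of_real (vec_index (e a) k / fact k) * h a)"

definition trace_fun :: "(real \<Rightarrow> complex) set \<Rightarrow> real \<Rightarrow> complex" where
  "trace_fun f = (\<lambda>a. \<Sum>k\<le>8. trace_term k (repr (wderiv L k f)) a)"

lemma R_eq: "R f = cls YF (trace_fun f)"
  unfolding trace_op_def trace_fun_def trace_term_def by (intro arg_cong[where f="cls YF"] ext sum.cong) auto

lemma coefficient_bound: obtains B where "B \<ge> 0" "\<And>a k. a \<in> {0<..<s} \<Longrightarrow> k \<le> 8 \<Longrightarrow> \<bar>vec_index (e a) k / fact k\<bar> \<le> B"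
proof -
  obtain B where B: "\<And>a k. a \<in> {0..<s} \<Longrightarrow> k < 9 \<Longrightarrow> \<bar>vec_index (e a) k\<bar> \<le> B" using bounded by blast
  have "\<bar>vec_index (e a) k / fact k\<bar> \<le> max B 0" if "a \<in> {0<..<s}" "k \<le> 8" for a k
  proof -
    have "\<bar>vec_index (e a) k / fact k\<bar> \<le> \<bar>vec_index (e a) k\<bar> / 1"
      unfolding abs_divide by (intro divide_left_mono) (auto simp: fact_ge_1)
    then show ?thesis using B[of a k] that by auto
  qed
  then show thesis using that[of "max B 0"] by simp
qed

lemma coefficient_measurable:
  assumes "k \<le> 8" shows "(\<lambda>a. indicator {0<..<s} a * (vec_index (e a) k / fact k)) \<in> borel_measurable borel"
proof -
  have [measurable]: "(\<lambda>a. indicator {0<..<s} a * vec_index (e a) k) \<in> borel_measurable borel"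
    using tv simple assms by (intro trace_vector_measurable) auto
  have "(\<lambda>a. (indicator {0<..<s} a * vec_index (e a) k) / fact k) \<in> borel_measurable borel" by measurable
  then show ?thesis by simp
qed

lemma repr_in:
  assumes "f \<in> pts (H8 L)" "k \<le> 8"
  shows "repr (wderiv L k f) \<in> pts YF" "nrm YF (repr (wderiv L k f)) \<le> nrm (H8 L) f"
proof -
  note w = wderiv_in[OF assms]
  have r: "repr (wderiv L k f) \<in> pts (L2fun {0<..<L})" using L2_repr[OF w] by simp
  have "{0<..<s} \<subseteq> {0<..<L}" using s by auto
  note sub = L2fun_subset[OF this _ r]
  show "repr (wderiv L k f) \<in> pts YF" by (rule sub(1)) simp
  have "nrm (L2fun {0<..<L}) (repr (wderiv L k f)) = nrm E (wderiv L k f)" by (simp add: L2_def L2fun.quot_nrm_repr)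
  then show "nrm YF (repr (wderiv L k f)) \<le> nrm (H8 L) f" using sub(2) H8_wderiv_le[OF assms] by simp
qed

lemma trace_term_in:
  assumes "h \<in> pts YF" "k \<le> 8" shows "trace_term k h \<in> pts YF"
proof -
  obtain B where "B \<ge> 0" "\<And>a k. a \<in> {0<..<s} \<Longrightarrow> k \<le> 8 \<Longrightarrow> \<bar>vec_index (e a) k / fact k\<bar> \<le> B" by (rule coefficient_bound) (rule that)
  then show ?thesis unfolding trace_term_def using L2fun_bounded_mult(1)[OF coefficient_measurable[OF assms(2)]] assms by blast
qed

lemma trace_fun_in: "f \<in> pts (H8 L) \<Longrightarrow> trace_fun f \<in> pts YF"
  unfolding trace_fun_def using L2fun_sum[of "{..8}" "\<lambda>k. trace_term k (repr (wderiv L k f))" "{0<..<s}"] trace_term_in repr_in(1) by auto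

lemma R_nrm: "f \<in> pts (H8 L) \<Longrightarrow> nrm Y (R f) = nrm YF (trace_fun f)"
  unfolding R_eq L2_def by (rule L2fun.quot_nrm[OF trace_fun_in])

lemma R_estimate:
  obtains C where "C \<ge> 0" "\<And>f. f \<in> pts (H8 L) \<Longrightarrow> nrm Y (R f) \<le> C * (\<Sum>k\<le>8. nrm YF (repr (wderiv L k f)))"
    "\<And>f. f \<in> pts (H8 L) \<Longrightarrow> C * (\<Sum>k\<le>8. nrm YF (repr (wderiv L k f))) \<le> (9 * C) * nrm (H8 L) f"
proof -
  obtain B where B: "B \<ge> 0" "\<And>a k. a \<in> {0<..<s} \<Longrightarrow> k \<le> 8 \<Longrightarrow> \<bar>vec_index (e a) k / fact k\<bar> \<le> B" by (rule coefficient_bound) (rule that)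
  show thesis
  proof (rule that[OF B(1)])
    fix f assume f: "f \<in> pts (H8 L)"
    have t: "nrm YF (trace_term k (repr (wderiv L k f))) \<le> B * nrm YF (repr (wderiv L k f))" if "k \<le> 8" for k
      unfolding trace_term_def using B that
      by (intro L2fun_bounded_mult(2)[OF coefficient_measurable[OF that] _ B(1) repr_in(1)[OF f that]]) auto
    have "nrm Y (R f) \<le> (\<Sum>k\<le>8. nrm YF (trace_term k (repr (wderiv L k f))))"
      unfolding R_nrm[OF f] trace_fun_def using L2fun_sum[of "{..8}" "\<lambda>k. trace_term k (repr (wderiv L k f))" "{0<..<s}"] trace_term_in repr_in(1)[OF f] by auto
    also have "\<dots> \<le> (\<Sum>k\<le>8. B * nrm YF (repr (wderiv L k f)))" using t by (intro sum_mono) auto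
    finally show "nrm Y (R f) \<le> B * (\<Sum>k\<le>8. nrm YF (repr (wderiv L k f)))" by (simp only: sum_distrib_left)
    \<comment> \<open>Orders 0 to 8 contribute one norm each, whence the factor 9.\<close>
    have "(\<Sum>k\<le>8. nrm YF (repr (wderiv L k f))) \<le> (\<Sum>k\<le>(8::nat). nrm (H8 L) f)"
      using repr_in(2)[OF f] by (intro sum_mono) auto
    then have "B * (\<Sum>k\<le>8. nrm YF (repr (wderiv L k f))) \<le> B * (9 * nrm (H8 L) f)" using B(1) by (intro mult_left_mono) auto
    then show "B * (\<Sum>k\<le>8. nrm YF (repr (wderiv L k f))) \<le> (9 * B) * nrm (H8 L) f" by simp
  qed
qed

lemma null_of_AE:
  assumes "f \<in> pts YF" "g \<in> pts YF" "AE x in lborel. x \<in> {0<..<s} \<longrightarrow> f x = g x"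
  shows "cls YF f = cls YF g"
proof -
  have "AE x in lborel. restr {0<..<s} (dif YF f g) x = 0"
    using assms(3) by eventually_elim (auto simp: restr_def indicator_def)
  then have "nrm YF (dif YF f g) = 0" using L2fun_null_iff[OF L2fun.dif_in[OF assms(1,2)]] by simp
  then show ?thesis using L2fun.cls_eq_iff[OF assms(1,2)] by simp
qed

text \<open>The representative chosen for a sum of classes is the sum of representatives only almost
  everywhere. The exceptional null sets for the nine orders are merged before the pointwise sums are
  compared.\<close>

lemma R_linear: "linear_op (H8 L) Y R"
  unfolding linear_op_def
proof (intro conjI ballI allI)
  fix x assume "x \<in> pts (H8 L)"
  then show "R x \<in> pts Y" unfolding R_eq L2_def by (intro L2fun.quot_in trace_fun_in)
next
  have dom: "x \<in> {0<..<L}" if "x \<in> {0<..<s}" for x using that s by auto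
  fix f g assume f: "f \<in> pts (H8 L)" and g: "g \<in> pts (H8 L)"
  have fg: "pls E f g \<in> pts (H8 L)" by (rule csubspaceD(4)[OF H8_sub f g])
  have "AE x in lborel. \<forall>k\<in>{..8}. restr {0<..<L} (repr (wderiv L k (pls E f g))) x
      = restr {0<..<L} (repr (wderiv L k f)) x + restr {0<..<L} (repr (wderiv L k g)) x"
    using f g by (intro AE_finite_allI) (auto simp: wderiv_linear(1) intro!: L2_repr_pls wderiv_in)
  then have ae: "AE x in lborel. x \<in> {0<..<s} \<longrightarrow> trace_fun (pls E f g) x = trace_fun f x + trace_fun g x"
  proof eventually_elim
    case (elim x)
    show ?case
    proof
      assume "x \<in> {0<..<s}"
      then have "repr (wderiv L k (pls E f g)) x = repr (wderiv L k f) x + repr (wderiv L k g) x" if "k \<le> 8" for k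
        using elim that dom[of x] by (auto simp: restr_def)
      then show "trace_fun (pls E f g) x = trace_fun f x + trace_fun g x"
        unfolding trace_fun_def trace_term_def by (simp add: distrib_left flip: sum.distrib)
    qed
  qed
  have "R (pls E f g) = cls YF (\<lambda>x. trace_fun f x + trace_fun g x)"
    unfolding R_eq using ae by (intro null_of_AE trace_fun_in fg L2fun_pls_in f g)
  also have "\<dots> = pls Y (R f) (R g)" unfolding R_eq L2_def using L2fun.quot_pls[OF trace_fun_in[OF f] trace_fun_in[OF g]] by simp
  finally show "R (pls (H8 L) f g) = pls Y (R f) (R g)" by (simp add: H8_sel)
next
  have dom: "x \<in> {0<..<L}" if "x \<in> {0<..<s}" for x using that s by auto
  fix c f assume f: "f \<in> pts (H8 L)"
  have cf: "scl E c f \<in> pts (H8 L)" by (rule csubspaceD(5)[OF H8_sub f])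
  have "AE x in lborel. \<forall>k\<in>{..8}. restr {0<..<L} (repr (wderiv L k (scl E c f))) x
      = c * restr {0<..<L} (repr (wderiv L k f)) x"
    using f by (intro AE_finite_allI) (auto simp: wderiv_linear(2) intro!: L2_repr_scl wderiv_in)
  then have ae: "AE x in lborel. x \<in> {0<..<s} \<longrightarrow> trace_fun (scl E c f) x = c * trace_fun f x"
  proof eventually_elim
    case (elim x)
    show ?case
    proof
      assume "x \<in> {0<..<s}"
      then have "repr (wderiv L k (scl E c f)) x = c * repr (wderiv L k f) x" if "k \<le> 8" for k
        using elim that dom[of x] by (auto simp: restr_def)
      then show "trace_fun (scl E c f) x = c * trace_fun f x"
        unfolding trace_fun_def trace_term_def by (simp add: sum_distrib_left mult_ac)
    qed
  qed
  have "R (scl E c f) = cls YF (\<lambda>x. c * trace_fun f x)"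
    unfolding R_eq using ae by (intro null_of_AE trace_fun_in cf L2fun_scl_in f)
  also have "\<dots> = scl Y c (R f)" unfolding R_eq L2_def using L2fun.quot_scl[OF trace_fun_in[OF f]] by simp
  finally show "R (scl (H8 L) c f) = scl Y c (R f)" by (simp add: H8_sel)
qed

text \<open>Everything is bounded in the norm of \<open>H8 L\<close> or of \<open>E\<close> and is
  transferred to \<open>V\<close> by the embedding constant B. The form takes two arguments from
  \<open>V\<close>, so B enters its bound c * B * B twice.\<close>

lemma form_space_trace_split:
  assumes V: "form_space L V"
  shows "\<exists>cq. trace_split V Y (q_form \<omega> L) R (Q_Psi \<omega> L) (trace_kernel V s R) (orth_complement V (pts (trace_kernel V s R)))
     (transported_space s R (orth_complement V (pts (trace_kernel V s R)))) cq"
proof -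
  have hV: "hilb V" and sub: "pts V \<subseteq> pts (H8 L)" and ops: "pls V = pls E" "scl V = scl E"
    using V by (auto simp: form_space_def hilb_iff H8_sel)
  interpret V: hilb V by (rule hV)
  obtain B0 where B0: "\<And>f. f \<in> pts V \<Longrightarrow> nrm (H8 L) f \<le> B0 * nrm V f" using V by (auto simp: form_space_def)
  define B where "B = max B0 0"
  have B: "B \<ge> 0" "nrm (H8 L) f \<le> B * nrm V f" if "f \<in> pts V" for f
    using B0[OF that] mult_right_mono[of B0 B "nrm V f"] that by (auto simp: B_def intro: order_trans)
  have B_nn: "B \<ge> 0" by (simp add: B_def)
  have VE: "f \<in> pts E" if "f \<in> pts V" for f using that sub by (auto simp: H8_pts)
  have nE: "nrm E f \<le> B * nrm V f" if f: "f \<in> pts V" for f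
    using H8_wderiv_le[of f 0] wderiv_0[OF VE[OF f]] B(2)[OF f] f sub by auto
  obtain c where c: "c > 0" "\<And>f g. f \<in> pts E \<Longrightarrow> g \<in> pts E \<Longrightarrow> cmod (q_form \<omega> L f g) \<le> c * nrm E f * nrm E g"
    by (rule q_form_bound) (rule that)
  have qb: "cmod (q_form \<omega> L f g) \<le> (c * B * B) * nrm V f * nrm V g" if f: "f \<in> pts V" and g: "g \<in> pts V" for f g
  proof -
    have "cmod (q_form \<omega> L f g) \<le> c * nrm E f * nrm E g" by (rule c(2)[OF VE[OF f] VE[OF g]])
    also have "\<dots> \<le> c * (B * nrm V f) * (B * nrm V g)"
      using nE[OF f] nE[OF g] c(1) B_nn f g VE[OF f] VE[OF g] by (intro mult_mono) auto
    finally show ?thesis by (simp add: mult_ac)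
  qed
  obtain C where C: "C \<ge> 0" "\<And>f. f \<in> pts (H8 L) \<Longrightarrow> nrm Y (R f) \<le> C * (\<Sum>k\<le>8. nrm YF (repr (wderiv L k f)))"
    "\<And>f. f \<in> pts (H8 L) \<Longrightarrow> C * (\<Sum>k\<le>8. nrm YF (repr (wderiv L k f))) \<le> (9 * C) * nrm (H8 L) f"
    by (rule R_estimate) (rule that)
  have Rb: "nrm Y (R f) \<le> (9 * C * B) * nrm V f" if f: "f \<in> pts V" for f
  proof -
    have "nrm Y (R f) \<le> (9 * C) * nrm (H8 L) f" using C(2,3)[of f] f sub by (meson order_trans subsetD)
    also have "\<dots> \<le> (9 * C) * (B * nrm V f)" using B(2)[OF f] C(1) by (intro mult_left_mono) auto
    finally show ?thesis by simp
  qed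
  have "linear_op V Y R" using R_linear sub unfolding linear_op_def ops H8_sel by blast
  then have bR: "bounded_op V Y R" using Rb unfolding bounded_op_def by blast
  have hq: "hermitian_form V (q_form \<omega> L)"
    using q_form_hermitian VE unfolding hermitian_form_def ops by blast
  show ?thesis
  proof (intro exI[of _ "c * B * B"], unfold_locales)
    show "hermitian_form V (q_form \<omega> L)" by (rule hq)
    show "bounded_op V Y R" by (rule bR)
    show "q_form \<omega> L f f = of_real (Q_Psi \<omega> L f)" if "f \<in> pts V" for f by (rule q_form_diag[OF VE[OF that]])
    show "cmod (q_form \<omega> L f g) \<le> c * B * B * nrm V f * nrm V g" if "f \<in> pts V" "g \<in> pts V" for f g by (rule qb[OF that])
    show "0 \<le> c * B * B" using c(1) B_nn by simp
  qed (simp_all add: trace_kernel_def transported_space_def)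
qed

end

theorem mainTheorem4:
  fixes \<omega> L s_star :: real
    and e :: "real \<Rightarrow> real vec"
    and V N U X_R :: "(real \<Rightarrow> complex) set cspace"
    and R :: "(real \<Rightarrow> complex) set \<Rightarrow> (real \<Rightarrow> complex) set"
    and q :: "(real \<Rightarrow> complex) set \<Rightarrow> (real \<Rightarrow> complex) set \<Rightarrow> complex"
    and Q :: "(real \<Rightarrow> complex) set \<Rightarrow> real"
  assumes "\<bar>\<omega>\<bar> < 1/2"
    and "crossing_point s_star" and "s_star < L"
    and "\<forall>a\<in>{0..<s_star}. trace_vector a (e a)"
    and simple: "\<forall>a\<in>{0..<s_star}. simple_eigenline a (e a)"
    and bounded: "\<exists>B. \<forall>a\<in>{0..<s_star}. \<forall>k<9. \<bar>vec_index (e a) k\<bar> \<le> B"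
    and "form_space L V"
    and R: "R = trace_op L e s_star"
    and q: "q = q_form \<omega> L" and Q: "Q = Q_Psi \<omega> L"
    and N: "N = trace_kernel V s_star R"
    and U: "U = orth_complement V (pts N)"
    and X_R: "X_R = transported_space s_star R U"
  shows
    "\<comment> \<open>the model case, the trace estimate and its consequences\<close>
    form_space L (H8 L) \<and>
    linear_op (H8 L) (L2 {0<..<s_star}) R \<and>
    (\<exists>C C'. \<forall>f\<in>pts (H8 L).
       nrm (L2 {0<..<s_star}) (R f)
         \<le> C * (\<Sum>k\<le>8. nrm (L2fun {0<..<s_star}) (repr (wderiv L k f))) \<and>
       C * (\<Sum>k\<le>8. nrm (L2fun {0<..<s_star}) (repr (wderiv L k f))) \<le> C' * nrm (H8 L) f) \<and>
    closed_op V (L2 {0<..<s_star}) R \<and>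
    closed_subset V (pts N) \<and>
    (\<forall>f\<in>pts V. \<exists>!z. fst z \<in> pts N \<and> snd z \<in> pts U \<and> f = pls V (fst z) (snd z)) \<and>
    hilbert_space X_R \<and>
    unitary_op U X_R R \<and>
    \<comment> \<open>the Hermitian form and its blocks\<close>
    hermitian_form V q \<and>
    (\<forall>f\<in>pts V. q f f = of_real (Q f)) \<and>
    (\<forall>n\<in>pts N. \<forall>m\<in>pts N. \<forall>u\<in>pts U. \<forall>v\<in>pts U.
       q (pls V n u) (pls V m v) = q n m + q n v + cnj (q m u) + q u v) \<and>
    \<comment> \<open>(i) and (ii) yield the factorization\<close>
    (\<forall>\<Gamma>. nonneg_form N q \<and> douglas_factor q N U \<Gamma> \<longrightarrow>
       (let C = form_op U q;
            \<Gamma>\<Gamma> = (\<lambda>u. adjoint_op U (H_A N q) \<Gamma> (\<Gamma> u));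
            T = (\<lambda>u. dif U (\<Gamma>\<Gamma> u) (C u));
            M = pos_part U T;
            S = (\<lambda>x. sqrt_op U M (inv_into (pts U) R x));
            p = (\<lambda>f. let n = orth_proj V (pts N) f; u = orth_proj V (pts U) f in
                  (nrm (H_A N q) (pls (H_A N q) (A_half N q n) (\<Gamma> u)))\<^sup>2
                  + Re (ip U (dif U (pls U (C u) (M u)) (\<Gamma>\<Gamma> u)) u))
        in bounded_op X_R U S \<and> (\<forall>u\<in>pts U. S (R u) = sqrt_op U M u) \<and>
           (\<forall>f\<in>pts V. 0 \<le> p f) \<and>
           (\<exists>(H :: (nat \<Rightarrow> (real \<Rightarrow> complex) set) set cspace) G.
              bounded_op V H G \<and> (\<forall>f\<in>pts V. (nrm H (G f))\<^sup>2 = p f) \<and>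
              quotient_factorization Q V R X_R H U G S) \<and>
           (\<forall>f\<in>pts V. R f = zer (L2 {0<..<s_star}) \<longrightarrow> 0 \<le> Q f))) \<and>
    \<comment> \<open>conversely, a factorization through arbitrary Hilbert spaces forces (i) and (ii)\<close>
    (\<forall>(H :: 'h cspace) (K :: 'k cspace) G S.
       quotient_factorization Q V R X_R H K G S \<longrightarrow>
         nonneg_form N q \<and> (\<exists>\<Gamma>. douglas_factor q N U \<Gamma>)) \<and>
    \<comment> \<open>the resulting equivalence\<close>
    ((\<exists>(H :: (nat \<Rightarrow> (real \<Rightarrow> complex) set) set cspace) G S.
        quotient_factorization Q V R X_R H U G S) \<longleftrightarrow>
     (\<forall>f\<in>pts V. R f = zer (L2 {0<..<s_star}) \<longrightarrow> 0 \<le> Q f) \<and> (\<exists>\<Gamma>. douglas_factor q N U \<Gamma>))"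
proof -
  have s0: "0 < s_star" using assms(2) by (simp add: crossing_point_def)
  interpret trace_setup L \<omega> s_star e
    by unfold_locales (use assms s0 in auto)
  obtain cq where "trace_split V (L2 {0<..<s_star}) q R Q N U X_R cq"
    using form_space_trace_split[OF \<open>form_space L V\<close>] unfolding R q Q N U X_R by blast
  then interpret T: trace_split V "L2 {0<..<s_star}" q R Q N U X_R cq .
  obtain C where C: "C \<ge> 0" "\<And>f. f \<in> pts (H8 L) \<Longrightarrow> nrm (L2 {0<..<s_star}) (trace_op L e s_star f) \<le> C * (\<Sum>k\<le>8. nrm (L2fun {0<..<s_star}) (repr (wderiv L k f)))"
    "\<And>f. f \<in> pts (H8 L) \<Longrightarrow> C * (\<Sum>k\<le>8. nrm (L2fun {0<..<s_star}) (repr (wderiv L k f))) \<le> (9 * C) * nrm (H8 L) f"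
    by (rule R_estimate) (rule that)
  show ?thesis
  proof (intro conjI)
    show "form_space L (H8 L)" by (rule H8_form_space)
    show "linear_op (H8 L) (L2 {0<..<s_star}) R" unfolding R by (rule R_linear)
    show "\<exists>C C'. \<forall>f\<in>pts (H8 L).
       nrm (L2 {0<..<s_star}) (R f) \<le> C * (\<Sum>k\<le>8. nrm (L2fun {0<..<s_star}) (repr (wderiv L k f))) \<and>
       C * (\<Sum>k\<le>8. nrm (L2fun {0<..<s_star}) (repr (wderiv L k f))) \<le> C' * nrm (H8 L) f"
      by (intro exI[of _ C] exI[of _ "9 * C"] ballI conjI C[folded R])
    show "closed_op V (L2 {0<..<s_star}) R" by (rule T.R_closed)
    show "closed_subset V (pts N)" by (rule T.N_closed)
    show "\<forall>f\<in>pts V. \<exists>!z. fst z \<in> pts N \<and> snd z \<in> pts U \<and> f = pls V (fst z) (snd z)" by (rule T.decomp)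
    show "hilbert_space X_R" using T.X_hilb by (simp only: hilb_iff)
    show "unitary_op U X_R R" by (rule T.R_unitary)
    show "hermitian_form V q" by (rule T.q.hermb)
    show "\<forall>f\<in>pts V. q f f = of_real (Q f)" by (intro ballI T.qQ)
    show "\<forall>n\<in>pts N. \<forall>m\<in>pts N. \<forall>u\<in>pts U. \<forall>v\<in>pts U.
       q (pls V n u) (pls V m v) = q n m + q n v + cnj (q m u) + q u v" by (intro ballI T.blocks)
    show "\<forall>\<Gamma>. nonneg_form N q \<and> douglas_factor q N U \<Gamma> \<longrightarrow>
       (let C = form_op U q;
            \<Gamma>\<Gamma> = (\<lambda>u. adjoint_op U (H_A N q) \<Gamma> (\<Gamma> u));
            T = (\<lambda>u. dif U (\<Gamma>\<Gamma> u) (C u));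
            M = pos_part U T;
            S = (\<lambda>x. sqrt_op U M (inv_into (pts U) R x));
            p = (\<lambda>f. let n = orth_proj V (pts N) f; u = orth_proj V (pts U) f in
                  (nrm (H_A N q) (pls (H_A N q) (A_half N q n) (\<Gamma> u)))\<^sup>2
                  + Re (ip U (dif U (pls U (C u) (M u)) (\<Gamma>\<Gamma> u)) u))
        in bounded_op X_R U S \<and> (\<forall>u\<in>pts U. S (R u) = sqrt_op U M u) \<and>
           (\<forall>f\<in>pts V. 0 \<le> p f) \<and>
           (\<exists>(H :: (nat \<Rightarrow> (real \<Rightarrow> complex) set) set cspace) G.
              bounded_op V H G \<and> (\<forall>f\<in>pts V. (nrm H (G f))\<^sup>2 = p f) \<and>
              quotient_factorization Q V R X_R H U G S) \<and>
           (\<forall>f\<in>pts V. R f = zer (L2 {0<..<s_star}) \<longrightarrow> 0 \<le> Q f))"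
      unfolding Let_def by (intro allI impI conjI; elim conjE; rule T.factorization; assumption)
    show "\<forall>(H :: 'h cspace) (K :: 'k cspace) G S.
       quotient_factorization Q V R X_R H K G S \<longrightarrow>
         nonneg_form N q \<and> (\<exists>\<Gamma>. douglas_factor q N U \<Gamma>)"
      by (intro allI impI conjI T.converse)
    show "(\<exists>(H :: (nat \<Rightarrow> (real \<Rightarrow> complex) set) set cspace) G S.
        quotient_factorization Q V R X_R H U G S) \<longleftrightarrow>
     (\<forall>f\<in>pts V. R f = zer (L2 {0<..<s_star}) \<longrightarrow> 0 \<le> Q f) \<and> (\<exists>\<Gamma>. douglas_factor q N U \<Gamma>)"
      by (rule T.equivalence)
  qed
qed

end
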